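(* Let $N \ge 1$, let $r_{\rm cut} > r_0 > 0$, and let $\mathcal{P}=\{P_n\}_{n\in\mathbb{N}}$ be a radial basis satisfying the radial-basis assumption given in the context. Then the family $\boldsymbol{\mathcal{B}}_N = \{\mathcal{B}_{\mathbf{n}\mathbf{l}i}\}$ constructed in the context is a linearly independent subset of $C^t_{r_{\rm cut}}(\Omega_{r_0}^N)$, and every $f\in C^t_{r_{\rm cut}}(\Omega_{r_0}^N)$ satisfying $f(QR)=f(R)$ for all $Q\in {\rm O}(3)$ and $f(\sigma R)=f(R)$ for all $\sigma\in S_N$ belongs to the closure of $\operatorname{span}\boldsymbol{\mathcal{B}}_N$ with respect to the norm $\|\cdot\|_{C^t(\Omega_{r_0}^N)}$. Moreover, $\boldsymbol{\mathcal{B}}_N$ is orthonormal with respect to the inner product $\langle\langle\cdot,\cdot\rangle\rangle$ defined in the context.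
   Context: $\mathbb{N}=\{0,1,2,\dots\}$; spans are over $\mathbb{C}$; $t\ge 1$ is a fixed integer. For $\mathbf{r}\in\mathbb{R}^3\setminus\{0\}$ write $r=|\mathbf{r}|$, $\hat{\mathbf{r}}=\mathbf{r}/r$. Domains and spaces. $\Omega_{r_0}^N=\{R=(\mathbf{r}_1,\dots,\mathbf{r}_N)\in\mathbb{R}^{3N} : \min_j r_j>r_0\}$. $C^t(\Omega_{r_0}^N)$ is the space of $C^t$ functions whose derivatives up to order $t$ are bounded and extend continuously to the closure of $\Omega_{r_0}^N$, with the usual sup-norm of all derivatives up to order $t$; $C^t_{r_{\rm cut}}(\Omega_{r_0}^N)$ is the subspace of those $f$ with $f(\mathbf{r}_1,\dots,\mathbf{r}_N)=0$ whenever $r_j\ge r_{\rm cut}$ for some $j$. For $Q\in {\rm O}(3)$ and $\sigma\in S_N$: $QR=(Q\mathbf{r}_j)_j$, $\sigma R=(\mathbf{r}_{\sigma 1},\dots,\mathbf{r}_{\sigma N})$, and $(\phi\circ\sigma)(R)=\phi(\sigma R)$. Radial-basis assumption. $\mathcal{P}$ is a linearly independent subset of $C^t_{r_{\rm cut}}([r_0,\infty))=\{f\in C^t([r_0,\infty)): f=0 \text{ on }[r_{\rm cut},\infty)\}$, and the closure of $\operatorname{span}\mathcal{P}$ in the $C^t$-norm contains $\{f\in C^\infty([r_0,\infty)): f=0\text{ on }[r_{\rm cut},\infty)\}$. Tensor products. $Y_l^m$ ($l\in\mathbb{N}$, $-l\le m\le l$) are the standard complex spherical harmonics, normalised to be orthonormal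 in $L^2(\mathbb{S}^2)$; $\phi_{nlm}(\mathbf{r})=P_n(r)Y_l^m(\hat{\mathbf{r}})$. For $\mathbf{n},\mathbf{l}\in\mathbb{N}^N$ and $\mathbf{m}\in\mathcal{M}_{\mathbf{l}}:=\{\boldsymbol\mu\in\mathbb{Z}^N: |\mu_\alpha|\le l_\alpha\ \forall\alpha\}$ put $\phi_{\mathbf{n}\mathbf{l}\mathbf{m}}(R)=\prod_{\alpha=1}^N\phi_{n_\alpha l_\alpha m_\alpha}(\mathbf{r}_\alpha)$. The inner product $\langle\langle\cdot,\cdot\rangle\rangle$ on $\operatorname{span}\{\phi_{\mathbf{n}\mathbf{l}\mathbf{m}}\}$ (linear in the first argument) is defined by $\langle\langle\phi_{\mathbf{n}\mathbf{l}\mathbf{m}},\phi_{\mathbf{n}'\mathbf{l}'\mathbf{m}'}\rangle\rangle=\delta_{\mathbf{n}\mathbf{n}'}\delta_{\mathbf{l}\mathbf{l}'}\delta_{\mathbf{m}\mathbf{m}'}$. Rotation coefficients. The Wigner matrices $D^l(Q)$, $Q\in {\rm SO}(3)$, are defined by $Y_l^m(Q\hat{\mathbf{r}})=\sum_{\mu=-l}^l D^l_{\mu m}(Q)Y_l^\mu(\hat{\mathbf{r}})$. For $\boldsymbol\mu,\mathbf{m}\in\mathcal{M}_{\mathbf{l}}$ set $\bar D^{\mathbf{l}}_{\boldsymbol\mu\mathbf{m}}=\int_{{\rm SO}(3)}\prod_{\alpha=1}^N D^{l_\alpha}_{\mu_\alpha m_\alpha}(Q)\,dQ$ with $dQ$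 the normalised Haar measure, $\tilde n_{\mathbf{l}}=\operatorname{rank}\bar D^{\mathbf{l}}$, and fix orthonormal vectors $\tilde{\mathcal{U}}^{\mathbf{l}}_i=(\tilde{\mathcal{U}}^{\mathbf{l}}_{\mathbf{m}i})_{\mathbf{m}\in\mathcal{M}_{\mathbf{l}}}$, $i=1,\dots,\tilde n_{\mathbf{l}}$, spanning the range of $\bar D^{\mathbf{l}}$. Symmetric basis. Let $\tilde{\mathcal{B}}_{\mathbf{n}\mathbf{l}i}=\sum_{\sigma\in S_N}\sum_{\mathbf{m}\in\mathcal{M}_{\mathbf{l}}}\tilde{\mathcal{U}}^{\mathbf{l}}_{\mathbf{m}i}\,\phi_{\mathbf{n}\mathbf{l}\mathbf{m}}\circ\sigma$, $i=1,\dots,\tilde n_{\mathbf{l}}$, with Gram matrix $G^{\mathbf{n}\mathbf{l}}_{ii'}=\langle\langle\tilde{\mathcal{B}}_{\mathbf{n}\mathbf{l}i},\tilde{\mathcal{B}}_{\mathbf{n}\mathbf{l}i'}\rangle\rangle$, and $n_{\mathbf{n}\mathbf{l}}=\operatorname{rank}G^{\mathbf{n}\mathbf{l}}$. Diagonalise $G^{\mathbf{n}\mathbf{l}}=V\Sigma V^*$ with $V$ unitary and $\Sigma$ diagonal, the nonzero eigenvalues $\Sigma_{ii}>0$ being listed first ($i=1,\dots,n_{\mathbf{n}\mathbf{l}}$), and define $$\mathcal{U}^{\mathbf{n}\mathbf{l}}_{\mathbf{m}i}=\frac{1}{\sqrt{\Sigma_{ii}}}\sum_{\alpha=1}^{\tilde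 n_{\mathbf{l}}}\overline{V_{\alpha i}}\,\tilde{\mathcal{U}}^{\mathbf{l}}_{\mathbf{m}\alpha},\qquad \mathcal{B}_{\mathbf{n}\mathbf{l}i}=\sum_{\mathbf{m}\in\mathcal{M}_{\mathbf{l}}}\mathcal{U}^{\mathbf{n}\mathbf{l}}_{\mathbf{m}i}\sum_{\sigma\in S_N}\phi_{\mathbf{n}\mathbf{l}\mathbf{m}}\circ\sigma,\qquad i=1,\dots,n_{\mathbf{n}\mathbf{l}}.$$ A pair $(\mathbf{n},\mathbf{l})\in\mathbb{N}^{N}\times\mathbb{N}^N$ is called ordered if the sequence $((n_1,l_1),\dots,(n_N,l_N))$ is lexicographically (weakly) increasing. Finally $$\boldsymbol{\mathcal{B}}_N=\{\mathcal{B}_{\mathbf{n}\mathbf{l}i} : (\mathbf{n},\mathbf{l})\in\mathbb{N}^{2N}\text{ ordered},\ \textstyle\sum_\alpha l_\alpha\text{ even},\ i=1,\dots,n_{\mathbf{n}\mathbf{l}}\}.$$ *)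

theory Defs
  imports
    "HOL-Analysis.Analysis"
    "HOL-Library.Function_Algebras"
    "HOL-Computational_Algebra.Polynomial"
begin

section \<open>Complex vector spaces of functions\<close>

definition cscale :: "complex \<Rightarrow> ('a \<Rightarrow> complex) \<Rightarrow> 'a \<Rightarrow> complex"
  where "cscale c f = (\<lambda>x. c * f x)"

interpretation cfun: vector_space "cscale :: complex \<Rightarrow> ('a \<Rightarrow> complex) \<Rightarrow> 'a \<Rightarrow> complex"
  by unfold_locales (auto simp: cscale_def fun_eq_iff algebra_simps)

definition indep_family :: "('i \<Rightarrow> 'a \<Rightarrow> complex) \<Rightarrow> 'i set \<Rightarrow> bool"
  where "indep_family v I \<longleftrightarrow> inj_on v I \<and> cfun.independent (v ` I)"

text \<open>
  For a linearly independent set \<open>A\<close>, the inner product on \<open>cfun.span A\<close> for which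
  \<open>A\<close> is orthonormal; it is linear in the first argument.
\<close>

definition coeff_inner :: "('a \<Rightarrow> complex) set \<Rightarrow> ('a \<Rightarrow> complex) \<Rightarrow> ('a \<Rightarrow> complex) \<Rightarrow> complex"
  where "coeff_inner A f g =
    (\<Sum>b | cfun.representation A f b \<noteq> 0.
       cfun.representation A f b * cnj (cfun.representation A g b))"

lemma coeff_inner_basis:
  assumes "cfun.independent A" "a \<in> A" "b \<in> A"
  shows "coeff_inner A a b = (if a = b then 1 else 0)"
  using assms by (simp add: coeff_inner_def cfun.representation_basis)

text \<open>
  A square matrix with a finite index set \<open>I\<close> is a function \<open>A i j\<close>, used for
  \<open>i, j \<in> I\<close> only; vectors indexed by \<open>I\<close> are functions vanishing outside \<open>I\<close>.
\<close>

definition mat_range :: "'i set \<Rightarrow> ('i \<Rightarrow> 'i \<Rightarrow> complex) \<Rightarrow> ('i \<Rightarrow> complex) set"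
  where "mat_range I A = range (\<lambda>c i. if i \<in> I then \<Sum>j\<in>I. A i j * c j else 0)"

definition mat_rank :: "'i set \<Rightarrow> ('i \<Rightarrow> 'i \<Rightarrow> complex) \<Rightarrow> nat"
  where "mat_rank I A = cfun.dim (mat_range I A)"

definition orthonormal_vectors_spanning ::
    "'i set \<Rightarrow> nat \<Rightarrow> (nat \<Rightarrow> 'i \<Rightarrow> complex) \<Rightarrow> ('i \<Rightarrow> complex) set \<Rightarrow> bool"
  where "orthonormal_vectors_spanning I k u W \<longleftrightarrow>
    (\<forall>i<k. \<forall>j<k. (\<Sum>m\<in>I. u i m * cnj (u j m)) = (if i = j then 1 else 0)) \<and>
    cfun.span (u ` {..<k}) = W"

text \<open>
  \<open>G = V diag(s) V\<^sup>*\<close> for a \<open>k \<times> k\<close> matrix \<open>G\<close>, with \<open>V\<close> unitary and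
  the nonzero (positive) eigenvalues listed first.
\<close>

definition unitary_diagonalisation ::
    "nat \<Rightarrow> (nat \<Rightarrow> nat \<Rightarrow> complex) \<Rightarrow> (nat \<Rightarrow> nat \<Rightarrow> complex) \<Rightarrow> (nat \<Rightarrow> real) \<Rightarrow> bool"
  where "unitary_diagonalisation k G V s \<longleftrightarrow>
    (\<forall>i<k. \<forall>j<k. (\<Sum>a<k. cnj (V a i) * V a j) = (if i = j then 1 else 0)) \<and>
    (\<forall>i<k. \<forall>j<k. G i j = (\<Sum>a<k. V i a * of_real (s a) * cnj (V j a))) \<and>
    (\<forall>a<k. if a < mat_rank {..<k} G then s a > 0 else s a = 0)"


section \<open>Spaces of \<open>C\<^sup>t\<close> functions\<close>

text \<open>
  Iterated directional derivatives within \<open>S\<close>.  For an open set these are the usual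
  derivatives, and for \<open>{r0..}\<close> they are one-sided at \<open>r0\<close>.
\<close>

primrec iter_deriv ::
    "'a::euclidean_space set \<Rightarrow> 'a list \<Rightarrow> ('a \<Rightarrow> complex) \<Rightarrow> 'a \<Rightarrow> complex"
  where
    "iter_deriv S [] f = f"
  | "iter_deriv S (v # vs) f = (\<lambda>x. frechet_derivative (iter_deriv S vs f) (at x within S) v)"

text \<open>
  A function on \<open>S\<close> is represented by a total function that vanishes outside \<open>S\<close>,
  so that equality of functions on \<open>S\<close> is equality in HOL.
\<close>

definition Ct :: "nat \<Rightarrow> 'a::euclidean_space set \<Rightarrow> ('a \<Rightarrow> complex) set"
  where "Ct t S = {f.
    (\<forall>x. x \<notin> S \<longrightarrow> f x = 0) \<and>
    (\<forall>vs. set vs \<subseteq> Basis \<and> length vs < t \<longrightarrow> iter_deriv S vs f differentiable_on S) \<and>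
    (\<forall>vs. set vs \<subseteq> Basis \<and> length vs \<le> t \<longrightarrow>
       bounded (iter_deriv S vs f ` S) \<and>
       (\<exists>g. continuous_on (closure S) g \<and> (\<forall>x\<in>S. g x = iter_deriv S vs f x)))}"

definition Ct_norm :: "nat \<Rightarrow> 'a::euclidean_space set \<Rightarrow> ('a \<Rightarrow> complex) \<Rightarrow> real"
  where "Ct_norm t S f =
    (SUP (vs, x) \<in> {vs. set vs \<subseteq> Basis \<and> length vs \<le> t} \<times> S. norm (iter_deriv S vs f x))"

definition Ct_closure ::
    "nat \<Rightarrow> 'a::euclidean_space set \<Rightarrow> ('a \<Rightarrow> complex) set \<Rightarrow> ('a \<Rightarrow> complex) set"
  where "Ct_closure t S A = {f \<in> Ct t S. \<forall>e>0. \<exists>g\<in>A. Ct_norm t S (f - g) < e}"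

text \<open>
  A configuration of \<open>N = CARD('n)\<close> points is a vector of type \<open>(real^3)^'n\<close>, whose canonical
  basis gives the partial derivatives in all \<open>3N\<close> coordinates.
\<close>

definition Omega :: "real \<Rightarrow> ((real^3)^'n) set"
  where "Omega r0 = {R. \<forall>j. norm (R $ j) > r0}"

definition Ct_cut :: "nat \<Rightarrow> real \<Rightarrow> real \<Rightarrow> ((real^3)^'n \<Rightarrow> complex) set"
  where "Ct_cut t r0 rcut =
    {f \<in> Ct t (Omega r0). \<forall>R\<in>Omega r0. (\<exists>j. norm (R $ j) \<ge> rcut) \<longrightarrow> f R = 0}"

text \<open>
  Functions that vanish on \<open>[rcut, \<infinity>)\<close> have bounded derivatives as soon as these are
  continuous, so the boundedness required in \<open>Ct\<close> is no restriction here.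
\<close>

definition radial_Ct_cut :: "nat \<Rightarrow> real \<Rightarrow> real \<Rightarrow> (real \<Rightarrow> complex) set"
  where "radial_Ct_cut t r0 rcut = {f \<in> Ct t {r0..}. \<forall>r\<ge>rcut. f r = 0}"

definition radial_basis :: "nat \<Rightarrow> real \<Rightarrow> real \<Rightarrow> (nat \<Rightarrow> real \<Rightarrow> complex) \<Rightarrow> bool"
  where "radial_basis t r0 rcut P \<longleftrightarrow>
    indep_family P UNIV \<and>
    range P \<subseteq> radial_Ct_cut t r0 rcut \<and>
    (\<Inter>k. radial_Ct_cut k r0 rcut) \<subseteq> Ct_closure t {r0..} (cfun.span (range P))"


section \<open>Spherical harmonics and rotation coefficients\<close>

definition legendre :: "nat \<Rightarrow> real poly"
  where "legendre l = smult (1 / (2 ^ l * fact l)) ((pderiv ^^ l) ([:-1, 0, 1:] ^ l))"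

text \<open>With Condon--Shortley phase.\<close>

definition assoc_legendre :: "nat \<Rightarrow> nat \<Rightarrow> real \<Rightarrow> real"
  where "assoc_legendre l m x = (-1) ^ m * sqrt (1 - x\<^sup>2) ^ m * poly ((pderiv ^^ m) (legendre l)) x"

text \<open>
  At a unit vector with polar angle \<open>\<theta>\<close> and azimuth \<open>\<phi>\<close>, the third coordinate is
  \<open>cos \<theta>\<close> and \<open>\<phi>\<close> is the argument of the first two; the value \<open>Arg 0 = 0\<close> at the
  poles is harmless, as \<open>assoc_legendre l m\<close> vanishes there for \<open>m > 0\<close>.
\<close>

definition sph_harm_nonneg :: "nat \<Rightarrow> nat \<Rightarrow> real^3 \<Rightarrow> complex"
  where "sph_harm_nonneg l m x =
    of_real (sqrt ((2 * real l + 1) / (4 * pi) * fact (l - m) / fact (l + m))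
             * assoc_legendre l m (x $ 3))
    * cis (real m * Arg (Complex (x $ 1) (x $ 2)))"

definition sph_harm :: "nat \<Rightarrow> int \<Rightarrow> real^3 \<Rightarrow> complex"
  where "sph_harm l m x =
    (if m \<ge> 0 then sph_harm_nonneg l (nat m) x
     else (-1) ^ nat (- m) * cnj (sph_harm_nonneg l (nat (- m)) x))"

text \<open>
  The entries with \<open>\<bar>\<mu>\<bar> \<le> l\<close> and \<open>\<bar>m\<bar> \<le> l\<close> are determined uniquely, because the
  spherical harmonics of degree \<open>l\<close> are linearly independent; other entries are never used.
\<close>

definition wigner :: "nat \<Rightarrow> real^3^3 \<Rightarrow> int \<Rightarrow> int \<Rightarrow> complex"
  where "wigner l Q = (SOME D. \<forall>m. \<bar>m\<bar> \<le> int l \<longrightarrow>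
    (\<forall>x. norm x = 1 \<longrightarrow>
       sph_harm l m (Q *v x) = (\<Sum>\<mu> = - int l..int l. D \<mu> m * sph_harm l \<mu> x)))"

definition SO3 :: "(real^3^3) set"
  where "SO3 = {Q. rotation_matrix Q}"

definition normalised_haar_SO3 :: "(real^3^3) measure \<Rightarrow> bool"
  where "normalised_haar_SO3 H \<longleftrightarrow>
    sets H = sets (restrict_space borel SO3) \<and>
    emeasure H SO3 = 1 \<and>
    (\<forall>Q\<in>SO3. distr H H (\<lambda>A. Q ** A) = H)"

definition M_idx :: "('n \<Rightarrow> nat) \<Rightarrow> ('n \<Rightarrow> int) set"
  where "M_idx l = {m. \<forall>a. \<bar>m a\<bar> \<le> int (l a)}"

definition Dbar ::
    "(real^3^3) measure \<Rightarrow> ('n::finite \<Rightarrow> nat) \<Rightarrow> ('n \<Rightarrow> int) \<Rightarrow> ('n \<Rightarrow> int) \<Rightarrow> complex"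
  where "Dbar H l \<mu> m = (\<integral>Q. (\<Prod>a\<in>UNIV. wigner (l a) Q (\<mu> a) (m a)) \<partial>H)"

definition ntilde :: "(real^3^3) measure \<Rightarrow> ('n::finite \<Rightarrow> nat) \<Rightarrow> nat"
  where "ntilde H l = mat_rank (M_idx l) (Dbar H l)"


section \<open>The symmetric basis\<close>

definition permute_pts :: "('n \<Rightarrow> 'n) \<Rightarrow> (real^3)^'n \<Rightarrow> (real^3)^'n"
  where "permute_pts \<sigma> R = (\<chi> j. R $ \<sigma> j)"

definition rotate_pts :: "real^3^3 \<Rightarrow> (real^3)^'n \<Rightarrow> (real^3)^'n"
  where "rotate_pts Q R = (\<chi> j. Q *v (R $ j))"

definition phi1 :: "(nat \<Rightarrow> real \<Rightarrow> complex) \<Rightarrow> nat \<Rightarrow> nat \<Rightarrow> int \<Rightarrow> real^3 \<Rightarrow> complex"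
  where "phi1 P n l m r = P n (norm r) * sph_harm l m (inverse (norm r) *\<^sub>R r)"

definition phi ::
    "real \<Rightarrow> (nat \<Rightarrow> real \<Rightarrow> complex) \<Rightarrow> ('n::finite \<Rightarrow> nat) \<Rightarrow> ('n \<Rightarrow> nat) \<Rightarrow> ('n \<Rightarrow> int)
      \<Rightarrow> (real^3)^'n \<Rightarrow> complex"
  where "phi r0 P n l m R =
    (if R \<in> Omega r0 then \<Prod>a\<in>UNIV. phi1 P (n a) (l a) (m a) (R $ a) else 0)"

definition tensor_inner ::
    "real \<Rightarrow> (nat \<Rightarrow> real \<Rightarrow> complex) \<Rightarrow> ((real^3)^'n::finite \<Rightarrow> complex) \<Rightarrow> ((real^3)^'n \<Rightarrow> complex)
      \<Rightarrow> complex"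
  where "tensor_inner r0 P = coeff_inner {phi r0 P n l m |n l m. m \<in> M_idx l}"

text \<open>
  Throughout, \<open>Ut l i m\<close> is the entry with index \<open>m\<close> of the \<open>i\<close>-th orthonormal vector for
  \<open>l\<close>; the indices \<open>i\<close> start from 0.
\<close>

definition Btilde ::
    "real \<Rightarrow> (nat \<Rightarrow> real \<Rightarrow> complex) \<Rightarrow> (('n::finite \<Rightarrow> nat) \<Rightarrow> nat \<Rightarrow> ('n \<Rightarrow> int) \<Rightarrow> complex)
      \<Rightarrow> ('n \<Rightarrow> nat) \<Rightarrow> ('n \<Rightarrow> nat) \<Rightarrow> nat \<Rightarrow> (real^3)^'n \<Rightarrow> complex"
  where "Btilde r0 P Ut n l i = (\<lambda>R.
    \<Sum>\<sigma> | \<sigma> permutes UNIV. \<Sum>m\<in>M_idx l. Ut l i m * phi r0 P n l m (permute_pts \<sigma> R))"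

definition gram ::
    "real \<Rightarrow> (nat \<Rightarrow> real \<Rightarrow> complex) \<Rightarrow> (('n::finite \<Rightarrow> nat) \<Rightarrow> nat \<Rightarrow> ('n \<Rightarrow> int) \<Rightarrow> complex)
      \<Rightarrow> ('n \<Rightarrow> nat) \<Rightarrow> ('n \<Rightarrow> nat) \<Rightarrow> nat \<Rightarrow> nat \<Rightarrow> complex"
  where "gram r0 P Ut n l i i' =
    tensor_inner r0 P (Btilde r0 P Ut n l i) (Btilde r0 P Ut n l i')"

definition nsym ::
    "(real^3^3) measure \<Rightarrow> real \<Rightarrow> (nat \<Rightarrow> real \<Rightarrow> complex)
      \<Rightarrow> (('n::finite \<Rightarrow> nat) \<Rightarrow> nat \<Rightarrow> ('n \<Rightarrow> int) \<Rightarrow> complex) \<Rightarrow> ('n \<Rightarrow> nat) \<Rightarrow> ('n \<Rightarrow> nat) \<Rightarrow> nat"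
  where "nsym H r0 P Ut n l = mat_rank {..<ntilde H l} (gram r0 P Ut n l)"

definition Ucoef ::
    "(real^3^3) measure \<Rightarrow> (('n::finite \<Rightarrow> nat) \<Rightarrow> nat \<Rightarrow> ('n \<Rightarrow> int) \<Rightarrow> complex)
      \<Rightarrow> (('n \<Rightarrow> nat) \<Rightarrow> ('n \<Rightarrow> nat) \<Rightarrow> nat \<Rightarrow> nat \<Rightarrow> complex)
      \<Rightarrow> (('n \<Rightarrow> nat) \<Rightarrow> ('n \<Rightarrow> nat) \<Rightarrow> nat \<Rightarrow> real)
      \<Rightarrow> ('n \<Rightarrow> nat) \<Rightarrow> ('n \<Rightarrow> nat) \<Rightarrow> nat \<Rightarrow> ('n \<Rightarrow> int) \<Rightarrow> complex"
  where "Ucoef H Ut V s n l i m =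
    of_real (1 / sqrt (s n l i)) * (\<Sum>a<ntilde H l. cnj (V n l a i) * Ut l a m)"

definition Bsym ::
    "(real^3^3) measure \<Rightarrow> real \<Rightarrow> (nat \<Rightarrow> real \<Rightarrow> complex)
      \<Rightarrow> (('n::finite \<Rightarrow> nat) \<Rightarrow> nat \<Rightarrow> ('n \<Rightarrow> int) \<Rightarrow> complex)
      \<Rightarrow> (('n \<Rightarrow> nat) \<Rightarrow> ('n \<Rightarrow> nat) \<Rightarrow> nat \<Rightarrow> nat \<Rightarrow> complex)
      \<Rightarrow> (('n \<Rightarrow> nat) \<Rightarrow> ('n \<Rightarrow> nat) \<Rightarrow> nat \<Rightarrow> real)
      \<Rightarrow> ('n \<Rightarrow> nat) \<times> ('n \<Rightarrow> nat) \<times> nat \<Rightarrow> (real^3)^'n \<Rightarrow> complex"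
  where "Bsym H r0 P Ut V s = (\<lambda>(n, l, i) R.
    \<Sum>m\<in>M_idx l. Ucoef H Ut V s n l i m *
      (\<Sum>\<sigma> | \<sigma> permutes UNIV. phi r0 P n l m (permute_pts \<sigma> R)))"

definition ordered_pair :: "('n::linorder \<Rightarrow> nat) \<Rightarrow> ('n \<Rightarrow> nat) \<Rightarrow> bool"
  where "ordered_pair n l \<longleftrightarrow>
    (\<forall>a b. a \<le> b \<longrightarrow> n a < n b \<or> n a = n b \<and> l a \<le> l b)"

definition Bindex ::
    "(real^3^3) measure \<Rightarrow> real \<Rightarrow> (nat \<Rightarrow> real \<Rightarrow> complex)
      \<Rightarrow> (('n::{finite,linorder} \<Rightarrow> nat) \<Rightarrow> nat \<Rightarrow> ('n \<Rightarrow> int) \<Rightarrow> complex)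
      \<Rightarrow> (('n \<Rightarrow> nat) \<times> ('n \<Rightarrow> nat) \<times> nat) set"
  where "Bindex H r0 P Ut =
    {(n, l, i). ordered_pair n l \<and> even (\<Sum>a\<in>UNIV. l a) \<and> i < nsym H r0 P Ut n l}"

end

theory Submission
  imports Defs
begin

text \<open>
  Density rests on four facts.  (i) Polynomials are \<open>C\<^sup>t\<close>-dense on bounded sets, by convolution
  with a Landau kernel.  For \<open>s > 1\<close> the dilation \<open>f (s R)\<close> is defined beyond the inner boundary \<open>r0\<close>
  and vanishes before \<open>rcut\<close>.  Divide it by \<open>M(R) = \<Prod>\<^sub>j h(r\<^sub>j)\<close>, where \<open>h\<close> is flat at \<open>rcut\<close> and
  \<open>1 / h\<close> is flat at some \<open>q < r0\<close>: the quotient extends by 0 to a \<open>C\<^sup>t\<close> function on the whole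
  space.  Approximating it by polynomials and multiplying back approximates \<open>f\<close> by sums of
  products of one-particle functions \<open>h(r) p(x)\<close>.  (ii) On the sphere every monomial is a
  combination of spherical harmonics, which separates radial from angular parts.  The radial
  parts are smooth and vanish beyond \<open>rcut\<close>, so they are limits of elements of \<open>span P\<close>.  Hence
  the span of the tensor products \<open>phi\<close> is dense in \<open>Ct_cut\<close>.
  (iii) Averaging an approximation of an invariant \<open>f\<close> over the rotations, the inversion and
  the permutations increases the error at most by a constant factor, and turns \<open>phi\<close> into
  symmetrised sums with coefficients in the range of \<open>Dbar\<close> and \<open>\<Sum>\<^sub>a l a\<close> even.
  (iv) The eigenvectors of the Gram matrix with eigenvalue 0 give functions of norm 0, so the
  remaining ones, which are orthonormal after scaling, still span.

  Since \<open>f\<close> is itself invariant, the average over \<open>SO(3)\<close> in (iii) only requires that the Wigner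
  coefficients are continuous in the rotation.  This follows from the generating function
  \<open>(a\<^sub>\<zeta> \<bullet> x)\<^sup>l\<close>, where \<open>a\<^sub>\<zeta>\<close> runs through the null cone: its coefficients at the powers of \<open>\<zeta>\<close>
  are multiples of the spherical harmonics of degree \<open>l\<close>.
\<close>

subsection \<open>Calculus of \<open>C\<^sup>k\<close> bounds\<close>

text \<open>Two obstacles shape the density proof. Convolution needs values beyond the boundary of
  \<open>Omega r0\<close>, where \<open>f\<close> has none; and the radial assumption only reaches
  smooth functions that vanish beyond \<open>rcut\<close>, which polynomials do not. Dilation solves
  the first without an extension theorem. For the second, every approximant must carry a smooth
  factor vanishing beyond \<open>rcut\<close>, so \<open>f\<close> has to be divided by it
  beforehand; dilation helps again, since the support of \<open>f (s R)\<close> stays away from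
  \<open>rcut\<close>, where the quotient would be singular. Flatness of \<open>1 / h\<close> at
  \<open>q\<close> makes the extension by 0 harmless at the inner edge as well. Stone-Weierstrass
  would control values only; a convolution commutes with derivatives and controls all orders up to
  \<open>t\<close> at once. Averaging acts on the finitely many coefficients of one approximant, so
  no derivative is ever exchanged with an integral over rotations. The inner product is defined by
  coefficients, so orthogonality reduces to comparing index triples, which rests on the independence
  of the tensor products.\<close>

text \<open>Guarantees that derivatives within \<open>S\<close> are unique.\<close>

definition nondegenerate :: "'a::euclidean_space set \<Rightarrow> bool"
  where "nondegenerate S \<longleftrightarrow>
    (\<forall>x\<in>S. \<forall>i\<in>Basis. \<forall>e>0. \<exists>d. 0 < \<bar>d\<bar> \<and> \<bar>d\<bar> < e \<and> x + d *\<^sub>R i \<in> S)"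

lemma nondegenerate_open:
  assumes "open S"
  shows "nondegenerate S"
  unfolding nondegenerate_def
proof (intro ballI allI impI)
  fix x i :: 'a and e :: real
  assume "x \<in> S" "i \<in> Basis" "0 < e"
  then obtain d where d: "d > 0" "ball x d \<subseteq> S"
    using assms openE by blast
  have "x + (min d e / 2) *\<^sub>R i \<in> ball x d"
    using \<open>i \<in> Basis\<close> d \<open>e > 0\<close> by (simp add: dist_norm)
  then show "\<exists>d. 0 < \<bar>d\<bar> \<and> \<bar>d\<bar> < e \<and> x + d *\<^sub>R i \<in> S"
    using d \<open>e > 0\<close> by (intro exI[of _ "min d e / 2"]) auto
qed

lemma nondegenerate_atLeast: "nondegenerate {r0::real..}"
  unfolding nondegenerate_def
proof (intro ballI allI impI)
  fix x i e :: real
  assume "x \<in> {r0..}" "i \<in> Basis" "0 < e"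
  then show "\<exists>d. 0 < \<bar>d\<bar> \<and> \<bar>d\<bar> < e \<and> x + d *\<^sub>R i \<in> {r0..}"
    by (intro exI[of _ "e / 2"]) auto
qed

lemma frechet_derivative_within_eq:
  assumes "nondegenerate S" "x \<in> S" "(f has_derivative f') (at x within S)"
  shows "frechet_derivative f (at x within S) = f'"
proof (rule frechet_derivative_unique_within)
  show "(f has_derivative frechet_derivative f (at x within S)) (at x within S)"
    using assms(3) by (meson differentiableI frechet_derivative_works)
  show "(f has_derivative f') (at x within S)" by fact
  show "\<exists>d. 0 < \<bar>d\<bar> \<and> \<bar>d\<bar> < e \<and> x + d *\<^sub>R i \<in> S" if "i \<in> Basis" "e > 0" for i e
    using assms(1,2) that by (auto simp: nondegenerate_def)
qed

lemma has_derivative_within_cong: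
  assumes "x \<in> S" "\<And>y. y \<in> S \<Longrightarrow> f y = g y"
  shows "(f has_derivative D) (at x within S) \<longleftrightarrow> (g has_derivative D) (at x within S)"
  using assms has_derivative_transform[of x S f g D] has_derivative_transform[of x S g f D]
  by metis

lemma frechet_derivative_within_cong:
  assumes "x \<in> S" "\<And>y. y \<in> S \<Longrightarrow> f y = g y"
  shows "frechet_derivative f (at x within S) = frechet_derivative g (at x within S)"
proof -
  have "(\<lambda>D. (f has_derivative D) (at x within S)) = (\<lambda>D. (g has_derivative D) (at x within S))"
    using has_derivative_within_cong[OF assms] by (simp add: fun_eq_iff)
  then show ?thesis by (simp add: frechet_derivative_def)
qed

text \<open>The two requirements that \<open>Ct\<close> makes of each derivative, with the bound
  kept explicit so that approximation errors can be propagated.\<close>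

definition bounded_ext :: "'a::euclidean_space set \<Rightarrow> real \<Rightarrow> ('a \<Rightarrow> complex) \<Rightarrow> bool"
  where "bounded_ext S M f \<longleftrightarrow> (\<forall>x\<in>S. norm (f x) \<le> M) \<and>
    (\<exists>g. continuous_on (closure S) g \<and> (\<forall>x\<in>S. g x = f x))"

text \<open>
  \<open>CB k S M f\<close> says that \<open>f\<close> is \<open>C\<^sup>k\<close> on \<open>S\<close> up to the boundary, with all derivatives up to
  order \<open>k\<close> bounded by \<open>M\<close>.  Unlike \<open>iter_deriv\<close>, the recursion takes the innermost derivative
  first, which suits the product and chain rules.
\<close>

primrec CB :: "nat \<Rightarrow> 'a::euclidean_space set \<Rightarrow> real \<Rightarrow> ('a \<Rightarrow> complex) \<Rightarrow> bool"
  where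
    "CB 0 S M f = bounded_ext S M f"
  | "CB (Suc k) S M f = (bounded_ext S M f \<and> f differentiable_on S \<and>
      (\<forall>b\<in>Basis. CB k S M (\<lambda>x. frechet_derivative f (at x within S) b)))"

lemma bounded_ext_mono: "bounded_ext S M f \<Longrightarrow> M \<le> M' \<Longrightarrow> bounded_ext S M' f"
  by (fastforce simp: bounded_ext_def)

lemma bounded_ext_cong:
  "(\<And>x. x \<in> S \<Longrightarrow> f x = g x) \<Longrightarrow> bounded_ext S M f \<longleftrightarrow> bounded_ext S M g"
  by (auto simp: bounded_ext_def)

lemma bounded_ext_const: "bounded_ext S (norm c) (\<lambda>x. c)"
  by (auto simp: bounded_ext_def intro!: exI[of _ "\<lambda>x. c"])

lemma bounded_ext_add:
  assumes "bounded_ext S M f" "bounded_ext S N g"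
  shows "bounded_ext S (M + N) (\<lambda>x. f x + g x)"
proof -
  obtain f' g' where *: "continuous_on (closure S) f'" "continuous_on (closure S) g'"
    "\<forall>x\<in>S. f' x = f x" "\<forall>x\<in>S. g' x = g x"
    using assms by (auto simp: bounded_ext_def)
  then have "continuous_on (closure S) (\<lambda>x. f' x + g' x)" by (intro continuous_intros)
  moreover have "\<forall>x\<in>S. norm (f x + g x) \<le> M + N"
    using assms by (auto simp: bounded_ext_def intro!: norm_triangle_mono)
  ultimately show ?thesis
    unfolding bounded_ext_def using * by (metis (no_types, lifting))
qed

lemma bounded_ext_mult:
  assumes "bounded_ext S M f" "bounded_ext S N g"
  shows "bounded_ext S (M * N) (\<lambda>x. f x * g x)"
proof -
  obtain f' g' where *: "continuous_on (closure S) f'" "continuous_on (closure S) g'"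
    "\<forall>x\<in>S. f' x = f x" "\<forall>x\<in>S. g' x = g x"
    using assms by (auto simp: bounded_ext_def)
  then have "continuous_on (closure S) (\<lambda>x. f' x * g' x)" by (intro continuous_intros)
  moreover have "norm (f x * g x) \<le> M * N" if "x \<in> S" for x
  proof -
    have "norm (f x) \<le> M" "norm (g x) \<le> N" using assms that by (auto simp: bounded_ext_def)
    then show ?thesis
      by (simp add: norm_mult mult_mono order.trans[OF norm_ge_zero])
  qed
  ultimately show ?thesis
    unfolding bounded_ext_def using * by (metis (no_types, lifting))
qed

lemma CB_empty: "CB k {} M f"
  by (induction k arbitrary: f) (auto simp: bounded_ext_def differentiable_on_def)

lemma CB_bounded_ext: "CB k S M f \<Longrightarrow> bounded_ext S M f"
  by (cases k) auto

lemma CB_bound: "CB k S M f \<Longrightarrow> x \<in> S \<Longrightarrow> norm (f x) \<le> M"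
  by (drule CB_bounded_ext) (simp add: bounded_ext_def)

lemma CB_nonneg: "CB k S M f \<Longrightarrow> x \<in> S \<Longrightarrow> 0 \<le> M"
  using CB_bound norm_ge_zero order_trans by blast

lemma CB_mono: "CB k S M f \<Longrightarrow> M \<le> M' \<Longrightarrow> CB k S M' f"
  by (induction k arbitrary: f) (auto intro: bounded_ext_mono)

lemma CB_cong:
  assumes "\<And>x. x \<in> S \<Longrightarrow> f x = g x"
  shows "CB k S M f \<longleftrightarrow> CB k S M g"
  using assms
proof (induction k arbitrary: f g)
  case 0
  then show ?case using bounded_ext_cong[of S f g] by simp
next
  case (Suc k)
  have "f differentiable_on S \<longleftrightarrow> g differentiable_on S"
    unfolding differentiable_on_def differentiable_def
    using has_derivative_within_cong[of _ S f g] Suc.prems by blast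
  moreover have "CB k S M (\<lambda>x. frechet_derivative f (at x within S) b) \<longleftrightarrow>
      CB k S M (\<lambda>x. frechet_derivative g (at x within S) b)" for b
    by (rule Suc.IH) (simp add: frechet_derivative_within_cong[OF _ Suc.prems])
  ultimately show ?case using bounded_ext_cong[of S f g] Suc.prems by simp
qed

lemma CB_Suc_D: "CB (Suc k) S M f \<Longrightarrow> CB k S M f"
  by (induction k arbitrary: f) auto

lemma CB_has_derivative:
  "CB (Suc k) S M f \<Longrightarrow> x \<in> S \<Longrightarrow>
    (f has_derivative frechet_derivative f (at x within S)) (at x within S)"
  by (simp add: differentiable_on_def frechet_derivative_works)

lemma CB_SucI:
  assumes "nondegenerate S" "bounded_ext S M f"
    "\<And>x. x \<in> S \<Longrightarrow> (f has_derivative f' x) (at x within S)"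
    "\<And>b. b \<in> Basis \<Longrightarrow> CB k S M (\<lambda>x. f' x b)"
  shows "CB (Suc k) S M f"
proof -
  have "CB k S M (\<lambda>x. frechet_derivative f (at x within S) b)" if "b \<in> Basis" for b
    using assms(4)[OF that] frechet_derivative_within_eq[OF assms(1) _ assms(3)]
    by (subst CB_cong[where g = "\<lambda>x. f' x b"]) auto
  moreover have "f differentiable_on S"
    unfolding differentiable_on_def using assms(3) differentiableI by blast
  ultimately show ?thesis using assms(2) by simp
qed

lemma CB_const: "nondegenerate S \<Longrightarrow> norm c \<le> M \<Longrightarrow> CB k S M (\<lambda>x. c)"
proof (induction k arbitrary: c)
  case 0
  then show ?case using bounded_ext_mono[OF bounded_ext_const] by auto
next
  case (Suc k)
  show ?case
    using Suc bounded_ext_mono[OF bounded_ext_const] order.trans[OF norm_ge_zero Suc.prems(2)]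
    by (intro CB_SucI[where f' = "\<lambda>x v. 0"]) (auto intro: derivative_intros)
qed

lemma CB_add:
  assumes "nondegenerate S" "CB k S M f" "CB k S N g"
  shows "CB k S (M + N) (\<lambda>x. f x + g x)"
  using assms(2,3)
proof (induction k arbitrary: f g)
  case 0
  then show ?case using bounded_ext_add by auto
next
  case (Suc k)
  show ?case
  proof (rule CB_SucI[OF assms(1)])
    show "bounded_ext S (M + N) (\<lambda>x. f x + g x)"
      using Suc.prems by (intro bounded_ext_add CB_bounded_ext)
    show "((\<lambda>x. f x + g x) has_derivative (\<lambda>b. frechet_derivative f (at x within S) b +
        frechet_derivative g (at x within S) b)) (at x within S)" if "x \<in> S" for x
      using Suc.prems that by (intro has_derivative_add CB_has_derivative)
  qed (use Suc in auto)
qed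

text \<open>Leibniz rule: every differentiation turns one product into a sum of two, so the constant
  doubles with the order.\<close>

lemma CB_mult:
  assumes "nondegenerate S" "CB k S M f" "CB k S N g"
  shows "CB k S (2 ^ k * M * N) (\<lambda>x. f x * g x)"
  using assms(2,3)
proof (induction k arbitrary: f g)
  case 0
  then show ?case using bounded_ext_mult by auto
next
  case (Suc k)
  show ?case
  proof (cases "S = {}")
    case True
    then show ?thesis by (simp add: CB_empty)
  next
    case False
    then have nn: "0 \<le> M" "0 \<le> N" using Suc.prems CB_nonneg by blast+
    have le: "M * N \<le> 2 ^ Suc k * M * N"
      using mult_right_mono[of 1 "2 ^ Suc k :: real" "M * N"] nn
      by (simp add: mult.assoc one_le_power del: power_Suc)
    show ?thesis
    proof (rule CB_SucI[OF assms(1)])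
      show "bounded_ext S (2 ^ Suc k * M * N) (\<lambda>x. f x * g x)"
        using Suc.prems le by (intro bounded_ext_mono[OF bounded_ext_mult] CB_bounded_ext)
      show "((\<lambda>x. f x * g x) has_derivative (\<lambda>b. f x * frechet_derivative g (at x within S) b +
          frechet_derivative f (at x within S) b * g x)) (at x within S)" if "x \<in> S" for x
        using Suc.prems that by (intro has_derivative_mult CB_has_derivative)
      show "CB k S (2 ^ Suc k * M * N) (\<lambda>x. f x * frechet_derivative g (at x within S) b +
          frechet_derivative f (at x within S) b * g x)" if "b \<in> Basis" for b
      proof -
        have "CB k S (2 ^ k * M * N + 2 ^ k * M * N)
          (\<lambda>x. f x * frechet_derivative g (at x within S) b +
            frechet_derivative f (at x within S) b * g x)"
          using Suc.prems that CB_Suc_D[OF Suc.prems(1)] CB_Suc_D[OF Suc.prems(2)]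
          by (intro CB_add[OF assms(1)] Suc.IH) auto
        then show ?thesis by (simp add: algebra_simps)
      qed
    qed
  qed
qed

text \<open>Treating \<open>c\<close> as a function would cost the factor \<open>2 ^ k\<close> of
  \<open>CB_mult\<close>; as constants differentiate to 0, it can be avoided.\<close>

lemma CB_cmult:
  assumes "nondegenerate S" "CB k S M f"
  shows "CB k S (norm c * M) (\<lambda>x. c * f x)"
  using assms(2)
proof (induction k arbitrary: f)
  case 0
  then show ?case using bounded_ext_mult[OF bounded_ext_const] by auto
next
  case (Suc k)
  show ?case
  proof (rule CB_SucI[OF assms(1)])
    show "bounded_ext S (norm c * M) (\<lambda>x. c * f x)"
      using Suc.prems by (intro bounded_ext_mult bounded_ext_const CB_bounded_ext)
    show "((\<lambda>x. c * f x) has_derivative (\<lambda>b. c * frechet_derivative f (at x within S) b))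
        (at x within S)" if "x \<in> S" for x
      using CB_has_derivative[OF Suc.prems that] by (rule has_derivative_mult_right)
  qed (use Suc in auto)
qed

lemma CB_diff:
  assumes "nondegenerate S" "CB k S M f" "CB k S N g"
  shows "CB k S (M + N) (\<lambda>x. f x - g x)"
  using CB_add[OF assms(1,2) CB_cmult[OF assms(1,3), of "-1"]] by simp

lemma CB_sum:
  assumes "nondegenerate S" "finite I" "\<And>i. i \<in> I \<Longrightarrow> CB k S (M i) (f i)"
  shows "CB k S (\<Sum>i\<in>I. M i) (\<lambda>x. \<Sum>i\<in>I. f i x)"
  using assms(2,3)
  by (induction I rule: finite_induct)
    (auto intro!: CB_const[OF assms(1)] CB_add[OF assms(1)])

section \<open>Iterated partial derivatives and the \<open>C^t\<close> norm\<close>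

lemma iter_deriv_snoc:
  "iter_deriv S (vs @ [v]) f = iter_deriv S vs (\<lambda>x. frechet_derivative f (at x within S) v)"
  by (induction vs) auto

lemma all_lists_Suc_iff:
  "(\<forall>vs. set vs \<subseteq> B \<and> length vs \<le> Suc k \<longrightarrow> Q vs) \<longleftrightarrow>
    Q [] \<and> (\<forall>v\<in>B. \<forall>vs. set vs \<subseteq> B \<and> length vs \<le> k \<longrightarrow> Q (vs @ [v]))"
  (is "?L \<longleftrightarrow> ?R")
proof
  assume ?L then show ?R by auto
next
  assume R: ?R
  show ?L
  proof (intro allI impI)
    fix vs assume "set vs \<subseteq> B \<and> length vs \<le> Suc k"
    then show "Q vs" using R by (cases vs rule: rev_cases) auto
  qed
qed

lemma all_lists_less_Suc_iff:
  "(\<forall>vs. set vs \<subseteq> B \<and> length vs < Suc k \<longrightarrow> Q vs) \<longleftrightarrow>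
    Q [] \<and> (\<forall>v\<in>B. \<forall>vs. set vs \<subseteq> B \<and> length vs < k \<longrightarrow> Q (vs @ [v]))"
  (is "?L \<longleftrightarrow> ?R")
proof
  assume ?L then show ?R by auto
next
  assume R: ?R
  show ?L
  proof (intro allI impI)
    fix vs assume "set vs \<subseteq> B \<and> length vs < Suc k"
    then show "Q vs" using R by (cases vs rule: rev_cases) auto
  qed
qed

text \<open>\<open>iter_deriv\<close> grows at the outermost derivative and \<open>CB\<close> at the
  innermost; splitting lists at their last element matches the two recursions.\<close>

lemma CB_iff:
  "CB k S M f \<longleftrightarrow>
    (\<forall>vs. set vs \<subseteq> Basis \<and> length vs < k \<longrightarrow> iter_deriv S vs f differentiable_on S) \<and>
    (\<forall>vs. set vs \<subseteq> Basis \<and> length vs \<le> k \<longrightarrow> bounded_ext S M (iter_deriv S vs f))"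
proof (induction k arbitrary: f)
  case 0
  then show ?case by auto
next
  case (Suc k)
  show ?case
    unfolding CB.simps Suc.IH all_lists_Suc_iff all_lists_less_Suc_iff iter_deriv_snoc
    by auto
qed

lemma finite_derivative_lists: "finite {vs. set vs \<subseteq> (Basis :: 'a::euclidean_space set) \<and> length vs \<le> t}"
  by (rule finite_lists_length_le) auto

lemma Ct_obtain_bound:
  fixes f :: "'a::euclidean_space \<Rightarrow> complex"
  assumes "f \<in> Ct t S"
  obtains M where "CB t S M f"
proof -
  let ?L = "{vs. set vs \<subseteq> (Basis :: 'a set) \<and> length vs \<le> t}"
  have "\<forall>vs\<in>?L. \<exists>M. \<forall>x\<in>S. norm (iter_deriv S vs f x) \<le> M"
    using assms by (auto simp: Ct_def bounded_iff)
  then obtain M where M: "\<forall>vs\<in>?L. \<forall>x\<in>S. norm (iter_deriv S vs f x) \<le> M vs" by metis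
  \<comment> \<open>\<open>Ct\<close> bounds each derivative separately. There are finitely many
    lists, so the sum of the absolute bounds dominates them all.\<close>
  define K where "K = (\<Sum>vs\<in>?L. \<bar>M vs\<bar>)"
  have "M vs \<le> K" if "vs \<in> ?L" for vs
  proof -
    have "\<bar>M vs\<bar> \<le> K" unfolding K_def
      using that by (intro member_le_sum finite_derivative_lists) auto
    then show ?thesis by simp
  qed
  then have "CB t S K f"
    using assms M unfolding CB_iff bounded_ext_def Ct_def by fastforce
  then show ?thesis by (rule that)
qed

lemma Ct_iff: "f \<in> Ct t S \<longleftrightarrow> (\<forall>x. x \<notin> S \<longrightarrow> f x = 0) \<and> (\<exists>M. CB t S M f)"
proof
  assume f: "f \<in> Ct t S"
  obtain M where "CB t S M f" using Ct_obtain_bound[OF f] .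
  moreover have "\<forall>x. x \<notin> S \<longrightarrow> f x = 0" using f by (simp add: Ct_def)
  ultimately show "(\<forall>x. x \<notin> S \<longrightarrow> f x = 0) \<and> (\<exists>M. CB t S M f)" by blast
next
  assume "(\<forall>x. x \<notin> S \<longrightarrow> f x = 0) \<and> (\<exists>M. CB t S M f)"
  then obtain M where z: "\<forall>x. x \<notin> S \<longrightarrow> f x = 0" and M: "CB t S M f" by blast
  have 1: "iter_deriv S vs f differentiable_on S" if "set vs \<subseteq> Basis \<and> length vs < t" for vs
    using M that unfolding CB_iff by blast
  have 2: "bounded_ext S M (iter_deriv S vs f)" if "set vs \<subseteq> Basis \<and> length vs \<le> t" for vs
    using M that unfolding CB_iff by blast
  have "bounded (iter_deriv S vs f ` S)" if "set vs \<subseteq> Basis \<and> length vs \<le> t" for vs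
    using 2[OF that] unfolding bounded_ext_def bounded_iff by (intro exI[of _ M]) auto
  moreover have "\<exists>g. continuous_on (closure S) g \<and> (\<forall>x\<in>S. g x = iter_deriv S vs f x)"
    if "set vs \<subseteq> Basis \<and> length vs \<le> t" for vs
    using 2[OF that] unfolding bounded_ext_def by (rule conjunct2)
  ultimately show "f \<in> Ct t S"
    unfolding Ct_def mem_Collect_eq using z 1 by blast
qed

lemma Ct_norm_le:
  assumes "CB t S M f" "S \<noteq> {}"
  shows "Ct_norm t S f \<le> M"
proof -
  obtain x where "x \<in> S" using assms by auto
  \<comment> \<open>The empty list makes the index set of the supremum nonempty; otherwise its value
    would be arbitrary.\<close>
  then have "([], x) \<in> {vs. set vs \<subseteq> Basis \<and> length vs \<le> t} \<times> S" by simp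
  then have "{vs. set vs \<subseteq> Basis \<and> length vs \<le> t} \<times> S \<noteq> {}" by blast
  then show ?thesis
    unfolding Ct_norm_def using assms(1) unfolding CB_iff bounded_ext_def
    by (intro cSUP_least) auto
qed

text \<open>A supremum of reals is an upper bound only for sets that are bounded above, which
  \<open>M\<close> provides.\<close>

lemma CB_Ct_norm:
  assumes "CB t S M f"
  shows "CB t S (Ct_norm t S f) f"
proof -
  let ?L = "{vs. set vs \<subseteq> Basis \<and> length vs \<le> t} \<times> S"
  have bdd: "bdd_above ((\<lambda>(vs, x). norm (iter_deriv S vs f x)) ` ?L)"
    using assms unfolding CB_iff bounded_ext_def by (intro bdd_aboveI2[of _ _ M]) auto
  have "norm (iter_deriv S vs f x) \<le> Ct_norm t S f" if "(vs, x) \<in> ?L" for vs x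
    using cSUP_upper[OF that bdd] by (simp add: Ct_norm_def)
  then show ?thesis
    using assms unfolding CB_iff bounded_ext_def by fastforce
qed

text \<open>Closure in \<open>C^k\<close>, with regularity demanded of the difference only. Neither
  \<open>f\<close> nor the members of \<open>A\<close> have to vanish outside \<open>S\<close>, so
  intermediate families need not be truncated to \<open>Omega r0\<close>.\<close>

definition capx :: "nat \<Rightarrow> 'a::euclidean_space set \<Rightarrow> ('a \<Rightarrow> complex) set \<Rightarrow> ('a \<Rightarrow> complex) \<Rightarrow> bool"
  where "capx k S A f \<longleftrightarrow> (\<forall>e>0. \<exists>g\<in>A. CB k S e (\<lambda>x. f x - g x))"

lemma capx_self:
  assumes "nondegenerate S" "f \<in> A" shows "capx k S A f"
  using assms CB_const[OF assms(1), of 0] by (auto simp: capx_def intro!: bexI[of _ f])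

lemma capx_cong:
  assumes "\<And>x. x \<in> S \<Longrightarrow> f x = g x"
  shows "capx k S A f \<longleftrightarrow> capx k S A g"
proof -
  have "CB k S e (\<lambda>x. f x - h x) \<longleftrightarrow> CB k S e (\<lambda>x. g x - h x)" for e h
    by (rule CB_cong) (simp add: assms)
  then show ?thesis by (simp add: capx_def)
qed

text \<open>Allows density to be proved in stages, through families that are not contained in
  \<open>B\<close>.\<close>

lemma capx_trans:
  assumes "nondegenerate S" "capx k S A f" "\<And>g. g \<in> A \<Longrightarrow> capx k S B g"
  shows "capx k S B f"
  unfolding capx_def
proof (intro allI impI)
  fix e :: real assume "e > 0"
  then obtain g where g: "g \<in> A" "CB k S (e/2) (\<lambda>x. f x - g x)"
    using assms(2) by (metis capx_def half_gt_zero)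
  then obtain h where h: "h \<in> B" "CB k S (e/2) (\<lambda>x. g x - h x)"
    using assms(3) \<open>e > 0\<close> by (metis capx_def half_gt_zero)
  have "CB k S (e/2 + e/2) (\<lambda>x. (f x - g x) + (g x - h x))"
    by (intro CB_add assms g h)
  then show "\<exists>g\<in>B. CB k S e (\<lambda>x. f x - g x)"
    using h(1) by (intro bexI[of _ h]) auto
qed

lemma capx_mult:
  assumes S: "nondegenerate S" and h: "CB k S M h" and f: "capx k S A f"
    and A: "\<And>g. g \<in> A \<Longrightarrow> capx k S B (\<lambda>x. h x * g x)"
  shows "capx k S B (\<lambda>x. h x * f x)"
proof (rule capx_trans[OF S])
  show "capx k S ((\<lambda>g x. h x * g x) ` A) (\<lambda>x. h x * f x)"
    unfolding capx_def
  proof (intro allI impI)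
    fix e :: real assume "e > 0"
    \<comment> \<open>\<open>K\<close> bounds the operator norm of multiplication by
      \<open>h\<close>; adding 1 keeps it positive even if \<open>M\<close> is 0.\<close>
    define K where "K = 2 ^ k * (\<bar>M\<bar> + 1)"
    have "K > 0" by (simp add: K_def add_nonneg_pos)
    then obtain g where g: "g \<in> A" "CB k S (e / K) (\<lambda>x. f x - g x)"
      using f \<open>e > 0\<close> unfolding capx_def by (meson divide_pos_pos)
    have "CB k S (2 ^ k * (\<bar>M\<bar> + 1) * (e / K)) (\<lambda>x. h x * (f x - g x))"
      by (intro CB_mult S g CB_mono[OF h]) auto
    then have "CB k S e (\<lambda>x. h x * f x - h x * g x)"
      using \<open>K > 0\<close> unfolding K_def[symmetric] by (simp add: right_diff_distrib)
    then show "\<exists>g\<in>(\<lambda>g x. h x * g x) ` A. CB k S e (\<lambda>x. h x * f x - g x)"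
      using g(1) by (intro bexI[of _ "\<lambda>x. h x * g x"]) auto
  qed
  show "capx k S B g" if "g \<in> (\<lambda>g x. h x * g x) ` A" for g
    using that A by auto
qed

section \<open>Linear substitutions, restriction and gluing\<close>

lemma bounded_ext_linear_compose:
  fixes L :: "'a::euclidean_space \<Rightarrow> 'b::euclidean_space"
  assumes L: "bounded_linear L" "L ` S \<subseteq> S'" and f: "bounded_ext S' M f"
  shows "bounded_ext S M (\<lambda>x. f (L x))"
proof -
  obtain g where g: "continuous_on (closure S') g" "\<forall>x\<in>S'. g x = f x"
    using f by (auto simp: bounded_ext_def)
  have contL: "continuous_on A L" for A
    by (rule linear_continuous_on[OF L(1)])
  have "L ` closure S \<subseteq> closure S'"
    by (rule image_closure_subset[OF contL closed_closure])
      (use L(2) closure_subset in blast)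
  then have "continuous_on (closure S) (\<lambda>x. g (L x))"
    using continuous_on_compose2[OF g(1) contL] by blast
  then show ?thesis
    using f g L(2) unfolding bounded_ext_def
    by (auto intro!: exI[of _ "\<lambda>x. g (L x)"])
qed

lemma bounded_ext_subset:
  assumes "S \<subseteq> S'" "bounded_ext S' M f"
  shows "bounded_ext S M f"
  using bounded_ext_linear_compose[OF bounded_linear_ident _ assms(2)] assms(1) by auto

text \<open>By the chain rule a partial derivative of the composition is a combination of
  \<open>DIM('b)\<close> partial derivatives of \<open>f\<close> with coefficients at most
  \<open>K\<close>, so each order costs one factor \<open>DIM('b) * K\<close>. With \<open>K\<close>
  at least 1 these factors only grow, hence one constant serves all orders up to
  \<open>k\<close>.\<close>

lemma CB_linear_compose:
  fixes L :: "'a::euclidean_space \<Rightarrow> 'b::euclidean_space" and K M :: real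
  assumes S: "nondegenerate S" and L: "bounded_linear L" "L ` S \<subseteq> S'"
    and K: "1 \<le> K" "\<And>b c. b \<in> Basis \<Longrightarrow> c \<in> Basis \<Longrightarrow> \<bar>L b \<bullet> c\<bar> \<le> K"
    and f: "CB k S' M f"
  shows "CB k S ((DIM('b) * K) ^ k * M) (\<lambda>x. f (L x))"
  using f
proof (induction k arbitrary: f)
  case 0
  then show ?case using bounded_ext_linear_compose[OF L] by simp
next
  case (Suc k)
  show ?case
  proof (cases "S = {}")
    case True
    then show ?thesis by (simp add: CB_empty)
  next
    case False
    then have M: "0 \<le> M" using Suc.prems CB_nonneg L(2) by blast
    let ?D = "real DIM('b) * K"
    have "1 \<le> real DIM('b)" using DIM_positive[where 'a = 'b] by linarith
    then have "1 \<le> ?D" using mult_mono[of 1 "real DIM('b)" 1 K] K(1) by simp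
    then have D: "M \<le> ?D ^ Suc k * M"
      using mult_right_mono[OF one_le_power M, of ?D "Suc k"] by simp
    have bdd: "bounded_ext S M (\<lambda>x. f (L x))"
      using bounded_ext_linear_compose[OF L CB_bounded_ext[OF Suc.prems]] .
    show ?thesis
    proof (rule CB_SucI[OF S])
      show "bounded_ext S (?D ^ Suc k * M) (\<lambda>x. f (L x))"
        using bdd D by (rule bounded_ext_mono)
      show "((\<lambda>x. f (L x)) has_derivative (\<lambda>v. frechet_derivative f (at (L x) within S') (L v)))
          (at x within S)" if "x \<in> S" for x
      proof -
        have 1: "(f has_derivative frechet_derivative f (at (L x) within S')) (at (L x) within L ` S)"
          using CB_has_derivative[OF Suc.prems, of "L x"] that L(2)
          by (meson has_derivative_subset imageI subsetD)
        show ?thesis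
          by (rule has_derivative_in_compose[OF bounded_linear_imp_has_derivative[OF L(1)] 1])
      qed
      fix b :: 'a assume b: "b \<in> Basis"
      have eq: "frechet_derivative f (at (L x) within S') (L b) =
          (\<Sum>c\<in>Basis. of_real (L b \<bullet> c) * frechet_derivative f (at (L x) within S') c)"
        if "x \<in> S" for x
      proof -
        have "linear (frechet_derivative f (at (L x) within S'))"
          using CB_has_derivative[OF Suc.prems, of "L x"] that L(2)
          by (meson has_derivative_linear imageI subsetD)
        then have "frechet_derivative f (at (L x) within S') (\<Sum>c\<in>Basis. (L b \<bullet> c) *\<^sub>R c) =
          (\<Sum>c\<in>Basis. (L b \<bullet> c) *\<^sub>R frechet_derivative f (at (L x) within S') c)"
          by (simp add: linear_sum linear_scale)
        then show ?thesis by (simp add: euclidean_representation scaleR_conv_of_real)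
      qed
      have "CB k S (\<Sum>c\<in>(Basis::'b set). K * (?D ^ k * M))
        (\<lambda>x. \<Sum>c\<in>Basis. of_real (L b \<bullet> c) * frechet_derivative f (at (L x) within S') c)"
      proof (rule CB_sum[OF S])
        fix c :: 'b assume c: "c \<in> Basis"
        have "CB k S (norm (of_real (L b \<bullet> c) :: complex) * (?D ^ k * M))
          (\<lambda>x. of_real (L b \<bullet> c) * frechet_derivative f (at (L x) within S') c)"
          using Suc.prems c by (intro CB_cmult[OF S] Suc.IH) auto
        then show "CB k S (K * (?D ^ k * M))
          (\<lambda>x. of_real (L b \<bullet> c) * frechet_derivative f (at (L x) within S') c)"
          by (rule CB_mono) (use K(2)[OF b c] M \<open>1 \<le> ?D\<close> in \<open>auto intro!: mult_right_mono\<close>)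
      qed auto
      then show "CB k S (?D ^ Suc k * M) (\<lambda>x. frechet_derivative f (at (L x) within S') (L b))"
        by (subst CB_cong[OF eq]) (auto simp: mult.assoc)
    qed
  qed
qed

lemma CB_subset:
  assumes "open S" "open S'" "S \<subseteq> S'" "CB k S' M f"
  shows "CB k S M f"
  using assms(4)
proof (induction k arbitrary: f)
  case 0
  then show ?case using bounded_ext_subset[OF assms(3)] by simp
next
  case (Suc k)
  have b: "bounded_ext S M f"
    using bounded_ext_subset[OF assms(3) CB_bounded_ext[OF Suc.prems]] .
  show ?case
  proof (rule CB_SucI[OF nondegenerate_open[OF assms(1)] b])
    show "(f has_derivative frechet_derivative f (at x within S')) (at x within S)" if "x \<in> S" for x
      using CB_has_derivative[OF Suc.prems] that assms(3) has_derivative_subset by blast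
  qed (use Suc in auto)
qed

text \<open>Gluing with the zero function. Since \<open>V\<close> and \<open>W\<close> are open,
  every point has a neighbourhood on which one of the two descriptions of \<open>f\<close> is
  valid.\<close>

lemma CB_localize:
  assumes "open S" "open V" "open W" "V \<union> W = UNIV"
    and "CB k (S \<inter> V) M f" "\<And>x. x \<in> S \<inter> W \<Longrightarrow> f x = 0" "0 \<le> M"
  shows "CB k S M f"
proof -
  have base: "bounded_ext S M f"
    if f: "bounded_ext (S \<inter> V) M f" "\<And>x. x \<in> S \<inter> W \<Longrightarrow> f x = 0" for f :: "'a \<Rightarrow> complex"
  proof -
    obtain g where g: "continuous_on (closure (S \<inter> V)) g" "\<forall>x\<in>S \<inter> V. g x = f x"
      using f(1) by (auto simp: bounded_ext_def)
    \<comment> \<open>\<open>V\<close> is open, so points of \<open>closure S\<close> in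
      \<open>V\<close> are limits of points of \<open>S\<close> in \<open>V\<close>, where
      \<open>g\<close> is prescribed.\<close>
    have sub: "closure S \<inter> V \<subseteq> closure (S \<inter> V)"
      using open_Int_closure_subset[OF assms(2), of S] by (simp add: Int_commute)
    \<comment> \<open>On the overlap, \<open>g\<close> is a limit of values of \<open>f\<close> at
      points of \<open>S\<close> lying in both \<open>V\<close> and \<open>W\<close>, which are all
      0. This makes the definition by cases continuous.\<close>
    have zero: "g x = 0" if x: "x \<in> closure S" "x \<in> V" "x \<in> W" for x
    proof -
      have "x \<in> closure (S \<inter> (V \<inter> W))"
        using open_Int_closure_subset[of "V \<inter> W" S] x assms(2,3)
        by (auto simp: Int_commute)
      moreover have "closure (S \<inter> (V \<inter> W)) \<subseteq> closure (S \<inter> V)"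
        by (rule closure_mono) auto
      ultimately show ?thesis
        using continuous_constant_on_closure[of "S \<inter> (V \<inter> W)" g 0 x] g f(2)
          continuous_on_subset[OF g(1)] by auto
    qed
    have S: "closure S = (closure S \<inter> V) \<union> (closure S \<inter> W)" using assms(4) by blast
    have cont: "continuous_on ((closure S \<inter> V) \<union> (closure S \<inter> W)) (\<lambda>x. if x \<in> V then g x else 0)"
    proof (rule continuous_on_cases_local_open)
      show "continuous_on (closure S \<inter> V) g" using continuous_on_subset[OF g(1) sub] .
      show "openin (top_of_set (closure S \<inter> V \<union> closure S \<inter> W)) (closure S \<inter> V)"
        using S assms(2) by (metis openin_open_Int)
      show "openin (top_of_set (closure S \<inter> V \<union> closure S \<inter> W)) (closure S \<inter> W)"
        using S assms(3) by (metis openin_open_Int)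
    qed (use zero in auto)
    have eq: "\<forall>x\<in>S. (if x \<in> V then g x else 0) = f x"
    proof
      fix x assume "x \<in> S"
      then show "(if x \<in> V then g x else 0) = f x"
        using g(2) f(2)[of x] assms(4) by (cases "x \<in> V") auto
    qed
    have "\<forall>x\<in>S. norm (f x) \<le> M"
    proof
      fix x assume "x \<in> S"
      then consider "x \<in> S \<inter> V" | "x \<in> S \<inter> W" using assms(4) by blast
      then show "norm (f x) \<le> M" using f assms(7) by cases (auto simp: bounded_ext_def)
    qed
    then show ?thesis unfolding bounded_ext_def using cont eq S[symmetric]
      by (intro conjI exI[of _ "\<lambda>x. if x \<in> V then g x else 0"]) auto
  qed
  show ?thesis using assms(5,6)
  proof (induction k arbitrary: f)
    case 0
    then show ?case using base by simp
  next
    case (Suc k)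
    define f' where "f' = (\<lambda>x. if x \<in> V then frechet_derivative f (at x within S \<inter> V) else (\<lambda>v. 0))"
    have SV: "open (S \<inter> V)" "open (S \<inter> W)" using assms by auto
    have W: "(f has_derivative (\<lambda>v. 0)) (at x within S)" if "x \<in> S \<inter> W" for x
    proof -
      have "((\<lambda>x. 0) has_derivative (\<lambda>v. 0)) (at x within S \<inter> W)" by simp
      then have "(f has_derivative (\<lambda>v. 0)) (at x within S \<inter> W)"
        using has_derivative_transform[OF that, of f "\<lambda>x. 0"] Suc.prems(2) by auto
      then show ?thesis
        using that assms(1) at_within_open[OF that SV(2)] at_within_open[of x S] by simp
    qed
    have V: "(f has_derivative frechet_derivative f (at x within S \<inter> V)) (at x within S)"
      if "x \<in> S \<inter> V" for x
      using CB_has_derivative[OF Suc.prems(1) that] that assms(1)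
        at_within_open[OF that SV(1)] at_within_open[of x S] by simp
    show ?case
    proof (rule CB_SucI[OF nondegenerate_open[OF assms(1)]])
      show "bounded_ext S M f" using base CB_bounded_ext Suc.prems by blast
      show "(f has_derivative f' x) (at x within S)" if "x \<in> S" for x
        using V[of x] W[of x] that assms(4) by (auto simp: f'_def)
      fix b :: 'a assume b: "b \<in> Basis"
      show "CB k S M (\<lambda>x. f' x b)"
      proof (rule Suc.IH)
        have "CB k (S \<inter> V) M (\<lambda>x. frechet_derivative f (at x within S \<inter> V) b)"
          using Suc.prems b by auto
        then show "CB k (S \<inter> V) M (\<lambda>x. f' x b)"
          by (subst CB_cong[where g = "\<lambda>x. frechet_derivative f (at x within S \<inter> V) b"])
            (auto simp: f'_def)
        show "f' x b = 0" if "x \<in> S \<inter> W" for x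
        proof (cases "x \<in> V")
          case True
          \<comment> \<open>Both derivatives are valid here, so by uniqueness the one used on
            \<open>V\<close> vanishes.\<close>
          then have "frechet_derivative f (at x within S \<inter> V) = (\<lambda>v. 0)"
            using frechet_derivative_within_eq[OF nondegenerate_open[OF assms(1)] _ V]
              frechet_derivative_within_eq[OF nondegenerate_open[OF assms(1)] _ W] that
            by (metis IntD1 IntI)
          then show ?thesis using True by (simp add: f'_def)
        qed (simp add: f'_def)
      qed
    qed
  qed
qed

subsection \<open>Spherical harmonics in Cartesian coordinates\<close>

text \<open>At a unit vector this is \<open>sin \<theta> * cis \<phi>\<close>; its powers and those
  of its conjugate carry the whole dependence on the azimuth.\<close>

definition xy :: "real^3 \<Rightarrow> complex"
  where "xy x = Complex (x $ 1) (x $ 2)"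

lemma norm_sq_3: "(norm (x::real^3))\<^sup>2 = (x $ 1)\<^sup>2 + (x $ 2)\<^sup>2 + (x $ 3)\<^sup>2"
  by (simp add: norm_vec_def L2_set_def sum_3)

lemma xy_cnj_xy:
  assumes "norm x = 1"
  shows "xy x * cnj (xy x) = 1 - (of_real (x $ 3))\<^sup>2"
proof -
  have "(x $ 1)\<^sup>2 + (x $ 2)\<^sup>2 = 1 - (x $ 3)\<^sup>2" using norm_sq_3[of x] assms by simp
  then show ?thesis by (simp add: xy_def complex_eq_iff power2_eq_square)
qed

lemma cmod_xy:
  assumes "norm x = 1"
  shows "cmod (xy x) = sqrt (1 - (x $ 3)\<^sup>2)"
  using norm_sq_3[of x] assms by (simp add: xy_def cmod_def)

definition leg :: "nat \<Rightarrow> nat \<Rightarrow> real poly"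
  where "leg l m = (pderiv ^^ m) (legendre l)"

definition rodrigues :: "nat \<Rightarrow> real poly"
  where "rodrigues l = [:-1, 0, 1:] ^ l"

lemma leg_rodrigues: "leg l m = smult (1 / (2 ^ l * fact l)) ((pderiv ^^ (l + m)) (rodrigues l))"
proof -
  have "(pderiv ^^ (m + l)) (rodrigues l) = (pderiv ^^ m) ((pderiv ^^ l) (rodrigues l))"
    by (simp only: funpow_add comp_apply)
  then show ?thesis
    by (simp only: add.commute[of l m] leg_def legendre_def rodrigues_def[symmetric]
        higher_pderiv_smult)
qed

lemma degree_leg: "degree (leg l m) \<le> l - m"
  by (simp add: leg_rodrigues degree_higher_pderiv rodrigues_def degree_power_eq)

text \<open>Of the \<open>2 * l\<close> degrees of the Rodrigues polynomial, \<open>l + m\<close>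
  are lost to differentiation. The exact degree \<open>l - m\<close> drives both the spanning and
  the independence argument, which are triangular in \<open>l\<close>.\<close>

lemma coeff_leg_top:
  assumes "m \<le> l"
  shows "coeff (leg l m) (l - m) \<noteq> 0"
proof -
  have "degree (rodrigues l) = 2 * l" by (simp add: rodrigues_def degree_power_eq)
  then have "coeff (rodrigues l) (2 * l) \<noteq> 0"
    unfolding rodrigues_def using leading_coeff_0_iff by (metis pCons_eq_0_iff power_not_zero zero_neq_one)
  moreover have "l - m + (l + m) = 2 * l" using assms by simp
  moreover have "pochhammer (of_nat (Suc (l - m)) :: real) (l + m) > 0"
    by (rule pochhammer_pos) simp
  ultimately show ?thesis
    unfolding leg_rodrigues by (simp add: coeff_higher_pderiv mult_2)
qed

text \<open>The normalisation of \<open>sph_harm\<close> with the Condon--Shortley sign merged into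
  it.\<close>

definition sphc :: "nat \<Rightarrow> nat \<Rightarrow> real"
  where "sphc l m = (-1) ^ m * sqrt ((2 * real l + 1) / (4 * pi) * fact (l - m) / fact (l + m))"

lemma sphc_nonzero: "sphc l m \<noteq> 0"
proof -
  have "0 < (2 * real l + 1) / (4 * pi) * fact (l - m) / fact (l + m)"
    by (intro divide_pos_pos mult_pos_pos) auto
  then show ?thesis unfolding sphc_def by (simp del: real_sqrt_divide real_sqrt_mult)
qed

text \<open>The square root in \<open>assoc_legendre\<close> is the modulus of \<open>xy x\<close>,
  so De Moivre's formula merges it with the azimuthal factor into a power. This works at the poles
  too, where the modulus is 0.\<close>

lemma sph_harm_nonneg_eq:
  assumes "norm x = 1"
  shows "sph_harm_nonneg l m x = of_real (sphc l m * poly (leg l m) (x $ 3)) * xy x ^ m"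
proof -
  have "of_real (sqrt (1 - (x $ 3)\<^sup>2)) ^ m * cis (real m * Arg (xy x)) = xy x ^ m"
  proof -
    have "xy x ^ m = (of_real (cmod (xy x)) * cis (Arg (xy x))) ^ m"
      using rcis_cmod_Arg[of "xy x"] by (simp only: rcis_def)
    also have "\<dots> = of_real (cmod (xy x)) ^ m * cis (real m * Arg (xy x))"
      by (simp only: power_mult_distrib Complex.DeMoivre)
    finally show ?thesis by (simp only: cmod_xy[OF assms])
  qed
  then show ?thesis
    by (simp add: sph_harm_nonneg_def assoc_legendre_def sphc_def leg_def xy_def algebra_simps)
qed

lemma sph_harm_pos:
  assumes "norm x = 1"
  shows "sph_harm l (int m) x = of_real (sphc l m * poly (leg l m) (x $ 3)) * xy x ^ m"
  using sph_harm_nonneg_eq[OF assms] by (simp add: sph_harm_def)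

lemma sph_harm_neg:
  assumes "norm x = 1"
  shows "sph_harm l (- int m) x =
    (-1) ^ m * of_real (sphc l m * poly (leg l m) (x $ 3)) * cnj (xy x) ^ m"
  using sph_harm_nonneg_eq[OF assms] by (cases "m = 0") (auto simp: sph_harm_def)

lemma sph_harm_uminus:
  assumes "norm x = 1"
  shows "sph_harm l (- int m) x = (-1) ^ m * cnj (sph_harm l (int m) x)"
  by (simp add: sph_harm_pos[OF assms] sph_harm_neg[OF assms])

subsection \<open>Polynomials on the sphere\<close>

text \<open>Equality is asked on the unit sphere only: that is where the relation between
  \<open>xy x\<close> and \<open>x $ 3\<close> holds, and only directions will be inserted.\<close>

definition sphspan :: "(real^3 \<Rightarrow> complex) \<Rightarrow> bool"
  where "sphspan f \<longleftrightarrow>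
    (\<exists>g\<in>cfun.span {sph_harm l m |l m. \<bar>m\<bar> \<le> int l}. \<forall>x. norm x = 1 \<longrightarrow> f x = g x)"

lemma sphspan_cong: "sphspan f \<Longrightarrow> (\<And>x. norm x = 1 \<Longrightarrow> f x = g x) \<Longrightarrow> sphspan g"
  by (auto simp: sphspan_def)

lemma sphspan_sph_harm: "\<bar>m\<bar> \<le> int l \<Longrightarrow> sphspan (sph_harm l m)"
  unfolding sphspan_def by (rule bexI[of _ "sph_harm l m"]) (auto intro: cfun.span_base)

lemma sphspan_zero: "sphspan (\<lambda>x. 0)"
  unfolding sphspan_def using cfun.span_zero by (auto simp: zero_fun_def intro!: bexI[of _ "\<lambda>x. 0"])

lemma sphspan_add:
  assumes "sphspan f" "sphspan g"
  shows "sphspan (\<lambda>x. f x + g x)"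
proof -
  obtain f' g' where "f' \<in> cfun.span {sph_harm l m |l m. \<bar>m\<bar> \<le> int l}"
    "g' \<in> cfun.span {sph_harm l m |l m. \<bar>m\<bar> \<le> int l}"
    "\<forall>x. norm x = 1 \<longrightarrow> f x = f' x" "\<forall>x. norm x = 1 \<longrightarrow> g x = g' x"
    using assms by (auto simp: sphspan_def)
  then show ?thesis
    unfolding sphspan_def by (intro bexI[of _ "f' + g'"] cfun.span_add) auto
qed

lemma sphspan_cmult:
  assumes "sphspan f"
  shows "sphspan (\<lambda>x. c * f x)"
proof -
  obtain f' where "f' \<in> cfun.span {sph_harm l m |l m. \<bar>m\<bar> \<le> int l}"
    "\<forall>x. norm x = 1 \<longrightarrow> f x = f' x"
    using assms by (auto simp: sphspan_def)
  then show ?thesis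
    unfolding sphspan_def by (intro bexI[of _ "cscale c f'"] cfun.span_scale) (auto simp: cscale_def)
qed

text \<open>\<open>leg (n + m) m\<close> has degree exactly \<open>n\<close>, so these polynomials
  span all polynomials, and the top coefficient of \<open>p\<close> can be removed step by step. The
  scalar \<open>c\<close> leaves room for the normalisation and the sign of the harmonics.\<close>

lemma sphspan_leg:
  assumes Y: "\<And>l. m \<le> l \<Longrightarrow> \<exists>c. c \<noteq> 0 \<and>
      sphspan (\<lambda>x. c * (of_real (poly (leg l m) (x $ 3)) * f x))"
  shows "sphspan (\<lambda>x. of_real (poly p (x $ 3)) * f x)"
proof -
  have "sphspan (\<lambda>x. of_real (poly p (x $ 3)) * f x)" if "\<forall>i\<ge>n. coeff p i = 0" for n p
    using that
  proof (induction n arbitrary: p)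
    case 0
    then have "p = 0" by (simp add: poly_eq_iff)
    then show ?case using sphspan_zero by simp
  next
    case (Suc n)
    let ?L = "leg (n + m) m"
    define a where "a = coeff p n / coeff ?L n"
    have top: "coeff ?L n \<noteq> 0" using coeff_leg_top[of m "n + m"] by simp
    have hi: "coeff ?L i = 0" if "i > n" for i
      using degree_leg[of "n + m" m] that by (intro coeff_eq_0) simp
    have "sphspan (\<lambda>x. of_real (poly (p - smult a ?L) (x $ 3)) * f x)"
    proof (rule Suc.IH, intro allI impI)
      fix i assume "n \<le> i"
      then show "coeff (p - smult a ?L) i = 0"
        using Suc.prems hi[of i] top by (cases "i = n") (auto simp: a_def)
    qed
    moreover obtain c where c: "c \<noteq> 0" "sphspan (\<lambda>x. c * (of_real (poly ?L (x $ 3)) * f x))"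
      using Y[of "n + m"] by auto
    ultimately have "sphspan (\<lambda>x. of_real (poly (p - smult a ?L) (x $ 3)) * f x +
        of_real a / c * (c * (of_real (poly ?L (x $ 3)) * f x)))"
      by (intro sphspan_add sphspan_cmult[OF c(2)])
    then show ?case using c(1) by (rule_tac sphspan_cong) (auto simp: algebra_simps)
  qed
  from this[of "Suc (degree p)" p] show ?thesis by (simp add: coeff_eq_0)
qed

lemma sphspan_pos: "sphspan (\<lambda>x. of_real (poly p (x $ 3)) * xy x ^ m)"
proof (rule sphspan_leg)
  fix l assume "m \<le> l"
  then have "sphspan (\<lambda>x. of_real (sphc l m) * (of_real (poly (leg l m) (x $ 3)) * xy x ^ m))"
    by (intro sphspan_cong[OF sphspan_sph_harm[of "int m" l]]) (auto simp: sph_harm_pos)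
  then show "\<exists>c. c \<noteq> 0 \<and> sphspan (\<lambda>x. c * (of_real (poly (leg l m) (x $ 3)) * xy x ^ m))"
    using sphc_nonzero[of l m] by (metis of_real_eq_0_iff)
qed

lemma sphspan_neg: "sphspan (\<lambda>x. of_real (poly p (x $ 3)) * cnj (xy x) ^ m)"
proof (rule sphspan_leg)
  fix l assume "m \<le> l"
  then have "sphspan (\<lambda>x. ((-1) ^ m * of_real (sphc l m)) *
      (of_real (poly (leg l m) (x $ 3)) * cnj (xy x) ^ m))"
    by (intro sphspan_cong[OF sphspan_sph_harm[of "- int m" l]]) (auto simp: sph_harm_neg)
  moreover have "(-1) ^ m * complex_of_real (sphc l m) \<noteq> 0" by (simp add: sphc_nonzero)
  ultimately show "\<exists>c. c \<noteq> 0 \<and> sphspan (\<lambda>x. c * (of_real (poly (leg l m) (x $ 3)) * cnj (xy x) ^ m))"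
    by metis
qed

lemma sphspan_mult:
  assumes h: "\<And>l m. \<bar>m\<bar> \<le> int l \<Longrightarrow> sphspan (\<lambda>x. h x * sph_harm l m x)" and f: "sphspan f"
  shows "sphspan (\<lambda>x. h x * f x)"
proof -
  obtain g where g: "g \<in> cfun.span {sph_harm l m |l m. \<bar>m\<bar> \<le> int l}"
    "\<And>x. norm x = 1 \<Longrightarrow> f x = g x"
    using f by (auto simp: sphspan_def)
  have "sphspan (\<lambda>x. h x * g x)"
    using g(1)
  proof (induction rule: cfun.span_induct_alt)
    case base
    then show ?case using sphspan_zero by (simp add: zero_fun_def)
  next
    case (step c x y)
    then have "sphspan (\<lambda>v. c * (h v * x v) + h v * y v)"
      using h by (intro sphspan_add sphspan_cmult) auto
    then show ?case by (rule sphspan_cong) (auto simp: cscale_def algebra_simps)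
  qed
  then show ?thesis using g(2) by (rule_tac sphspan_cong) auto
qed

lemma sph_harm_cases:
  assumes "\<bar>m\<bar> \<le> int l"
  obtains k where "k \<le> l" "m = int k" | k where "0 < k" "k \<le> l" "m = - int k"
proof (cases "m \<ge> 0")
  case True
  then show ?thesis using assms that(1)[of "nat m"] by auto
next
  case False
  then show ?thesis using assms that(2)[of "nat (- m)"] by auto
qed

lemma sphspan_mult_z:
  assumes "sphspan f" shows "sphspan (\<lambda>x. of_real (x $ 3) * f x)"
proof (rule sphspan_mult[OF _ assms])
  fix l m assume "\<bar>m\<bar> \<le> int l"
  then show "sphspan (\<lambda>x. of_real (x $ 3) * sph_harm l m x)"
  proof (cases rule: sph_harm_cases)
    case (1 k)
    show ?thesis
      by (rule sphspan_cong[OF sphspan_pos[of "smult (sphc l k) ([:0, 1:] * leg l k)" k]])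
        (simp add: 1 sph_harm_pos)
  next
    case (2 k)
    show ?thesis
      by (rule sphspan_cong[OF sphspan_neg[of "smult ((-1) ^ k * sphc l k) ([:0, 1:] * leg l k)" k]])
        (simp add: 2 sph_harm_neg)
  qed
qed

lemma sphspan_mult_xy:
  assumes "sphspan f" shows "sphspan (\<lambda>x. xy x * f x)"
proof (rule sphspan_mult[OF _ assms])
  fix l m assume "\<bar>m\<bar> \<le> int l"
  then show "sphspan (\<lambda>x. xy x * sph_harm l m x)"
  proof (cases rule: sph_harm_cases)
    case (1 k)
    show ?thesis
      by (rule sphspan_cong[OF sphspan_pos[of "smult (sphc l k) (leg l k)" "Suc k"]])
        (simp add: 1 sph_harm_pos)
  next
    case (2 k)
    \<comment> \<open>One factor \<open>xy x\<close> meets one conjugate factor and gives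
      \<open>1 - z^2\<close> for \<open>z = x $ 3\<close>, which joins the polynomial;
      \<open>j\<close> is the remaining power.\<close>
    obtain j where j: "k = Suc j" using 2 by (cases k) auto
    show ?thesis
    proof (rule sphspan_cong[OF sphspan_neg[of "smult ((-1) ^ k * sphc l k) ([:1, 0, -1:] * leg l k)" j]])
      fix x :: "real^3" assume x: "norm x = 1"
      have "xy x * sph_harm l m x = (-1) ^ k * of_real (sphc l k * poly (leg l k) (x $ 3)) *
          (xy x * cnj (xy x)) * cnj (xy x) ^ j"
        unfolding 2(3) sph_harm_neg[OF x] j power_Suc by (simp only: mult_ac)
      then show "complex_of_real (poly (smult ((-1) ^ k * sphc l k) ([:1, 0, -1:] * leg l k)) (x $ 3)) *
          cnj (xy x) ^ j = xy x * sph_harm l m x"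
        unfolding xy_cnj_xy[OF x] by (simp add: power2_eq_square algebra_simps)
    qed
  qed
qed

lemma sphspan_cnj:
  assumes "sphspan f" shows "sphspan (\<lambda>x. cnj (f x))"
proof -
  obtain g where g: "g \<in> cfun.span {sph_harm l m |l m. \<bar>m\<bar> \<le> int l}"
    "\<And>x. norm x = 1 \<Longrightarrow> f x = g x"
    using assms by (auto simp: sphspan_def)
  have base: "sphspan (\<lambda>x. cnj (sph_harm l m x))" if "\<bar>m\<bar> \<le> int l" for l m
    using that
  proof (cases rule: sph_harm_cases)
    case (1 k)
    show ?thesis
      by (rule sphspan_cong[OF sphspan_neg[of "smult (sphc l k) (leg l k)" k]])
        (simp add: 1 sph_harm_pos)
  next
    case (2 k)
    show ?thesis
      by (rule sphspan_cong[OF sphspan_pos[of "smult ((-1) ^ k * sphc l k) (leg l k)" k]])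
        (simp add: 2 sph_harm_neg)
  qed
  have "sphspan (\<lambda>x. cnj (g x))"
    using g(1)
  proof (induction rule: cfun.span_induct_alt)
    case base
    then show ?case using sphspan_zero by (simp add: zero_fun_def)
  next
    case (step c x y)
    then have "sphspan (\<lambda>v. cnj c * cnj (x v) + cnj (y v))"
      using base by (intro sphspan_add sphspan_cmult) auto
    then show ?case by (rule sphspan_cong) (auto simp: cscale_def algebra_simps)
  qed
  then show ?thesis using g(2) by (rule_tac sphspan_cong) auto
qed

text \<open>Conjugation swaps \<open>xy x\<close> with its conjugate and preserves the span, so this
  reduces to \<open>sphspan_mult_xy\<close>.\<close>

lemma sphspan_mult_cnj_xy:
  assumes "sphspan f" shows "sphspan (\<lambda>x. cnj (xy x) * f x)"
  using sphspan_cnj[OF sphspan_mult_xy[OF sphspan_cnj[OF assms]]] by simp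

lemma sphspan_mult_coordinate:
  assumes "sphspan f" shows "sphspan (\<lambda>x. of_real (x $ i) * f x)"
proof -
  have 1: "sphspan (\<lambda>x. of_real (x $ 1) * f x)"
    by (rule sphspan_cong[OF sphspan_cmult[OF sphspan_add[OF sphspan_mult_xy[OF assms]
        sphspan_mult_cnj_xy[OF assms]], of "1 / 2"]])
      (simp add: xy_def complex_eq_iff field_simps)
  have 2: "sphspan (\<lambda>x. of_real (x $ 2) * f x)"
    by (rule sphspan_cong[OF sphspan_cmult[OF sphspan_add[OF sphspan_mult_xy[OF assms]
        sphspan_cmult[OF sphspan_mult_cnj_xy[OF assms], of "-1"]], of "- \<i> / 2"]])
      (simp add: xy_def complex_eq_iff field_simps)
  have "i = 1 \<or> i = 2 \<or> i = 3" using exhaust_3 by blast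
  then show ?thesis using 1 2 sphspan_mult_z[OF assms] by auto
qed

lemma sphspan_monomial: "sphspan (\<lambda>x. of_real (\<Prod>i\<in>UNIV. (x $ i) ^ k i))"
proof -
  have pw: "sphspan (\<lambda>x. of_real ((x $ i) ^ j) * f x)" if "sphspan f" for i j f
  proof (induction j)
    case (Suc j)
    from sphspan_mult_coordinate[OF this, of i] show ?case
      by (rule sphspan_cong) (simp add: algebra_simps)
  qed (use that in simp)
  have "sphspan (\<lambda>x. 1)"
    using sphspan_pos[of 1 0] by simp
  from pw[OF pw[OF pw[OF this, of 3 "k 3"], of 2 "k 2"], of 1 "k 1"]
  show ?thesis
  proof (rule sphspan_cong)
    have "(\<Prod>i\<in>UNIV. (x $ i) ^ k i) = (x $ 1) ^ k 1 * ((x $ 2) ^ k 2 * (x $ 3) ^ k 3)" for x :: "real^3"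
      unfolding UNIV_3 by simp
    then show "of_real ((x $ 1) ^ k 1) * (of_real ((x $ 2) ^ k 2) * (of_real ((x $ 3) ^ k 3) * 1)) =
        complex_of_real (\<Prod>i\<in>UNIV. (x $ i) ^ k i)" for x :: "real^3"
      by (simp only: of_real_mult mult_1_right)
  qed
qed

subsection \<open>Polynomial approximation in \<open>C\<^sup>k\<close>\<close>

definition sbox :: "real \<Rightarrow> 'a::euclidean_space set"
  where "sbox r = cbox (- (r *\<^sub>R One)) (r *\<^sub>R One)"

lemma mem_sbox: "x \<in> sbox r \<longleftrightarrow> (\<forall>b\<in>Basis. \<bar>x \<bullet> b\<bar> \<le> r)"
  by (auto simp: sbox_def mem_box abs_le_iff algebra_simps)

lemma norm_le_imp_mem_sbox: "norm x \<le> r \<Longrightarrow> x \<in> sbox r"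
  unfolding mem_sbox using Basis_le_norm order_trans by blast

lemma norm_le_of_mem_sbox:
  fixes x :: "'a::euclidean_space"
  assumes "x \<in> sbox r"
  shows "norm x \<le> real DIM('a) * r"
proof -
  have "norm x \<le> (\<Sum>b\<in>Basis. \<bar>x \<bullet> b\<bar>)" by (rule norm_le_l1)
  also have "\<dots> \<le> (\<Sum>b\<in>(Basis::'a set). r)"
    using assms by (intro sum_mono) (simp add: mem_sbox)
  finally show ?thesis by simp
qed

lemma content_sbox_pos:
  assumes "0 < r"
  shows "0 < measure lborel (sbox r :: 'a::euclidean_space set)"
proof -
  have "(0::'a) \<in> sbox r" using assms by (simp add: mem_sbox)
  then show ?thesis
    using assms unfolding sbox_def by (subst content_cbox') (auto intro!: prod_pos)
qed

text \<open>The classical kernel, without its normalising constant. \<open>L\<close> will be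
  \<open>DIM('a) * r\<close>, an upper bound for the norm on the cube \<open>sbox r\<close>, which
  makes the kernel nonnegative there.\<close>

definition landau :: "real \<Rightarrow> nat \<Rightarrow> 'a::euclidean_space \<Rightarrow> real"
  where "landau L n y = (1 - (norm y / L)\<^sup>2) ^ n"

lemma continuous_landau [continuous_intros]:
  "continuous_on S f \<Longrightarrow> continuous_on S (\<lambda>x. landau L n (f x))"
  unfolding landau_def divide_inverse by (intro continuous_intros)

definition landau_mass :: "'a::euclidean_space itself \<Rightarrow> real \<Rightarrow> nat \<Rightarrow> real"
  where "landau_mass T r n = integral (sbox r :: 'a set) (landau (real DIM('a) * r) n)"

lemma landau_nonneg:
  fixes y :: "'a::euclidean_space"
  assumes "0 < r" "y \<in> sbox r"
  shows "0 \<le> landau (real DIM('a) * r) n y"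
proof -
  have "norm y / (real DIM('a) * r) \<le> 1"
    using norm_le_of_mem_sbox[OF assms(2)] assms(1) by (simp add: divide_le_eq)
  then have "(norm y / (real DIM('a) * r))\<^sup>2 \<le> 1"
    using assms(1) by (intro power_le_one) auto
  then show ?thesis unfolding landau_def by (intro zero_le_power) simp
qed

text \<open>Away from the origin the kernel is at most \<open>a ^ n\<close>, on a small cube it is
  at least \<open>b ^ n\<close>, and \<open>a < b\<close>; the volume of the small cube is a fixed
  factor.\<close>

lemma landau_concentration:
  assumes r: "0 < r" and "0 < \<delta>" "0 < \<eta>"
  shows "\<forall>\<^sub>F n in sequentially. 0 < landau_mass TYPE('a::euclidean_space) r n \<and>
    (\<forall>y\<in>(sbox r :: 'a set). \<delta> \<le> norm y \<longrightarrow>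
      landau (real DIM('a) * r) n y \<le> \<eta> * landau_mass TYPE('a) r n)"
proof -
  define L where "L = real DIM('a) * r"
  have L: "0 < L" using r by (simp add: L_def)
  \<comment> \<open>Capping at \<open>L\<close> keeps \<open>d / L\<close> at most 1, hence
    \<open>a\<close> nonnegative.\<close>
  define d where "d = min \<delta> L"
  have d: "0 < d" "d \<le> L" "d \<le> \<delta>" using assms L by (auto simp: d_def)
  define a where "a = 1 - (d / L)\<^sup>2"
  define b where "b = 1 - (d / (2 * L))\<^sup>2"
  have dL: "d / L \<le> 1" "0 < d / L" using d L by auto
  have a: "0 \<le> a" using dL power_le_one[of "d / L" 2] by (simp add: a_def)
  have "(d / (2 * L))\<^sup>2 = (d / L)\<^sup>2 / 4" by (simp add: power_divide power_mult_distrib)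
  moreover have "0 < (d / L)\<^sup>2" using dL(2) by (rule zero_less_power)
  ultimately have ab: "a < b" unfolding a_def b_def by linarith
  \<comment> \<open>With this half-side the cube lies in the ball of radius \<open>d / 2\<close>,
    where the kernel is at least \<open>b ^ n\<close>.\<close>
  define s where "s = d / (2 * real DIM('a))"
  have s: "0 < s" using d by (simp add: s_def)
  have "d / (2 * real DIM('a)) \<le> L / (2 * real DIM('a))" using d by (intro divide_right_mono) auto
  then have sr: "s \<le> r" using r by (simp add: s_def L_def)
  let ?W = "sbox s :: 'a set" and ?X = "sbox r :: 'a set"
  have WX: "?W \<subseteq> ?X" using sr by (force simp: mem_sbox)
  have int: "landau L n integrable_on sbox q" for n and q :: real
    unfolding sbox_def by (intro integrable_continuous continuous_intros)
  have low: "b ^ n * measure lborel ?W \<le> landau_mass TYPE('a) r n" for n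
  proof -
    have "integral ?W (\<lambda>y. b ^ n) \<le> integral ?W (landau L n)"
    proof (rule integral_le)
      fix y :: 'a assume "y \<in> sbox s"
      then have "norm y \<le> d / 2"
        using norm_le_of_mem_sbox[of y s] by (simp add: s_def)
      then have "norm y / L \<le> d / (2 * L)"
        using L by (simp add: divide_le_eq)
      then have "(norm y / L)\<^sup>2 \<le> (d / (2 * L))\<^sup>2"
        using L by (intro power_mono) auto
      then show "b ^ n \<le> landau L n y"
        using a ab unfolding landau_def b_def by (intro power_mono) auto
    qed (use int in \<open>auto simp: sbox_def\<close>)
    also have "\<dots> \<le> integral ?X (landau L n)"
      using WX int landau_nonneg[OF r] by (intro integral_subset_le) (auto simp: L_def)
    finally show ?thesis by (simp add: L_def landau_mass_def sbox_def mult.commute)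
  qed
  have pos: "0 < landau_mass TYPE('a) r n" for n
  proof -
    have "0 < b ^ n * measure lborel ?W" using a ab content_sbox_pos[OF s, where 'a = 'a] by (intro mult_pos_pos) auto
    then show ?thesis using low[of n] by linarith
  qed
  have "(\<lambda>n. (a / b) ^ n) \<longlonglongrightarrow> 0" using a ab by (intro LIMSEQ_realpow_zero) auto
  then have "\<forall>\<^sub>F n in sequentially. (a / b) ^ n < \<eta> * measure lborel ?W"
    using content_sbox_pos[OF s, where 'a = 'a] assms by (intro order_tendstoD) auto
  then show ?thesis
  proof eventually_elim
    case (elim n)
    have "landau L n y \<le> \<eta> * landau_mass TYPE('a) r n" if "y \<in> sbox r" "\<delta> \<le> norm y" for y :: 'a
    proof -
      have "d / L \<le> norm y / L" using that d L by (intro divide_right_mono) auto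
      then have "(d / L)\<^sup>2 \<le> (norm y / L)\<^sup>2" using dL by (intro power_mono) auto
      moreover have "norm y / L \<le> 1"
        using norm_le_of_mem_sbox[OF that(1)] L by (simp add: L_def)
      then have "(norm y / L)\<^sup>2 \<le> 1" using L by (intro power_le_one) auto
      ultimately have "landau L n y \<le> a ^ n"
        unfolding landau_def a_def by (intro power_mono) auto
      also have "\<dots> = (a / b) ^ n * b ^ n" using a ab by (simp add: power_divide)
      also have "\<dots> \<le> \<eta> * measure lborel ?W * b ^ n"
        using elim a ab by (intro mult_right_mono) auto
      also have "\<dots> \<le> \<eta> * landau_mass TYPE('a) r n"
        using mult_left_mono[OF low[of n], of \<eta>] assms by (simp add: algebra_simps)
      finally show ?thesis .
    qed
    then show ?case using pos by (simp add: L_def)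
  qed
qed

text \<open>The kernel is even, so \<open>G (x + y)\<close> gives the convolution. In this form
  \<open>x\<close> occurs in \<open>G\<close> only, and derivatives fall on
  \<open>G\<close>.\<close>

definition landau_conv :: "real \<Rightarrow> nat \<Rightarrow> ('a::euclidean_space \<Rightarrow> complex) \<Rightarrow> 'a \<Rightarrow> complex"
  where "landau_conv r n G x = (1 / landau_mass TYPE('a) r n) *\<^sub>R
    integral (sbox r) (\<lambda>y. landau (real DIM('a) * r) n y *\<^sub>R G (x + y))"

lemma continuous_landau_conv:
  fixes G :: "'a::euclidean_space \<Rightarrow> complex"
  assumes "continuous_on UNIV G"
  shows "continuous_on S (landau_conv r n G)"
proof -
  have "continuous_on UNIV (\<lambda>x. integral (sbox r) (\<lambda>y. landau (real DIM('a) * r) n y *\<^sub>R G (x + y)))"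
    unfolding sbox_def
    by (rule integral_continuous_on_param)
      (auto simp: split_beta intro!: continuous_intros continuous_on_compose2[OF assms])
  then show ?thesis
    unfolding landau_conv_def
    by (intro continuous_intros) (rule continuous_on_subset, auto)
qed

text \<open>Derivatives pass to \<open>G\<close>, so uniform convergence for continuous functions
  will apply to each derivative of \<open>G\<close> separately.\<close>

lemma has_derivative_landau_conv:
  fixes G :: "'a::euclidean_space \<Rightarrow> complex"
  assumes G: "\<And>x. (G has_derivative G' x) (at x)"
    and cont: "\<And>b. b \<in> Basis \<Longrightarrow> continuous_on UNIV (\<lambda>x. G' x b)"
    and U: "convex U" "x0 \<in> U"
  shows "(landau_conv r n G has_derivative (\<lambda>v. landau_conv r n (\<lambda>x. G' x v) x0)) (at x0 within U)"
proof -
  let ?k = "\<lambda>y::'a. landau (real DIM('a) * r) n y"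
  \<comment> \<open>\<open>leibniz_rule\<close> asks for a derivative that is continuous as an
    operator; in finite dimension this follows from the basis directions.\<close>
  define D where "D x = Blinfun (G' x)" for x
  have bl: "bounded_linear (G' x)" for x using G has_derivative_bounded_linear by blast
  have D: "blinfun_apply (D x) = G' x" for x
    unfolding D_def by (rule bounded_linear_Blinfun_apply[OF bl])
  have contD: "continuous_on UNIV D"
    by (rule continuous_on_blinfun_componentwise) (simp add: D cont)
  have contG: "continuous_on UNIV G"
    using G has_derivative_continuous continuous_at_imp_continuous_on by blast
  have cF: "continuous_on (U \<times> sbox r) (\<lambda>(x, y). ?k y *\<^sub>R D (x + y))"
    unfolding split_beta
    by (intro continuous_intros continuous_on_compose2[OF contD] subset_UNIV)
  have "((\<lambda>x. integral (sbox r) (\<lambda>y. ?k y *\<^sub>R G (x + y))) has_derivative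
      blinfun_apply (integral (sbox r) (\<lambda>y. ?k y *\<^sub>R D (x0 + y)))) (at x0 within U)"
    unfolding sbox_def
  proof (rule leibniz_rule[OF _ _ _ U(2,1)])
    fix x t assume "x \<in> U"
    have "((\<lambda>x. G (x + t)) has_derivative G' (x + t)) (at x within U)"
    proof -
      have "((\<lambda>x. x + t) has_derivative (\<lambda>v. v)) (at x within U)"
        by (auto intro!: derivative_eq_intros)
      from has_derivative_compose[OF this G] show ?thesis .
    qed
    then show "((\<lambda>x. ?k t *\<^sub>R G (x + t)) has_derivative blinfun_apply (?k t *\<^sub>R D (x + t)))
        (at x within U)"
      by (auto simp: D scaleR_blinfun.rep_eq intro: has_derivative_scaleR_right)
  next
    fix x assume "x \<in> U"
    show "(\<lambda>y. ?k y *\<^sub>R G (x + y)) integrable_on cbox (- (r *\<^sub>R One)) (r *\<^sub>R One)"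
      by (intro integrable_continuous continuous_intros continuous_on_compose2[OF contG]) auto
  next
    show "continuous_on (U \<times> cbox (- (r *\<^sub>R One)) (r *\<^sub>R One)) (\<lambda>(x, y). ?k y *\<^sub>R D (x + y))"
      using cF unfolding sbox_def .
  qed
  moreover have "blinfun_apply (integral (sbox r) (\<lambda>y. ?k y *\<^sub>R D (x0 + y))) =
      (\<lambda>v. integral (sbox r) (\<lambda>y. ?k y *\<^sub>R G' (x0 + y) v))"
  proof
    fix v
    have "(\<lambda>y. ?k y *\<^sub>R D (x0 + y)) integrable_on sbox r"
      unfolding sbox_def
      by (intro integrable_continuous continuous_intros continuous_on_compose2[OF contD] subset_UNIV)
    from blinfun_apply_integral[OF this, of v]
    show "blinfun_apply (integral (sbox r) (\<lambda>y. ?k y *\<^sub>R D (x0 + y))) v =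
        integral (sbox r) (\<lambda>y. ?k y *\<^sub>R G' (x0 + y) v)"
      by (simp only: D scaleR_blinfun.rep_eq)
  qed
  ultimately have "((\<lambda>x. integral (sbox r) (\<lambda>y. ?k y *\<^sub>R G (x + y))) has_derivative
      (\<lambda>v. integral (sbox r) (\<lambda>y. ?k y *\<^sub>R G' (x0 + y) v))) (at x0 within U)"
    by (simp only:)
  then show ?thesis
    unfolding landau_conv_def by (rule has_derivative_scaleR_right)
qed

text \<open>Standard approximate identity: near the origin uniform continuity makes the integrand
  small, elsewhere the kernel is negligible against its mass.\<close>

lemma landau_conv_uniform:
  fixes G :: "'a::euclidean_space \<Rightarrow> complex"
  assumes G: "continuous_on UNIV G" and r: "0 < r" and e: "0 < e"
  shows "\<forall>\<^sub>F n in sequentially. \<forall>x\<in>cball 0 r. norm (G x - landau_conv r n G x) \<le> e"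
proof -
  \<comment> \<open>For \<open>x\<close> in the ball of radius \<open>r\<close>, all points
    \<open>x + y\<close> with \<open>y\<close> in the cube stay in this compact ball.\<close>
  let ?C = "cball (0::'a) (r + real DIM('a) * r)" and ?X = "sbox r :: 'a set"
  have comp: "compact ?C" by simp
  have GC: "continuous_on ?C G" using G continuous_on_subset by blast
  have "uniformly_continuous_on ?C G" by (rule compact_uniformly_continuous[OF GC comp])
  then obtain \<delta> where \<delta>: "\<delta> > 0"
    "\<And>x x'. x \<in> ?C \<Longrightarrow> x' \<in> ?C \<Longrightarrow> dist x' x < \<delta> \<Longrightarrow> dist (G x') (G x) < e / 2"
    unfolding uniformly_continuous_on_def using e by (meson half_gt_zero)
  have "bounded (G ` ?C)" using compact_continuous_image[OF GC comp] compact_imp_bounded by blast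
  then obtain M where M: "0 < M" "\<And>x. x \<in> ?C \<Longrightarrow> norm (G x) \<le> M"
    by (auto simp: bounded_pos)
  define V where "V = measure lborel ?X"
  have V: "0 < V" using content_sbox_pos[OF r, where 'a = 'a] by (simp add: V_def)
  \<comment> \<open>The far part contributes at most \<open>2 * M * \<eta> * Z * V\<close>, which
    this choice makes half of \<open>e * Z\<close>.\<close>
  define \<eta> where "\<eta> = e / (4 * M * V)"
  have \<eta>: "0 < \<eta>" using e M V by (simp add: \<eta>_def)
  have "\<forall>\<^sub>F n in sequentially. 0 < landau_mass TYPE('a) r n \<and>
    (\<forall>y\<in>(sbox r :: 'a set). \<delta> \<le> norm y \<longrightarrow>
      landau (real DIM('a) * r) n y \<le> \<eta> * landau_mass TYPE('a) r n)"
    by (rule landau_concentration[OF r \<delta>(1) \<eta>])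
  then show ?thesis
  proof eventually_elim
    case (elim n)
    let ?k = "\<lambda>y::'a. landau (real DIM('a) * r) n y"
    define Z where "Z = landau_mass TYPE('a) r n"
    have Z: "0 < Z" using elim by (simp add: Z_def)
    have intk: "?k integrable_on ?X"
      unfolding sbox_def by (intro integrable_continuous continuous_intros)
    show ?case
    proof
      fix x :: 'a assume x: "x \<in> cball 0 r"
      have int: "(\<lambda>y. ?k y *\<^sub>R G (x + y)) integrable_on ?X"
        unfolding sbox_def
        by (intro integrable_continuous continuous_intros continuous_on_compose2[OF G]) auto
      have int': "(\<lambda>y. ?k y *\<^sub>R G x) integrable_on ?X"
        unfolding sbox_def by (intro integrable_continuous continuous_intros)
      have bound: "norm (?k y *\<^sub>R G x - ?k y *\<^sub>R G (x + y)) \<le> e / 2 * ?k y + 2 * M * \<eta> * Z"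
        if y: "y \<in> ?X" for y
      proof -
        have k0: "0 \<le> ?k y" by (rule landau_nonneg[OF r y])
        have "norm x \<le> r" "norm y \<le> real DIM('a) * r" using x norm_le_of_mem_sbox[OF y] by auto
        then have C: "x \<in> ?C" "x + y \<in> ?C"
          using norm_triangle_ineq[of x y] r by (auto intro: order_trans add_mono)
        have eq: "norm (?k y *\<^sub>R G x - ?k y *\<^sub>R G (x + y)) = ?k y * norm (G x - G (x + y))"
          using k0 by (simp add: scaleR_right_diff_distrib[symmetric])
        show ?thesis
        proof (cases "norm y < \<delta>")
          case True
          then have "norm (G x - G (x + y)) \<le> e / 2"
            using \<delta>(2)[OF C(2) C(1)] by (simp add: dist_norm)
          then have "?k y * norm (G x - G (x + y)) \<le> e / 2 * ?k y"
            using mult_right_mono[OF _ k0] by (metis mult.commute)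
          also have "\<dots> \<le> e / 2 * ?k y + 2 * M * \<eta> * Z" using M \<eta> Z by simp
          finally show ?thesis using eq by simp
        next
          case False
          then have "?k y \<le> \<eta> * Z" using elim y by (simp add: Z_def)
          moreover have "norm (G x - G (x + y)) \<le> 2 * M"
            using norm_triangle_ineq4[of "G x" "G (x + y)"] M(2)[OF C(1)] M(2)[OF C(2)] by linarith
          ultimately have "?k y * norm (G x - G (x + y)) \<le> \<eta> * Z * (2 * M)"
            using k0 \<eta> Z by (intro mult_mono) auto
          also have "\<dots> \<le> e / 2 * ?k y + 2 * M * \<eta> * Z" using e k0 by simp
          finally show ?thesis using eq by simp
        qed
      qed
      have cint: "(\<lambda>y. 2 * M * \<eta> * Z) integrable_on ?X"
        unfolding sbox_def by (intro integrable_continuous continuous_intros)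
      have int2: "(\<lambda>y. e / 2 * ?k y) integrable_on ?X"
        unfolding sbox_def by (intro integrable_continuous continuous_intros)
      have "norm (integral ?X (\<lambda>y. ?k y *\<^sub>R G x - ?k y *\<^sub>R G (x + y))) \<le>
          integral ?X (\<lambda>y. e / 2 * ?k y + 2 * M * \<eta> * Z)"
        by (intro Henstock_Kurzweil_Integration.integral_norm_bound_integral integrable_add
            integrable_diff int int' int2 cint bound)
      also have "\<dots> = integral ?X (\<lambda>y. e / 2 * ?k y) + integral ?X (\<lambda>y. 2 * M * \<eta> * Z)"
        by (rule Henstock_Kurzweil_Integration.integral_add[OF int2 cint])
      also have "\<dots> = e / 2 * Z + 2 * M * \<eta> * Z * V"
        unfolding integral_mult_right by (simp add: Z_def landau_mass_def V_def sbox_def)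
      also have "\<dots> = e * Z" using M V by (simp add: \<eta>_def field_simps)
      finally have 1: "norm (integral ?X (\<lambda>y. ?k y *\<^sub>R G x - ?k y *\<^sub>R G (x + y))) \<le> e * Z" .
      have "integral ?X (\<lambda>y. ?k y *\<^sub>R G x) = Z *\<^sub>R G x"
      proof -
        have "integral ?X (\<lambda>y. ?k y *\<^sub>R G x) = integral ?X ?k *\<^sub>R G x"
          by (rule integral_unique, rule has_integral_scaleR_left)
            (simp add: integrable_integral intk)
        then show ?thesis by (simp add: Z_def landau_mass_def)
      qed
      then have "integral ?X (\<lambda>y. ?k y *\<^sub>R G x - ?k y *\<^sub>R G (x + y)) =
          Z *\<^sub>R (G x - landau_conv r n G x)"
        using Z int int'
        by (simp add: Henstock_Kurzweil_Integration.integral_diff landau_conv_def Z_def[symmetric]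
            scaleR_right_diff_distrib)
      then have "Z * norm (G x - landau_conv r n G x) \<le> e * Z" using 1 Z by simp
      then show "norm (G x - landau_conv r n G x) \<le> e" using Z by (simp add: mult.commute)
    qed
  qed
qed

lemma CB_UNIV_continuous: "CB k UNIV M f \<Longrightarrow> continuous_on UNIV f"
proof -
  assume "CB k UNIV M f"
  then have "bounded_ext UNIV M f" by (rule CB_bounded_ext)
  then obtain g where "continuous_on UNIV g" "\<forall>x. g x = f x" by (auto simp: bounded_ext_def)
  then show ?thesis by (metis ext)
qed

text \<open>Phrased with an eventuality in \<open>n\<close>, so that the finitely many basis
  directions at each order share one \<open>n\<close>.\<close>

lemma landau_conv_CB:
  fixes G :: "'a::euclidean_space \<Rightarrow> complex"
  assumes "CB t UNIV M G" and r: "0 < r" and e: "0 < e"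
  shows "\<forall>\<^sub>F n in sequentially. CB t (ball 0 r) e (\<lambda>x. G x - landau_conv r n G x)"
  using assms(1)
proof (induction t arbitrary: G)
  have base: "bounded_ext (ball 0 r) e (\<lambda>x. G x - landau_conv r n G x)"
    if G: "continuous_on UNIV G" and "\<forall>x\<in>cball 0 r. norm (G x - landau_conv r n G x) \<le> e"
    for G and n
    unfolding bounded_ext_def
  proof (intro conjI exI)
    show "continuous_on (closure (ball 0 r)) (\<lambda>x. G x - landau_conv r n G x)"
      using continuous_on_subset[OF G] by (intro continuous_intros continuous_landau_conv G) auto
  qed (use that in auto)
  {
    case 0
    show ?case
      using landau_conv_uniform[OF CB_UNIV_continuous[OF 0] r e]
      by eventually_elim (use base CB_UNIV_continuous[OF 0] in auto)
  next
    case (Suc t)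
    have G: "continuous_on UNIV G" by (rule CB_UNIV_continuous[OF Suc.prems])
    define G' where "G' x = frechet_derivative G (at x)" for x
    have der: "(G has_derivative G' x) (at x)" for x
      using CB_has_derivative[OF Suc.prems] by (simp add: G'_def)
    have CBG': "CB t UNIV M (\<lambda>x. G' x b)" if "b \<in> Basis" for b
      using Suc.prems that by (simp add: G'_def)
    have "\<forall>\<^sub>F n in sequentially. \<forall>b\<in>Basis.
        CB t (ball 0 r) e (\<lambda>x. G' x b - landau_conv r n (\<lambda>x. G' x b) x)"
      by (intro eventually_ball_finite ballI Suc.IH CBG') auto
    with landau_conv_uniform[OF G r e] show ?case
    proof eventually_elim
      case (elim n)
      show ?case
      proof (rule CB_SucI[OF nondegenerate_open[OF open_ball] base[OF G elim(1)]])
        fix x :: 'a assume "x \<in> ball 0 r"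
        then show "((\<lambda>x. G x - landau_conv r n G x) has_derivative
            (\<lambda>b. G' x b - landau_conv r n (\<lambda>x. G' x b) x)) (at x within ball 0 r)"
          by (intro has_derivative_diff has_derivative_landau_conv der has_derivative_at_withinI
              CB_UNIV_continuous[OF CBG']) auto
      qed (use elim in auto)
    qed
  }
qed

text \<open>Substituting \<open>u = x + y\<close> moves \<open>x\<close> from \<open>G\<close> into
  the kernel. The moving cube can be replaced by the fixed \<open>sbox r\<close> because
  \<open>G\<close> vanishes outside it; the kernel lives on \<open>sbox (2 * r)\<close> so that the
  shifted cube fits in for every \<open>x\<close> of norm at most \<open>r\<close>.\<close>

lemma landau_conv_shift:
  fixes G :: "'a::euclidean_space \<Rightarrow> complex"
  assumes G: "continuous_on UNIV G" and x: "norm x \<le> r"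
    and supp: "\<And>x. norm x > r \<Longrightarrow> G x = 0"
  shows "landau_conv (2 * r) n G x = (1 / landau_mass TYPE('a) (2 * r) n) *\<^sub>R
    integral (sbox r) (\<lambda>u. landau (real DIM('a) * (2 * r)) n (u - x) *\<^sub>R G u)"
proof -
  let ?k = "\<lambda>y::'a. landau (real DIM('a) * (2 * r)) n y"
  let ?F = "\<lambda>u. ?k (u - x) *\<^sub>R G u" and ?a = "- (r *\<^sub>R One) :: 'a" and ?b = "r *\<^sub>R One :: 'a"
  have "?F integrable_on cbox ?a ?b"
    by (intro integrable_continuous continuous_intros continuous_on_subset[OF G]) auto
  then have "(?F has_integral integral (cbox ?a ?b) ?F) (cbox ?a ?b)" by (rule integrable_integral)
  then have "((\<lambda>y. ?F (y + x)) has_integral integral (cbox ?a ?b) ?F) (cbox (?a - x) (?b - x))"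
    using has_integral_affinity_iff[of 1 ?F x "integral (cbox ?a ?b) ?F" ?a ?b] by simp
  then have 1: "((\<lambda>y. ?k y *\<^sub>R G (x + y)) has_integral integral (sbox r) ?F) (cbox (?a - x) (?b - x))"
    by (simp add: sbox_def add.commute)
  have mem: "y \<in> cbox (?a - x) (?b - x) \<longleftrightarrow> x + y \<in> sbox r" for y
    by (auto simp: sbox_def mem_box inner_diff_left inner_add_left algebra_simps)
  have "((\<lambda>y. ?k y *\<^sub>R G (x + y)) has_integral integral (sbox r) ?F) (sbox (2 * r))"
  proof (rule has_integral_on_superset[OF 1])
    fix y assume "y \<notin> cbox (?a - x) (?b - x)"
    then have "norm (x + y) > r" using mem norm_le_imp_mem_sbox[of "x + y" r] by force
    then show "?k y *\<^sub>R G (x + y) = 0" using supp by simp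
  next
    show "cbox (?a - x) (?b - x) \<subseteq> sbox (2 * r)"
    proof
      fix y assume "y \<in> cbox (?a - x) (?b - x)"
      then have y: "x + y \<in> sbox r" using mem by blast
      show "y \<in> sbox (2 * r)"
        unfolding mem_sbox
      proof
        fix b :: 'a assume b: "b \<in> Basis"
        have "\<bar>(x + y) \<bullet> b\<bar> \<le> r" using y b by (auto simp: mem_sbox)
        moreover have "\<bar>x \<bullet> b\<bar> \<le> r" using Basis_le_norm[OF b, of x] x by linarith
        ultimately show "\<bar>y \<bullet> b\<bar> \<le> 2 * r" by (simp add: inner_add_left abs_le_iff)
      qed
    qed
  qed
  then show ?thesis unfolding landau_conv_def by (simp add: integral_unique)
qed

text \<open>
  The Landau kernel is a polynomial in \<open>u - x\<close>, so integrating it against any function of \<open>u\<close>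
  leaves a polynomial in \<open>x\<close>.
\<close>

lemma landau_integral_polynomial:
  fixes g :: "'a::euclidean_space \<Rightarrow> complex" and F :: "('a \<Rightarrow> complex) set"
  assumes F: "\<And>c. (\<lambda>x. c) \<in> F" "\<And>f g. f \<in> F \<Longrightarrow> g \<in> F \<Longrightarrow> (\<lambda>x. f x + g x) \<in> F"
      "\<And>b f. b \<in> Basis \<Longrightarrow> f \<in> F \<Longrightarrow> (\<lambda>x. of_real (x \<bullet> b) * f x) \<in> F"
      "\<And>c f. f \<in> F \<Longrightarrow> (\<lambda>x. c * f x) \<in> F"
    and g: "continuous_on UNIV g"
  shows "(\<lambda>x. integral (sbox r) (\<lambda>u. landau L n (u - x) *\<^sub>R g u)) \<in> F"
proof -
  \<comment> \<open>Quantifying over every \<open>g\<close> lets factors that depend on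
    \<open>u\<close> alone be absorbed into \<open>g\<close>; factors in \<open>x\<close> leave the
    integral.\<close>
  define P where "P \<kappa> \<longleftrightarrow> (\<forall>x. continuous_on UNIV (\<lambda>u. \<kappa> u x)) \<and>
    (\<forall>g. continuous_on UNIV g \<longrightarrow> (\<lambda>x. integral (sbox r) (\<lambda>u. \<kappa> u x *\<^sub>R g u)) \<in> F)"
    for \<kappa> :: "'a \<Rightarrow> 'a \<Rightarrow> real"
  have int: "(\<lambda>u. \<kappa> u x *\<^sub>R g u) integrable_on sbox r"
    if "P \<kappa>" "continuous_on UNIV g" for \<kappa> x and g :: "'a \<Rightarrow> complex"
  proof -
    have "continuous_on UNIV (\<lambda>u. \<kappa> u x)" using that(1) unfolding P_def by blast
    then have "continuous_on UNIV (\<lambda>u. \<kappa> u x *\<^sub>R g u)"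
      using that(2) by (rule continuous_on_scaleR)
    then show ?thesis
      unfolding sbox_def by (intro integrable_continuous) (rule continuous_on_subset, auto)
  qed
  have add: "P (\<lambda>u x. \<kappa> u x + \<kappa>' u x)" if "P \<kappa>" "P \<kappa>'" for \<kappa> \<kappa>'
  proof -
    have "(\<lambda>x. integral (sbox r) (\<lambda>u. (\<kappa> u x + \<kappa>' u x) *\<^sub>R g u)) \<in> F"
      if g: "continuous_on UNIV g" for g
    proof -
      have "(\<lambda>x. integral (sbox r) (\<lambda>u. (\<kappa> u x + \<kappa>' u x) *\<^sub>R g u)) =
        (\<lambda>x. integral (sbox r) (\<lambda>u. \<kappa> u x *\<^sub>R g u) + integral (sbox r) (\<lambda>u. \<kappa>' u x *\<^sub>R g u))"
        using int[OF \<open>P \<kappa>\<close> g] int[OF \<open>P \<kappa>'\<close> g]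
        by (simp add: scaleR_left_distrib Henstock_Kurzweil_Integration.integral_add)
      then show ?thesis using that \<open>P \<kappa>\<close> \<open>P \<kappa>'\<close> F(2) by (simp add: P_def)
    qed
    then show ?thesis using that by (auto simp: P_def intro!: continuous_intros)
  qed
  have mult_u: "P (\<lambda>u x. \<kappa> u x * h u)" if "P \<kappa>" "continuous_on UNIV h" for \<kappa> h
  proof -
    have "(\<lambda>x. integral (sbox r) (\<lambda>u. (\<kappa> u x * h u) *\<^sub>R g u)) \<in> F"
      if g: "continuous_on UNIV g" for g
    proof -
      have "continuous_on UNIV (\<lambda>u. h u *\<^sub>R g u)"
        using g \<open>continuous_on UNIV h\<close> by (intro continuous_intros)
      then have "(\<lambda>x. integral (sbox r) (\<lambda>u. \<kappa> u x *\<^sub>R (h u *\<^sub>R g u))) \<in> F"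
        using \<open>P \<kappa>\<close> unfolding P_def by blast
      then show ?thesis by simp
    qed
    then show ?thesis using that by (auto simp: P_def intro!: continuous_intros)
  qed
  have mult_x: "P (\<lambda>u x. \<kappa> u x * (x \<bullet> b))" if "P \<kappa>" "b \<in> Basis" for \<kappa> b
  proof -
    have "(\<lambda>x. integral (sbox r) (\<lambda>u. (\<kappa> u x * (x \<bullet> b)) *\<^sub>R g u)) \<in> F"
      if g: "continuous_on UNIV g" for g
    proof -
      have "(\<lambda>x. of_real (x \<bullet> b) * integral (sbox r) (\<lambda>u. \<kappa> u x *\<^sub>R g u)) \<in> F"
        using \<open>P \<kappa>\<close> g F(3)[OF \<open>b \<in> Basis\<close>] by (simp add: P_def)
      moreover have "integral (sbox r) (\<lambda>u. (\<kappa> u x * (x \<bullet> b)) *\<^sub>R g u) =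
          of_real (x \<bullet> b) * integral (sbox r) (\<lambda>u. \<kappa> u x *\<^sub>R g u)" for x
        unfolding integral_mult_right[symmetric]
        by (intro integral_cong) (simp add: scaleR_conv_of_real)
      ultimately show ?thesis by simp
    qed
    then show ?thesis using that by (auto simp: P_def intro!: continuous_intros)
  qed
  have cmult: "P (\<lambda>u x. \<kappa> u x * c)" if "P \<kappa>" for \<kappa> c
    by (rule mult_u[OF that]) auto
  have sum: "P (\<lambda>u x. \<Sum>i\<in>I. \<kappa> i u x)" if "finite I" "P (\<lambda>u x. 0)" "\<And>i. i \<in> I \<Longrightarrow> P (\<kappa> i)"
    for I :: "'a set" and \<kappa>
    using that by (induction I rule: finite_induct) (auto intro: add)
  have "P (\<lambda>u x. landau L n (u - x))"
  proof (induction n)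
    case 0
    have "(\<lambda>x. integral (sbox r) g) \<in> F" for g by (rule F(1))
    then show ?case by (auto simp: P_def landau_def)
  next
    case (Suc n)
    let ?k = "\<lambda>u x :: 'a. landau L n (u - x)"
    define K where "K = 1 / L\<^sup>2"
    have nrm: "(norm (u - x))\<^sup>2 = (\<Sum>b\<in>Basis. (u \<bullet> b)\<^sup>2 + (-2) * ((u \<bullet> b) * (x \<bullet> b)) + (x \<bullet> b) * (x \<bullet> b))"
      for u x :: 'a
      unfolding power2_norm_eq_inner euclidean_inner[of "u - x" "u - x"]
      by (intro sum.cong) (auto simp: inner_diff_left power2_eq_square algebra_simps)
    \<comment> \<open>The squared distance is expanded so that each term is the old kernel times a
      function of \<open>u\<close> and at most two coordinates of \<open>x\<close>.\<close>
    have eq: "landau L (Suc n) (u - x) = ?k u x + (\<Sum>b\<in>Basis.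
        ?k u x * ((u \<bullet> b)\<^sup>2 * (- K)) + ?k u x * (x \<bullet> b) * ((u \<bullet> b) * (2 * K)) +
        ?k u x * (x \<bullet> b) * (x \<bullet> b) * (- K))" for u x :: 'a
    proof -
      have "landau L (Suc n) (u - x) = ?k u x * (1 - (norm (u - x))\<^sup>2 / L\<^sup>2)"
        by (simp add: landau_def power_divide)
      also have "\<dots> = ?k u x * (1 - K * (norm (u - x))\<^sup>2)" by (simp add: K_def)
      also have "\<dots> = ?k u x + ?k u x * (- K) * (norm (u - x))\<^sup>2"
        by (simp add: algebra_simps)
      also have "?k u x * (- K) * (norm (u - x))\<^sup>2 = (\<Sum>b\<in>Basis.
        ?k u x * ((u \<bullet> b)\<^sup>2 * (- K)) + ?k u x * (x \<bullet> b) * ((u \<bullet> b) * (2 * K)) +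
        ?k u x * (x \<bullet> b) * (x \<bullet> b) * (- K))"
        unfolding nrm sum_distrib_left
        by (intro sum.cong refl) (simp add: algebra_simps)
      finally show ?thesis .
    qed
    have "P (\<lambda>u x. 0)" using cmult[OF Suc, of 0] by simp
    then have "P (\<lambda>u x. ?k u x + (\<Sum>b\<in>Basis.
        ?k u x * ((u \<bullet> b)\<^sup>2 * (- K)) + ?k u x * (x \<bullet> b) * ((u \<bullet> b) * (2 * K)) +
        ?k u x * (x \<bullet> b) * (x \<bullet> b) * (- K)))"
      by (intro add sum Suc cmult mult_x mult_u) (auto intro!: continuous_intros)
    then show ?case unfolding eq .
  qed
  then show ?thesis using g by (auto simp: P_def)
qed

text \<open>\<open>F\<close> stands for the polynomials, known only through closure properties; it
  will be the span of the monomials on configuration space. Convolving at radius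
  \<open>2 * r\<close> makes \<open>landau_conv_shift\<close> applicable on the whole ball.\<close>

lemma Ct_polynomial_approx:
  fixes G :: "'a::euclidean_space \<Rightarrow> complex" and F :: "('a \<Rightarrow> complex) set"
  assumes G: "CB t UNIV M G" and r: "0 < r" and supp: "\<And>x. norm x > r \<Longrightarrow> G x = 0"
    and F: "\<And>c. (\<lambda>x. c) \<in> F" "\<And>f g. f \<in> F \<Longrightarrow> g \<in> F \<Longrightarrow> (\<lambda>x. f x + g x) \<in> F"
      "\<And>b f. b \<in> Basis \<Longrightarrow> f \<in> F \<Longrightarrow> (\<lambda>x. of_real (x \<bullet> b) * f x) \<in> F"
      "\<And>c f. f \<in> F \<Longrightarrow> (\<lambda>x. c * f x) \<in> F"
  shows "capx t (ball 0 r) F G"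
  unfolding capx_def
proof (intro allI impI)
  fix e :: real assume "e > 0"
  have "\<forall>\<^sub>F n in sequentially. CB t (ball 0 (2 * r)) e (\<lambda>x. G x - landau_conv (2 * r) n G x)"
    using landau_conv_CB[OF G _ \<open>e > 0\<close>, of "2 * r"] r by simp
  then obtain n where n: "CB t (ball 0 (2 * r)) e (\<lambda>x. G x - landau_conv (2 * r) n G x)"
    using eventually_happens'[OF sequentially_bot] by blast
  define p where "p x = of_real (1 / landau_mass TYPE('a) (2 * r) n) *
    integral (sbox r) (\<lambda>u. landau (real DIM('a) * (2 * r)) n (u - x) *\<^sub>R G u)" for x
  have cont: "continuous_on UNIV G" by (rule CB_UNIV_continuous[OF G])
  have "p \<in> F" unfolding p_def by (intro F(4) landau_integral_polynomial F cont)
  moreover have "CB t (ball 0 r) e (\<lambda>x. G x - p x)"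
  proof (subst CB_cong)
    show "CB t (ball 0 r) e (\<lambda>x. G x - landau_conv (2 * r) n G x)"
      using r by (intro CB_subset[OF open_ball open_ball _ n] subset_ball) auto
    show "G x - p x = G x - landau_conv (2 * r) n G x" if "x \<in> ball 0 r" for x
      using landau_conv_shift[OF cont _ supp, where x = x and n = n] that
      by (simp add: p_def scaleR_conv_of_real)
  qed
  ultimately show "\<exists>g\<in>F. CB t (ball 0 r) e (\<lambda>x. G x - g x)" by blast
qed

subsection \<open>Independence of the spherical harmonics\<close>

lemma infinite_unit_circle: "infinite {w::complex. cmod w = 1}"
proof
  assume fin: "finite {w::complex. cmod w = 1}"
  have "inj_on cis {0..pi}"
  proof (rule inj_onI)
    fix x y assume "x \<in> {0..pi}" "y \<in> {0..pi}" "cis x = cis y"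
    then have "cos x = cos y" by (metis cis.sel(1))
    then show "x = y" using \<open>x \<in> {0..pi}\<close> \<open>y \<in> {0..pi}\<close> cos_inj_pi by simp
  qed
  moreover have "finite (cis ` {0..pi})" by (rule finite_subset[OF _ fin]) auto
  ultimately have "finite {0..pi}" using finite_imageD by blast
  then show False using pi_gt_zero by (simp add: infinite_Icc)
qed

lemma poly_zero_on_infinite:
  fixes p :: "complex poly"
  assumes "infinite S" "\<And>w. w \<in> S \<Longrightarrow> poly p w = 0"
  shows "p = 0"
proof (rule ccontr)
  assume "p \<noteq> 0"
  then have "finite {w. poly p w = 0}" by (rule poly_roots_finite)
  moreover have "S \<subseteq> {w. poly p w = 0}" using assms(2) by auto
  ultimately show False using assms(1) finite_subset by blast
qed

lemma poly_map_of_real: "poly (map_poly complex_of_real p) (of_real x) = of_real (poly p x)"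
proof -
  have "degree (map_poly complex_of_real p) = degree p" by (rule degree_map_poly) simp
  then show ?thesis by (simp add: poly_altdef coeff_map_poly)
qed

lemma norm_circle_point:
  assumes "cmod w = 1" "s\<^sup>2 + z\<^sup>2 = 1"
  shows "norm (vector [s * Re w, s * Im w, z] :: real^3) = 1"
proof -
  have "(norm (vector [s * Re w, s * Im w, z] :: real^3))\<^sup>2 = s\<^sup>2 * ((Re w)\<^sup>2 + (Im w)\<^sup>2) + z\<^sup>2"
    unfolding norm_sq_3 by (simp add: power_mult_distrib algebra_simps)
  also have "(Re w)\<^sup>2 + (Im w)\<^sup>2 = 1" using assms(1) by (simp add: cmod_def)
  finally have "norm (vector [s * Re w, s * Im w, z] :: real^3) ^ 2 = 1 ^ 2" using assms(2) by simp
  then show ?thesis by (rule power2_eq_imp_eq) auto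
qed

text \<open>On the circle the conjugate of \<open>w\<close> is its inverse, so the factor
  \<open>w ^ N\<close> clears the negative powers and leaves a single monomial in
  \<open>w\<close>.\<close>

lemma sph_harm_circle:
  assumes w: "cmod w = 1" and z: "s\<^sup>2 + z\<^sup>2 = 1" and m: "\<bar>m\<bar> \<le> int l" "l \<le> N"
  shows "w ^ N * sph_harm l m (vector [s * Re w, s * Im w, z]) =
    of_real ((if m \<ge> 0 then 1 else (-1) ^ nat \<bar>m\<bar>) * sphc l (nat \<bar>m\<bar>) *
      poly (leg l (nat \<bar>m\<bar>)) z * s ^ nat \<bar>m\<bar>) * w ^ nat (int N + m)"
proof -
  let ?x = "vector [s * Re w, s * Im w, z] :: real^3"
  have xy: "xy ?x = of_real s * w" by (simp add: xy_def complex_eq_iff)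
  have nx: "norm ?x = 1" by (rule norm_circle_point[OF w z])
  have ww: "w * cnj w = 1" using w complex_norm_square[of w] by simp
  have x3: "?x $ 3 = z" by simp
  show ?thesis
    using m(1)
  proof (cases rule: sph_harm_cases)
    case (1 k)
    then have "nat (int N + m) = N + k" "nat \<bar>m\<bar> = k" by auto
    then show ?thesis
      using 1 by (simp add: sph_harm_pos[OF nx] xy x3 power_mult_distrib power_add del: vector_3)
  next
    case (2 k)
    then have k: "nat (int N + m) = N - k" "nat \<bar>m\<bar> = k" "\<not> m \<ge> 0" by auto
    have "w ^ N * cnj w ^ k = w ^ (N - k) * (w * cnj w) ^ k"
      using 2 m(2) by (simp add: power_mult_distrib mult.assoc[symmetric] power_add[symmetric])
    then have wk: "w ^ N * cnj w ^ k = w ^ (N - k)" by (simp add: ww)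
    have "w ^ N * sph_harm l m ?x =
        of_real ((-1) ^ k * sphc l k * poly (leg l k) z * s ^ k) * (w ^ N * cnj w ^ k)"
      unfolding 2(3) sph_harm_neg[OF nx] xy x3 by (simp add: power_mult_distrib)
    then show ?thesis unfolding wk k(1,2) using k(3) by simp
  qed
qed

text \<open>At fixed height \<open>z\<close> the relation becomes a polynomial in \<open>w\<close>
  that vanishes on a circle, which separates the orders \<open>m\<close>. What remains for one order
  is a polynomial identity in \<open>z\<close>, separated by degrees.\<close>

lemma sph_harm_independent:
  assumes K: "finite K" "\<And>l m. (l, m) \<in> K \<Longrightarrow> \<bar>m\<bar> \<le> int l"
    and zero: "\<And>x. norm x = 1 \<Longrightarrow> (\<Sum>p\<in>K. c p * sph_harm (fst p) (snd p) x) = 0"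
    and p: "p \<in> K"
  shows "c p = 0"
proof (rule ccontr)
  assume cp: "c p \<noteq> 0"
  define \<mu> where "\<mu> = snd p"
  \<comment> \<open>\<open>N\<close> dominates every degree, so the exponents \<open>N + m\<close>
    are nonnegative and differ for different \<open>m\<close>.\<close>
  define N where "N = (\<Sum>p\<in>K. fst p)"
  have N: "fst q \<le> N" if "q \<in> K" for q
    unfolding N_def using K(1) that by (intro member_le_sum) auto
  define A where "A q = c q * of_real ((if snd q \<ge> 0 then 1 else (-1) ^ nat \<bar>snd q\<bar>) *
    sphc (fst q) (nat \<bar>snd q\<bar>))" for q
  have A0: "A q = 0 \<longleftrightarrow> c q = 0" for q by (simp add: A_def sphc_nonzero)
  define k where "k = nat \<bar>\<mu>\<bar>"
  define K' where "K' = {q \<in> K. snd q = \<mu>}"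
  have K': "finite K'" "p \<in> K'" using K(1) p by (auto simp: K'_def \<mu>_def)
  have slice: "(\<Sum>q\<in>K'. A q * of_real (poly (leg (fst q) k) z)) = 0" if z: "-1 < z" "z < 1" for z
  proof -
    define s where "s = sqrt (1 - z\<^sup>2)"
    have "z\<^sup>2 < 1" using z by (simp add: abs_square_less_1 abs_less_iff)
    then have s: "s > 0" "s\<^sup>2 + z\<^sup>2 = 1" by (auto simp: s_def)
    define B where "B q = A q * of_real (poly (leg (fst q) (nat \<bar>snd q\<bar>)) z * s ^ nat \<bar>snd q\<bar>)" for q
    define P where "P = (\<Sum>q\<in>K. monom (B q) (nat (int N + snd q)))"
    have "poly P w = 0" if w: "w \<in> {w. cmod w = 1}" for w
    proof -
      let ?x = "vector [s * Re w, s * Im w, z] :: real^3"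
      have "norm ?x = 1" using norm_circle_point[OF _ s(2)] w by simp
      then have "0 = w ^ N * (\<Sum>q\<in>K. c q * sph_harm (fst q) (snd q) ?x)" using zero by simp
      also have "\<dots> = (\<Sum>q\<in>K. c q * (w ^ N * sph_harm (fst q) (snd q) ?x))"
        by (simp add: sum_distrib_left mult_ac)
      also have "\<dots> = (\<Sum>q\<in>K. B q * w ^ nat (int N + snd q))"
      proof (rule sum.cong[OF refl])
        fix q assume q: "q \<in> K"
        have "\<bar>snd q\<bar> \<le> int (fst q)" using K(2)[of "fst q" "snd q"] q by simp
        then show "c q * (w ^ N * sph_harm (fst q) (snd q) ?x) = B q * w ^ nat (int N + snd q)"
          using sph_harm_circle[OF _ s(2) _ N[OF q], of w "snd q"] w
          by (simp add: B_def A_def)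
      qed
      finally show ?thesis by (simp add: P_def poly_sum poly_monom)
    qed
    then have "P = 0" by (rule poly_zero_on_infinite[OF infinite_unit_circle])
    then have "0 = coeff P (nat (int N + \<mu>))" by simp
    also have "\<dots> = (\<Sum>q\<in>K. if nat (int N + snd q) = nat (int N + \<mu>) then B q else 0)"
      by (simp add: P_def coeff_sum)
    also have "\<dots> = (\<Sum>q\<in>K. if snd q = \<mu> then B q else 0)"
    proof (rule sum.cong[OF refl])
      fix q assume q: "q \<in> K"
      have "\<bar>snd q\<bar> \<le> int N" "\<bar>\<mu>\<bar> \<le> int N"
        using K(2)[of "fst q" "snd q"] K(2)[of "fst p" "snd p"] N[OF q] N[OF p] q p
        by (auto simp: \<mu>_def)
      then show "(if nat (int N + snd q) = nat (int N + \<mu>) then B q else 0) =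
          (if snd q = \<mu> then B q else 0)" by (auto simp: eq_nat_nat_iff)
    qed
    also have "\<dots> = (\<Sum>q\<in>K'. B q)" using K(1) by (simp add: K'_def sum.inter_filter)
    also have "\<dots> = (\<Sum>q\<in>K'. A q * of_real (poly (leg (fst q) k) z) * of_real (s ^ k))"
      by (rule sum.cong) (auto simp: K'_def B_def k_def)
    also have "\<dots> = (\<Sum>q\<in>K'. A q * of_real (poly (leg (fst q) k) z)) * of_real (s ^ k)"
      by (simp add: sum_distrib_right)
    finally show ?thesis using s(1) by simp
  qed
  define R where "R = (\<Sum>q\<in>K'. smult (A q) (map_poly of_real (leg (fst q) k)))"
  have "R = 0"
  proof (rule poly_zero_on_infinite)
    have "inj_on complex_of_real {-1<..<1}" by (auto simp: inj_on_def)
    then show "infinite (complex_of_real ` {-1<..<1})"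
      by (subst finite_image_iff) (auto simp: infinite_Ioo)
    show "poly R w = 0" if "w \<in> complex_of_real ` {-1<..<1}" for w
      using that slice by (auto simp: R_def poly_sum poly_map_of_real)
  qed
  \<comment> \<open>Among the members with nonzero coefficient, the one of largest \<open>l\<close>
    is alone in reaching degree \<open>l - k\<close>: equal order and equal \<open>l\<close> would
    make two members equal.\<close>
  define l where "l = Max (fst ` {q \<in> K'. c q \<noteq> 0})"
  have fin: "finite (fst ` {q \<in> K'. c q \<noteq> 0})" using K'(1) by simp
  have ne: "fst ` {q \<in> K'. c q \<noteq> 0} \<noteq> {}" using K'(2) cp by blast
  obtain q0 where q0: "q0 \<in> K'" "c q0 \<noteq> 0" "fst q0 = l"
    using Max_in[OF fin ne] by (auto simp: l_def)
  have lmax: "fst q \<le> l" if "q \<in> K'" "c q \<noteq> 0" for q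
    unfolding l_def using fin that by (intro Max_ge) auto
  have kl: "k \<le> l" using K(2)[of "fst q0" "snd q0"] q0 by (auto simp: K'_def k_def)
  have "0 = coeff R (l - k)" using \<open>R = 0\<close> by simp
  also have "\<dots> = (\<Sum>q\<in>K'. A q * of_real (coeff (leg (fst q) k) (l - k)))"
    by (simp add: R_def coeff_sum coeff_map_poly)
  also have "\<dots> = (\<Sum>q\<in>{q0}. A q * of_real (coeff (leg (fst q) k) (l - k)))"
  proof (rule sum.mono_neutral_right[OF K'(1)])
    show "{q0} \<subseteq> K'" using q0 by simp
    show "\<forall>q\<in>K' - {q0}. A q * of_real (coeff (leg (fst q) k) (l - k)) = 0"
    proof
      fix q assume q: "q \<in> K' - {q0}"
      show "A q * of_real (coeff (leg (fst q) k) (l - k)) = 0"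
      proof (cases "c q = 0")
        case False
        have "fst q \<noteq> l"
          using q q0 by (cases q, cases q0) (auto simp: K'_def)
        then have lt: "fst q < l" using lmax[of q] q False by simp
        have "k \<le> fst q" using K(2)[of "fst q" "snd q"] q by (auto simp: K'_def k_def)
        then have "coeff (leg (fst q) k) (l - k) = 0"
          using degree_leg[of "fst q" k] lt by (intro coeff_eq_0) linarith
        then show ?thesis by simp
      qed (simp add: A0)
    qed
  qed
  also have "\<dots> = A q0 * of_real (coeff (leg l k) (l - k))" using q0 by simp
  finally show False using coeff_leg_top[OF kl] q0 A0 by simp
qed

subsection \<open>A generating function and the rotation of spherical harmonics\<close>

lemma higher_pderiv_pcompose_linear:
  fixes p :: "'a::field_char_0 poly"
  shows "(pderiv ^^ k) (pcompose p [:a, b:]) = smult (b ^ k) (pcompose ((pderiv ^^ k) p) [:a, b:])"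
proof (induction k)
  case (Suc k)
  have "pderiv [:a, b:] = [:b:]" by (simp add: pderiv_pCons)
  then show ?case using Suc
    by (simp add: pderiv_smult pderiv_pcompose mult.commute)
qed simp

text \<open>Taylor's formula at \<open>a\<close> in a variable scaled by \<open>b\<close>; it will
  turn the derivatives of the Rodrigues formula into coefficients.\<close>

lemma coeff_pcompose_linear:
  fixes p :: "'a::field_char_0 poly"
  shows "coeff (pcompose p [:a, b:]) k = b ^ k * poly ((pderiv ^^ k) p) a / fact k"
proof -
  have "coeff ((pderiv ^^ k) (pcompose p [:a, b:])) 0 = fact k * coeff (pcompose p [:a, b:]) k"
    using coeff_higher_pderiv[of k "pcompose p [:a, b:]" 0] pochhammer_fact[of k, where 'a = 'a] by simp
  moreover have "coeff ((pderiv ^^ k) (pcompose p [:a, b:])) 0 = b ^ k * poly ((pderiv ^^ k) p) a"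
    unfolding higher_pderiv_pcompose_linear by (simp add: poly_0_coeff_0[symmetric] poly_pcompose)
  ultimately show ?thesis by (simp add: field_simps)
qed

lemma pcompose_power: "pcompose (p ^ n) q = pcompose p q ^ n" for p q :: "'a::comm_ring_1 poly"
  by (induction n) (simp_all add: pcompose_mult pcompose_1)

text \<open>
  The bilinear form of \<open>x\<close> with the null vector \<open>((\<zeta>\<^sup>2 - 1) / 2, \<i> (\<zeta>\<^sup>2 + 1) / 2, \<zeta>)\<close>, as a
  polynomial in \<open>\<zeta>\<close>.
\<close>

definition gen_poly :: "real^3 \<Rightarrow> complex poly"
  where "gen_poly x = [: - cnj (xy x) / 2, of_real (x $ 3), xy x / 2 :]"

text \<open>The factor between the coefficient of \<open>\<zeta> ^ (l + m)\<close> in the power of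
  the generating polynomial and the harmonic; being nonzero, it allows the harmonic to be
  recovered.\<close>

definition sphk :: "nat \<Rightarrow> nat \<Rightarrow> real"
  where "sphk l m = fact l / (fact (l + m) * sphc l m)"

lemma sphk_nonzero: "sphk l m \<noteq> 0"
  by (simp add: sphk_def sphc_nonzero)

lemma map_poly_rodrigues: "map_poly of_real (rodrigues l) = ([:-1, 0, 1:] :: complex poly) ^ l"
proof (induction l)
  case (Suc l)
  have "coeff (map_poly of_real (rodrigues (Suc l))) i =
      coeff ([:-1, 0, 1:] * map_poly complex_of_real (rodrigues l)) i" for i
    by (simp add: rodrigues_def coeff_map_poly coeff_pCons split: nat.split)
  then have "map_poly of_real (rodrigues (Suc l)) =
      [:-1, 0, 1:] * map_poly complex_of_real (rodrigues l)"
    by (rule poly_eqI)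
  then show ?case using Suc by simp
qed (simp add: rodrigues_def)

lemma higher_pderiv_rodrigues:
  "poly ((pderiv ^^ (l + m)) ([:-1, 0, 1:] ^ l)) (complex_of_real z) =
    of_real (2 ^ l * fact l * poly (leg l m) z)"
proof -
  have "(pderiv ^^ k) (map_poly complex_of_real p) = map_poly complex_of_real ((pderiv ^^ k) p)" for k p
    by (rule poly_eqI) (simp add: coeff_higher_pderiv coeff_map_poly pochhammer_of_real[symmetric])
  then have "poly ((pderiv ^^ (l + m)) ([:-1, 0, 1:] ^ l)) (complex_of_real z) =
      of_real (poly ((pderiv ^^ (l + m)) (rodrigues l)) z)"
    by (simp only: map_poly_rodrigues[symmetric] poly_map_of_real)
  then show ?thesis by (simp add: leg_rodrigues)
qed

text \<open>With \<open>q = xy x\<close> and \<open>z = x $ 3\<close>, on the sphere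
  \<open>2 * q\<close> times the generating polynomial equals
  \<open>(z + q * \<zeta>)^2 - 1\<close>. Up to a power of \<open>2 * q\<close>, its
  \<open>l\<close>-th power is therefore the Rodrigues polynomial expanded at \<open>z\<close>,
  whose Taylor coefficients are derivatives of Legendre polynomials.\<close>

lemma gen_poly_coeff_nonneg:
  assumes x: "norm x = 1"
  shows "coeff (gen_poly x ^ l) (l + m) = of_real (sphk l m) * sph_harm l (int m) x"
proof -
  let ?q = "xy x" and ?z = "complex_of_real (x $ 3)"
  have goal: "of_real (sphk l m) * sph_harm l (int m) x =
      of_real (fact l / fact (l + m) * poly (leg l m) (x $ 3)) * ?q ^ m"
    using sphc_nonzero[of l m] by (simp add: sph_harm_pos[OF x] sphk_def)
  have qq: "?q * cnj ?q = 1 - ?z\<^sup>2" by (rule xy_cnj_xy[OF x])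
  show ?thesis
  proof (cases "?q = 0")
    case False
    have "pcompose [:-1, 0, 1:] [:?z, ?q:] = smult (2 * ?q) (gen_poly x)"
      using qq by (simp add: pcompose_pCons gen_poly_def power2_eq_square algebra_simps)
    then have "pcompose ([:-1, 0, 1:] ^ l) [:?z, ?q:] = smult ((2 * ?q) ^ l) (gen_poly x ^ l)"
      by (simp only: pcompose_power smult_power)
    then have "(2 * ?q) ^ l * coeff (gen_poly x ^ l) (l + m) =
        coeff (pcompose ([:-1, 0, 1:] ^ l) [:?z, ?q:]) (l + m)" by simp
    also have "\<dots> = ?q ^ (l + m) * of_real (2 ^ l * fact l * poly (leg l m) (x $ 3)) / fact (l + m)"
      unfolding coeff_pcompose_linear higher_pderiv_rodrigues ..
    also have "\<dots> = (2 * ?q) ^ l * (of_real (fact l / fact (l + m) * poly (leg l m) (x $ 3)) * ?q ^ m)"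
      by (simp add: power_add power_mult_distrib)
    finally have eq: "(2 * ?q) ^ l * coeff (gen_poly x ^ l) (l + m) = (2 * ?q) ^ l *
        (of_real (fact l / fact (l + m) * poly (leg l m) (x $ 3)) * ?q ^ m)" .
    have "(2 * ?q) ^ l \<noteq> 0" using False by simp
    with eq show ?thesis unfolding goal by (simp only: mult_left_cancel simp_thms)
  next
    case True
    \<comment> \<open>At the poles \<open>q\<close> is 0 and cannot be divided out. Only
      \<open>m = 0\<close> contributes, and it needs the Legendre values at 1 and -1, read off from
      \<open>(z + \<zeta>)^2 - 1 = \<zeta> * (2 * z + \<zeta>)\<close>.\<close>
    then have z2: "?z\<^sup>2 = 1" using qq by simp
    have "pcompose [:-1, 0, 1:] [:?z, 1:] = [:0, 1:] * [:2 * ?z, 1:]"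
      using z2 by (simp add: pcompose_pCons power2_eq_square)
    then have "pcompose ([:-1, 0, 1:] ^ l) [:?z, 1:] = [:0, 1:] ^ l * [:2 * ?z, 1:] ^ l"
      by (simp only: pcompose_power power_mult_distrib)
    moreover have "[:0, 1:] ^ l = monom (1::complex) l" by (simp add: monom_altdef)
    ultimately have "coeff (pcompose ([:-1, 0, 1:] ^ l) [:?z, 1:]) (l + 0) = (2 * ?z) ^ l"
      by (simp add: coeff_monom_mult poly_0_coeff_0[symmetric])
    then have "of_real (2 ^ l * fact l * poly (leg l 0) (x $ 3)) / fact l = (2 * ?z) ^ l"
      unfolding coeff_pcompose_linear higher_pderiv_rodrigues by simp
    then have leg0: "of_real (poly (leg l 0) (x $ 3)) = ?z ^ l"
      by (simp add: power_mult_distrib)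
    have "gen_poly x = [:0, 1:] * [:?z:]" using True by (simp add: gen_poly_def)
    then have "gen_poly x ^ l = [:0, 1:] ^ l * [:?z:] ^ l" by (simp only: power_mult_distrib)
    also have "\<dots> = monom (?z ^ l) l"
      by (simp add: monom_altdef poly_const_pow)
    finally have "coeff (gen_poly x ^ l) (l + m) = (if m = 0 then ?z ^ l else 0)" by simp
    then show ?thesis unfolding goal using leg0 True by (cases "m = 0") auto
  qed
qed

text \<open>Integer indices with value 0 below 0 let the recursion over \<open>l\<close> run without
  boundary cases.\<close>

definition gen_coeff :: "nat \<Rightarrow> int \<Rightarrow> real^3 \<Rightarrow> complex"
  where "gen_coeff l i x = (if i < 0 then 0 else coeff (gen_poly x ^ l) (nat i))"

text \<open>Reversing the coefficients of \<open>gen_poly\<close>, conjugating them and alternating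
  signs gives the same polynomial, and powers inherit this. It transfers the case of nonnegative
  \<open>m\<close> to negative \<open>m\<close>.\<close>

lemma gen_coeff_sym:
  "gen_coeff l i x = (if even (int l + i) then 1 else -1) * cnj (gen_coeff l (2 * int l - i) x)"
proof (induction l arbitrary: i)
  case 0
  show ?case by (auto simp: gen_coeff_def)
next
  case (Suc l)
  let ?q = "xy x" and ?z = "complex_of_real (x $ 3)"
  have rec: "gen_coeff (Suc l) i x = - cnj ?q / 2 * gen_coeff l i x + ?z * gen_coeff l (i - 1) x + ?q / 2 * gen_coeff l (i - 2) x" for i
  proof -
    consider "i < 0" | "i = 0" | "i = 1" | j where "i = int (Suc (Suc j))"
    proof -
      have "i < 0 \<or> i = 0 \<or> i = 1 \<or> (\<exists>j. i = int (Suc (Suc j)))" by presburger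
      then show ?thesis using that by blast
    qed
    then show ?thesis
    proof cases
      case 4
      have "nat (i - 1) = Suc j" "nat (i - 2) = j" "nat i = Suc (Suc j)" using 4 by auto
      then show ?thesis using 4 by (simp add: gen_coeff_def gen_poly_def algebra_simps)
    qed (auto simp: gen_coeff_def gen_poly_def)
  qed
  have e: "2 * int l - (i - 2) - 2 = 2 * int l - i" "2 * int l - (i - 2) - 1 = 2 * int l - (i - 1)"
    "2 * int (Suc l) - i = 2 * int l - (i - 2)" by auto
  have r: "gen_coeff (Suc l) (2 * int (Suc l) - i) x = - cnj ?q / 2 * gen_coeff l (2 * int l - (i - 2)) x +
      ?z * gen_coeff l (2 * int l - (i - 1)) x + ?q / 2 * gen_coeff l (2 * int l - i) x"
    using rec[of "2 * int (Suc l) - i"] by (simp only: e)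
  show ?case
    unfolding r rec[of i] Suc[of i] Suc[of "i - 1"] Suc[of "i - 2"]
    by (auto simp: algebra_simps)
qed

lemma gen_poly_coeff:
  assumes x: "norm x = 1" and m: "\<bar>m\<bar> \<le> int l"
  shows "coeff (gen_poly x ^ l) (nat (int l + m)) = of_real (sphk l (nat \<bar>m\<bar>)) * sph_harm l m x"
  using m
proof (cases rule: sph_harm_cases)
  case (1 k)
  then have "nat (int l + m) = l + k" by auto
  then show ?thesis using 1 gen_poly_coeff_nonneg[OF x] by simp
next
  case (2 k)
  have k: "nat (int l + m) = l - k" "2 * int l - int (l - k) = int (l + k)" using 2 by auto
  have g: "gen_coeff l (int n) x = coeff (gen_poly x ^ l) n" for n by (simp add: gen_coeff_def)
  have "even (int l + int (l - k)) \<longleftrightarrow> even k"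
    using 2 by (simp add: of_nat_diff)
  then have s: "(if even (int l + int (l - k)) then 1 else - 1 :: complex) = (-1) ^ k"
    by (simp add: minus_one_power_iff)
  have "coeff (gen_poly x ^ l) (l - k) = (-1) ^ k * cnj (coeff (gen_poly x ^ l) (l + k))"
    using gen_coeff_sym[of l "int (l - k)" x] unfolding k(2) g s .
  then show ?thesis
    using 2 unfolding k(1) gen_poly_coeff_nonneg[OF x] by (simp add: sph_harm_uminus[OF x])
qed

text \<open>
  The monomials of degree \<open>l\<close> in the coordinates \<open>c, d, e\<close> of the null cone \<open>d\<^sup>2 = c * e\<close>, indexed so
  that for \<open>c = 1\<close> they are the powers \<open>d ^ k\<close>.
\<close>

definition null_coeff :: "nat \<Rightarrow> 'a::comm_ring_1 \<Rightarrow> 'a \<Rightarrow> 'a \<Rightarrow> nat \<Rightarrow> 'a"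
  where "null_coeff l c d e k = (if k \<le> l then c ^ (l - k) * d ^ k else d ^ (2 * l - k) * e ^ (k - l))"

lemma degree_gen_poly_power: "degree (gen_poly x ^ l) \<le> 2 * l"
proof -
  have "degree (gen_poly x) \<le> 2" unfolding gen_poly_def by simp
  then show ?thesis using degree_power_le[of "gen_poly x" l] by (simp add: order_trans)
qed

text \<open>If \<open>c\<close> is nonzero, the point \<open>(c, d, e)\<close> of the cone is
  \<open>c\<close> times the null vector at \<open>\<zeta> = d / c\<close>, so the power is
  \<open>c ^ l\<close> times a value of the generating polynomial's power. Points with
  \<open>c = 0\<close> are out of reach of this parametrisation.\<close>

lemma null_expansion:
  fixes c d e :: complex
  assumes "d\<^sup>2 = c * e"
  shows "(d * of_real (x $ 3) + e * xy x / 2 - c * cnj (xy x) / 2) ^ l =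
    (\<Sum>k\<le>2 * l. null_coeff l c d e k * coeff (gen_poly x ^ l) k)"
proof (cases "c = 0")
  case False
  have e: "e = d\<^sup>2 / c" using assms False by simp
  have "d * of_real (x $ 3) + e * xy x / 2 - c * cnj (xy x) / 2 = c * poly (gen_poly x) (d / c)"
    using False by (simp add: gen_poly_def e power2_eq_square field_simps)
  then have "(d * of_real (x $ 3) + e * xy x / 2 - c * cnj (xy x) / 2) ^ l =
      c ^ l * poly (gen_poly x ^ l) (d / c)"
    by (simp only: power_mult_distrib poly_power)
  also have "poly (gen_poly x ^ l) (d / c) = (\<Sum>k\<le>2 * l. coeff (gen_poly x ^ l) k * (d / c) ^ k)"
    unfolding poly_altdef
    by (rule sum.mono_neutral_left) (use degree_gen_poly_power[of x l] in \<open>auto simp: coeff_eq_0\<close>)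
  also have "c ^ l * \<dots> = (\<Sum>k\<le>2 * l. null_coeff l c d e k * coeff (gen_poly x ^ l) k)"
    unfolding sum_distrib_left
  proof (rule sum.cong[OF refl])
    fix k assume k: "k \<in> {..2 * l}"
    have "null_coeff l c d e k = c ^ l * (d / c) ^ k"
    proof (cases "k \<le> l")
      case True
      then show ?thesis using False by (simp add: null_coeff_def power_diff power_divide)
    next
      case kl: False
      have "d ^ (2 * l - k) * e ^ (k - l) = d ^ (2 * l - k + 2 * (k - l)) / c ^ (k - l)"
        by (simp add: e power_divide power_add power_mult)
      also have "2 * l - k + 2 * (k - l) = k" using k kl by simp
      also have "d ^ k / c ^ (k - l) = c ^ l * (d / c) ^ k"
        using False kl by (simp add: power_divide power_diff)
      finally show ?thesis using kl by (simp add: null_coeff_def)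
    qed
    then show "c ^ l * (coeff (gen_poly x ^ l) k * (d / c) ^ k) =
        null_coeff l c d e k * coeff (gen_poly x ^ l) k" by simp
  qed
  finally show ?thesis .
next
  case True
  then have d: "d = 0" using assms by simp
  \<comment> \<open>For \<open>c = d = 0\<close> only the index \<open>2 * l\<close> survives, with
    \<open>0 ^ 0 = 1\<close>; this includes \<open>l = 0\<close>.\<close>
  have "null_coeff l c d e k * coeff (gen_poly x ^ l) k = 0" if "k \<in> {..2 * l} - {2 * l}" for k
    using that True d by (auto simp: null_coeff_def power_0_left)
  then have "(\<Sum>k\<le>2 * l. null_coeff l c d e k * coeff (gen_poly x ^ l) k) =
      (\<Sum>k\<in>{2 * l}. null_coeff l c d e k * coeff (gen_poly x ^ l) k)"
    by (intro sum.mono_neutral_right) auto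
  also have "\<dots> = e ^ l * coeff (gen_poly x ^ l) (2 * l)"
    using True d by (auto simp: null_coeff_def power_0_left)
  also have "coeff (gen_poly x ^ l) (2 * l) = (xy x / 2) ^ l"
  proof (induction l)
    case (Suc l)
    have hi: "coeff (gen_poly x ^ l) i = 0" if "i > 2 * l" for i
      using degree_gen_poly_power[of x l] that by (intro coeff_eq_0) simp
    show ?case using Suc hi[of "Suc (2 * l)"] hi[of "Suc (Suc (2 * l))"]
      by (simp add: gen_poly_def[of x])
  qed simp
  finally show ?thesis using True d by (simp add: power_mult_distrib[symmetric])
qed

definition cone_poly :: "real^3^3 \<Rightarrow> 3 \<Rightarrow> complex poly"
  where "cone_poly Q j = smult (of_real (Q $ 1 $ j)) [:-1/2, 0, 1/2:] +
    smult (of_real (Q $ 2 $ j)) [:\<i>/2, 0, \<i>/2:] + smult (of_real (Q $ 3 $ j)) [:0, 1:]"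

text \<open>\<open>cone_poly Q j\<close> is coordinate \<open>j\<close> of the transpose of
  \<open>Q\<close> applied to the null vector, and the three arguments are the cone coordinates of
  that vector. The homogeneous monomials avoid dividing by the first of them, so the result is
  polynomial in \<open>\<zeta>\<close> and in the entries of \<open>Q\<close>.\<close>

definition rot_poly :: "nat \<Rightarrow> real^3^3 \<Rightarrow> nat \<Rightarrow> complex poly"
  where "rot_poly l Q k = null_coeff l (- (cone_poly Q 1 + smult \<i> (cone_poly Q 2))) (cone_poly Q 3)
    (cone_poly Q 1 - smult \<i> (cone_poly Q 2)) k"

lemma orthogonal_matrix_rows:
  fixes Q :: "real^3^3"
  assumes "orthogonal_matrix Q"
  shows "Q $ i $ 1 * Q $ k $ 1 + Q $ i $ 2 * Q $ k $ 2 + Q $ i $ 3 * Q $ k $ 3 = (if i = k then 1 else 0)"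
proof -
  have "(Q ** transpose Q) $ i $ k = (mat 1 :: real^3^3) $ i $ k"
    using assms by (simp add: orthogonal_matrix_def)
  then show ?thesis by (simp add: matrix_matrix_mult_def transpose_def mat_def sum_3)
qed

text \<open>The bilinear form moves \<open>Q\<close> from \<open>x\<close> to the null vector, where
  orthogonality keeps the vector null, so the expansion on the cone applies again.\<close>

lemma gen_poly_rotate:
  assumes Q: "orthogonal_matrix Q"
  shows "gen_poly (Q *v x) ^ l = (\<Sum>k\<le>2 * l. smult (coeff (gen_poly x ^ l) k) (rot_poly l Q k))"
proof -
  have "poly (gen_poly (Q *v x) ^ l) w =
      poly (\<Sum>k\<le>2 * l. smult (coeff (gen_poly x ^ l) k) (rot_poly l Q k)) w" for w
  proof -
    define a1 a2 where "a1 = (w\<^sup>2 - 1) / 2" and "a2 = \<i> * (w\<^sup>2 + 1) / 2"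
    have null: "a1\<^sup>2 + a2\<^sup>2 + w\<^sup>2 = 0"
      by (simp add: a1_def a2_def power_mult_distrib power_divide) (simp add: power2_eq_square field_simps)
    define b where "b j = of_real (Q $ 1 $ j) * a1 + of_real (Q $ 2 $ j) * a2 + of_real (Q $ 3 $ j) * w" for j
    have bp: "poly (cone_poly Q j) w = b j" for j
      by (simp add: cone_poly_def b_def a1_def a2_def power2_eq_square field_simps)
    define c e where "c = - (b 1 + \<i> * b 2)" and "e = b 1 - \<i> * b 2"
    have rows: "complex_of_real (Q $ i $ 1) * of_real (Q $ k $ 1) + of_real (Q $ i $ 2) * of_real (Q $ k $ 2) +
        of_real (Q $ i $ 3) * of_real (Q $ k $ 3) = (if i = k then 1 else 0)" for i k
      using orthogonal_matrix_rows[OF Q, of i k]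
      by (simp only: of_real_mult[symmetric] of_real_add[symmetric]) auto
    \<comment> \<open>The coefficients 1 and 0 are the inner products of the rows of
      \<open>Q\<close>; they show that a null vector stays null.\<close>
    have "(b 1)\<^sup>2 + (b 2)\<^sup>2 + (b 3)\<^sup>2 = a1\<^sup>2 * 1 + a2\<^sup>2 * 1 + w\<^sup>2 * 1 + 2 * a1 * a2 * 0 + 2 * a1 * w * 0 + 2 * a2 * w * 0"
      using rows[of 1 1] rows[of 2 2] rows[of 3 3] rows[of 1 2] rows[of 1 3] rows[of 2 3]
      unfolding b_def by simp algebra
    then have b0: "(b 1)\<^sup>2 + (b 2)\<^sup>2 + (b 3)\<^sup>2 = 0" using null by simp
    have "c * e = - ((b 1)\<^sup>2 + (b 2)\<^sup>2)"
      by (simp add: c_def e_def power2_eq_square algebra_simps)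
    then have ce: "(b 3)\<^sup>2 = c * e" using b0 by (simp add: add_eq_0_iff)
    have Qx: "(Q *v x) $ i = Q $ i $ 1 * x $ 1 + Q $ i $ 2 * x $ 2 + Q $ i $ 3 * x $ 3" for i
      by (simp add: matrix_vector_mult_def sum_3)
    have xy2: "xy y = of_real (y $ 1) + \<i> * of_real (y $ 2)" for y
      by (simp add: xy_def complex_eq_iff)
    have "poly (gen_poly (Q *v x)) w = a1 * of_real ((Q *v x) $ 1) + a2 * of_real ((Q *v x) $ 2) +
        w * of_real ((Q *v x) $ 3)"
      by (simp add: gen_poly_def xy2 a1_def a2_def power2_eq_square field_simps)
    also have "\<dots> = b 1 * of_real (x $ 1) + b 2 * of_real (x $ 2) + b 3 * of_real (x $ 3)"
      unfolding Qx b_def by (simp add: algebra_simps)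
    also have "\<dots> = b 3 * of_real (x $ 3) + e * xy x / 2 - c * cnj (xy x) / 2"
      by (simp add: xy2 c_def e_def field_simps)
    finally have "poly (gen_poly (Q *v x) ^ l) w =
        (\<Sum>k\<le>2 * l. null_coeff l c (b 3) e k * coeff (gen_poly x ^ l) k)"
      by (simp only: poly_power null_expansion[OF ce])
    moreover have "null_coeff l c (b 3) e k = poly (rot_poly l Q k) w" for k
      by (simp add: rot_poly_def null_coeff_def bp c_def e_def)
    ultimately show ?thesis by (simp add: poly_sum mult.commute)
  qed
  then show ?thesis using poly_eq_poly_eq_iff by blast
qed

text \<open>An explicit Wigner matrix, obtained by comparing coefficients of the rotated generating
  polynomial.\<close>

definition wigner_rep :: "nat \<Rightarrow> real^3^3 \<Rightarrow> int \<Rightarrow> int \<Rightarrow> complex"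
  where "wigner_rep l Q \<mu> m = coeff (rot_poly l Q (nat (int l + \<mu>))) (nat (int l + m)) *
    of_real (sphk l (nat \<bar>\<mu>\<bar>) / sphk l (nat \<bar>m\<bar>))"

lemma norm_orthogonal_matrix:
  fixes Q :: "real^'n^'n"
  assumes "orthogonal_matrix Q" shows "norm (Q *v x) = norm x"
proof -
  have "orthogonal_transformation ((*v) Q)"
    using assms by (simp add: orthogonal_transformation_matrix)
  then show ?thesis by (simp add: orthogonal_transformation)
qed

lemma sph_harm_rotate:
  assumes Q: "orthogonal_matrix Q" and x: "norm x = 1" and m: "\<bar>m\<bar> \<le> int l"
  shows "sph_harm l m (Q *v x) = (\<Sum>\<mu> = - int l..int l. wigner_rep l Q \<mu> m * sph_harm l \<mu> x)"
proof -
  have nQ: "norm (Q *v x) = 1" using norm_orthogonal_matrix[OF Q] x by simp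
  let ?c = "\<lambda>k. coeff (gen_poly x ^ l) k * coeff (rot_poly l Q k) (nat (int l + m))"
  have "of_real (sphk l (nat \<bar>m\<bar>)) * sph_harm l m (Q *v x) = (\<Sum>k\<le>2 * l. ?c k)"
    unfolding gen_poly_coeff[OF nQ m, symmetric] gen_poly_rotate[OF Q] by (simp add: coeff_sum)
  also have "\<dots> = (\<Sum>\<mu> = - int l..int l. ?c (nat (int l + \<mu>)))"
    by (rule sum.reindex_bij_witness[where i = "\<lambda>\<mu>. nat (int l + \<mu>)" and j = "\<lambda>k. int k - int l"]) auto
  also have "\<dots> = (\<Sum>\<mu> = - int l..int l.
      of_real (sphk l (nat \<bar>m\<bar>)) * (wigner_rep l Q \<mu> m * sph_harm l \<mu> x))"
  proof (rule sum.cong[OF refl])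
    fix \<mu> assume "\<mu> \<in> {- int l..int l}"
    then have "\<bar>\<mu>\<bar> \<le> int l" by auto
    from gen_poly_coeff[OF x this] show "?c (nat (int l + \<mu>)) =
        of_real (sphk l (nat \<bar>m\<bar>)) * (wigner_rep l Q \<mu> m * sph_harm l \<mu> x)"
      by (simp add: wigner_rep_def sphk_nonzero)
  qed
  finally show ?thesis using sphk_nonzero by (simp add: sum_distrib_left[symmetric])
qed

text \<open>The choice operator could leave \<open>wigner\<close> undetermined only through linear
  relations among the harmonics of degree \<open>l\<close>, and there are none; hence it inherits
  the explicit formula.\<close>

lemma wigner_eq:
  assumes Q: "orthogonal_matrix Q" and m: "\<bar>m\<bar> \<le> int l" and \<mu>: "\<bar>\<mu>\<bar> \<le> int l"
  shows "wigner l Q \<mu> m = wigner_rep l Q \<mu> m"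
proof -
  let ?P = "\<lambda>D. \<forall>m. \<bar>m\<bar> \<le> int l \<longrightarrow> (\<forall>x. norm x = 1 \<longrightarrow>
       sph_harm l m (Q *v x) = (\<Sum>\<mu> = - int l..int l. D \<mu> m * sph_harm l \<mu> x))"
  have "?P (wigner_rep l Q)" using sph_harm_rotate[OF Q] by blast
  then have P: "?P (wigner l Q)" unfolding wigner_def by (rule someI[of ?P])
  define K where "K = (\<lambda>\<mu>. (l, \<mu>)) ` {- int l..int l}"
  define c where "c p = wigner l Q (snd p) m - wigner_rep l Q (snd p) m" for p :: "nat \<times> int"
  have "c (l, \<mu>) = 0"
  proof (rule sph_harm_independent[of K])
    show "finite K" "(l, \<mu>) \<in> K" using \<mu> by (auto simp: K_def abs_le_iff intro!: imageI)
    show "\<bar>m\<bar> \<le> int l'" if "(l', m) \<in> K" for l' m using that by (auto simp: K_def)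
    fix x :: "real^3" assume x: "norm x = 1"
    have "(\<Sum>p\<in>K. c p * sph_harm (fst p) (snd p) x) =
        (\<Sum>\<mu> = - int l..int l. c (l, \<mu>) * sph_harm l \<mu> x)"
      unfolding K_def by (subst sum.reindex) (auto simp: inj_on_def)
    also have "\<dots> = (\<Sum>\<mu> = - int l..int l. wigner l Q \<mu> m * sph_harm l \<mu> x) -
        (\<Sum>\<mu> = - int l..int l. wigner_rep l Q \<mu> m * sph_harm l \<mu> x)"
      by (simp add: c_def left_diff_distrib sum_subtractf)
    also have "\<dots> = 0" using P m x sph_harm_rotate[OF Q x m] by simp
    finally show "(\<Sum>p\<in>K. c p * sph_harm (fst p) (snd p) x) = 0" .
  qed
  then show ?thesis by (simp add: c_def)
qed

section \<open>Continuity of the Wigner coefficients\<close>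

definition cont_coeffs :: "(real^3^3 \<Rightarrow> complex poly) \<Rightarrow> bool"
  where "cont_coeffs p \<longleftrightarrow> (\<forall>k. continuous_on UNIV (\<lambda>Q. coeff (p Q) k))"

lemma cont_coeffs_mult: "cont_coeffs p \<Longrightarrow> cont_coeffs q \<Longrightarrow> cont_coeffs (\<lambda>Q. p Q * q Q)"
  unfolding cont_coeffs_def coeff_mult by (intro allI continuous_intros) blast+

lemma cont_coeffs_power: "cont_coeffs p \<Longrightarrow> cont_coeffs (\<lambda>Q. p Q ^ n)"
proof (induction n)
  case 0
  show ?case unfolding cont_coeffs_def by simp
next
  case (Suc n)
  then show ?case using cont_coeffs_mult[of p "\<lambda>Q. p Q ^ n"] by simp
qed

lemma cont_coeffs_cone_poly: "cont_coeffs (\<lambda>Q. cone_poly Q j)"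
  unfolding cont_coeffs_def cone_poly_def coeff_add coeff_smult
  by (intro allI continuous_intros)

lemma continuous_wigner_rep: "continuous_on UNIV (\<lambda>Q. wigner_rep l Q \<mu> m)"
proof -
  have 1: "cont_coeffs (\<lambda>Q. - (cone_poly Q 1 + smult \<i> (cone_poly Q 2)))"
      "cont_coeffs (\<lambda>Q. cone_poly Q 1 - smult \<i> (cone_poly Q 2))"
    unfolding cont_coeffs_def coeff_minus coeff_add coeff_diff coeff_smult
    by (intro allI continuous_intros; use cont_coeffs_cone_poly in \<open>simp add: cont_coeffs_def\<close>)+
  have "cont_coeffs (\<lambda>Q. rot_poly l Q k)" for k
  proof (cases "k \<le> l")
    case True
    show ?thesis using True unfolding rot_poly_def null_coeff_def if_P[OF True]
      by (intro cont_coeffs_mult cont_coeffs_power 1 cont_coeffs_cone_poly)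
  next
    case False
    show ?thesis using False unfolding rot_poly_def null_coeff_def if_not_P[OF False]
      by (intro cont_coeffs_mult cont_coeffs_power 1 cont_coeffs_cone_poly)
  qed
  then show ?thesis unfolding wigner_rep_def cont_coeffs_def by (intro continuous_intros) blast+
qed

subsection \<open>One-particle functions\<close>

text \<open>\<open>CB\<close> with the constant forgotten, for regularity claims that need no
  quantitative control.\<close>

definition cb :: "nat \<Rightarrow> 'a::euclidean_space set \<Rightarrow> ('a \<Rightarrow> complex) \<Rightarrow> bool"
  where "cb k S f \<longleftrightarrow> (\<exists>M. CB k S M f)"

lemma cb_cong: "(\<And>x. x \<in> S \<Longrightarrow> f x = g x) \<Longrightarrow> cb k S f \<longleftrightarrow> cb k S g"
  unfolding cb_def using CB_cong[of S f g k] by simp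

lemma cb_const: "nondegenerate S \<Longrightarrow> cb k S (\<lambda>x. c)"
  unfolding cb_def using CB_const[of S c "norm c"] by auto

lemma cb_add: "nondegenerate S \<Longrightarrow> cb k S f \<Longrightarrow> cb k S g \<Longrightarrow> cb k S (\<lambda>x. f x + g x)"
  unfolding cb_def using CB_add by blast

lemma cb_diff: "nondegenerate S \<Longrightarrow> cb k S f \<Longrightarrow> cb k S g \<Longrightarrow> cb k S (\<lambda>x. f x - g x)"
  unfolding cb_def using CB_diff by blast

lemma cb_mult: "nondegenerate S \<Longrightarrow> cb k S f \<Longrightarrow> cb k S g \<Longrightarrow> cb k S (\<lambda>x. f x * g x)"
  unfolding cb_def using CB_mult by blast

lemma cb_cmult: "nondegenerate S \<Longrightarrow> cb k S f \<Longrightarrow> cb k S (\<lambda>x. c * f x)"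
  unfolding cb_def using CB_cmult by blast

lemma cb_sum:
  assumes "nondegenerate S" "finite I" "\<And>i. i \<in> I \<Longrightarrow> cb k S (f i)"
  shows "cb k S (\<lambda>x. \<Sum>i\<in>I. f i x)"
  using assms(2,3) by (induction I rule: finite_induct) (auto intro!: cb_const cb_add assms(1))

lemma cb_prod:
  assumes "nondegenerate S" "finite I" "\<And>i. i \<in> I \<Longrightarrow> cb k S (f i)"
  shows "cb k S (\<lambda>x. \<Prod>i\<in>I. f i x)"
  using assms(2,3) by (induction I rule: finite_induct) (auto intro!: cb_const cb_mult assms(1))

lemma cb_power: "nondegenerate S \<Longrightarrow> cb k S f \<Longrightarrow> cb k S (\<lambda>x. f x ^ n)"
  by (induction n) (auto intro!: cb_const cb_mult)

lemma cb_poly: "nondegenerate S \<Longrightarrow> cb k S f \<Longrightarrow> cb k S (\<lambda>x. poly p (f x))"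
  by (induction p) (auto intro!: cb_const cb_add cb_mult)

lemma cb_SucI:
  fixes S :: "'a::euclidean_space set"
  assumes S: "nondegenerate S" and b: "bounded_ext S M f"
    and d: "\<And>x. x \<in> S \<Longrightarrow> (f has_derivative f' x) (at x within S)"
    and c: "\<And>b. b \<in> Basis \<Longrightarrow> cb k S (\<lambda>x. f' x b)"
  shows "cb (Suc k) S f"
proof -
  obtain N where N: "\<And>b. b \<in> Basis \<Longrightarrow> CB k S (N b) (\<lambda>x. f' x b)"
    using c unfolding cb_def by metis
  define K where "K = \<bar>M\<bar> + (\<Sum>b\<in>(Basis::'a set). \<bar>N b\<bar>)"
  have 1: "N b \<le> K" if "b \<in> Basis" for b
  proof -
    have "\<bar>N b\<bar> \<le> (\<Sum>b\<in>(Basis::'a set). \<bar>N b\<bar>)" using that by (intro member_le_sum) auto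
    then show ?thesis unfolding K_def by linarith
  qed
  have "0 \<le> (\<Sum>b\<in>(Basis::'a set). \<bar>N b\<bar>)" by (rule sum_nonneg) simp
  then have "M \<le> K" unfolding K_def by linarith
  then have "CB (Suc k) S K f"
    using 1 N by (intro CB_SucI[OF S _ d] bounded_ext_mono[OF b]) (auto intro: CB_mono)
  then show ?thesis by (auto simp: cb_def)
qed

lemma cb_0: "cb 0 S f \<longleftrightarrow> (\<exists>M. bounded_ext S M f)"
  by (simp add: cb_def)

lemma bounded_extI:
  assumes "closure S \<subseteq> K" "continuous_on K f" "\<And>x. x \<in> S \<Longrightarrow> norm (f x) \<le> M"
  shows "bounded_ext S M f"
  unfolding bounded_ext_def using assms continuous_on_subset by blast

lemma bounded_ext_compactI:
  assumes "closure S \<subseteq> K" "compact K" "continuous_on K f"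
  shows "\<exists>M. bounded_ext S M f"
proof -
  have "bounded (f ` K)" using assms compact_continuous_image compact_imp_bounded by blast
  then obtain M where "\<And>x. x \<in> K \<Longrightarrow> norm (f x) \<le> M" by (auto simp: bounded_iff)
  then show ?thesis using assms(1,3) closure_subset[of S]
    by (intro exI[of _ M] bounded_extI[of S K]) auto
qed

subsection \<open>Functions of the lengths and directions of the particle positions\<close>

lemma open_Omega: "open (Omega r0 :: ((real^3)^'n) set)"
proof -
  have "Omega r0 = (\<Inter>j. {R :: (real^3)^'n. r0 < norm (R $ j)})" by (auto simp: Omega_def)
  moreover have "open {R :: (real^3)^'n. r0 < norm (R $ j)}" for j
    by (intro open_Collect_less continuous_intros)
  ultimately show ?thesis by auto
qed

lemma nondegenerate_Omega: "nondegenerate (Omega r0 :: ((real^3)^'n) set)"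
  by (rule nondegenerate_open[OF open_Omega])

lemma closure_Omega: "closure (Omega r0 :: ((real^3)^'n) set) \<subseteq> {R. \<forall>j. r0 \<le> norm (R $ j)}"
proof (rule closure_minimal)
  show "Omega r0 \<subseteq> {R :: (real^3)^'n. \<forall>j. r0 \<le> norm (R $ j)}" by (auto simp: Omega_def intro: less_imp_le)
  have "{R :: (real^3)^'n. \<forall>j. r0 \<le> norm (R $ j)} = (\<Inter>j. {R. r0 \<le> norm (R $ j)})" by auto
  moreover have "closed {R :: (real^3)^'n. r0 \<le> norm (R $ j)}" for j
    by (intro closed_Collect_le continuous_intros)
  ultimately show "closed {R :: (real^3)^'n. \<forall>j. r0 \<le> norm (R $ j)}" by auto
qed

lemma Omega_nth_nonzero: "0 < r0 \<Longrightarrow> R \<in> Omega r0 \<Longrightarrow> R $ a \<noteq> 0"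
  unfolding Omega_def by (metis mem_Collect_eq norm_zero not_less_iff_gr_or_eq)

definition dirc :: "'n \<Rightarrow> 3 \<Rightarrow> (real^3)^'n \<Rightarrow> complex"
  where "dirc a c R = of_real (R $ a $ c / norm (R $ a))"

definition invr :: "'n \<Rightarrow> (real^3)^'n \<Rightarrow> complex"
  where "invr a R = of_real (inverse (norm (R $ a)))"

lemma has_derivative_norm_nth:
  fixes R :: "(real^3)^'n"
  assumes "R $ a \<noteq> 0"
  shows "((\<lambda>R. norm (R $ a)) has_derivative (\<lambda>v. v $ a \<bullet> sgn (R $ a))) (at R within S)"
proof -
  have "((\<lambda>R::(real^3)^'n. R $ a) has_derivative (\<lambda>v. v $ a)) (at R within S)"
    by (rule bounded_linear_imp_has_derivative[OF bounded_linear_vec_nth])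
  from has_derivative_compose[OF this has_derivative_norm[OF assms]] show ?thesis .
qed

lemma inner_sgn_dirc:
  "complex_of_real (v \<bullet> sgn (R $ a)) = (\<Sum>c\<in>UNIV. of_real (v $ c) * dirc a c R)"
  by (simp add: inner_vec_def sgn_vec_def dirc_def sgn_div_norm divide_inverse mult_ac)

lemma has_derivative_invr:
  fixes R :: "(real^3)^'n"
  assumes "R $ a \<noteq> 0"
  shows "(invr a has_derivative
    (\<lambda>v. (- (invr a R * invr a R)) * (\<Sum>c\<in>UNIV. of_real (v $ a $ c) * dirc a c R))) (at R within S)"
proof -
  have "((\<lambda>R. inverse (norm (R $ a))) has_derivative
      (\<lambda>v. - (inverse (norm (R $ a)) * (v $ a \<bullet> sgn (R $ a)) * inverse (norm (R $ a))))) (at R within S)"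
    by (rule Deriv.has_derivative_inverse[OF _ has_derivative_norm_nth]) (use assms in auto)
  then have "((\<lambda>R. complex_of_real (inverse (norm (R $ a)))) has_derivative (\<lambda>v. of_real
      (- (inverse (norm (R $ a)) * (v $ a \<bullet> sgn (R $ a)) * inverse (norm (R $ a)))))) (at R within S)"
    by (rule bounded_linear.has_derivative[OF bounded_linear_of_real])
  then show ?thesis
    unfolding invr_def[abs_def] inner_sgn_dirc[symmetric]
    by (simp only: of_real_minus of_real_mult mult_minus_left mult_minus_right mult_ac)
qed

lemma has_derivative_dirc:
  fixes R :: "(real^3)^'n"
  assumes "R $ a \<noteq> 0"
  shows "(dirc a c has_derivative (\<lambda>v. of_real (v $ a $ c) * invr a R -
    dirc a c R * invr a R * (\<Sum>d\<in>UNIV. of_real (v $ a $ d) * dirc a d R))) (at R within S)"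
proof -
  have lin: "bounded_linear (\<lambda>R::(real^3)^'n. R $ a $ c)"
    using bounded_linear_compose[OF bounded_linear_vec_nth bounded_linear_vec_nth] .
  have "((\<lambda>R::(real^3)^'n. complex_of_real (R $ a $ c)) has_derivative (\<lambda>v. of_real (v $ a $ c))) (at R within S)"
    by (rule bounded_linear.has_derivative[OF bounded_linear_of_real
        bounded_linear_imp_has_derivative[OF lin]])
  from has_derivative_mult[OF this has_derivative_invr[OF assms]]
  have "((\<lambda>R. of_real (R $ a $ c) * invr a R) has_derivative
    (\<lambda>v. of_real (R $ a $ c) * (- (invr a R * invr a R) * (\<Sum>d\<in>UNIV. of_real (v $ a $ d) * dirc a d R)) +
      of_real (v $ a $ c) * invr a R)) (at R within S)" .
  moreover have eq: "dirc a c = (\<lambda>R. of_real (R $ a $ c) * invr a R)"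
    by (auto simp: dirc_def invr_def divide_inverse fun_eq_iff)
  ultimately show ?thesis
    by (simp add: eq algebra_simps)
qed

text \<open>The derivatives of \<open>invr\<close> and \<open>dirc\<close> are polynomials in these
  same functions, so one induction treats both. The distance \<open>r0\<close> from the origin
  bounds \<open>invr\<close>.\<close>

lemma cb_dirc_invr:
  fixes a :: "'n::finite"
  assumes r0: "0 < r0"
  shows "cb k (Omega r0) (invr a) \<and> (\<forall>c. cb k (Omega r0) (dirc a c))"
proof -
  let ?S = "Omega r0 :: ((real^3)^'n) set" and ?K = "{R :: (real^3)^'n. \<forall>j. r0 \<le> norm (R $ j)}"
  have nz: "R $ a \<noteq> 0" if "R \<in> ?K" for R proof -
    have "r0 \<le> norm (R $ a)" using that by simp
    then show ?thesis using r0 by auto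
  qed
  have nz': "R $ a \<noteq> 0" if "R \<in> ?S" for R using Omega_nth_nonzero[OF r0 that] .
  have ir: "bounded_ext ?S (inverse r0) (invr a)"
  proof (rule bounded_extI[OF closure_Omega])
    show "continuous_on ?K (invr a)"
      unfolding invr_def by (intro continuous_intros) (use nz in auto)
    fix R :: "(real^3)^'n" assume "R \<in> ?S"
    then have "r0 \<le> norm (R $ a)" by (auto simp: Omega_def intro: less_imp_le)
    then show "norm (invr a R) \<le> inverse r0"
      using r0 unfolding invr_def norm_of_real by (simp add: le_imp_inverse_le)
  qed
  have dr: "bounded_ext ?S 1 (dirc a c)" for c
  proof (rule bounded_extI[OF closure_Omega])
    show "continuous_on ?K (dirc a c)"
      unfolding dirc_def by (intro continuous_intros) (use nz in auto)
    fix R :: "(real^3)^'n" assume "R \<in> ?S"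
    then show "norm (dirc a c R) \<le> 1"
      using component_le_norm_cart[of "R $ a" c] nz'[of R]
      unfolding dirc_def norm_of_real by simp
  qed
  show ?thesis
  proof (induction k)
    case 0
    show ?case using ir dr by (auto simp: cb_0)
  next
    case (Suc k)
    note I = cb_mult cb_cmult cb_diff cb_sum nondegenerate_Omega
    have "cb (Suc k) ?S (invr a)"
    proof (rule cb_SucI[OF nondegenerate_Omega ir has_derivative_invr[OF nz']])
      fix b :: "(real^3)^'n"
      have "cb k ?S (\<lambda>R. (- 1) * ((invr a R * invr a R) *
          (\<Sum>c\<in>UNIV. of_real (b $ a $ c) * dirc a c R)))"
        using Suc by (intro I) auto
      then show "cb k ?S (\<lambda>R. - (invr a R * invr a R) *
          (\<Sum>c\<in>UNIV. of_real (b $ a $ c) * dirc a c R))" by simp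
    qed
    moreover have "cb (Suc k) ?S (dirc a c)" for c
    proof (rule cb_SucI[OF nondegenerate_Omega dr has_derivative_dirc[OF nz']])
      fix b :: "(real^3)^'n"
      show "cb k ?S (\<lambda>R. of_real (b $ a $ c) * invr a R - dirc a c R * invr a R *
          (\<Sum>d\<in>UNIV. of_real (b $ a $ d) * dirc a d R))"
        using Suc by (intro I) auto
    qed
    ultimately show ?case by blast
  qed
qed

text \<open>\<open>C\<close> does not depend on \<open>h\<close>, since the bound will be applied to
  approximation errors. A directional derivative of the lift is the lift of \<open>h'\<close> times
  a combination of direction cosines, which yields the induction.\<close>

lemma radial_lift_bound:
  fixes a :: "'n::finite"
  assumes r0: "0 < r0"
  shows "\<exists>C\<ge>1. \<forall>h M. CB k {r0..} M h \<longrightarrow>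
    CB k (Omega r0) (C * M) (\<lambda>R::(real^3)^'n. h (norm (R $ a)))"
proof -
  let ?S = "Omega r0 :: ((real^3)^'n) set" and ?K = "{R :: (real^3)^'n. \<forall>j. r0 \<le> norm (R $ j)}"
  have nz: "R $ a \<noteq> 0" if "R \<in> ?S" for R using Omega_nth_nonzero[OF r0 that] .
  have base: "bounded_ext ?S M (\<lambda>R. h (norm (R $ a)))" if "bounded_ext {r0..} M h" for h M
  proof -
    have "\<exists>g. continuous_on (closure {r0..}) g \<and> (\<forall>x\<in>{r0..}. g x = h x)"
      using that unfolding bounded_ext_def by (rule conjunct2)
    then obtain g where g: "continuous_on {r0..} g" "\<forall>x\<in>{r0..}. g x = h x" by auto
    have "continuous_on {r0..} h" using g(2) by (intro continuous_on_eq[OF g(1)]) auto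
    then have "continuous_on ?K (\<lambda>R. h (norm (R $ a)))"
      by (rule continuous_on_compose2) (auto intro!: continuous_intros)
    then show ?thesis
      using that by (intro bounded_extI[OF closure_Omega])
        (auto simp: bounded_ext_def Omega_def intro: less_imp_le)
  qed
  show ?thesis
  proof (induction k)
    case 0
    show ?case using base by (intro exI[of _ 1]) auto
  next
    case (Suc k)
    then obtain C where C: "C \<ge> 1" "\<And>h M. CB k {r0..} M h \<Longrightarrow> CB k ?S (C * M) (\<lambda>R. h (norm (R $ a)))"
      by blast
    have "\<forall>c. \<exists>M. CB k ?S M (dirc a c)" using cb_dirc_invr[OF r0, of k a] by (auto simp: cb_def)
    then obtain U where U: "\<And>c. CB k ?S (U c) (dirc a c)" by metis
    define W where "W b = (\<Sum>c\<in>UNIV. norm (complex_of_real (b $ a $ c)) * U c)" for b :: "(real^3)^'n"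
    have W: "CB k ?S (W b) (\<lambda>R. \<Sum>c\<in>UNIV. of_real (b $ a $ c) * dirc a c R)" for b
      unfolding W_def by (intro CB_sum CB_cmult U nondegenerate_Omega) auto
    \<comment> \<open>One constant for all basis directions; the summand 1 covers the bound for the
      function itself.\<close>
    define D where "D = 1 + (\<Sum>b\<in>Basis. 2 ^ k * \<bar>W b\<bar> * C)"
    have D1: "D \<ge> 1" unfolding D_def using C(1) by (simp add: sum_nonneg)
    have DW: "2 ^ k * W b * C \<le> D" if "b \<in> Basis" for b
    proof -
      have "2 ^ k * W b * C \<le> 2 ^ k * \<bar>W b\<bar> * C" using C(1) by (intro mult_right_mono mult_left_mono) auto
      also have "\<dots> \<le> (\<Sum>b\<in>Basis. 2 ^ k * \<bar>W b\<bar> * C)" using that C(1) by (intro member_le_sum) auto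
      finally show ?thesis by (simp add: D_def)
    qed
    have "CB (Suc k) ?S (D * M) (\<lambda>R. h (norm (R $ a)))" if h: "CB (Suc k) {r0..} M h" for h M
    proof -
      have M: "0 \<le> M" using CB_nonneg[OF h, of r0] by simp
      define h' where "h' r = frechet_derivative h (at r within {r0..}) 1" for r
      have h': "CB k {r0..} M h'" using h by (simp add: h'_def[abs_def])
      have der: "(h has_derivative (\<lambda>s. of_real s * h' r)) (at r within {r0..})" if "r \<in> {r0..}" for r
      proof -
        have 1: "(h has_derivative frechet_derivative h (at r within {r0..})) (at r within {r0..})"
          by (rule CB_has_derivative[OF h that])
        have "frechet_derivative h (at r within {r0..}) s = of_real s * h' r" for s
          using linear_scale[OF has_derivative_linear[OF 1], of s 1]
          by (simp add: h'_def scaleR_conv_of_real)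
        then show ?thesis using 1 by (metis (no_types, lifting) ext)
      qed
      show ?thesis
      proof (rule CB_SucI[OF nondegenerate_Omega])
        have "1 * M \<le> D * M" using D1 M by (rule mult_right_mono)
        then show "bounded_ext ?S (D * M) (\<lambda>R. h (norm (R $ a)))"
          using base[OF CB_bounded_ext[OF h]] by (rule_tac bounded_ext_mono) auto
        fix R assume R: "R \<in> ?S"
        then have mem: "norm (R $ a) \<in> {r0..}" by (auto simp: Omega_def intro: less_imp_le)
        have sub: "(\<lambda>R. norm (R $ a)) ` ?S \<subseteq> {r0..}" by (auto simp: Omega_def intro: less_imp_le)
        show "((\<lambda>R. h (norm (R $ a))) has_derivative
            (\<lambda>v. of_real (v $ a \<bullet> sgn (R $ a)) * h' (norm (R $ a)))) (at R within ?S)"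
          by (rule has_derivative_in_compose[OF has_derivative_norm_nth[OF nz[OF R]]
              has_derivative_subset[OF der[OF mem] sub]])
      next
        fix b :: "(real^3)^'n" assume b: "b \<in> Basis"
        have "CB k ?S (2 ^ k * W b * (C * M)) (\<lambda>R. (\<Sum>c\<in>UNIV. of_real (b $ a $ c) * dirc a c R) * h' (norm (R $ a)))"
          by (intro CB_mult nondegenerate_Omega W C(2) h')
        then have "CB k ?S (D * M) (\<lambda>R. (\<Sum>c\<in>UNIV. of_real (b $ a $ c) * dirc a c R) * h' (norm (R $ a)))"
          by (rule CB_mono) (use mult_right_mono[OF DW[OF b] M] in \<open>simp add: mult.assoc\<close>)
        then show "CB k ?S (D * M) (\<lambda>R. of_real (b $ a \<bullet> sgn (R $ a)) * h' (norm (R $ a)))"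
          unfolding inner_sgn_dirc .
      qed
    qed
    then show ?case using D1 by blast
  qed
qed

lemma cb_radial_lift:
  fixes a :: "'n::finite"
  assumes "0 < r0" "cb k {r0..} h"
  shows "cb k (Omega r0) (\<lambda>R::(real^3)^'n. h (norm (R $ a)))"
  using radial_lift_bound[OF assms(1), of k a] assms(2) unfolding cb_def by blast

section \<open>Regularity of spherical harmonics of the directions\<close>

lemma norm_normalized: "x \<noteq> 0 \<Longrightarrow> norm (inverse (norm x) *\<^sub>R x) = 1" for x :: "'a::real_normed_vector"
  by simp

lemma xy_eq: "xy x = of_real (x $ 1) + \<i> * of_real (x $ 2)"
  by (simp add: xy_def complex_eq_iff)

text \<open>On directions a harmonic is a polynomial in the direction cosines, whose regularity is
  known.\<close>

lemma cb_sph_harm: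
  fixes a :: "'n::finite"
  assumes r0: "0 < r0" and m: "\<bar>m\<bar> \<le> int l"
  shows "cb k (Omega r0) (\<lambda>R::(real^3)^'n. sph_harm l m (inverse (norm (R $ a)) *\<^sub>R R $ a))"
proof -
  let ?S = "Omega r0 :: ((real^3)^'n) set" and ?u = "\<lambda>R::(real^3)^'n. inverse (norm (R $ a)) *\<^sub>R R $ a"
  have nu: "norm (?u R) = 1" if "R \<in> ?S" for R
    using Omega_nth_nonzero[OF r0 that] by (rule norm_normalized)
  have u: "complex_of_real (?u R $ c) = dirc a c R" for R c
    by (simp add: dirc_def divide_inverse mult.commute)
  have x: "xy (?u R) = dirc a 1 R + \<i> * dirc a 2 R" "cnj (xy (?u R)) = dirc a 1 R - \<i> * dirc a 2 R" for R
    unfolding u[symmetric] xy_eq by (simp_all add: complex_eq_iff)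
  have x': "cnj (dirc a 1 R + \<i> * dirc a 2 R) = dirc a 1 R - \<i> * dirc a 2 R" for R
    by (simp only: x[symmetric])
  have p: "complex_of_real (poly p (?u R $ 3)) = poly (map_poly of_real p) (dirc a 3 R)" for p R
  proof -
    have "degree (map_poly complex_of_real p) = degree p" by (rule degree_map_poly) simp
    then show ?thesis unfolding u[symmetric] by (simp add: poly_altdef coeff_map_poly)
  qed
  have d: "cb k ?S (dirc a c)" for c using cb_dirc_invr[OF r0] by blast
  note I = cb_mult cb_cmult cb_diff cb_add cb_power cb_poly d nondegenerate_Omega
  from m show ?thesis
  proof (cases rule: sph_harm_cases)
    case (1 j)
    have "cb k ?S (\<lambda>R. of_real (sphc l j) * (poly (map_poly of_real (leg l j)) (dirc a 3 R) *
        (dirc a 1 R + \<i> * dirc a 2 R) ^ j))" by (intro I)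
    moreover have "of_real (sphc l j) * (poly (map_poly of_real (leg l j)) (dirc a 3 R) *
        (dirc a 1 R + \<i> * dirc a 2 R) ^ j) = sph_harm l m (?u R)" if "R \<in> ?S" for R
      by (simp only: 1(2) sph_harm_pos[OF nu[OF that]] of_real_mult x p mult.assoc)
    ultimately show ?thesis using cb_cong[of ?S] by (metis (no_types, lifting))
  next
    case (2 j)
    have "cb k ?S (\<lambda>R. ((- 1) ^ j * of_real (sphc l j)) * (poly (map_poly of_real (leg l j)) (dirc a 3 R) *
        (dirc a 1 R - \<i> * dirc a 2 R) ^ j))" by (intro I)
    moreover have "((- 1) ^ j * of_real (sphc l j)) * (poly (map_poly of_real (leg l j)) (dirc a 3 R) *
        (dirc a 1 R - \<i> * dirc a 2 R) ^ j) = sph_harm l m (?u R)" if "R \<in> ?S" for R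
      by (simp only: 2(3) sph_harm_neg[OF nu[OF that]] of_real_mult x(1) x' p mult.assoc)
    ultimately show ?thesis using cb_cong[of ?S] by (metis (no_types, lifting))
  qed
qed

lemma phi1_lift_cb:
  fixes a :: "'n::finite"
  assumes "0 < r0" "cb k {r0..} (P n)" "\<bar>m\<bar> \<le> int l"
  shows "cb k (Omega r0) (\<lambda>R::(real^3)^'n. phi1 P n l m (R $ a))"
  unfolding phi1_def
  by (intro cb_mult cb_radial_lift cb_sph_harm assms nondegenerate_Omega)

section \<open>Approximation from subspaces and of tensor products\<close>

lemma capx_zero: "nondegenerate S \<Longrightarrow> cfun.subspace V \<Longrightarrow> capx k S V (\<lambda>x. 0)"
  using capx_self[of S "\<lambda>x. 0" V k] cfun.subspace_0[of V] by (simp add: zero_fun_def)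

lemma capx_add:
  assumes "nondegenerate S" "cfun.subspace V" "capx k S V f" "capx k S V g"
  shows "capx k S V (\<lambda>x. f x + g x)"
  unfolding capx_def
proof (intro allI impI)
  fix e :: real assume "e > 0"
  then have e2: "e / 2 > 0" by simp
  obtain f' where f': "f' \<in> V" "CB k S (e / 2) (\<lambda>x. f x - f' x)"
    using assms(3) e2 unfolding capx_def by blast
  obtain g' where g': "g' \<in> V" "CB k S (e / 2) (\<lambda>x. g x - g' x)"
    using assms(4) e2 unfolding capx_def by blast
  have "CB k S (e / 2 + e / 2) (\<lambda>x. (f x - f' x) + (g x - g' x))"
    by (rule CB_add[OF assms(1) f'(2) g'(2)])
  then have "CB k S e (\<lambda>x. f x + g x - (f' + g') x)" by (simp add: algebra_simps)
  then show "\<exists>h\<in>V. CB k S e (\<lambda>x. f x + g x - h x)"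
    using cfun.subspace_add[OF assms(2) f'(1) g'(1)] by blast
qed

lemma capx_cmult:
  assumes "nondegenerate S" "cfun.subspace V" "capx k S V f"
  shows "capx k S V (\<lambda>x. c * f x)"
  unfolding capx_def
proof (intro allI impI)
  fix e :: real assume "e > 0"
  define K where "K = norm c + 1"
  have K: "K > 0" by (simp add: K_def add_nonneg_pos)
  then have eK: "e / K > 0" using \<open>e > 0\<close> by simp
  obtain f' where f': "f' \<in> V" "CB k S (e / K) (\<lambda>x. f x - f' x)"
    using assms(3) eK unfolding capx_def by blast
  have "CB k S (norm c * (e / K)) (\<lambda>x. c * (f x - f' x))"
    by (rule CB_cmult[OF assms(1) f'(2)])
  moreover have "norm c * (e / K) \<le> e"
    using K \<open>e > 0\<close> by (simp add: K_def divide_le_eq mult.commute algebra_simps)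
  ultimately have "CB k S e (\<lambda>x. c * (f x - f' x))" by (rule CB_mono)
  then have "CB k S e (\<lambda>x. c * f x - cscale c f' x)"
    by (simp add: cscale_def right_diff_distrib)
  then show "\<exists>h\<in>V. CB k S e (\<lambda>x. c * f x - h x)"
    using cfun.subspace_scale[OF assms(2) f'(1)] by blast
qed

text \<open>\<open>L\<close> will be a multiplication by, or a composition with, fixed functions;
  such operators are linear pointwise, which is all that is asked on \<open>S\<close>.\<close>

lemma capx_span_induct:
  assumes S: "nondegenerate S" and V: "cfun.subspace V" and g: "g \<in> cfun.span B"
    and lin: "\<And>x y R. R \<in> S \<Longrightarrow> L (x + y) R = L x R + L y R"
      "\<And>c x R. R \<in> S \<Longrightarrow> L (cscale c x) R = c * L x R"
    and base: "\<And>b. b \<in> B \<Longrightarrow> capx k S V (L b)"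
  shows "capx k S V (L g)"
  using g
proof (induction rule: cfun.span_induct_alt)
  case base
  have "L 0 R = 0" if "R \<in> S" for R
    using lin(2)[OF that, of 0 0] by (simp add: cscale_def zero_fun_def)
  then show ?case by (rule capx_cong[THEN iffD2, OF _ capx_zero[OF S V]])
next
  case (step c x y)
  have "capx k S V (\<lambda>R. c * L x R + L y R)"
    using step assms(6) by (intro capx_add[OF S V] capx_cmult[OF S V]) auto
  then show ?case
    by (subst capx_cong[where g = "\<lambda>R. c * L x R + L y R"]) (auto simp: lin)
qed

text \<open>The factors are replaced one at a time. \<open>T\<close> holds those that are already
  general; the claim is kept for every choice of the remaining \<open>e a\<close> in
  \<open>E\<close>, so that slot \<open>b\<close> can be refilled with any generator
  \<open>y\<close>.\<close>

lemma capx_tensor: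
  fixes f :: "'n::finite \<Rightarrow> real^3 \<Rightarrow> complex" and E :: "(real^3 \<Rightarrow> complex) set"
  assumes S: "nondegenerate S" and V: "cfun.subspace V" and ne: "E \<noteq> {}"
    and E: "\<And>e. (\<forall>a. e a \<in> E) \<Longrightarrow> capx t S V (\<lambda>R. \<Prod>a\<in>UNIV. e a (R $ a))"
    and cbE: "\<And>a g. g \<in> E \<Longrightarrow> cb t S (\<lambda>R::(real^3)^'n. g (R $ a))"
    and cbf: "\<And>a. cb t S (\<lambda>R. f a (R $ a))"
    and app: "\<And>a. capx t S ((\<lambda>g R. g (R $ a)) ` cfun.span E) (\<lambda>R. f a (R $ a))"
  shows "capx t S V (\<lambda>R. \<Prod>a\<in>UNIV. f a (R $ a))"
proof -
  have "\<forall>e. (\<forall>a. e a \<in> E) \<longrightarrow>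
      capx t S V (\<lambda>R. (\<Prod>a\<in>T. f a (R $ a)) * (\<Prod>a\<in>- T. e a (R $ a)))"
    if "finite T" for T :: "'n set"
    using that
  proof (induction T rule: finite_induct)
    case empty
    then show ?case using E by simp
  next
    case (insert b T)
    show ?case
    proof (intro allI impI)
      fix e :: "'n \<Rightarrow> real^3 \<Rightarrow> complex" assume e: "\<forall>a. e a \<in> E"
      \<comment> \<open>All factors except that of \<open>b\<close>: a fixed multiplier, regular
        enough for \<open>capx_mult\<close>.\<close>
      define X where "X R = (\<Prod>a\<in>T. f a (R $ a)) * (\<Prod>a\<in>- insert b T. e a (R $ a))" for R
      have X: "cb t S X"
        unfolding X_def using e by (intro cb_mult cb_prod S cbf cbE) auto
      obtain M where M: "CB t S M X" using X by (auto simp: cb_def)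
      have "capx t S V (\<lambda>R. X R * f b (R $ b))"
      proof (rule capx_mult[OF S M app])
        fix g assume "g \<in> (\<lambda>g R. g (R $ b)) ` cfun.span E"
        then obtain g' where g': "g' \<in> cfun.span E" "g = (\<lambda>R. g' (R $ b))" by blast
        have "capx t S V ((\<lambda>g' R. X R * g' (R $ b)) g')"
        proof (rule capx_span_induct[OF S V g'(1)])
          fix y assume y: "y \<in> E"
          have "capx t S V (\<lambda>R. (\<Prod>a\<in>T. f a (R $ a)) * (\<Prod>a\<in>- T. (e(b := y)) a (R $ a)))"
            by (rule insert.IH[rule_format]) (use e y in auto)
          moreover have T: "- T = insert b (- insert b T)" using insert.hyps by auto
          have "(\<Prod>a\<in>- T. (e(b := y)) a (R $ a)) = y (R $ b) * (\<Prod>a\<in>- insert b T. e a (R $ a))" for R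
          proof -
            have "(\<Prod>a\<in>insert b (- insert b T). (e(b := y)) a (R $ a)) =
                (e(b := y)) b (R $ b) * (\<Prod>a\<in>- insert b T. (e(b := y)) a (R $ a))"
              by (rule prod.insert) auto
            also have "(\<Prod>a\<in>- insert b T. (e(b := y)) a (R $ a)) = (\<Prod>a\<in>- insert b T. e a (R $ a))"
              by (rule prod.cong) auto
            finally show ?thesis unfolding T[symmetric] by simp
          qed
          ultimately show "capx t S V (\<lambda>R. X R * y (R $ b))"
            by (simp add: X_def mult_ac)
        qed (auto simp: cscale_def algebra_simps)
        then show "capx t S V (\<lambda>x. X x * g x)" using g'(2) by simp
      qed
      then show "capx t S V (\<lambda>R. (\<Prod>a\<in>insert b T. f a (R $ a)) * (\<Prod>a\<in>- insert b T. e a (R $ a)))"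
        using insert.hyps by (simp add: X_def mult_ac)
    qed
  qed
  from this[of UNIV] show ?thesis using ne by auto
qed

subsection \<open>A smooth cutoff\<close>

text \<open>The powers of \<open>inverse x\<close> are what differentiating
  \<open>exp (- inverse x)\<close> produces; with them the family is closed under differentiation up
  to linear combinations.\<close>

definition bump :: "nat \<Rightarrow> real \<Rightarrow> real"
  where "bump i x = (if x > 0 then inverse x ^ i * exp (- inverse x) else 0)"

lemma bump_tendsto_0: "(bump i \<longlongrightarrow> 0) (at 0)"
proof -
  have "((\<lambda>x. x ^ i / exp x) \<longlongrightarrow> (0::real)) at_top" by (rule tendsto_power_div_exp_0)
  then have "((\<lambda>x. inverse x ^ i / exp (inverse x)) \<longlongrightarrow> (0::real)) (at_right 0)"
    by (rule filterlim_compose[OF _ filterlim_inverse_at_top_right])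
  then have r: "(bump i \<longlongrightarrow> 0) (at_right 0)"
    by (rule Lim_transform_eventually)
      (auto simp: bump_def exp_minus divide_inverse eventually_at_filter)
  have "((\<lambda>x. 0) \<longlongrightarrow> (0::real)) (at_left 0)" by simp
  then have "(bump i \<longlongrightarrow> 0) (at_left 0)"
    by (rule Lim_transform_eventually) (auto simp: bump_def eventually_at_filter)
  then show ?thesis using r by (simp add: filterlim_at_split)
qed

lemma bump_deriv: "(bump i has_real_derivative bump (i + 2) x - real i * bump (i + 1) x) (at x)"
proof -
  consider "x > 0" | "x < 0" | "x = 0" by linarith
  then show ?thesis
  proof cases
    case 1
    \<comment> \<open>Merges the exponents; at \<open>i = 0\<close> the truncated
      \<open>i - 1\<close> is harmless because of the factor \<open>i\<close>.\<close>
    have pw: "real i * inverse x ^ (i - Suc 0) * - (inverse x ^ 2) = - (real i * inverse x ^ (i + 1))"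
      by (cases i) (simp_all add: power2_eq_square)
    have "((\<lambda>x. inverse x ^ i * exp (- inverse x)) has_real_derivative
        real i * inverse x ^ (i - Suc 0) * - (inverse x ^ 2) * exp (- inverse x) +
        exp (- inverse x) * - (- (inverse x ^ 2)) * inverse x ^ i) (at x)"
      using 1 by (auto intro!: derivative_eq_intros simp: power2_eq_square)
    then have "((\<lambda>x. inverse x ^ i * exp (- inverse x)) has_real_derivative
        bump (i + 2) x - real i * bump (i + 1) x) (at x)"
      unfolding pw using 1 by (simp add: bump_def algebra_simps power2_eq_square)
    then show ?thesis
      by (rule DERIV_cong_ev[THEN iffD1, rotated -1])
        (use 1 in \<open>auto simp: bump_def intro!: eventually_mono[OF eventually_nhds_in_open[of "{0<..}"]]\<close>)
  next
    case 2
    have "((\<lambda>x. 0) has_real_derivative 0) (at x)" by simp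
    then have "(bump i has_real_derivative 0) (at x)"
      by (rule DERIV_cong_ev[THEN iffD1, rotated -1])
        (use 2 in \<open>auto simp: bump_def intro!: eventually_mono[OF eventually_nhds_in_open[of "{..<0}"]]\<close>)
    then show ?thesis using 2 by (simp add: bump_def)
  next
    case 3
    \<comment> \<open>At 0 the difference quotient of \<open>bump i\<close> is
      \<open>bump (Suc i)\<close>, whose limit is known.\<close>
    have "((\<lambda>h. (bump i (0 + h) - bump i 0) / h) \<longlongrightarrow> 0) (at 0)"
    proof (rule Lim_transform_eventually[OF bump_tendsto_0[of "Suc i"]])
      show "\<forall>\<^sub>F h in at 0. bump (Suc i) h = (bump i (0 + h) - bump i 0) / h"
        by (auto simp: bump_def eventually_at_filter divide_inverse)
    qed
    then show ?thesis using 3 by (simp add: DERIV_def bump_def)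
  qed
qed

lemma continuous_bump: "continuous_on S (bump i)"
  using bump_deriv DERIV_isCont continuous_at_imp_continuous_on by blast

lemma bump_0_mult_exp: "x > 0 \<Longrightarrow> bump 0 x * exp (inverse x) = 1"
  by (simp add: bump_def exp_minus)

text \<open>
  Of this family only the case \<open>i = j = p = 0\<close> is the cutoff; the other members make the family
  closed under differentiation up to linear combinations.  The factors \<open>r ^ j\<close> also absorb the
  radial parts of monomials.
\<close>

definition hrad :: "real \<Rightarrow> real \<Rightarrow> nat \<Rightarrow> nat \<Rightarrow> nat \<Rightarrow> real \<Rightarrow> complex"
  where "hrad q rcut i j p r = of_real (r ^ j * bump i (rcut\<^sup>2 - r\<^sup>2) *
    inverse (r\<^sup>2 - q\<^sup>2) ^ p * exp (inverse (r\<^sup>2 - q\<^sup>2)))"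

lemma hrad_zero: "0 < rcut \<Longrightarrow> rcut \<le> r \<Longrightarrow> hrad q rcut i j p r = 0"
proof -
  assume "0 < rcut" "rcut \<le> r"
  then have "rcut\<^sup>2 \<le> r\<^sup>2" by (intro power_mono) auto
  then show ?thesis by (simp add: hrad_def bump_def)
qed

text \<open>The derivative stays in the span of the family. The assumption \<open>q < r\<close>
  keeps away from the pole of \<open>inverse (r^2 - q^2)\<close>, and for \<open>j = 0\<close> the
  truncated index \<open>j - 1\<close> has coefficient 0.\<close>

lemma hrad_deriv:
  assumes q: "0 < q" "q < r"
  shows "(hrad q rcut i j p has_derivative (\<lambda>s. of_real s *
    (of_nat j * hrad q rcut i (j - 1) p r - 2 * hrad q rcut (i + 2) (j + 1) p r
      + 2 * of_nat i * hrad q rcut (i + 1) (j + 1) p r - 2 * of_nat p * hrad q rcut i (j + 1) (p + 1) r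
      - 2 * hrad q rcut i (j + 1) (p + 2) r))) (at r within S)"
proof -
  define T where "T r = inverse (r\<^sup>2 - q\<^sup>2)" for r
  have nz: "r\<^sup>2 - q\<^sup>2 \<noteq> 0" using q power_strict_mono[of q r 2] by simp
  have dT: "(T has_real_derivative (- 2 * r * T r ^ 2)) (at r within S)"
    unfolding T_def using nz
    by (auto intro!: derivative_eq_intros simp: power2_eq_square)
  have dB: "((\<lambda>r. bump i (rcut\<^sup>2 - r\<^sup>2)) has_real_derivative
      (bump (i + 2) (rcut\<^sup>2 - r\<^sup>2) - real i * bump (i + 1) (rcut\<^sup>2 - r\<^sup>2)) * (- 2 * r)) (at r within S)"
    by (rule DERIV_chain2[OF bump_deriv]) (auto intro!: derivative_eq_intros)
  let ?B = "\<lambda>i. bump i (rcut\<^sup>2 - r\<^sup>2)"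
  have "((\<lambda>r. r ^ j * bump i (rcut\<^sup>2 - r\<^sup>2) * T r ^ p * exp (T r)) has_real_derivative
      ((real j * r ^ (j - 1) * ?B i + (?B (i + 2) - real i * ?B (i + 1)) * (- 2 * r) * r ^ j) * T r ^ p +
        (real p * T r ^ (p - 1) * (- 2 * r * T r ^ 2)) * (r ^ j * ?B i)) * exp (T r) +
      (exp (T r) * (- 2 * r * T r ^ 2)) * (r ^ j * ?B i * T r ^ p)) (at r within S)"
    by (intro DERIV_mult dB DERIV_chain2[OF DERIV_exp] dT)
      (auto intro!: derivative_eq_intros dT)
  moreover have "((real j * r ^ (j - 1) * ?B i + (?B (i + 2) - real i * ?B (i + 1)) * (- 2 * r) * r ^ j) * T r ^ p +
        (real p * T r ^ (p - 1) * (- 2 * r * T r ^ 2)) * (r ^ j * ?B i)) * exp (T r) +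
      (exp (T r) * (- 2 * r * T r ^ 2)) * (r ^ j * ?B i * T r ^ p) =
      real j * (r ^ (j - 1) * ?B i * T r ^ p * exp (T r)) - 2 * (r ^ (j + 1) * ?B (i + 2) * T r ^ p * exp (T r)) +
      2 * real i * (r ^ (j + 1) * ?B (i + 1) * T r ^ p * exp (T r)) -
      2 * real p * (r ^ (j + 1) * ?B i * T r ^ (p + 1) * exp (T r)) -
      2 * (r ^ (j + 1) * ?B i * T r ^ (p + 2) * exp (T r))" (is "_ = ?D")
    by (cases p) (simp_all add: algebra_simps power2_eq_square)
  ultimately have "((\<lambda>r. r ^ j * bump i (rcut\<^sup>2 - r\<^sup>2) * T r ^ p * exp (T r)) has_derivative (\<lambda>s. ?D * s)) (at r within S)"
    by (simp only: has_field_derivative_def)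
  then have "((\<lambda>r. complex_of_real (r ^ j * bump i (rcut\<^sup>2 - r\<^sup>2) * T r ^ p * exp (T r))) has_derivative
      (\<lambda>s. of_real (?D * s))) (at r within S)"
    by (rule bounded_linear.has_derivative[OF bounded_linear_of_real])
  moreover have "(\<lambda>s. complex_of_real (?D * s)) = (\<lambda>s. of_real s *
    (of_nat j * hrad q rcut i (j - 1) p r - 2 * hrad q rcut (i + 2) (j + 1) p r
      + 2 * of_nat i * hrad q rcut (i + 1) (j + 1) p r - 2 * of_nat p * hrad q rcut i (j + 1) (p + 1) r
      - 2 * hrad q rcut i (j + 1) (p + 2) r))"
    unfolding hrad_def T_def[symmetric]
    by (rule ext) (simp only: of_real_mult of_real_diff of_real_add of_real_of_nat_eq of_real_numeral mult_ac)
  ultimately show ?thesis unfolding hrad_def[abs_def] T_def by (simp only:)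
qed

lemma cb_hrad:
  assumes q: "0 < q" "q < r0" and rc: "0 < rcut"
  shows "cb k {r0..} (hrad q rcut i j p)"
proof -
  \<comment> \<open>Beyond \<open>rcut\<close> the function is 0, so boundedness is a matter of the
    compact interval up to \<open>rcut\<close>.\<close>
  have base: "\<exists>M. bounded_ext {r0..} M (hrad q rcut i j p)" for i j p
  proof -
    have nz: "r\<^sup>2 - q\<^sup>2 \<noteq> 0" if "r \<in> {r0..}" for r using q power_strict_mono[of q r 2] that by auto
    have cont: "continuous_on {r0..} (hrad q rcut i j p)"
      unfolding hrad_def
      by (intro continuous_intros continuous_on_compose2[OF continuous_bump[of UNIV]]) (use nz in auto)
    then have "compact (hrad q rcut i j p ` {r0..rcut})"
      by (intro compact_continuous_image) (auto intro: continuous_on_subset)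
    then have "bounded (hrad q rcut i j p ` {r0..rcut})" by (rule compact_imp_bounded)
    then obtain M where M: "\<forall>r\<in>{r0..rcut}. norm (hrad q rcut i j p r) \<le> M"
      by (auto simp: bounded_iff)
    have "norm (hrad q rcut i j p r) \<le> \<bar>M\<bar>" if "r \<in> {r0..}" for r
    proof (cases "r \<le> rcut")
      case True
      then have "norm (hrad q rcut i j p r) \<le> M" using M that by auto
      then show ?thesis by linarith
    next
      case False
      then show ?thesis using hrad_zero[OF rc, of r] by simp
    qed
    then have "bounded_ext {r0..} \<bar>M\<bar> (hrad q rcut i j p)"
      using cont by (intro bounded_extI[of _ "{r0..}"]) auto
    then show ?thesis by blast
  qed
  show ?thesis
  proof (induction k arbitrary: i j p)
    case 0
    then show ?case using base by (simp add: cb_0)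
  next
    case (Suc k)
    note N = nondegenerate_atLeast[of r0]
    obtain M where "bounded_ext {r0..} M (hrad q rcut i j p)" using base by blast
    then show ?case
    proof (rule cb_SucI[OF N])
      fix r assume "r \<in> {r0..}"
      then have "q < r" using q by auto
      from hrad_deriv[OF q(1) this]
      show "(hrad q rcut i j p has_derivative (\<lambda>s. of_real s *
    (of_nat j * hrad q rcut i (j - 1) p r - 2 * hrad q rcut (i + 2) (j + 1) p r
      + 2 * of_nat i * hrad q rcut (i + 1) (j + 1) p r - 2 * of_nat p * hrad q rcut i (j + 1) (p + 1) r
      - 2 * hrad q rcut i (j + 1) (p + 2) r))) (at r within {r0..})" .
    next
      fix b :: real
      show "cb k {r0..} (\<lambda>r. of_real b *
    (of_nat j * hrad q rcut i (j - 1) p r - 2 * hrad q rcut (i + 2) (j + 1) p r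
      + 2 * of_nat i * hrad q rcut (i + 1) (j + 1) p r - 2 * of_nat p * hrad q rcut i (j + 1) (p + 1) r
      - 2 * hrad q rcut i (j + 1) (p + 2) r))"
        by (intro cb_cmult cb_diff cb_add N Suc)
    qed
  qed
qed

text \<open>The radial assumption concerns smooth functions, hence regularity of every order
  \<open>k\<close> is asked of \<open>h\<close>, although the approximation takes place in
  \<open>C^t\<close>.\<close>

lemma capx_radial:
  assumes P: "radial_basis t r0 rcut P" and h: "\<And>k. cb k {r0..} h"
    and z: "\<And>r. rcut \<le> r \<Longrightarrow> h r = 0"
  shows "capx t {r0..} (cfun.span (range P)) h"
proof -
  \<comment> \<open>Functions on \<open>{r0..}\<close> are represented by 0 below \<open>r0\<close>,
    which \<open>h\<close> need not satisfy.\<close>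
  define h' where "h' r = (if r0 \<le> r then h r else 0)" for r
  have cong: "cb k {r0..} h'" for k
    using h[of k] by (subst cb_cong[where g = h]) (auto simp: h'_def)
  have "h' \<in> radial_Ct_cut k r0 rcut" for k
    using cong[of k] z by (auto simp: radial_Ct_cut_def Ct_iff cb_def h'_def)
  then have "h' \<in> Ct_closure t {r0..} (cfun.span (range P))"
    using P unfolding radial_basis_def by blast
  then have cl: "\<And>e. e > 0 \<Longrightarrow> \<exists>g\<in>cfun.span (range P). Ct_norm t {r0..} (h' - g) < e"
    by (auto simp: Ct_closure_def)
  have span: "cb t {r0..} g" if "g \<in> cfun.span (range P)" for g
    using that
  proof (induction rule: cfun.span_induct_alt)
    case base
    then show ?case using cb_const[OF nondegenerate_atLeast, of t r0 0] by (simp add: zero_fun_def)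
  next
    case (step c x y)
    have "x \<in> radial_Ct_cut t r0 rcut" using P step(1) by (auto simp: radial_basis_def)
    then have "cb t {r0..} x" by (auto simp: radial_Ct_cut_def Ct_iff cb_def)
    then have "cb t {r0..} (\<lambda>v. c * x v + y v)"
      using step(2) by (intro cb_add cb_cmult nondegenerate_atLeast)
    moreover have "cscale c x + y = (\<lambda>v. c * x v + y v)" by (auto simp: cscale_def)
    ultimately show ?case by simp
  qed
  have "capx t {r0..} (cfun.span (range P)) h'"
    unfolding capx_def
  proof (intro allI impI)
    fix e :: real assume "e > 0"
    then obtain g where g: "g \<in> cfun.span (range P)" "Ct_norm t {r0..} (h' - g) < e" using cl by blast
    have "cb t {r0..} (\<lambda>x. h' x - g x)"
      by (intro cb_diff nondegenerate_atLeast cong span g)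
    then have "CB t {r0..} (Ct_norm t {r0..} (h' - g)) (\<lambda>x. h' x - g x)"
      using CB_Ct_norm[of t "{r0..}" _ "\<lambda>x. h' x - g x"] unfolding cb_def fun_diff_def by blast
    then show "\<exists>g\<in>cfun.span (range P). CB t {r0..} e (\<lambda>x. h' x - g x)"
      using g by (intro bexI[OF CB_mono g(1)]) auto
  qed
  then show ?thesis by (subst capx_cong[where g = h']) (auto simp: h'_def)
qed

lemma subspace_lift: "cfun.subspace V \<Longrightarrow> cfun.subspace ((\<lambda>g R. g (R $ a)) ` V)"
  unfolding cfun.subspace_def
proof (intro conjI ballI allI; elim conjE)
  assume V: "0 \<in> V" "\<forall>x\<in>V. \<forall>y\<in>V. x + y \<in> V" "\<forall>c. \<forall>x\<in>V. cscale c x \<in> V"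
  show "0 \<in> (\<lambda>g R. g (R $ a)) ` V" using V(1) by (intro image_eqI[of _ _ 0]) auto
  show "x + y \<in> (\<lambda>g R. g (R $ a)) ` V"
    if xy: "x \<in> (\<lambda>g R. g (R $ a)) ` V" "y \<in> (\<lambda>g R. g (R $ a)) ` V" for x y
  proof -
    obtain x' y' where "x' \<in> V" "y' \<in> V" "x = (\<lambda>R. x' (R $ a))" "y = (\<lambda>R. y' (R $ a))" using xy by blast
    then show ?thesis using V(2) by (intro image_eqI[of _ _ "x' + y'"]) auto
  qed
  show "cscale c x \<in> (\<lambda>g R. g (R $ a)) ` V" if x: "x \<in> (\<lambda>g R. g (R $ a)) ` V" for c x
  proof -
    obtain x' where "x' \<in> V" "x = (\<lambda>R. x' (R $ a))" using x by blast
    then show ?thesis using V(3) by (intro image_eqI[of _ _ "cscale c x'"]) (auto simp: cscale_def)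
  qed
qed

definition phi1s :: "(nat \<Rightarrow> real \<Rightarrow> complex) \<Rightarrow> (real^3 \<Rightarrow> complex) set"
  where "phi1s P = {phi1 P n l m |n l m. \<bar>m\<bar> \<le> int l}"

text \<open>A monomial of degree \<open>J\<close> is \<open>r ^ J\<close> times its value at the
  direction. That value is a combination of harmonics, while \<open>r ^ J\<close> joins the cutoff
  as the member \<open>j = J\<close> of the family \<open>hrad\<close>, to which the radial
  approximation applies.\<close>

lemma capx_single:
  fixes a :: "'n::finite"
  assumes r0: "0 < r0" and q: "0 < q" "q < r0" and rc: "0 < rcut" and P: "radial_basis t r0 rcut P"
  shows "capx t (Omega r0) ((\<lambda>g R. g (R $ a)) ` cfun.span (phi1s P))
    (\<lambda>R::(real^3)^'n. hrad q rcut 0 0 0 (norm (R $ a)) * of_real (\<Prod>i\<in>UNIV. (R $ a $ i) ^ k i))"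
proof -
  let ?S = "Omega r0 :: ((real^3)^'n) set"
  let ?V = "(\<lambda>g (R::(real^3)^'n). g (R $ a)) ` cfun.span (phi1s P)"
  let ?u = "\<lambda>R::(real^3)^'n. inverse (norm (R $ a)) *\<^sub>R R $ a"
  have V: "cfun.subspace ?V" by (intro subspace_lift cfun.subspace_span)
  define J where "J = (\<Sum>i\<in>UNIV. k i)"
  obtain g where g: "g \<in> cfun.span {sph_harm l m |l m. \<bar>m\<bar> \<le> int l}"
    "\<And>x. norm x = 1 \<Longrightarrow> of_real (\<Prod>i\<in>UNIV. (x $ i) ^ k i) = g x"
    using sphspan_monomial[of k] unfolding sphspan_def by blast
  have "capx t ?S ?V ((\<lambda>g R. hrad q rcut 0 J 0 (norm (R $ a)) * g (?u R)) g)"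
  proof (rule capx_span_induct[OF nondegenerate_Omega V g(1)])
    fix y :: "real^3 \<Rightarrow> complex" assume "y \<in> {sph_harm l m |l m. \<bar>m\<bar> \<le> int l}"
    then obtain l m where y: "y = sph_harm l m" "\<bar>m\<bar> \<le> int l" by blast
    obtain M where M: "CB t ?S M (\<lambda>R. y (?u R))"
      using cb_sph_harm[OF r0 y(2), of t a] unfolding y(1) cb_def by blast
    obtain C where C: "C \<ge> 1" "\<And>h M. CB t {r0..} M h \<Longrightarrow> CB t ?S (C * M) (\<lambda>R. h (norm (R $ a)))"
      using radial_lift_bound[OF r0, of t a] by blast
    have rad: "capx t {r0..} (cfun.span (range P)) (hrad q rcut 0 J 0)"
      by (rule capx_radial[OF P cb_hrad[OF q rc]]) (rule hrad_zero[OF rc])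
    have lift: "capx t ?S ((\<lambda>g R. g (norm (R $ a))) ` cfun.span (range P)) (\<lambda>R. hrad q rcut 0 J 0 (norm (R $ a)))"
      unfolding capx_def
    proof (intro allI impI)
      fix e :: real assume "e > 0"
      then have "e / C > 0" using C(1) by simp
      then obtain h where h: "h \<in> cfun.span (range P)" "CB t {r0..} (e / C) (\<lambda>r. hrad q rcut 0 J 0 r - h r)"
        using rad unfolding capx_def by blast
      have "CB t ?S e (\<lambda>R. hrad q rcut 0 J 0 (norm (R $ a)) - h (norm (R $ a)))"
        using C(2)[OF h(2)] C(1) by simp
      then show "\<exists>g\<in>(\<lambda>g R. g (norm (R $ a))) ` cfun.span (range P).
          CB t ?S e (\<lambda>x. hrad q rcut 0 J 0 (norm (x $ a)) - g x)"
        using h(1) by (intro bexI[of _ "\<lambda>R. h (norm (R $ a))"]) auto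
    qed
    \<comment> \<open>The harmonic is a fixed multiplier; only the radial factor is
      approximated.\<close>
    have "capx t ?S ?V (\<lambda>R. y (?u R) * hrad q rcut 0 J 0 (norm (R $ a)))"
    proof (rule capx_mult[OF nondegenerate_Omega M lift])
      fix h assume "h \<in> (\<lambda>g (R::(real^3)^'n). g (norm (R $ a))) ` cfun.span (range P)"
      then obtain h' where h': "h' \<in> cfun.span (range P)" "h = (\<lambda>R. h' (norm (R $ a)))" by blast
      have "(\<lambda>x. y (inverse (norm x) *\<^sub>R x) * h' (norm x)) \<in> cfun.span (phi1s P)"
        using h'(1)
      proof (induction rule: cfun.span_induct_alt)
        case base
        have "(\<lambda>x. y (inverse (norm x) *\<^sub>R x) * 0 (norm x)) = 0" by (auto simp: zero_fun_def)
        then show ?case using cfun.span_zero by simp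
      next
        case (step c v w)
        then obtain n where n: "v = P n" by blast
        have "phi1 P n l m \<in> cfun.span (phi1s P)"
          using y(2) by (intro cfun.span_base) (auto simp: phi1s_def)
        then have "cscale c (phi1 P n l m) + (\<lambda>x. y (inverse (norm x) *\<^sub>R x) * w (norm x)) \<in> cfun.span (phi1s P)"
          using step by (intro cfun.span_add cfun.span_scale)
        moreover have "cscale c (phi1 P n l m) + (\<lambda>x. y (inverse (norm x) *\<^sub>R x) * w (norm x)) =
            (\<lambda>x. y (inverse (norm x) *\<^sub>R x) * (cscale c v + w) (norm x))"
          by (auto simp: cscale_def phi1_def n y(1) algebra_simps)
        ultimately show ?case by simp
      qed
      then have "(\<lambda>x. y (?u x) * h x) \<in> ?V" unfolding h'(2) by (rule rev_image_eqI) auto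
      then show "capx t ?S ?V (\<lambda>x. y (?u x) * h x)" by (rule capx_self[OF nondegenerate_Omega])
    qed
    then show "capx t ?S ?V (\<lambda>R. hrad q rcut 0 J 0 (norm (R $ a)) * y (?u R))"
      by (simp only: mult.commute)
  qed (auto simp: cscale_def algebra_simps)
  moreover have "hrad q rcut 0 J 0 (norm (R $ a)) * g (?u R) =
      hrad q rcut 0 0 0 (norm (R $ a)) * of_real (\<Prod>i\<in>UNIV. (R $ a $ i) ^ k i)" if "R \<in> ?S" for R
  proof -
    have nz: "norm (R $ a) \<noteq> 0" using Omega_nth_nonzero[OF r0 that] by simp
    have "norm (R $ a) ^ J * (\<Prod>i\<in>UNIV. (?u R $ i) ^ k i) = (\<Prod>i\<in>UNIV. (R $ a $ i) ^ k i)"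
      unfolding J_def power_sum prod.distrib[symmetric]
      by (rule prod.cong[OF refl]) (use nz in \<open>simp add: power_mult_distrib[symmetric] mult.assoc[symmetric]\<close>)
    moreover have "g (?u R) = of_real (\<Prod>i\<in>UNIV. (?u R $ i) ^ k i)"
      using g(2)[OF norm_normalized[OF Omega_nth_nonzero[OF r0 that]]] by simp
    moreover have "hrad q rcut 0 J 0 s = hrad q rcut 0 0 0 s * of_real (s ^ J)" for s
      by (simp add: hrad_def)
    ultimately show ?thesis by (simp only: of_real_mult[symmetric] mult.assoc)
  qed
  ultimately show ?thesis using capx_cong[of ?S] by (metis (no_types, lifting))
qed

subsection \<open>Dilations\<close>

lemma bounded_ext_rebound:
  "bounded_ext S M f \<Longrightarrow> (\<And>x. x \<in> S \<Longrightarrow> norm (f x) \<le> e) \<Longrightarrow> bounded_ext S e f"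
  by (simp add: bounded_ext_def)

lemma bounded_ext_diff:
  assumes "bounded_ext S M f" "bounded_ext S N g"
  shows "bounded_ext S (M + N) (\<lambda>x. f x - g x)"
  using bounded_ext_add[OF assms(1) bounded_ext_mult[OF bounded_ext_const[of S "-1"] assms(2)]] by simp

lemma norm_le_sum_nth: "norm (R :: (real^3)^'n) \<le> (\<Sum>j\<in>UNIV. norm (R $ j))"
  unfolding norm_vec_def by (rule L2_set_le_sum) simp

lemma norm_le_card:
  fixes R :: "(real^3)^'n"
  assumes "\<And>j. norm (R $ j) \<le> B"
  shows "norm R \<le> real CARD('n) * B"
proof -
  have "(\<Sum>j\<in>(UNIV::'n set). norm (R $ j)) \<le> (\<Sum>j\<in>(UNIV::'n set). B)"
    using assms by (intro sum_mono)
  then show ?thesis using norm_le_sum_nth[of R] by simp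
qed

lemma scale_Omega:
  assumes "1 \<le> s" "R \<in> Omega r0" shows "s *\<^sub>R R \<in> Omega r0"
proof -
  have "r0 < norm ((s *\<^sub>R R) $ j)" for j
  proof -
    have "1 * norm (R $ j) \<le> s * norm (R $ j)" using assms(1) by (intro mult_right_mono) auto
    moreover have "r0 < norm (R $ j)" using assms(2) by (simp add: Omega_def)
    ultimately show ?thesis using assms(1) by simp
  qed
  then show ?thesis by (simp add: Omega_def)
qed

text \<open>If some length exceeds \<open>rcut\<close>, both values vanish. The remaining
  configurations lie in a compact set together with their dilations for \<open>s < 2\<close>, and
  uniform continuity of the extension applies there.\<close>

lemma dilation_bounded_ext:
  fixes f :: "(real^3)^'n \<Rightarrow> complex"
  assumes r0: "0 < r0" and rc: "0 < rcut" and f: "bounded_ext (Omega r0) M f"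
    and supp: "\<And>R j. R \<in> Omega r0 \<Longrightarrow> norm (R $ j) > rcut \<Longrightarrow> f R = 0" and e: "0 < e"
  shows "\<forall>\<^sub>F s in at_right 1. bounded_ext (Omega r0) e (\<lambda>R. f R - f (s *\<^sub>R R))"
proof -
  let ?S = "Omega r0 :: ((real^3)^'n) set"
  obtain g where g: "continuous_on (closure ?S) g" "\<forall>x\<in>?S. g x = f x"
    using f by (auto simp: bounded_ext_def)
  define B where "B = real CARD('n) * (2 * rcut)"
  have B: "0 < B" using rc by (simp add: B_def)
  define C where "C = closure ?S \<inter> cball 0 B"
  have "compact C" unfolding C_def by (intro closed_Int_compact) auto
  then have "uniformly_continuous_on C g"
    using continuous_on_subset[OF g(1)] by (intro compact_uniformly_continuous) (auto simp: C_def)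
  then obtain d where d: "d > 0" "\<And>x x'. x \<in> C \<Longrightarrow> x' \<in> C \<Longrightarrow> dist x' x < d \<Longrightarrow> dist (g x') (g x) < e"
    unfolding uniformly_continuous_on_def using e by meson
  \<comment> \<open>\<open>s < 2\<close> keeps the dilated point in \<open>C\<close>, and
    \<open>s < 1 + d / B\<close> moves it by less than \<open>d\<close>.\<close>
  define b where "b = min 2 (1 + d / B)"
  have b: "1 < b" using d B by (simp add: b_def)
  have main: "bounded_ext ?S e (\<lambda>R. f R - f (s *\<^sub>R R))" if s: "1 < s" "s < b" for s
  proof -
    have "bounded_ext ?S (M + M) (\<lambda>R. f R - f (s *\<^sub>R R))"
      using s scale_Omega[of s]
      by (intro bounded_ext_diff f bounded_ext_linear_compose[OF bounded_linear_scaleR_right _ f]) auto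
    then show ?thesis
    proof (rule bounded_ext_rebound)
      fix R assume R: "R \<in> ?S"
      have sR: "s *\<^sub>R R \<in> ?S" using scale_Omega[OF _ R] s by simp
      show "norm (f R - f (s *\<^sub>R R)) \<le> e"
      proof (cases "\<exists>j. norm (R $ j) > rcut")
        case True
        then obtain j where j: "norm (R $ j) > rcut" by blast
        have "1 * norm (R $ j) \<le> s * norm (R $ j)" using s by (intro mult_right_mono) auto
        then have "norm ((s *\<^sub>R R) $ j) > rcut" using j s by simp
        then show ?thesis using supp[OF R j] supp[OF sR] e by simp
      next
        case False
        then have le: "norm (R $ j) \<le> rcut" for j by (simp add: not_less)
        then have n1: "norm R \<le> real CARD('n) * rcut" by (rule norm_le_card)
        have "s < 2" using s by (simp add: b_def)
        then have "norm ((s *\<^sub>R R) $ j) \<le> 2 * rcut" for j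
          using mult_mono[of s 2 "norm (R $ j)" rcut] le[of j] s by simp
        then have "norm (s *\<^sub>R R) \<le> B" unfolding B_def by (rule norm_le_card)
        moreover have "real CARD('n) * rcut \<le> B"
          unfolding B_def by (rule mult_left_mono) (use rc in auto)
        then have nB: "norm R \<le> B" using n1 by linarith
        ultimately have C: "R \<in> C" "s *\<^sub>R R \<in> C"
          using R sR closure_subset[of ?S] by (auto simp: C_def)
        have "dist (s *\<^sub>R R) R = (s - 1) * norm R"
        proof -
          have "s *\<^sub>R R - R = (s - 1) *\<^sub>R R" by (simp add: scaleR_left_diff_distrib)
          then show ?thesis using s by (simp add: dist_norm)
        qed
        also have "\<dots> \<le> (s - 1) * B" using nB s by (intro mult_left_mono) auto
        also have "\<dots> < d / B * B" using s B by (intro mult_strict_right_mono) (auto simp: b_def)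
        finally have "dist (s *\<^sub>R R) R < d" using B by simp
        from d(2)[OF C this] have "dist (g (s *\<^sub>R R)) (g R) < e" .
        then show ?thesis using g(2) R sR by (simp add: dist_norm norm_minus_commute)
      qed
    qed
  qed
  show ?thesis
    unfolding eventually_at_right_field using b main by blast
qed

text \<open>The derivative of the dilated function carries a factor \<open>s\<close>. The difference
  of derivatives splits into \<open>D R - D (s R)\<close>, small by induction, and a multiple
  \<open>s - 1\<close> of \<open>D (s R)\<close>, small because \<open>D\<close> is bounded with its
  derivatives.\<close>

lemma dilation_CB:
  fixes f :: "(real^3)^'n \<Rightarrow> complex"
  assumes r0: "0 < r0" and rc: "0 < rcut" and f: "CB k (Omega r0) M f"
    and supp: "\<And>R j. R \<in> Omega r0 \<Longrightarrow> norm (R $ j) > rcut \<Longrightarrow> f R = 0" and e: "0 < e"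
  shows "\<forall>\<^sub>F s in at_right 1. CB k (Omega r0) e (\<lambda>R. f R - f (s *\<^sub>R R))"
  using f supp e
proof (induction k arbitrary: f e)
  case 0
  then show ?case using dilation_bounded_ext[OF r0 rc, of M f e] by simp
next
  case (Suc k)
  let ?S = "Omega r0 :: ((real^3)^'n) set"
  define D where "D R = frechet_derivative f (at R within ?S)" for R
  have der: "(f has_derivative D R) (at R within ?S)" if "R \<in> ?S" for R
    using CB_has_derivative[OF Suc.prems(1) that] by (simp add: D_def)
  have CBD: "CB k ?S M (\<lambda>R. D R b)" if "b \<in> Basis" for b
    using Suc.prems(1) that by (simp add: D_def)
  \<comment> \<open>The strict inequality makes the region open, so the derivative vanishes there
    too and the induction hypothesis applies to it.\<close>
  have suppD: "D R = (\<lambda>v. 0)" if R: "R \<in> ?S" "norm (R $ j) > rcut" for R j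
  proof -
    let ?U = "{R :: (real^3)^'n. norm (R $ j) > rcut}"
    have "open ?U" by (intro open_Collect_less continuous_intros)
    then have op: "open (?S \<inter> ?U)" using open_Omega by blast
    have mem: "R \<in> ?S \<inter> ?U" using R by simp
    have "((\<lambda>x. 0) has_derivative (\<lambda>v. 0)) (at R within ?S \<inter> ?U)" by simp
    then have "(f has_derivative (\<lambda>v. 0)) (at R within ?S \<inter> ?U)"
      by (rule has_derivative_transform[OF mem, rotated]) (use Suc.prems(2) in auto)
    then have "(f has_derivative (\<lambda>v. 0)) (at R within ?S)"
      using at_within_open[OF mem op] at_within_open[OF R(1) open_Omega] by simp
    then show ?thesis
      unfolding D_def by (rule frechet_derivative_within_eq[OF nondegenerate_Omega R(1)])
  qed
  \<comment> \<open>A bound for the composed derivative that is uniform in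
    \<open>1 < s < 2\<close>.\<close>
  define N where "N = (real DIM((real^3)^'n) * 2) ^ k * M"
  have "((\<lambda>s. (s - 1) * N) \<longlongrightarrow> (1 - 1) * N) (at_right 1)" by (intro tendsto_intros)
  then have "\<forall>\<^sub>F s in at_right 1. (s - 1) * N < e / 2"
    using Suc.prems(3) by (intro order_tendstoD(2)) auto
  moreover have "\<forall>\<^sub>F s in at_right (1::real). 1 < s \<and> s < 2"
    unfolding eventually_at_right_field by (intro exI[of _ 2]) auto
  moreover have "\<forall>\<^sub>F s in at_right 1. \<forall>b\<in>Basis. CB k ?S (e / 2) (\<lambda>R. D R b - D (s *\<^sub>R R) b)"
    by (intro eventually_ball_finite ballI Suc.IH CBD) (use suppD Suc.prems(3) in auto)
  moreover have "\<forall>\<^sub>F s in at_right 1. bounded_ext ?S e (\<lambda>R. f R - f (s *\<^sub>R R))"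
    using Suc.prems by (intro dilation_bounded_ext[OF r0 rc CB_bounded_ext[OF Suc.prems(1)]])
  ultimately show ?case
  proof eventually_elim
    case (elim s)
    then have s: "1 < s" "s < 2" by auto
    have sub: "(\<lambda>R. s *\<^sub>R R) ` ?S \<subseteq> ?S" using scale_Omega[of s] s by auto
    show ?case
    proof (rule CB_SucI[OF nondegenerate_Omega elim(4)])
      fix R assume R: "R \<in> ?S"
      have sR: "s *\<^sub>R R \<in> ?S" using sub R by blast
      have 1: "((\<lambda>R. s *\<^sub>R R) has_derivative (\<lambda>v. s *\<^sub>R v)) (at R within ?S)"
        by (rule bounded_linear_imp_has_derivative[OF bounded_linear_scaleR_right])
      have "((\<lambda>R. f (s *\<^sub>R R)) has_derivative (\<lambda>v. D (s *\<^sub>R R) (s *\<^sub>R v))) (at R within ?S)"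
        by (rule has_derivative_in_compose[OF 1 has_derivative_subset[OF der[OF sR] sub]])
      moreover have "D (s *\<^sub>R R) (s *\<^sub>R v) = of_real s * D (s *\<^sub>R R) v" for v
        using linear_scale[OF has_derivative_linear[OF der[OF sR]], of s v]
        by (simp add: scaleR_conv_of_real)
      ultimately have "((\<lambda>R. f (s *\<^sub>R R)) has_derivative (\<lambda>v. of_real s * D (s *\<^sub>R R) v)) (at R within ?S)"
        by simp
      from has_derivative_diff[OF der[OF R] this]
      show "((\<lambda>R. f R - f (s *\<^sub>R R)) has_derivative (\<lambda>v. D R v - of_real s * D (s *\<^sub>R R) v)) (at R within ?S)" .
    next
      fix b :: "(real^3)^'n" assume b: "b \<in> Basis"
      have comp: "CB k ?S N (\<lambda>R. D (s *\<^sub>R R) b)"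
        unfolding N_def
      proof (rule CB_linear_compose[OF nondegenerate_Omega bounded_linear_scaleR_right sub _ _ CBD[OF b]])
        show "\<bar>(s *\<^sub>R b) \<bullet> c\<bar> \<le> 2" if "b \<in> Basis" "c \<in> Basis" for b c :: "(real^3)^'n"
          using that s by (auto simp: inner_Basis)
      qed simp
      have "CB k ?S (norm (- complex_of_real (s - 1)) * N) (\<lambda>R. - of_real (s - 1) * D (s *\<^sub>R R) b)"
        by (rule CB_cmult[OF nondegenerate_Omega comp])
      then have "CB k ?S (e / 2) (\<lambda>R. - of_real (s - 1) * D (s *\<^sub>R R) b)"
        by (rule CB_mono) (use elim(1) s in \<open>simp only: norm_minus_cancel norm_of_real; simp\<close>)
      then have "CB k ?S (e / 2 + e / 2) (\<lambda>R. (D R b - D (s *\<^sub>R R) b) + - of_real (s - 1) * D (s *\<^sub>R R) b)"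
        using elim(3) b by (intro CB_add nondegenerate_Omega) auto
      then show "CB k ?S e (\<lambda>R. D R b - of_real s * D (s *\<^sub>R R) b)"
        by (simp add: algebra_simps)
    qed
  qed
qed

subsection \<open>Smooth functions on a bounded shell\<close>

text \<open>If differentiation maps the family \<open>\<phi>\<close> to finite combinations of its
  members, continuity on a compact set containing the closure of \<open>V\<close> already gives all
  orders: the chain rule produces only further members and the derivative of
  \<open>\<sigma>\<close>.\<close>

lemma cb_family_compose:
  fixes \<phi> :: "'i \<Rightarrow> real \<Rightarrow> real" and \<sigma> :: "'a::euclidean_space \<Rightarrow> real"
  assumes V: "open V" "closure V \<subseteq> K" "compact K" "continuous_on K \<sigma>" "\<sigma> ` K \<subseteq> X"
    and \<phi>: "\<And>i. continuous_on X (\<phi> i)" "\<And>i. finite (J i)"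
      "\<And>i x. x \<in> X \<Longrightarrow> (\<phi> i has_real_derivative (\<Sum>j\<in>J i. c i j * \<phi> j x)) (at x)"
    and \<sigma>: "\<And>x. x \<in> V \<Longrightarrow> (\<sigma> has_derivative \<sigma>' x) (at x within V)"
      "\<And>k b. cb k V (\<lambda>x. of_real (\<sigma>' x b))"
  shows "cb k V (\<lambda>x. complex_of_real (\<phi> i (\<sigma> x)))"
proof -
  have base: "\<exists>M. bounded_ext V M (\<lambda>x. complex_of_real (\<phi> i (\<sigma> x)))" for i
    by (rule bounded_ext_compactI[OF V(2,3)])
      (intro continuous_intros continuous_on_compose2[OF \<phi>(1) V(4,5)])
  show ?thesis
  proof (induction k arbitrary: i)
    case 0
    then show ?case using base by (simp add: cb_0)
  next
    case (Suc k)
    obtain M where "bounded_ext V M (\<lambda>x. complex_of_real (\<phi> i (\<sigma> x)))" using base by blast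
    then show ?case
    proof (rule cb_SucI[OF nondegenerate_open[OF V(1)]])
      fix x assume x: "x \<in> V"
      then have "\<sigma> x \<in> X" using V closure_subset[of V] by blast
      then have "(\<phi> i has_derivative (\<lambda>s. (\<Sum>j\<in>J i. c i j * \<phi> j (\<sigma> x)) * s)) (at (\<sigma> x))"
        using \<phi>(3) by (simp add: has_field_derivative_def)
      from has_derivative_compose[OF \<sigma>(1)[OF x] this]
      have "((\<lambda>x. \<phi> i (\<sigma> x)) has_derivative (\<lambda>v. (\<Sum>j\<in>J i. c i j * \<phi> j (\<sigma> x)) * \<sigma>' x v)) (at x within V)" .
      then show "((\<lambda>x. complex_of_real (\<phi> i (\<sigma> x))) has_derivative
          (\<lambda>v. of_real ((\<Sum>j\<in>J i. c i j * \<phi> j (\<sigma> x)) * \<sigma>' x v))) (at x within V)"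
        by (rule bounded_linear.has_derivative[OF bounded_linear_of_real])
    next
      fix b :: 'a
      have "cb k V (\<lambda>x. (\<Sum>j\<in>J i. of_real (c i j) * of_real (\<phi> j (\<sigma> x))) * of_real (\<sigma>' x b))"
        by (intro cb_mult cb_sum cb_cmult Suc \<sigma>(2) \<phi>(2) nondegenerate_open V(1))
      then show "cb k V (\<lambda>x. of_real ((\<Sum>j\<in>J i. c i j * \<phi> j (\<sigma> x)) * \<sigma>' x b))" by simp
    qed
  qed
qed

definition shell :: "real \<Rightarrow> real \<Rightarrow> ((real^3)^'n) set"
  where "shell p s = {R. \<forall>j. p < norm (R $ j) \<and> norm (R $ j) < s}"

definition closed_shell :: "real \<Rightarrow> real \<Rightarrow> ((real^3)^'n) set"
  where "closed_shell p s = {R. \<forall>j. p \<le> norm (R $ j) \<and> norm (R $ j) \<le> s}"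

lemma open_shell: "open (shell p s :: ((real^3)^'n) set)"
proof -
  have "shell p s = (\<Inter>j. {R :: (real^3)^'n. p < norm (R $ j)} \<inter> {R. norm (R $ j) < s})" by (auto simp: shell_def)
  moreover have "open ({R :: (real^3)^'n. p < norm (R $ j)} \<inter> {R. norm (R $ j) < s})" for j
    by (intro open_Int open_Collect_less continuous_intros)
  ultimately show ?thesis by auto
qed

lemma closed_closed_shell: "closed (closed_shell p s :: ((real^3)^'n) set)"
proof -
  have "closed_shell p s = (\<Inter>j. {R :: (real^3)^'n. p \<le> norm (R $ j)} \<inter> {R. norm (R $ j) \<le> s})"
    by (auto simp: closed_shell_def)
  moreover have "closed ({R :: (real^3)^'n. p \<le> norm (R $ j)} \<inter> {R. norm (R $ j) \<le> s})" for j
    by (intro closed_Int closed_Collect_le continuous_intros)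
  ultimately show ?thesis by auto
qed

lemma compact_closed_shell: "compact (closed_shell p s :: ((real^3)^'n) set)"
proof -
  have "norm R \<le> real CARD('n) * s" if "R \<in> closed_shell p s" for R :: "(real^3)^'n"
    using that by (intro norm_le_card) (auto simp: closed_shell_def)
  then have "bounded (closed_shell p s :: ((real^3)^'n) set)" by (auto simp: bounded_iff)
  then show ?thesis using closed_closed_shell compact_eq_bounded_closed by blast
qed

lemma closure_shell: "closure (shell p s :: ((real^3)^'n) set) \<subseteq> closed_shell p s"
  by (rule closure_minimal[OF _ closed_closed_shell]) (auto simp: shell_def closed_shell_def intro: less_imp_le)

lemma cb_coordinate:
  fixes a :: "'n::finite"
  shows "cb k (shell p s) (\<lambda>R::(real^3)^'n. of_real (R $ a $ c))"
proof -
  have lin: "bounded_linear (\<lambda>R::(real^3)^'n. R $ a $ c)"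
    using bounded_linear_compose[OF bounded_linear_vec_nth bounded_linear_vec_nth] .
  have "continuous_on (closed_shell p s) (\<lambda>R::(real^3)^'n. complex_of_real (R $ a $ c))"
    by (intro continuous_intros)
  then obtain M where M: "bounded_ext (shell p s) M (\<lambda>R::(real^3)^'n. complex_of_real (R $ a $ c))"
    using bounded_ext_compactI[OF closure_shell compact_closed_shell] by blast
  show ?thesis
  proof (cases k)
    case 0
    then show ?thesis using M by (auto simp: cb_0)
  next
    case (Suc k')
    have "cb (Suc k') (shell p s) (\<lambda>R::(real^3)^'n. complex_of_real (R $ a $ c))"
    proof (rule cb_SucI[OF nondegenerate_open[OF open_shell] M])
      show "((\<lambda>R::(real^3)^'n. complex_of_real (R $ a $ c)) has_derivative (\<lambda>v. of_real (v $ a $ c))) (at R within shell p s)" for R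
        by (rule bounded_linear.has_derivative[OF bounded_linear_of_real
            bounded_linear_imp_has_derivative[OF lin]])
      show "cb k' (shell p s) (\<lambda>R. complex_of_real (b $ a $ c))" for b :: "(real^3)^'n"
        by (rule cb_const[OF nondegenerate_open[OF open_shell]])
    qed
    then show ?thesis using Suc by simp
  qed
qed

lemma has_derivative_norm_sq_nth:
  "((\<lambda>R::(real^3)^'n. m * (norm (R $ a))\<^sup>2 + d) has_derivative (\<lambda>v. m * (2 * (R $ a \<bullet> v $ a)))) (at R within S)"
proof -
  have 1: "((\<lambda>R::(real^3)^'n. R $ a) has_derivative (\<lambda>v. v $ a)) (at R within S)"
    by (rule bounded_linear_imp_has_derivative[OF bounded_linear_vec_nth])
  have "((\<lambda>R::(real^3)^'n. R $ a \<bullet> R $ a) has_derivative (\<lambda>v. R $ a \<bullet> v $ a + v $ a \<bullet> R $ a)) (at R within S)"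
    by (rule has_derivative_inner[OF 1 1])
  then have "((\<lambda>R::(real^3)^'n. m * (R $ a \<bullet> R $ a) + d) has_derivative (\<lambda>v. m * (R $ a \<bullet> v $ a + v $ a \<bullet> R $ a))) (at R within S)"
    by (intro has_derivative_add_const has_derivative_mult_right)
  then show ?thesis by (simp add: power2_norm_eq_inner inner_commute)
qed

lemma cb_norm_sq_derivative:
  fixes a :: "'n::finite"
  shows "cb k (shell p s) (\<lambda>R::(real^3)^'n. complex_of_real (m * (2 * (R $ a \<bullet> b $ a))))"
proof -
  have "cb k (shell p s) (\<lambda>R::(real^3)^'n. \<Sum>c\<in>UNIV. of_real (m * 2 * (b $ a $ c)) * complex_of_real (R $ a $ c))"
    by (intro cb_sum cb_cmult cb_coordinate nondegenerate_open[OF open_shell]) auto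
  moreover have "(\<Sum>c\<in>UNIV. of_real (m * 2 * (b $ a $ c)) * complex_of_real (R $ a $ c)) =
      complex_of_real (m * (2 * (R $ a \<bullet> b $ a)))" for R
    by (simp add: inner_vec_def sum_distrib_left mult_ac)
  ultimately show ?thesis by simp
qed

lemma cb_bump_norm:
  fixes a :: "'n::finite"
  shows "cb k (shell p s) (\<lambda>R::(real^3)^'n. complex_of_real (bump i ((norm (R $ a))\<^sup>2 - q\<^sup>2)))"
proof -
  have "cb k (shell p s) (\<lambda>R::(real^3)^'n. complex_of_real (bump i (1 * (norm (R $ a))\<^sup>2 + - q\<^sup>2)))"
  proof (rule cb_family_compose[OF open_shell closure_shell compact_closed_shell, where X = UNIV
      and \<phi> = bump and i = i and \<sigma> = "\<lambda>R::(real^3)^'n. 1 * (norm (R $ a))\<^sup>2 + - q\<^sup>2"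
      and \<sigma>' = "\<lambda>R v. 1 * (2 * (R $ a \<bullet> v $ a))" and J = "\<lambda>i. {i + 2, i + 1}" and c = "\<lambda>i j. if j = i + 2 then 1 else - real i"])
    show "continuous_on (closed_shell p s) (\<lambda>R::(real^3)^'n. 1 * (norm (R $ a))\<^sup>2 + - q\<^sup>2)"
      by (intro continuous_intros)
    show "continuous_on UNIV (bump i)" for i by (rule continuous_bump)
    show "(bump i has_real_derivative (\<Sum>j\<in>{i + 2, i + 1}. (if j = i + 2 then 1 else - real i) * bump j x)) (at x)"
      for i x using bump_deriv[of i x] by simp
  qed (rule has_derivative_norm_sq_nth cb_norm_sq_derivative subset_UNIV finite.intros)+
  then show ?thesis by simp
qed

lemma cb_exp_norm:
  fixes a :: "'n::finite"
  assumes "0 < s" "s < rcut"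
  shows "cb k (shell p s) (\<lambda>R::(real^3)^'n. complex_of_real (exp (inverse (rcut\<^sup>2 - (norm (R $ a))\<^sup>2))))"
proof -
  \<comment> \<open>The powers of \<open>inverse x\<close> again close the family under
    differentiation; the arguments stay positive because \<open>s < rcut\<close>.\<close>
  define \<phi> :: "nat \<Rightarrow> real \<Rightarrow> real" where "\<phi> i x = inverse x ^ i * exp (inverse x)" for i x
  have "cb k (shell p s) (\<lambda>R::(real^3)^'n. complex_of_real (\<phi> 0 ((- 1) * (norm (R $ a))\<^sup>2 + rcut\<^sup>2)))"
  proof (rule cb_family_compose[OF open_shell closure_shell compact_closed_shell, where X = "{0<..}"
      and \<phi> = \<phi> and i = 0 and \<sigma> = "\<lambda>R::(real^3)^'n. (- 1) * (norm (R $ a))\<^sup>2 + rcut\<^sup>2"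
      and \<sigma>' = "\<lambda>R v. (- 1) * (2 * (R $ a \<bullet> v $ a))" and J = "\<lambda>i. {i + 2, i + 1}" and c = "\<lambda>i j. if j = i + 2 then - 1 else - real i"])
    show "continuous_on (closed_shell p s) (\<lambda>R::(real^3)^'n. (- 1) * (norm (R $ a))\<^sup>2 + rcut\<^sup>2)"
      by (intro continuous_intros)
    show "(\<lambda>R::(real^3)^'n. (- 1) * (norm (R $ a))\<^sup>2 + rcut\<^sup>2) ` closed_shell p s \<subseteq> {0<..}"
    proof
      fix y assume "y \<in> (\<lambda>R::(real^3)^'n. (- 1) * (norm (R $ a))\<^sup>2 + rcut\<^sup>2) ` closed_shell p s"
      then obtain R :: "(real^3)^'n" where R: "norm (R $ a) \<le> s" "y = rcut\<^sup>2 - (norm (R $ a))\<^sup>2"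
        by (auto simp: closed_shell_def)
      have "(norm (R $ a))\<^sup>2 \<le> s\<^sup>2" using R by (intro power_mono) auto
      also have "s\<^sup>2 < rcut\<^sup>2" using assms by (intro power_strict_mono) auto
      finally show "y \<in> {0<..}" using R by simp
    qed
    show "continuous_on {0<..} (\<phi> i)" for i
      unfolding \<phi>_def by (intro continuous_intros) auto
    show "(\<phi> i has_real_derivative (\<Sum>j\<in>{i + 2, i + 1}. (if j = i + 2 then - 1 else - real i) * \<phi> j x)) (at x)"
      if "x \<in> {0<..}" for i x
    proof -
      have pw: "real i * inverse x ^ (i - Suc 0) * - (inverse x ^ 2) = - (real i * inverse x ^ (i + 1))"
        by (cases i) (simp_all add: power2_eq_square)
      have "(\<phi> i has_real_derivative
          real i * inverse x ^ (i - Suc 0) * - (inverse x ^ 2) * exp (inverse x) +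
          exp (inverse x) * - (inverse x ^ 2) * inverse x ^ i) (at x)"
        unfolding \<phi>_def using that by (auto intro!: derivative_eq_intros simp: power2_eq_square)
      then show ?thesis
        unfolding pw by (simp add: \<phi>_def algebra_simps power2_eq_square)
    qed
  qed (rule has_derivative_norm_sq_nth cb_norm_sq_derivative finite.intros)+
  then show ?thesis by (simp add: \<phi>_def)
qed

section \<open>Density of the tensor products\<close>

definition phis :: "real \<Rightarrow> (nat \<Rightarrow> real \<Rightarrow> complex) \<Rightarrow> ((real^3)^'n::finite \<Rightarrow> complex) set"
  where "phis r0 P = {phi r0 P n l m |n l m. m \<in> M_idx l}"

lemma radial_basis_cb: "radial_basis t r0 rcut P \<Longrightarrow> cb t {r0..} (P n)"
  by (auto simp: radial_basis_def radial_Ct_cut_def Ct_iff cb_def)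

lemma capx_imp_cb:
  assumes "nondegenerate S" "capx k S A f" "\<And>g. g \<in> A \<Longrightarrow> cb k S g"
  shows "cb k S f"
proof -
  obtain g where g: "g \<in> A" "CB k S 1 (\<lambda>x. f x - g x)"
    using assms(2) unfolding capx_def by (meson zero_less_one)
  have "cb k S (\<lambda>x. (f x - g x) + g x)"
    using g assms(3) by (intro cb_add assms(1)) (auto simp: cb_def)
  then show ?thesis by simp
qed

definition monomial :: "('n::finite \<Rightarrow> 3 \<Rightarrow> nat) \<Rightarrow> (real^3)^'n \<Rightarrow> complex"
  where "monomial k R = of_real (\<Prod>a\<in>UNIV. \<Prod>i\<in>UNIV. (R $ a $ i) ^ k a i)"

lemma capx_monomial:
  fixes k :: "'n::finite \<Rightarrow> 3 \<Rightarrow> nat"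
  assumes r0: "0 < r0" and q: "0 < q" "q < r0" and rc: "0 < rcut" and P: "radial_basis t r0 rcut P"
  shows "capx t (Omega r0) (cfun.span (phis r0 P))
    (\<lambda>R. (\<Prod>a\<in>UNIV. hrad q rcut 0 0 0 (norm (R $ a))) * monomial k R)"
proof -
  let ?S = "Omega r0 :: ((real^3)^'n) set"
  define f where "f a x = hrad q rcut 0 0 0 (norm x) * of_real (\<Prod>i\<in>UNIV. (x $ i) ^ k a i)" for a and x :: "real^3"
  have app: "capx t ?S ((\<lambda>g R. g (R $ a)) ` cfun.span (phi1s P)) (\<lambda>R. f a (R $ a))" for a
    unfolding f_def by (rule capx_single[OF assms])
  have cb1: "cb t ?S (\<lambda>R. g (R $ a))" if "g \<in> phi1s P" for g a
    using that phi1_lift_cb[OF r0 radial_basis_cb[OF P]] by (auto simp: phi1s_def)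
  have cbspan: "cb t ?S (\<lambda>R. g (R $ a))" if "g \<in> cfun.span (phi1s P)" for g a
    using that
  proof (induction rule: cfun.span_induct_alt)
    case base
    then show ?case using cb_const[OF nondegenerate_Omega, of t r0 0] by (simp add: zero_fun_def)
  next
    case (step c x y)
    have "cb t ?S (\<lambda>R. c * x (R $ a) + y (R $ a))"
      using step cb1 by (intro cb_add cb_cmult nondegenerate_Omega) auto
    then show ?case by (simp add: cscale_def)
  qed
  have "capx t ?S (cfun.span (phis r0 P)) (\<lambda>R. \<Prod>a\<in>UNIV. f a (R $ a))"
  proof (rule capx_tensor[OF nondegenerate_Omega cfun.subspace_span _ _ cb1 _ app])
    have "phi1 P 0 0 0 \<in> phi1s P" unfolding phi1s_def by (intro CollectI exI conjI refl) auto
    then show "phi1s P \<noteq> {}" by blast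
    show "cb t ?S (\<lambda>R. f a (R $ a))" for a
      by (rule capx_imp_cb[OF nondegenerate_Omega app]) (use cbspan in auto)
    fix e :: "'n \<Rightarrow> real^3 \<Rightarrow> complex" assume "\<forall>a. e a \<in> phi1s P"
    then have "\<forall>a. \<exists>n l m. e a = phi1 P n l m \<and> \<bar>m\<bar> \<le> int l" by (auto simp: phi1s_def)
    then obtain n l m where e: "\<And>a. e a = phi1 P (n a) (l a) (m a)" "\<And>a. \<bar>m a\<bar> \<le> int (l a)" by metis
    then have "phi r0 P n l m \<in> phis r0 P" by (auto simp: phis_def M_idx_def)
    then have "capx t ?S (cfun.span (phis r0 P)) (phi r0 P n l m)"
      by (intro capx_self nondegenerate_Omega cfun.span_base)
    then show "capx t ?S (cfun.span (phis r0 P)) (\<lambda>R. \<Prod>a\<in>UNIV. e a (R $ a))"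
      by (subst capx_cong[where g = "phi r0 P n l m"]) (auto simp: phi_def e)
  qed
  moreover have "(\<Prod>a\<in>UNIV. f a (R $ a)) = (\<Prod>a\<in>UNIV. hrad q rcut 0 0 0 (norm (R $ a))) * monomial k R" for R
    by (simp add: f_def monomial_def prod.distrib)
  ultimately show ?thesis by simp
qed

text \<open>The factors next to \<open>hrad\<close> form the reciprocal of the cutoff: each
  \<open>bump 0\<close> cancels the exponential of the same argument.\<close>

lemma hrad_000: "q < x \<Longrightarrow> 0 < q \<Longrightarrow> x < rcut \<Longrightarrow>
    hrad q rcut 0 0 0 x * (of_real (bump 0 (x\<^sup>2 - q\<^sup>2)) * of_real (exp (inverse (rcut\<^sup>2 - x\<^sup>2)))) = 1"
proof -
  assume "q < x" "0 < q" "x < rcut"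
  then have "x\<^sup>2 - q\<^sup>2 > 0" "rcut\<^sup>2 - x\<^sup>2 > 0" by (auto intro!: power_strict_mono)
  then have "bump 0 (x\<^sup>2 - q\<^sup>2) * exp (inverse (x\<^sup>2 - q\<^sup>2)) = 1" "bump 0 (rcut\<^sup>2 - x\<^sup>2) * exp (inverse (rcut\<^sup>2 - x\<^sup>2)) = 1"
    by (auto intro: bump_0_mult_exp)
  then have "(bump 0 (rcut\<^sup>2 - x\<^sup>2) * exp (inverse (x\<^sup>2 - q\<^sup>2))) * (bump 0 (x\<^sup>2 - q\<^sup>2) * exp (inverse (rcut\<^sup>2 - x\<^sup>2))) = 1"
  proof -
    assume 1: "bump 0 (x\<^sup>2 - q\<^sup>2) * exp (inverse (x\<^sup>2 - q\<^sup>2)) = 1" "bump 0 (rcut\<^sup>2 - x\<^sup>2) * exp (inverse (rcut\<^sup>2 - x\<^sup>2)) = 1"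
    have "(bump 0 (rcut\<^sup>2 - x\<^sup>2) * exp (inverse (x\<^sup>2 - q\<^sup>2))) * (bump 0 (x\<^sup>2 - q\<^sup>2) * exp (inverse (rcut\<^sup>2 - x\<^sup>2))) =
        (bump 0 (x\<^sup>2 - q\<^sup>2) * exp (inverse (x\<^sup>2 - q\<^sup>2))) * (bump 0 (rcut\<^sup>2 - x\<^sup>2) * exp (inverse (rcut\<^sup>2 - x\<^sup>2)))"
      by (simp only: mult_ac)
    then show ?thesis unfolding 1 by simp
  qed
  then show ?thesis
    unfolding hrad_def of_real_mult[symmetric] by simp
qed

text \<open>The closure properties that \<open>Ct_polynomial_approx\<close> requires of the
  polynomials.\<close>

lemma monomial_span:
  defines "F \<equiv> cfun.span (range (monomial :: ('n::finite \<Rightarrow> 3 \<Rightarrow> nat) \<Rightarrow> (real^3)^'n \<Rightarrow> complex))"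
  shows "(\<lambda>x. c) \<in> F" "f \<in> F \<Longrightarrow> g \<in> F \<Longrightarrow> (\<lambda>x. f x + g x) \<in> F"
    "b \<in> Basis \<Longrightarrow> f \<in> F \<Longrightarrow> (\<lambda>x. of_real (x \<bullet> b) * f x) \<in> F"
    "f \<in> F \<Longrightarrow> (\<lambda>x. c * f x) \<in> F"
proof -
  have add: "(\<lambda>x. f x + g x) \<in> F" if "f \<in> F" "g \<in> F" for f g
    using cfun.span_add[of f _ g] that by (simp add: F_def plus_fun_def)
  have sc: "(\<lambda>x. c * f x) \<in> F" if "f \<in> F" for f c
    using cfun.span_scale[of f _ c] that by (simp add: F_def cscale_def)
  have one: "(\<lambda>x. 1) \<in> F"
  proof -
    have "monomial (\<lambda>a i. 0) = (\<lambda>x::(real^3)^'n. 1)" by (simp add: monomial_def fun_eq_iff)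
    then show ?thesis unfolding F_def by (metis cfun.span_base rangeI)
  qed
  show "(\<lambda>x. c) \<in> F" using sc[OF one, of c] by simp
  show "f \<in> F \<Longrightarrow> g \<in> F \<Longrightarrow> (\<lambda>x. f x + g x) \<in> F" by (rule add)
  show "f \<in> F \<Longrightarrow> (\<lambda>x. c * f x) \<in> F" by (rule sc)
  assume b: "b \<in> Basis" and f: "f \<in> F"
  then obtain a i where ai: "b = axis a (axis i 1)" by (auto simp: Basis_vec_def)
  have xb: "x \<bullet> b = x $ a $ i" for x by (simp add: ai inner_axis)
  have "(\<lambda>x. of_real (x $ a $ i) * f x) \<in> F"
    using f unfolding F_def
  proof (induction rule: cfun.span_induct_alt)
    case base
    have "(\<lambda>x::(real^3)^'n. of_real (x $ a $ i) * 0 x) = (0 :: (real^3)^'n \<Rightarrow> complex)" by (auto simp: zero_fun_def)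
    then show ?case using cfun.span_zero by simp
  next
    case (step c x y)
    then obtain k where k: "x = monomial k" by blast
    define k' where "k' = k(a := (k a)(i := Suc (k a i)))"
    have "monomial k' R = of_real (R $ a $ i) * monomial k R" for R
    proof -
      have "(\<Prod>j\<in>UNIV. (R $ a $ j) ^ k' a j) = R $ a $ i * (\<Prod>j\<in>UNIV. (R $ a $ j) ^ k a j)"
      proof -
        have "(\<Prod>j\<in>UNIV. (R $ a $ j) ^ k' a j) = (R $ a $ i) ^ k' a i * (\<Prod>j\<in>UNIV - {i}. (R $ a $ j) ^ k' a j)"
          by (rule prod.remove) auto
        also have "(\<Prod>j\<in>UNIV - {i}. (R $ a $ j) ^ k' a j) = (\<Prod>j\<in>UNIV - {i}. (R $ a $ j) ^ k a j)"
          by (rule prod.cong) (auto simp: k'_def)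
        also have "(R $ a $ i) ^ k' a i = R $ a $ i * (R $ a $ i) ^ k a i" by (simp add: k'_def)
        finally show ?thesis using prod.remove[of UNIV i "\<lambda>j. (R $ a $ j) ^ k a j"] by (simp add: mult.assoc)
      qed
      moreover have "(\<Prod>c\<in>UNIV - {a}. \<Prod>j\<in>UNIV. (R $ c $ j) ^ k' c j) = (\<Prod>c\<in>UNIV - {a}. \<Prod>j\<in>UNIV. (R $ c $ j) ^ k c j)"
        by (rule prod.cong) (auto simp: k'_def)
      ultimately show ?thesis
        unfolding monomial_def of_real_mult[symmetric]
        using prod.remove[of UNIV a "\<lambda>c. \<Prod>j\<in>UNIV. (R $ c $ j) ^ k' c j"]
          prod.remove[of UNIV a "\<lambda>c. \<Prod>j\<in>UNIV. (R $ c $ j) ^ k c j"] by (simp add: mult.assoc)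
    qed
    then have "(\<lambda>R. of_real (R $ a $ i) * (cscale c x + y) R) =
        cscale c (monomial k') + (\<lambda>R. of_real (R $ a $ i) * y R)"
      by (auto simp: cscale_def k fun_eq_iff algebra_simps)
    moreover have "cscale c (monomial k') + (\<lambda>R. of_real (R $ a $ i) * y R) \<in> cfun.span (range monomial)"
      using step by (intro cfun.span_add cfun.span_scale[OF cfun.span_base]) auto
    ultimately show ?case by (simp only:)
  qed
  then show "(\<lambda>x. of_real (x \<bullet> b) * f x) \<in> F" unfolding xb .
qed

lemma capx_phis:
  fixes f :: "(real^3)^'n::finite \<Rightarrow> complex"
  assumes r0: "0 < r0" and rc: "r0 < rcut" and P: "radial_basis t r0 rcut P" and f: "f \<in> Ct_cut t r0 rcut"
  shows "capx t (Omega r0) (cfun.span (phis r0 P)) f"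
proof -
  let ?S = "Omega r0 :: ((real^3)^'n) set"
  let ?F = "cfun.span (range monomial) :: ((real^3)^'n \<Rightarrow> complex) set"
  have rc0: "0 < rcut" using r0 rc by simp
  obtain M where M: "CB t ?S M f" using f by (auto simp: Ct_cut_def Ct_iff)
  have f0: "f R = 0" if "R \<notin> ?S" for R using f that by (auto simp: Ct_cut_def Ct_iff)
  have fc: "f R = 0" if "norm (R $ j) \<ge> rcut" for R j
    using f f0[of R] that by (auto simp: Ct_cut_def)
  have step1: "capx t ?S ((\<lambda>s R. f (s *\<^sub>R R)) ` {1<..}) f"
    unfolding capx_def
  proof (intro allI impI)
    fix e :: real assume "e > 0"
    have "\<forall>\<^sub>F s in at_right 1. CB t ?S e (\<lambda>R. f R - f (s *\<^sub>R R))"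
      by (rule dilation_CB[OF r0 rc0 M _ \<open>e > 0\<close>]) (use fc in \<open>auto intro: less_imp_le\<close>)
    moreover have "\<forall>\<^sub>F s in at_right (1::real). s \<in> {1<..}"
      by (simp add: eventually_at_right_less)
    ultimately have "\<forall>\<^sub>F s in at_right 1. CB t ?S e (\<lambda>R. f R - f (s *\<^sub>R R)) \<and> s \<in> {1<..}"
      by (rule eventually_conj)
    then obtain s where "CB t ?S e (\<lambda>R. f R - f (s *\<^sub>R R))" "s \<in> {1<..}"
      using eventually_happens'[OF trivial_limit_at_right_real] by blast
    then show "\<exists>g\<in>(\<lambda>s R. f (s *\<^sub>R R)) ` {1<..}. CB t ?S e (\<lambda>x. f x - g x)"
      by (intro bexI[of _ "\<lambda>R. f (s *\<^sub>R R)"]) auto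
  qed
  have step2: "capx t ?S (cfun.span (phis r0 P)) (\<lambda>R. f (s *\<^sub>R R))" if s: "1 < s" for s
  proof -
    have rs: "r0 / s < r0" "rcut / s < rcut" "0 < r0 / s" "0 < rcut / s"
      using s r0 rc0 by (auto simp: divide_less_eq)
    define x where "x = r0 / s"
    \<comment> \<open>Two radii between \<open>r0 / s\<close> and \<open>r0\<close>: the quotient is
      regular from \<open>q1\<close> on and vanishes below \<open>q\<close>, so the two regions
      overlap. Likewise \<open>s1\<close> will lie between \<open>rcut / s\<close>, where the
      dilated function ends, and \<open>rcut\<close>, where the cutoff does.\<close>
    define q1 q where "q1 = (2 * x + r0) / 3" and "q = (x + 2 * r0) / 3"
    have q: "r0 / s < q1" "q1 < q" "q < r0" "0 < q1" "0 < q"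
      using rs unfolding x_def[symmetric] by (auto simp: q1_def q_def)
    define y where "y = rcut / s"
    define s1 where "s1 = (y + rcut) / 2"
    have s1: "rcut / s < s1" "s1 < rcut" "0 < s1"
      using rs unfolding y_def[symmetric] by (auto simp: s1_def)
    define V W :: "((real^3)^'n) set" where "V = shell q1 s1"
      and "W = (\<Union>j. {R. norm (R $ j) < q} \<union> {R. rcut / s < norm (R $ j)})"
    have VW: "open V" "open W" "V \<union> W = UNIV"
    proof -
      show "open V" by (simp add: V_def open_shell)
      show "open W" unfolding W_def by (intro open_UN ballI open_Un open_Collect_less continuous_intros)
      show "V \<union> W = UNIV"
      proof (rule set_eqI)
        fix R :: "(real^3)^'n"
        have "q1 < norm (R $ j) \<and> norm (R $ j) < s1" if "R \<notin> W" for j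
        proof -
          have "\<not> norm (R $ j) < q" "\<not> rcut / s < norm (R $ j)" using that by (auto simp: W_def)
          then show ?thesis using q s1 by linarith
        qed
        then show "R \<in> V \<union> W \<longleftrightarrow> R \<in> UNIV" by (auto simp: V_def shell_def)
      qed
    qed
    \<comment> \<open>\<open>w\<close> is the reciprocal of the cutoff on \<open>(q, rcut)\<close> and vanishes to infinite order at \<open>q\<close>.\<close>
    define w where "w x = complex_of_real (bump 0 (x\<^sup>2 - q\<^sup>2)) * of_real (exp (inverse (rcut\<^sup>2 - x\<^sup>2)))" for x
    \<comment> \<open>\<open>f (s R)\<close> divided by the cutoff. Outside the shell
      \<open>V\<close> one of the factors is 0, which makes this formula an extension by 0.\<close>
    define G where "G R = f (s *\<^sub>R R) * (\<Prod>a\<in>UNIV. w (norm (R $ a)))" for R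
    have dil: "cb t V (\<lambda>R. f (s *\<^sub>R R))"
    proof -
      have "(\<lambda>R. s *\<^sub>R R) ` V \<subseteq> ?S"
      proof
        fix R' assume "R' \<in> (\<lambda>R. s *\<^sub>R R) ` V"
        then obtain R where R: "R \<in> V" "R' = s *\<^sub>R R" by blast
        have "r0 < norm (R' $ j)" for j
        proof -
          have "r0 / s < norm (R $ j)" using R(1) q(1) by (auto simp: V_def shell_def intro: less_trans)
          then show ?thesis using s R(2) by (simp add: divide_less_eq mult.commute)
        qed
        then show "R' \<in> ?S" by (simp add: Omega_def)
      qed
      moreover have "\<bar>(s *\<^sub>R b) \<bullet> c\<bar> \<le> s" if "b \<in> Basis" "c \<in> Basis" for b c :: "(real^3)^'n"
        using that s by (auto simp: inner_Basis)
      ultimately show ?thesis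
        using CB_linear_compose[OF nondegenerate_open[OF VW(1)] bounded_linear_scaleR_right _ _ _ M, of s s] s
        unfolding cb_def by (meson less_imp_le)
    qed
    have "cb t V G"
      unfolding G_def w_def V_def
      by (intro cb_mult cb_prod cb_bump_norm cb_exp_norm s1 nondegenerate_open open_shell dil[unfolded V_def]) auto
    then obtain N where N: "CB t V N G" by (auto simp: cb_def)
    have GW: "G R = 0" if R: "R \<in> W" for R
    proof -
      obtain j where "norm (R $ j) < q \<or> rcut / s < norm (R $ j)" using R by (auto simp: W_def)
      then show ?thesis
      proof
        assume "norm (R $ j) < q"
        then have "(norm (R $ j))\<^sup>2 < q\<^sup>2" by (intro power_strict_mono) auto
        then have "w (norm (R $ j)) = 0" by (simp add: w_def bump_def)
        then have "(\<Prod>a\<in>UNIV. w (norm (R $ a))) = 0" by (intro prod_zero) auto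
        then show ?thesis by (simp add: G_def)
      next
        assume "rcut / s < norm (R $ j)"
        then have "rcut \<le> norm ((s *\<^sub>R R) $ j)" using s by (simp add: divide_less_eq mult.commute)
        then show ?thesis using fc by (simp add: G_def)
      qed
    qed
    have CBG: "CB t UNIV \<bar>N\<bar> G"
    proof (rule CB_localize[OF open_UNIV VW])
      show "CB t (UNIV \<inter> V) \<bar>N\<bar> G" using CB_mono[OF N] by simp
    qed (use GW in auto)
    \<comment> \<open>The ball of this radius contains every configuration with all lengths at most
      \<open>2 * rcut\<close>, in particular the support of \<open>G\<close>; the summand 1 makes
      the inclusion strict.\<close>
    define \<rho> where "\<rho> = real CARD('n) * (2 * rcut) + 1"
    have \<rho>: "0 < \<rho>" using rc0 by (simp add: \<rho>_def add_nonneg_pos)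
    have supp: "G R = 0" if R: "norm R > \<rho>" for R
    proof (rule ccontr)
      assume "G R \<noteq> 0"
      then have "R \<notin> W" using GW by blast
      then have "norm (R $ j) \<le> 2 * rcut" for j
      proof -
        have "\<not> rcut / s < norm (R $ j)" using \<open>R \<notin> W\<close> by (auto simp: W_def)
        then show ?thesis using rs rc0 by linarith
      qed
      then have "norm R \<le> real CARD('n) * (2 * rcut)" by (rule norm_le_card)
      then show False using R by (simp add: \<rho>_def)
    qed
    have poly: "capx t (ball 0 \<rho>) ?F G"
      by (rule Ct_polynomial_approx[OF CBG \<rho> supp monomial_span])
    define X where "X R = (\<Prod>a\<in>UNIV. hrad q rcut 0 0 0 (norm (R $ a)))" for R :: "(real^3)^'n"
    have "cb t ?S X"
      unfolding X_def by (intro cb_prod cb_radial_lift cb_hrad q rc0 r0 nondegenerate_Omega) auto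
    then obtain L where L: "CB t ?S L X" by (auto simp: cb_def)
    \<comment> \<open>Beyond the cutoff both sides vanish, so the identity holds on all of
      \<open>Omega r0\<close>.\<close>
    have XG: "X R * G R = f (s *\<^sub>R R)" if R: "R \<in> ?S" for R
    proof (cases "\<exists>j. rcut \<le> norm (R $ j)")
      case True
      then obtain j where j: "rcut \<le> norm (R $ j)" by blast
      have "1 * norm (R $ j) \<le> s * norm (R $ j)" using s by (intro mult_right_mono) auto
      then have "rcut \<le> norm ((s *\<^sub>R R) $ j)" using j s by simp
      then have "f (s *\<^sub>R R) = 0" by (rule fc)
      then show ?thesis by (simp add: G_def)
    next
      case False
      have "hrad q rcut 0 0 0 (norm (R $ a)) * w (norm (R $ a)) = 1" for a
      proof -
        have "r0 < norm (R $ a)" using R by (simp add: Omega_def)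
        moreover have "norm (R $ a) < rcut" using False by (simp add: not_le)
        ultimately show ?thesis unfolding w_def using q by (intro hrad_000) auto
      qed
      then have "X R * (\<Prod>a\<in>UNIV. w (norm (R $ a))) = 1"
        unfolding X_def prod.distrib[symmetric] by simp
      then show ?thesis by (simp add: G_def mult_ac)
    qed
    \<comment> \<open>The polynomials approximate on the ball only. Where some length exceeds
      \<open>rcut\<close> the multiplier \<open>X\<close> is 0, so their growth there does not
      matter.\<close>
    define V2 W2 :: "((real^3)^'n) set" where "V2 = (\<Inter>j. {R. norm (R $ j) < 2 * rcut})"
      and "W2 = (\<Union>j. {R. rcut < norm (R $ j)})"
    have V2: "open V2" "open W2" "V2 \<union> W2 = UNIV"
    proof -
      show "open V2" unfolding V2_def by (intro open_INT ballI open_Collect_less continuous_intros) auto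
      show "open W2" unfolding W2_def by (intro open_UN ballI open_Collect_less continuous_intros)
      show "V2 \<union> W2 = UNIV"
      proof (rule set_eqI)
        fix R :: "(real^3)^'n"
        have "norm (R $ j) < 2 * rcut" if "R \<notin> W2" for j
        proof -
          have "\<not> rcut < norm (R $ j)" using that by (auto simp: W2_def)
          then show ?thesis using rc0 by linarith
        qed
        then show "R \<in> V2 \<union> W2 \<longleftrightarrow> R \<in> UNIV" by (auto simp: V2_def)
      qed
    qed
    have V2ball: "V2 \<subseteq> ball 0 \<rho>"
    proof
      fix R assume "R \<in> V2"
      then have "norm R \<le> real CARD('n) * (2 * rcut)"
        by (intro norm_le_card) (auto simp: V2_def intro: less_imp_le)
      then show "R \<in> ball 0 \<rho>" by (simp add: \<rho>_def)
    qed
    have "capx t ?S ((\<lambda>p R. X R * p R) ` ?F) (\<lambda>R. f (s *\<^sub>R R))"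
      unfolding capx_def
    proof (intro allI impI)
      fix e :: real assume e: "e > 0"
      define K where "K = 2 ^ t * (\<bar>L\<bar> + 1)"
      have K: "K > 0" by (simp add: K_def add_nonneg_pos)
      then have "e / K > 0" using e by simp
      then obtain p where p: "p \<in> ?F" "CB t (ball 0 \<rho>) (e / K) (\<lambda>R. G R - p R)"
        using poly unfolding capx_def by blast
      have "CB t (?S \<inter> V2) (e / K) (\<lambda>R. G R - p R)"
        using V2ball by (intro CB_subset[OF _ open_ball _ p(2)] open_Int open_Omega V2(1)) auto
      moreover have "CB t (?S \<inter> V2) (\<bar>L\<bar> + 1) X"
        by (intro CB_mono[OF CB_subset[OF open_Int[OF open_Omega V2(1)] open_Omega _ L]]) auto
      ultimately have "CB t (?S \<inter> V2) (2 ^ t * (\<bar>L\<bar> + 1) * (e / K)) (\<lambda>R. X R * (G R - p R))"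
        by (intro CB_mult nondegenerate_open open_Int open_Omega V2(1))
      then have 1: "CB t (?S \<inter> V2) e (\<lambda>R. X R * (G R - p R))"
        unfolding K_def[symmetric] using K by simp
      have "CB t ?S e (\<lambda>R. X R * (G R - p R))"
      proof (rule CB_localize[OF open_Omega V2 1])
        fix R assume "R \<in> ?S \<inter> W2"
        then obtain j where j: "rcut < norm (R $ j)" by (auto simp: W2_def)
        then have "hrad q rcut 0 0 0 (norm (R $ j)) = 0" by (intro hrad_zero rc0) auto
        then have "X R = 0" unfolding X_def by (intro prod_zero) auto
        then show "X R * (G R - p R) = 0" by simp
      qed (use e in simp)
      then have "CB t ?S e (\<lambda>R. f (s *\<^sub>R R) - X R * p R)"
        by (subst CB_cong[where g = "\<lambda>R. X R * (G R - p R)"]) (auto simp: XG[symmetric] right_diff_distrib)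
      then show "\<exists>g\<in>(\<lambda>p R. X R * p R) ` ?F. CB t ?S e (\<lambda>x. f (s *\<^sub>R x) - g x)"
        using p(1) by (intro bexI[of _ "\<lambda>R. X R * p R"]) auto
    qed
    then show ?thesis
    proof (rule capx_trans[OF nondegenerate_Omega])
      fix g assume "g \<in> (\<lambda>p R. X R * p R) ` ?F"
      then obtain p where p: "p \<in> ?F" "g = (\<lambda>R. X R * p R)" by blast
      have "capx t ?S (cfun.span (phis r0 P)) ((\<lambda>p R. X R * p R) p)"
      proof (rule capx_span_induct[OF nondegenerate_Omega cfun.subspace_span p(1)])
        fix b :: "(real^3)^'n \<Rightarrow> complex" assume "b \<in> range monomial"
        then obtain k where "b = monomial k" by blast
        then show "capx t ?S (cfun.span (phis r0 P)) (\<lambda>R. X R * b R)"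
          using capx_monomial[OF r0 q(5,3) rc0 P, of k] by (simp add: X_def)
      qed (auto simp: cscale_def algebra_simps)
      then show "capx t ?S (cfun.span (phis r0 P)) g" using p(2) by simp
    qed
  qed
  show ?thesis
    by (rule capx_trans[OF nondegenerate_Omega step1]) (use step2 in auto)
qed

subsection \<open>Linear algebra of coefficient inner products\<close>

lemma sum_fun_apply: "(\<Sum>i\<in>I. f i) x = (\<Sum>i\<in>I. f i x)"
  by (induction I rule: infinite_finite_induct) auto

lemma indep_familyI:
  assumes "\<And>K c. finite K \<Longrightarrow> K \<subseteq> T \<Longrightarrow> (\<Sum>k\<in>K. cscale (c k) (v k)) = 0 \<Longrightarrow> \<forall>k\<in>K. c k = 0"
  shows "indep_family v T"
proof -
  have inj: "inj_on v T"
  proof (rule inj_onI, rule ccontr)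
    fix k k' assume k: "k \<in> T" "k' \<in> T" "v k = v k'" "k \<noteq> k'"
    \<comment> \<open>Equal values at different indices would be a relation with coefficients 1 and
      -1; thus the criterion also yields injectivity.\<close>
    define c where "c x = (if x = k then 1 else - 1 :: complex)" for x
    have "(\<Sum>x\<in>{k, k'}. cscale (c x) (v x)) = 0"
      using k by (auto simp: c_def cscale_def fun_eq_iff)
    then have "\<forall>x\<in>{k, k'}. c x = 0" using k by (intro assms) auto
    then show False by (simp add: c_def)
  qed
  have "cfun.independent (v ` T)"
    unfolding cfun.dependent_explicit
  proof clarify
    fix t u w assume t: "finite t" "t \<subseteq> v ` T" "(\<Sum>x\<in>t. cscale (u x) x) = 0" "w \<in> t" "u w \<noteq> 0"
    obtain K where K: "K \<subseteq> T" "t = v ` K" using t(2) by (meson subset_imageE)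
    have injK: "inj_on v K" using inj K(1) inj_on_subset by blast
    then have fin: "finite K" using t(1) K(2) finite_imageD by blast
    have "(\<Sum>k\<in>K. cscale (u (v k)) (v k)) = 0"
      using t(3) unfolding K(2) sum.reindex[OF injK] by simp
    then have "\<forall>k\<in>K. u (v k) = 0" by (rule assms[OF fin K(1)])
    then show False using t(4,5) K(2) by auto
  qed
  then show ?thesis using inj by (simp add: indep_family_def)
qed

context
  fixes A :: "('a \<Rightarrow> complex) set"
  assumes A: "cfun.independent A"
begin

text \<open>\<open>coeff_inner\<close> sums over the support of its first argument; a common larger
  set is needed to compare different arguments.\<close>

lemma coeff_inner_eq:
  assumes "finite F" "{b. cfun.representation A f b \<noteq> 0} \<subseteq> F"
  shows "coeff_inner A f g = (\<Sum>b\<in>F. cfun.representation A f b * cnj (cfun.representation A g b))"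
  unfolding coeff_inner_def using assms by (intro sum.mono_neutral_left) auto

lemma coeff_inner_add_left:
  assumes "f \<in> cfun.span A" "f' \<in> cfun.span A"
  shows "coeff_inner A (f + f') g = coeff_inner A f g + coeff_inner A f' g"
proof -
  let ?F = "{b. cfun.representation A f b \<noteq> 0} \<union> {b. cfun.representation A f' b \<noteq> 0}"
  have fin: "finite ?F" by (simp add: cfun.finite_representation)
  have rep: "cfun.representation A (f + f') b = cfun.representation A f b + cfun.representation A f' b" for b
    using cfun.representation_add[OF A assms(2) assms(1)] by (simp add: add.commute)
  have "coeff_inner A (f + f') g = (\<Sum>b\<in>?F. cfun.representation A (f + f') b * cnj (cfun.representation A g b))"
    by (rule coeff_inner_eq[OF fin]) (auto simp: rep)
  also have "\<dots> = (\<Sum>b\<in>?F. cfun.representation A f b * cnj (cfun.representation A g b)) +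
      (\<Sum>b\<in>?F. cfun.representation A f' b * cnj (cfun.representation A g b))"
    by (simp add: rep distrib_right sum.distrib)
  also have "\<dots> = coeff_inner A f g + coeff_inner A f' g"
    using coeff_inner_eq[OF fin, of f g] coeff_inner_eq[OF fin, of f' g] by simp
  finally show ?thesis .
qed

lemma coeff_inner_scale_left:
  assumes "f \<in> cfun.span A"
  shows "coeff_inner A (cscale c f) g = c * coeff_inner A f g"
proof -
  let ?F = "{b. cfun.representation A f b \<noteq> 0}"
  have fin: "finite ?F" by (simp add: cfun.finite_representation)
  have rep: "cfun.representation A (cscale c f) b = c * cfun.representation A f b" for b
    using cfun.representation_scale[OF A assms(1)] by simp
  have "coeff_inner A (cscale c f) g = (\<Sum>b\<in>?F. cfun.representation A (cscale c f) b * cnj (cfun.representation A g b))"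
    by (rule coeff_inner_eq[OF fin]) (auto simp: rep)
  then show ?thesis by (simp add: rep coeff_inner_def sum_distrib_left mult.assoc)
qed

lemma coeff_inner_zero_left: "coeff_inner A 0 g = 0"
  by (simp add: coeff_inner_def cfun.representation_zero)

lemma coeff_inner_cnj:
  shows "coeff_inner A g f = cnj (coeff_inner A f g)"
proof -
  let ?F = "{b. cfun.representation A f b \<noteq> 0} \<union> {b. cfun.representation A g b \<noteq> 0}"
  have fin: "finite ?F" by (simp add: cfun.finite_representation)
  show ?thesis
    using coeff_inner_eq[OF fin, of f g] coeff_inner_eq[OF fin, of g f] by (simp add: mult.commute)
qed

lemma coeff_inner_sum_left:
  assumes "finite I" "\<And>i. i \<in> I \<Longrightarrow> x i \<in> cfun.span A"
  shows "coeff_inner A (\<Sum>i\<in>I. cscale (a i) (x i)) g = (\<Sum>i\<in>I. a i * coeff_inner A (x i) g)"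
  using assms
proof (induction I rule: finite_induct)
  case empty
  show ?case unfolding sum.empty by (rule coeff_inner_zero_left)
next
  case (insert i I)
  have "(\<Sum>i\<in>I. cscale (a i) (x i)) \<in> cfun.span A"
    using insert by (intro cfun.span_sum cfun.span_scale) auto
  then have "coeff_inner A (cscale (a i) (x i) + (\<Sum>i\<in>I. cscale (a i) (x i))) g =
      a i * coeff_inner A (x i) g + coeff_inner A (\<Sum>i\<in>I. cscale (a i) (x i)) g"
    using insert.prems by (simp add: coeff_inner_add_left cfun.span_scale coeff_inner_scale_left)
  also have "coeff_inner A (\<Sum>i\<in>I. cscale (a i) (x i)) g = (\<Sum>i\<in>I. a i * coeff_inner A (x i) g)"
    using insert by blast
  finally show ?case unfolding sum.insert[OF insert.hyps] .
qed

lemma coeff_inner_sum_right: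
  assumes "finite I" "\<And>i. i \<in> I \<Longrightarrow> x i \<in> cfun.span A"
  shows "coeff_inner A g (\<Sum>i\<in>I. cscale (a i) (x i)) = (\<Sum>i\<in>I. cnj (a i) * coeff_inner A g (x i))"
proof -
  have "coeff_inner A g (\<Sum>i\<in>I. cscale (a i) (x i)) = cnj (coeff_inner A (\<Sum>i\<in>I. cscale (a i) (x i)) g)"
    by (rule coeff_inner_cnj)
  also have "\<dots> = (\<Sum>i\<in>I. cnj (a i) * cnj (coeff_inner A (x i) g))"
    by (simp only: coeff_inner_sum_left[OF assms] cnj_sum complex_cnj_mult)
  finally show ?thesis by (simp only: coeff_inner_cnj[of g, symmetric])
qed

lemma coeff_inner_scale_right:
  assumes "f \<in> cfun.span A"
  shows "coeff_inner A g (cscale c f) = cnj c * coeff_inner A g f"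
proof -
  have "coeff_inner A g (cscale c f) = cnj (coeff_inner A (cscale c f) g)" by (rule coeff_inner_cnj)
  also have "\<dots> = cnj c * cnj (coeff_inner A f g)"
    by (simp only: coeff_inner_scale_left[OF assms] complex_cnj_mult)
  finally show ?thesis by (simp only: coeff_inner_cnj[of g, symmetric])
qed

lemma coeff_inner_definite:
  assumes "f \<in> cfun.span A" "coeff_inner A f f = 0"
  shows "f = 0"
proof -
  let ?F = "{b. cfun.representation A f b \<noteq> 0}"
  have fin: "finite ?F" by (simp add: cfun.finite_representation)
  have "complex_of_real (\<Sum>b\<in>?F. (cmod (cfun.representation A f b))\<^sup>2) = coeff_inner A f f"
    by (simp only: coeff_inner_def of_real_sum complex_norm_square)
  then have "(\<Sum>b\<in>?F. (cmod (cfun.representation A f b))\<^sup>2) = 0"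
    unfolding assms(2) by (simp only: of_real_eq_0_iff)
  then have "\<forall>b\<in>?F. (cmod (cfun.representation A f b))\<^sup>2 = 0"
    using fin by (subst (asm) sum_nonneg_eq_0_iff) auto
  then have "?F = {}" by auto
  then show ?thesis
    using cfun.sum_nonzero_representation_eq[OF A assms(1)] by simp
qed

lemma orthonormal_indep_family:
  assumes span: "\<And>k. k \<in> T \<Longrightarrow> v k \<in> cfun.span A"
    and on: "\<And>k k'. k \<in> T \<Longrightarrow> k' \<in> T \<Longrightarrow> coeff_inner A (v k) (v k') = (if k = k' then 1 else 0)"
  shows "indep_family v T"
proof (rule indep_familyI)
  fix K c assume K: "finite K" "K \<subseteq> T" "(\<Sum>k\<in>K. cscale (c k) (v k)) = 0"
  show "\<forall>k\<in>K. c k = 0"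
  proof
    fix k assume k: "k \<in> K"
    have "coeff_inner A (\<Sum>k\<in>K. cscale (c k) (v k)) (v k) = (\<Sum>k'\<in>K. c k' * coeff_inner A (v k') (v k))"
      using K span by (intro coeff_inner_sum_left) auto
    also have "\<dots> = (\<Sum>k'\<in>K. if k' = k then c k' else 0)"
    proof (rule sum.cong[OF refl])
      fix k' assume "k' \<in> K"
      then have "k' \<in> T" "k \<in> T" using K(2) k by auto
      then show "c k' * coeff_inner A (v k') (v k) = (if k' = k then c k' else 0)" by (simp add: on)
    qed
    also have "\<dots> = c k" using k K(1) by simp
    finally have "c k = coeff_inner A (0 :: 'a \<Rightarrow> complex) (v k)" using K(3) by simp
    then show "c k = 0" using coeff_inner_zero_left by metis
  qed
qed

end

subsection \<open>Independence of the tensor products\<close>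

text \<open>Variables are removed one by one. Freezing variable \<open>b\<close> at \<open>y\<close>
  gives a relation in the others with coefficients \<open>c \<kappa> * g (\<kappa> b) y\<close>; as
  \<open>y\<close> varies, independence in one variable separates the values of
  \<open>\<kappa> b\<close>. Each stage keeps those \<open>\<kappa>\<close> that agree with
  \<open>\<kappa>0\<close>.\<close>

lemma tensor_independent:
  fixes g :: "'i \<Rightarrow> 'x \<Rightarrow> complex" and K :: "('n::finite \<Rightarrow> 'i) set"
  assumes single: "\<And>J c. finite J \<Longrightarrow> J \<subseteq> Idx \<Longrightarrow> (\<And>x. x \<in> X \<Longrightarrow> (\<Sum>i\<in>J. c i * g i x) = 0) \<Longrightarrow> \<forall>i\<in>J. c i = 0"
    and K: "finite K" "\<And>\<kappa> a. \<kappa> \<in> K \<Longrightarrow> \<kappa> a \<in> Idx"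
    and zero: "\<And>x. (\<And>a. x a \<in> X) \<Longrightarrow> (\<Sum>\<kappa>\<in>K. c \<kappa> * (\<Prod>a\<in>UNIV. g (\<kappa> a) (x a))) = 0"
    and \<kappa>0: "\<kappa>0 \<in> K"
  shows "c \<kappa>0 = 0"
proof -
  have main: "(\<forall>x. (\<forall>a. x a \<in> X) \<longrightarrow> (\<Sum>\<kappa>\<in>K. c \<kappa> * (\<Prod>a\<in>B. g (\<kappa> a) (x a))) = 0) \<longrightarrow> X \<noteq> {} \<longrightarrow>
      (\<Sum>\<kappa>\<in>{\<kappa>\<in>K. \<forall>a\<in>B. \<kappa> a = \<kappa>0 a}. c \<kappa>) = 0" if "finite B" for B :: "'n set" and c
    using that
  proof (induction B arbitrary: c rule: finite_induct)
    case empty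
    show ?case
    proof (intro impI)
      assume z: "\<forall>x. (\<forall>a. x a \<in> X) \<longrightarrow> (\<Sum>\<kappa>\<in>K. c \<kappa> * (\<Prod>a\<in>{}. g (\<kappa> a) (x a))) = 0" and "X \<noteq> {}"
      then obtain y where "y \<in> X" by blast
      with z[rule_format, of "\<lambda>_. y"] show "(\<Sum>\<kappa>\<in>{\<kappa> \<in> K. \<forall>a\<in>{}. \<kappa> a = \<kappa>0 a}. c \<kappa>) = 0" by simp
    qed
  next
    case (insert b B)
    show ?case
    proof (intro impI)
      assume z: "\<forall>x. (\<forall>a. x a \<in> X) \<longrightarrow> (\<Sum>\<kappa>\<in>K. c \<kappa> * (\<Prod>a\<in>insert b B. g (\<kappa> a) (x a))) = 0" and ne: "X \<noteq> {}"
      let ?K = "{\<kappa>\<in>K. \<forall>a\<in>B. \<kappa> a = \<kappa>0 a}"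
      have y: "(\<Sum>\<kappa>\<in>?K. c \<kappa> * g (\<kappa> b) y) = 0" if y: "y \<in> X" for y
      proof -
        have "(\<Sum>\<kappa>\<in>K. c \<kappa> * g (\<kappa> b) y * (\<Prod>a\<in>B. g (\<kappa> a) (x a))) = 0" if x: "\<forall>a. x a \<in> X" for x
        proof -
          have "(\<Sum>\<kappa>\<in>K. c \<kappa> * (\<Prod>a\<in>insert b B. g (\<kappa> a) ((x(b := y)) a))) = 0"
          proof -
            have "\<forall>a. (x(b := y)) a \<in> X" using x y by simp
            then show ?thesis using z by blast
          qed
          moreover have "(\<Prod>a\<in>insert b B. g (\<kappa> a) ((x(b := y)) a)) = g (\<kappa> b) y * (\<Prod>a\<in>B. g (\<kappa> a) (x a))" for \<kappa>
          proof -
            have "(\<Prod>a\<in>B. g (\<kappa> a) ((x(b := y)) a)) = (\<Prod>a\<in>B. g (\<kappa> a) (x a))"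
              using insert.hyps by (intro prod.cong) auto
            then show ?thesis using insert.hyps by simp
          qed
          ultimately show ?thesis by (simp add: mult.assoc)
        qed
        then show ?thesis by (intro insert.IH[THEN mp, THEN mp, OF _ ne] allI impI)
      qed
      let ?J = "(\<lambda>\<kappa>. \<kappa> b) ` K"
      have fin: "finite ?K" using K(1) by simp
      have "(\<Sum>i\<in>?J. (\<Sum>\<kappa>\<in>{\<kappa>\<in>?K. \<kappa> b = i}. c \<kappa>) * g i y) = 0" if "y \<in> X" for y
      proof -
        have "(\<Sum>i\<in>?J. (\<Sum>\<kappa>\<in>{\<kappa>\<in>?K. \<kappa> b = i}. c \<kappa>) * g i y) =
            (\<Sum>i\<in>?J. (\<Sum>\<kappa>\<in>{\<kappa>\<in>?K. \<kappa> b = i}. c \<kappa> * g (\<kappa> b) y))"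
          by (simp add: sum_distrib_right)
        also have "\<dots> = (\<Sum>\<kappa>\<in>?K. c \<kappa> * g (\<kappa> b) y)"
          by (rule sum.group) (use fin K(1) in auto)
        finally show ?thesis using y[OF that] by simp
      qed
      from single[OF _ _ this] have "\<forall>i\<in>?J. (\<Sum>\<kappa>\<in>{\<kappa>\<in>?K. \<kappa> b = i}. c \<kappa>) = 0"
        using K by blast
      then have "(\<Sum>\<kappa>\<in>{\<kappa>\<in>?K. \<kappa> b = \<kappa>0 b}. c \<kappa>) = 0" using \<kappa>0 by blast
      moreover have "{\<kappa>\<in>?K. \<kappa> b = \<kappa>0 b} = {\<kappa>\<in>K. \<forall>a\<in>insert b B. \<kappa> a = \<kappa>0 a}" by auto
      ultimately show "(\<Sum>\<kappa>\<in>{\<kappa>\<in>K. \<forall>a\<in>insert b B. \<kappa> a = \<kappa>0 a}. c \<kappa>) = 0" by simp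
    qed
  qed
  \<comment> \<open>An empty \<open>X\<close> would contradict \<open>single\<close> for a
    one-element family.\<close>
  have ne: "X \<noteq> {}"
  proof
    assume "X = {}"
    then have "\<forall>i\<in>{\<kappa>0 undefined}. (1::complex) = 0"
      using single[of "{\<kappa>0 undefined}" "\<lambda>_. 1"] K(2)[OF \<kappa>0] by simp
    then show False by simp
  qed
  have "(\<Sum>\<kappa>\<in>{\<kappa>\<in>K. \<forall>a\<in>UNIV. \<kappa> a = \<kappa>0 a}. c \<kappa>) = 0"
    by (rule main[OF finite_class.finite_UNIV, THEN mp, THEN mp, OF _ ne]) (use zero in blast)
  moreover have "{\<kappa>\<in>K. \<forall>a\<in>UNIV. \<kappa> a = \<kappa>0 a} = {\<kappa>0}" using \<kappa>0 by auto
  ultimately show ?thesis by simp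
qed

text \<open>At fixed length \<open>s\<close> the harmonics separate the pairs \<open>(l, m)\<close>;
  what is left for each pair is a relation among the radial functions.\<close>

lemma phi1_independent:
  assumes r0: "0 < r0" and P: "radial_basis t r0 rcut P"
    and J: "finite J" "\<And>n l m. (n, l, m) \<in> J \<Longrightarrow> \<bar>m\<bar> \<le> int l"
    and zero: "\<And>x. norm x > r0 \<Longrightarrow> (\<Sum>i\<in>J. c i * phi1 P (fst i) (fst (snd i)) (snd (snd i)) x) = 0"
  shows "\<forall>i\<in>J. c i = 0"
proof
  fix i assume i: "i \<in> J"
  define d where "d n = (if (n, snd i) \<in> J then c (n, snd i) else 0)" for n
  have s: "(\<Sum>n\<in>fst ` J. d n * P n s) = 0" if s: "s > r0" for s
  proof -
    define C where "C p = (\<Sum>j\<in>{j\<in>J. snd j = p}. c j * P (fst j) s)" for p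
    have "C (snd i) = 0"
    proof (rule sph_harm_independent[of "snd ` J"])
      show "finite (snd ` J)" "snd i \<in> snd ` J" using J i by auto
      show "\<bar>m\<bar> \<le> int l" if "(l, m) \<in> snd ` J" for l m using that J(2) by auto
      fix u :: "real^3" assume u: "norm u = 1"
      have nx: "norm (s *\<^sub>R u) = s" using u s r0 by simp
      have "phi1 P n l m (s *\<^sub>R u) = P n s * sph_harm l m u" for n l m
        using s r0 u unfolding phi1_def nx by simp
      then have "0 = (\<Sum>j\<in>J. c j * (P (fst j) s * sph_harm (fst (snd j)) (snd (snd j)) u))"
        using zero[of "s *\<^sub>R u"] nx s by simp
      also have "\<dots> = (\<Sum>p\<in>snd ` J. \<Sum>j\<in>{j\<in>J. snd j = p}. c j * (P (fst j) s * sph_harm (fst (snd j)) (snd (snd j)) u))"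
        by (rule sum.group[symmetric]) (use J in auto)
      also have "\<dots> = (\<Sum>p\<in>snd ` J. C p * sph_harm (fst p) (snd p) u)"
        unfolding C_def sum_distrib_right by (intro sum.cong) (auto simp: mult.assoc)
      finally show "(\<Sum>p\<in>snd ` J. C p * sph_harm (fst p) (snd p) u) = 0" by simp
    qed
    also have "C (snd i) = (\<Sum>n\<in>fst ` {j\<in>J. snd j = snd i}. c (n, snd i) * P n s)"
      unfolding C_def by (subst sum.reindex) (auto simp: inj_on_def prod_eq_iff intro!: sum.cong)
    also have "\<dots> = (\<Sum>n\<in>fst ` J. d n * P n s)"
    proof (rule sum.mono_neutral_cong_left)
      show "\<forall>n\<in>fst ` J - fst ` {j \<in> J. snd j = snd i}. d n * P n s = 0"
        by (force simp: d_def)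
      show "c (n, snd i) * P n s = d n * P n s" if "n \<in> fst ` {j \<in> J. snd j = snd i}" for n
        using that by (force simp: d_def)
    qed (use J(1) in auto)
    finally show ?thesis by simp
  qed
  have PC: "P n \<in> radial_Ct_cut t r0 rcut" for n using P by (auto simp: radial_basis_def)
  have cont: "continuous_on {r0..} (P n)" for n
  proof -
    have "cb t {r0..} (P n)" by (rule radial_basis_cb[OF P])
    then obtain M where "CB t {r0..} M (P n)" by (auto simp: cb_def)
    then have "bounded_ext {r0..} M (P n)" by (rule CB_bounded_ext)
    then obtain g where "continuous_on {r0..} g" "\<forall>x\<in>{r0..}. g x = P n x" by (auto simp: bounded_ext_def)
    then show ?thesis by (metis (no_types, lifting) continuous_on_eq)
  qed
  \<comment> \<open>Positions only provide \<open>s > r0\<close>, whereas the radial functions live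
    on the closed half-line; continuity supplies the endpoint.\<close>
  have "(\<Sum>n\<in>fst ` J. d n * P n s) = 0" if "s \<in> {r0..}" for s
  proof (rule continuous_constant_on_closure[of "{r0<..}"])
    show "continuous_on (closure {r0<..}) (\<lambda>s. \<Sum>n\<in>fst ` J. d n * P n s)"
      using cont by (auto intro!: continuous_intros)
  qed (use s that in auto)
  moreover have "P n s = 0" if "s \<notin> {r0..}" for n s
    using PC[of n] that by (auto simp: radial_Ct_cut_def Ct_iff)
  ultimately have "(\<Sum>n\<in>fst ` J. d n * P n s) = 0" for s by (cases "s \<in> {r0..}") auto
  then have z: "(\<Sum>n\<in>fst ` J. cscale (d n) (P n)) = 0"
    by (simp add: fun_eq_iff cscale_def sum_fun_apply)
  have "inj P" and ind: "cfun.independent (range P)" using P by (auto simp: radial_basis_def indep_family_def)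
  have "(\<Sum>p\<in>P ` fst ` J. cscale (d (inv P p)) p) = 0"
    using z \<open>inj P\<close> by (subst sum.reindex) (auto intro: inj_on_subset)
  then have dep: "d (inv P (P (fst i))) \<noteq> 0 \<Longrightarrow> cfun.dependent (range P)"
    unfolding cfun.dependent_explicit using J(1) i
    by (intro exI[of _ "P ` fst ` J"] exI[of _ "\<lambda>p. d (inv P p)"] conjI bexI[of _ "P (fst i)"]) auto
  then have "d (inv P (P (fst i))) = 0" using ind by blast
  then show "c i = 0" using \<open>inj P\<close> i by (simp add: d_def)
qed

lemma indep_family_phi:
  assumes r0: "0 < r0" and P: "radial_basis t r0 rcut P"
  shows "indep_family (\<lambda>(n, l, m). phi r0 P n l m :: (real^3)^'n::finite \<Rightarrow> complex) {(n, l, m). m \<in> M_idx l}"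
proof (rule indep_familyI)
  fix K :: "(('n \<Rightarrow> nat) \<times> ('n \<Rightarrow> nat) \<times> ('n \<Rightarrow> int)) set" and c
  assume K: "finite K" "K \<subseteq> {(n, l, m). m \<in> M_idx l}"
    and z: "(\<Sum>k\<in>K. cscale (c k) (case k of (n, l, m) \<Rightarrow> phi r0 P n l m)) = (0 :: (real^3)^'n \<Rightarrow> complex)"
  \<comment> \<open>A triple of functions of the particle becomes a function into triples, the form
    that \<open>tensor_independent\<close> expects.\<close>
  define J where "J k = (\<lambda>a. (fst k a, fst (snd k) a, snd (snd k) a))" for k :: "('n \<Rightarrow> nat) \<times> ('n \<Rightarrow> nat) \<times> ('n \<Rightarrow> int)"
  have inj: "inj J" by (auto simp: inj_def J_def fun_eq_iff)
  have "c k0 = 0" if k0: "k0 \<in> K" for k0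
  proof -
    have "(\<lambda>\<kappa>. c (inv J \<kappa>)) (J k0) = 0"
    proof (rule tensor_independent[where Idx = "{(n, l, m). \<bar>m\<bar> \<le> int l}" and X = "{x :: real^3. r0 < norm x}"
          and K = "J ` K" and g = "\<lambda>i. phi1 P (fst i) (fst (snd i)) (snd (snd i))"])
      fix J' :: "(nat \<times> nat \<times> int) set" and d
      assume "finite J'" "J' \<subseteq> {(n, l, m). \<bar>m\<bar> \<le> int l}"
        "\<And>x. x \<in> {x :: real^3. r0 < norm x} \<Longrightarrow> (\<Sum>i\<in>J'. d i * phi1 P (fst i) (fst (snd i)) (snd (snd i)) x) = 0"
      then show "\<forall>i\<in>J'. d i = 0" by (intro phi1_independent[OF r0 P]) auto
    next
      show "finite (J ` K)" "J k0 \<in> J ` K" using K k0 by auto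
      show "\<kappa> a \<in> {(n, l, m). \<bar>m\<bar> \<le> int l}" if "\<kappa> \<in> J ` K" for \<kappa> a
        using that K(2) by (auto simp: J_def M_idx_def)
    next
      fix x :: "'n \<Rightarrow> real^3" assume x: "\<And>a. x a \<in> {x. r0 < norm x}"
      define R where "R = (\<chi> a. x a)"
      have R: "R \<in> Omega r0" using x by (simp add: R_def Omega_def)
      have "(\<Sum>k\<in>K. c k * (\<Prod>a\<in>UNIV. phi1 P (fst (J k a)) (fst (snd (J k a))) (snd (snd (J k a))) (x a))) =
          (\<Sum>k\<in>K. cscale (c k) (case k of (n, l, m) \<Rightarrow> phi r0 P n l m)) R"
        unfolding sum_fun_apply
      proof (rule sum.cong[OF refl])
        fix k
        show "c k * (\<Prod>a\<in>UNIV. phi1 P (fst (J k a)) (fst (snd (J k a))) (snd (snd (J k a))) (x a)) =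
          cscale (c k) (case k of (n, l, m) \<Rightarrow> phi r0 P n l m) R"
          using R by (cases k) (simp add: cscale_def phi_def J_def R_def)
      qed
      then have "(\<Sum>k\<in>K. c k * (\<Prod>a\<in>UNIV. phi1 P (fst (J k a)) (fst (snd (J k a))) (snd (snd (J k a))) (x a))) = 0"
        unfolding z by simp
      then show "(\<Sum>\<kappa>\<in>J ` K. c (inv J \<kappa>) * (\<Prod>a\<in>UNIV. phi1 P (fst (\<kappa> a)) (fst (snd (\<kappa> a))) (snd (snd (\<kappa> a))) (x a))) = 0"
        using inj by (subst sum.reindex) (auto intro: inj_on_subset)
    qed
    then show ?thesis using inj by simp
  qed
  then show "\<forall>k\<in>K. c k = 0" by blast
qed

lemma phis_image: "phis r0 P = (\<lambda>(n, l, m). phi r0 P n l m) ` {(n, l, m). m \<in> M_idx l}"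
  by (auto simp: phis_def image_iff) blast

lemma tensor_inner_phis: "tensor_inner r0 P = coeff_inner (phis r0 P)"
  by (simp add: tensor_inner_def phis_def)

subsection \<open>Sorting\<close>

lemma exists_sorting_permutation:
  fixes key :: "'n::{finite,linorder} \<Rightarrow> nat"
  shows "\<exists>\<tau>. \<tau> permutes UNIV \<and> (\<forall>a b. a \<le> b \<longrightarrow> key (\<tau> a) \<le> key (\<tau> b))"
proof -
  define ys where "ys = sort_key key (sorted_list_of_set (UNIV :: 'n set))"
  have ys: "distinct ys" "set ys = UNIV" "sorted (map key ys)" "length ys = CARD('n)"
    by (auto simp: ys_def)
  \<comment> \<open>The position of \<open>a\<close> in the increasing enumeration of the index
    type.\<close>
  define rank where "rank a = card {b. b < a}" for a :: 'n
  have less: "rank a < CARD('n)" for a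
    unfolding rank_def by (rule psubset_card_mono) auto
  have smono: "rank a < rank b" if "a < b" for a b
    unfolding rank_def by (rule psubset_card_mono) (use that in auto)
  then have mono: "rank a \<le> rank b" if "a \<le> b" for a b
    using that by (cases "a = b") (auto intro: less_imp_le)
  have "inj rank" using smono by (intro injI) (metis less_irrefl neqE)
  define \<tau> where "\<tau> a = ys ! rank a" for a
  have "inj \<tau>"
  proof (rule injI)
    fix a b assume "\<tau> a = \<tau> b"
    then have "rank a = rank b" using nth_eq_iff_index_eq[OF ys(1)] less ys(4) by (simp add: \<tau>_def)
    then show "a = b" using \<open>inj rank\<close> by (simp add: inj_eq)
  qed
  then have "bij \<tau>" by (simp add: bij_def finite_UNIV_inj_surj)
  then have "\<tau> permutes UNIV" by (intro bij_imp_permutes) auto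
  moreover have "key (\<tau> a) \<le> key (\<tau> b)" if "a \<le> b" for a b
    using sorted_nth_mono[OF ys(3) mono[OF that]] less ys(4) by (simp add: \<tau>_def)
  ultimately show ?thesis by blast
qed

lemma mset_sorted_list_of_set: "mset (sorted_list_of_set A) = mset_set A"
  by (metis mset_sorted_list_of_multiset sorted_list_of_mset_set)

text \<open>Both sequences are sorted and have the same multiset of values, and a sorted list is
  determined by its multiset.\<close>

lemma sorted_permutation_eq:
  fixes key :: "'n::{finite,linorder} \<Rightarrow> nat"
  assumes \<tau>: "\<tau> permutes UNIV" and m: "\<And>a b. a \<le> b \<Longrightarrow> key a \<le> key b"
    "\<And>a b. a \<le> b \<Longrightarrow> key (\<tau> a) \<le> key (\<tau> b)"
  shows "key (\<tau> a) = key a"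
proof -
  let ?xs = "sorted_list_of_set (UNIV :: 'n set)"
  have s: "sorted (map f ?xs)" if "\<And>a b. a \<le> b \<Longrightarrow> f a \<le> f b" for f :: "'n \<Rightarrow> nat"
    unfolding sorted_map by (rule sorted_wrt_mono_rel[of ?xs "(\<le>)"]) (use that in auto)
  have "mset (map (\<lambda>a. key (\<tau> a)) ?xs) = image_mset key (image_mset \<tau> (mset_set UNIV))"
    unfolding mset_map mset_sorted_list_of_set by (simp add: multiset.map_comp comp_def)
  also have "image_mset \<tau> (mset_set UNIV) = mset_set UNIV"
    using \<tau> by (simp add: image_mset_mset_set permutes_inj permutes_image)
  also have "image_mset key (mset_set UNIV) = mset (map key ?xs)"
    unfolding mset_map mset_sorted_list_of_set ..
  finally have "sort (map key ?xs) = map (\<lambda>a. key (\<tau> a)) ?xs"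
    using s[OF m(2)] by (intro properties_for_sort) auto
  moreover have "sort (map key ?xs) = map key ?xs" using s[OF m(1)] by (simp add: sorted_sort_id)
  ultimately have "map (\<lambda>a. key (\<tau> a)) ?xs = map key ?xs" by simp
  then show ?thesis by (simp add: map_eq_conv)
qed

text \<open>The multiplier exceeds every \<open>l a\<close>, so the order of the keys is lexicographic.\<close>

definition pair_key :: "('n::finite \<Rightarrow> nat) \<Rightarrow> ('n \<Rightarrow> nat) \<Rightarrow> 'n \<Rightarrow> nat"
  where "pair_key n l a = n a * Suc (\<Sum>b\<in>UNIV. l b) + l a"

lemma pair_key_le:
  "pair_key n l a \<le> pair_key n l b \<longleftrightarrow> n a < n b \<or> n a = n b \<and> l a \<le> l b"
proof -
  let ?K = "Suc (\<Sum>b\<in>UNIV. l b)"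
  have K: "l c < ?K" for c using member_le_sum[of c UNIV l] by (simp add: less_Suc_eq_le)
  have less: "n a * ?K + l a < n b * ?K + l b" if "n a < n b" for a b
  proof -
    have "n a * ?K + l a < Suc (n a) * ?K" using K[of a] by simp
    also have "\<dots> \<le> n b * ?K" using that by (intro mult_right_mono) auto
    finally show ?thesis by simp
  qed
  show ?thesis
    unfolding pair_key_def using less[of a b] less[of b a] by (cases "n a" "n b" rule: linorder_cases) auto
qed

lemma exists_ordering:
  fixes n l :: "'n::{finite,linorder} \<Rightarrow> nat"
  shows "\<exists>\<tau>. \<tau> permutes UNIV \<and> ordered_pair (n \<circ> \<tau>) (l \<circ> \<tau>)"
  using exists_sorting_permutation[of "pair_key n l"] by (simp add: ordered_pair_def pair_key_le)

text \<open>Each class of pairs under relabelling has one ordered representative; this is what makes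
  basis functions of different ordered pairs orthogonal.\<close>

lemma ordered_pair_unique:
  fixes n l :: "'n::{finite,linorder} \<Rightarrow> nat"
  assumes "\<tau> permutes UNIV" "ordered_pair n l" "ordered_pair (n \<circ> \<tau>) (l \<circ> \<tau>)"
  shows "n \<circ> \<tau> = n \<and> l \<circ> \<tau> = l"
proof -
  have "pair_key n l (\<tau> a) = pair_key n l a" for a
    by (rule sorted_permutation_eq[OF assms(1)])
      (use assms(2,3) in \<open>auto simp: ordered_pair_def pair_key_le\<close>)
  then have "pair_key n l (\<tau> a) \<le> pair_key n l a \<and> pair_key n l a \<le> pair_key n l (\<tau> a)" for a by simp
  then show ?thesis unfolding pair_key_le by (auto simp: fun_eq_iff) (metis less_asym order_antisym)+
qed

subsection \<open>Averaging over rotations\<close>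

lemma haar_SO3:
  assumes "normalised_haar_SO3 H"
  shows "space H = SO3" "finite_measure H" "measure H (space H) = 1"
proof -
  have sets: "sets H = sets (restrict_space borel SO3)" and em: "emeasure H SO3 = 1"
    using assms by (auto simp: normalised_haar_SO3_def)
  show sp: "space H = SO3" using sets_eq_imp_space_eq[OF sets] by (simp add: space_restrict_space)
  show "finite_measure H" by (rule finite_measureI) (simp add: sp em)
  show "measure H (space H) = 1" by (simp add: sp measure_def em)
qed

lemma SO3_orthogonal: "Q \<in> SO3 \<Longrightarrow> orthogonal_matrix Q"
  by (simp add: SO3_def rotation_matrix_def)

text \<open>The bound counts three rows of norm 1; it confines the group to a compact ball.\<close>

lemma norm_SO3: "Q \<in> SO3 \<Longrightarrow> norm Q \<le> 3"
proof -
  assume Q: "Q \<in> SO3"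
  have "norm (Q $ i) = 1" for i
  proof -
    have "(norm (Q $ i))\<^sup>2 = 1 ^ 2"
      using orthogonal_matrix_rows[OF SO3_orthogonal[OF Q], of i i]
      unfolding norm_sq_3 by (simp add: power2_eq_square)
    then show ?thesis by (rule power2_eq_imp_eq) auto
  qed
  then show "norm Q \<le> 3" using norm_le_card[of Q 1] by simp
qed

text \<open>\<open>wigner\<close> is a choice, known to be continuous only through its explicit
  formula on the group; hence the detour over a function \<open>c'\<close> that is continuous on all
  matrices.\<close>

lemma integrable_SO3:
  fixes c :: "real^3^3 \<Rightarrow> complex"
  assumes H: "normalised_haar_SO3 H" and c: "continuous_on UNIV c'" "\<And>Q. Q \<in> SO3 \<Longrightarrow> c Q = c' Q"
  shows "integrable H c"
proof -
  have "c' \<in> borel_measurable borel" using c(1) by (rule borel_measurable_continuous_onI)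
  then have "c' \<in> borel_measurable (restrict_space borel SO3)" by (rule measurable_restrict_space1)
  moreover have "sets H = sets (restrict_space borel SO3)" using H by (simp add: normalised_haar_SO3_def)
  ultimately have "c' \<in> borel_measurable H" using measurable_cong_sets[of H "restrict_space borel SO3" borel borel] by blast
  then have m: "c \<in> borel_measurable H"
    using measurable_cong[of H c c' borel] c(2) haar_SO3(1)[OF H] by simp
  have "compact (c' ` cball 0 3)"
    by (rule compact_continuous_image[OF continuous_on_subset[OF c(1)]]) auto
  then have "bounded (c' ` cball 0 3)" by (rule compact_imp_bounded)
  then obtain B where B: "\<forall>Q\<in>cball 0 3. norm (c' Q) \<le> B" by (auto simp: bounded_iff)
  have "AE Q in H. norm (c Q) \<le> B"
    by (rule AE_I2) (use B norm_SO3 c(2) haar_SO3(1)[OF H] in auto)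
  then show ?thesis using m haar_SO3(2)[OF H] by (rule_tac finite_measure.integrable_const_bound)
qed

text \<open>The \<open>c i\<close> do not depend on \<open>R\<close>, so differentiation in
  \<open>R\<close> meets a finite sum and never an integral. At each order the bound passes to the
  average because \<open>H\<close> has total mass 1.\<close>

lemma average_CB:
  fixes f :: "'a::euclidean_space \<Rightarrow> complex" and H :: "'q measure"
  assumes S: "nondegenerate S" and H: "finite_measure H" "measure H (space H) = 1" and I: "finite I"
    and c: "\<And>i. i \<in> I \<Longrightarrow> integrable H (c i)"
    and f: "cb k S f" and \<psi>: "\<And>i. i \<in> I \<Longrightarrow> cb k S (\<psi> i)"
    and u: "\<And>Q. Q \<in> space H \<Longrightarrow> CB k S C (\<lambda>R. f R - (\<Sum>i\<in>I. c i Q * \<psi> i R))"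
  shows "CB k S C (\<lambda>R. f R - (\<Sum>i\<in>I. (\<integral>Q. c i Q \<partial>H) * \<psi> i R))"
proof -
  interpret finite_measure H by fact
  \<comment> \<open>Stated for arbitrary functions, since the induction replaces \<open>f\<close>
    and \<open>\<psi>\<close> by their derivatives.\<close>
  have base: "bounded_ext S C (\<lambda>R. f R - (\<Sum>i\<in>I. (\<integral>Q. c i Q \<partial>H) * \<psi> i R))"
    if f: "cb k S f" and \<psi>: "\<And>i. i \<in> I \<Longrightarrow> cb k S (\<psi> i)"
      and u: "\<And>Q. Q \<in> space H \<Longrightarrow> CB k S C (\<lambda>R. f R - (\<Sum>i\<in>I. c i Q * \<psi> i R))" for k f \<psi>
  proof -
    have "cb k S (\<lambda>R. f R - (\<Sum>i\<in>I. (\<integral>Q. c i Q \<partial>H) * \<psi> i R))"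
      by (intro cb_diff cb_sum cb_cmult S I f \<psi>)
    then obtain M where "bounded_ext S M (\<lambda>R. f R - (\<Sum>i\<in>I. (\<integral>Q. c i Q \<partial>H) * \<psi> i R))"
      unfolding cb_def using CB_bounded_ext by blast
    then show ?thesis
    proof (rule bounded_ext_rebound)
      fix R assume R: "R \<in> S"
      have int: "integrable H (\<lambda>Q. \<Sum>i\<in>I. c i Q * \<psi> i R)"
        using c by (intro Bochner_Integration.integrable_sum integrable_mult_left) auto
      have "(\<integral>Q. f R - (\<Sum>i\<in>I. c i Q * \<psi> i R) \<partial>H) = (\<integral>Q. f R \<partial>H) - (\<integral>Q. (\<Sum>i\<in>I. c i Q * \<psi> i R) \<partial>H)"
        by (rule Bochner_Integration.integral_diff[OF _ int]) simp
      also have "(\<integral>Q. f R \<partial>H) = f R" using H(2) by simp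
      also have "(\<integral>Q. (\<Sum>i\<in>I. c i Q * \<psi> i R) \<partial>H) = (\<Sum>i\<in>I. (\<integral>Q. c i Q \<partial>H) * \<psi> i R)"
        using c by (subst Bochner_Integration.integral_sum) (auto intro: integrable_mult_left)
      finally have eq: "f R - (\<Sum>i\<in>I. (\<integral>Q. c i Q \<partial>H) * \<psi> i R) = (\<integral>Q. f R - (\<Sum>i\<in>I. c i Q * \<psi> i R) \<partial>H)" ..
      have int': "integrable H (\<lambda>Q. f R - (\<Sum>i\<in>I. c i Q * \<psi> i R))"
        using int by (intro Bochner_Integration.integrable_diff) simp_all
      have "norm (\<integral>Q. f R - (\<Sum>i\<in>I. c i Q * \<psi> i R) \<partial>H) \<le> (\<integral>Q. norm (f R - (\<Sum>i\<in>I. c i Q * \<psi> i R)) \<partial>H)"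
        by (rule integral_norm_bound)
      also have "\<dots> \<le> (\<integral>Q. C \<partial>H)"
      proof (rule integral_mono)
        show "integrable H (\<lambda>Q. norm (f R - (\<Sum>i\<in>I. c i Q * \<psi> i R)))"
          using int' by (rule integrable_norm)
        show "norm (f R - (\<Sum>i\<in>I. c i Q * \<psi> i R)) \<le> C" if "Q \<in> space H" for Q
          using CB_bound[OF u[OF that] R] .
      qed simp
      also have "(\<integral>Q. C \<partial>H) = C" using H(2) by simp
      finally show "norm (f R - (\<Sum>i\<in>I. (\<integral>Q. c i Q \<partial>H) * \<psi> i R)) \<le> C" unfolding eq .
    qed
  qed
  show ?thesis using f \<psi> u
  proof (induction k arbitrary: f \<psi>)
    case 0
    then show ?case using base[of 0 f \<psi>] by simp
  next
    case (Suc k)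
    define Df where "Df R = frechet_derivative f (at R within S)" for R
    define D\<psi> where "D\<psi> i R = frechet_derivative (\<psi> i) (at R within S)" for i R
    have df: "(f has_derivative Df R) (at R within S)" if "R \<in> S" for R
      using Suc.prems(1) CB_has_derivative that unfolding cb_def Df_def by blast
    have d\<psi>: "(\<psi> i has_derivative D\<psi> i R) (at R within S)" if "R \<in> S" "i \<in> I" for R i
      using Suc.prems(2)[OF that(2)] CB_has_derivative that(1) unfolding cb_def D\<psi>_def by blast
    have der: "((\<lambda>R. f R - (\<Sum>i\<in>I. a i * \<psi> i R)) has_derivative (\<lambda>v. Df R v - (\<Sum>i\<in>I. a i * D\<psi> i R v))) (at R within S)"
      if "R \<in> S" for R a
      by (intro has_derivative_diff has_derivative_sum has_derivative_mult_right df d\<psi> that)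
    show ?case
    proof (rule CB_SucI[OF S base[OF Suc.prems] der])
      fix b :: 'a assume b: "b \<in> Basis"
      show "CB k S C (\<lambda>R. Df R b - (\<Sum>i\<in>I. (\<integral>Q. c i Q \<partial>H) * D\<psi> i R b))"
      proof (rule Suc.IH)
        show "cb k S (\<lambda>R. Df R b)" using Suc.prems(1) b by (auto simp: cb_def Df_def)
        show "cb k S (\<lambda>R. D\<psi> i R b)" if "i \<in> I" for i
          using Suc.prems(2)[OF that] b by (auto simp: cb_def D\<psi>_def)
        fix Q assume Q: "Q \<in> space H"
        have "CB k S C (\<lambda>R. frechet_derivative (\<lambda>R. f R - (\<Sum>i\<in>I. c i Q * \<psi> i R)) (at R within S) b)"
          using Suc.prems(3)[OF Q] b by simp
        then show "CB k S C (\<lambda>R. Df R b - (\<Sum>i\<in>I. c i Q * D\<psi> i R b))"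
          by (subst CB_cong[where g = "\<lambda>R. frechet_derivative (\<lambda>R. f R - (\<Sum>i\<in>I. c i Q * \<psi> i R)) (at R within S) b"])
            (simp_all add: frechet_derivative_within_eq[OF S _ der])
      qed
    qed
  qed
qed

text \<open>Matrix entries of an isometry are at most 1, so the constant depends on dimension and
  order only and is the same for all rotations and permutations.\<close>

lemma CB_isometry:
  fixes L :: "'a::euclidean_space \<Rightarrow> 'a"
  assumes S: "nondegenerate S" and L: "bounded_linear L" "\<And>x. norm (L x) = norm x" "L ` S \<subseteq> S"
    and f: "CB k S M f"
  shows "CB k S (real DIM('a) ^ k * M) (\<lambda>x. f (L x))"
proof -
  have "\<bar>L b \<bullet> c\<bar> \<le> 1" if "b \<in> Basis" "c \<in> Basis" for b c
    using Cauchy_Schwarz_ineq2[of "L b" c] that by (simp add: L(2))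
  from CB_linear_compose[OF S L(1,3) _ this f] show ?thesis by simp
qed

section \<open>Rotations acting on tensor products\<close>

lemma rotate_pts_linear: "bounded_linear (rotate_pts Q :: (real^3)^'n \<Rightarrow> (real^3)^'n)"
proof -
  have "linear (rotate_pts Q :: (real^3)^'n \<Rightarrow> (real^3)^'n)"
    by (rule linearI) (simp_all add: rotate_pts_def vec_eq_iff matrix_vector_mult_def
        sum_distrib_left distrib_left sum.distrib mult.left_commute)
  then show ?thesis by (simp add: linear_conv_bounded_linear)
qed

lemma rotate_pts_nth: "rotate_pts Q R $ j = Q *v (R $ j)"
  by (simp add: rotate_pts_def)

lemma permute_pts_nth: "permute_pts \<sigma> R $ j = R $ \<sigma> j"
  by (simp add: permute_pts_def)

lemma norm_rotate_pts: "orthogonal_matrix Q \<Longrightarrow> norm (rotate_pts Q R) = norm R"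
  unfolding norm_vec_def[of "rotate_pts Q R"] norm_vec_def[of R] rotate_pts_nth
  by (simp only: norm_orthogonal_matrix)

lemma rotate_pts_Omega: "orthogonal_matrix Q \<Longrightarrow> R \<in> Omega r0 \<Longrightarrow> rotate_pts Q R \<in> Omega r0"
  by (simp add: Omega_def rotate_pts_def norm_orthogonal_matrix)

lemma M_idx_PiE: "M_idx l = PiE UNIV (\<lambda>a. {- int (l a)..int (l a)})"
  by (auto simp: M_idx_def PiE_def Pi_def abs_le_iff) (metis minus_le_iff)+

lemma finite_M_idx: "finite (M_idx (l :: 'n::finite \<Rightarrow> nat))"
  unfolding M_idx_PiE by (rule finite_PiE) auto

definition wprod :: "('n::finite \<Rightarrow> nat) \<Rightarrow> ('n \<Rightarrow> int) \<Rightarrow> ('n \<Rightarrow> int) \<Rightarrow> real^3^3 \<Rightarrow> complex"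
  where "wprod l \<mu> m Q = (\<Prod>a\<in>UNIV. wigner (l a) Q (\<mu> a) (m a))"

text \<open>Lengths are unchanged, so only the harmonics transform; expanding the product of the
  one-particle sums gives a sum over \<open>M_idx l\<close>.\<close>

lemma phi_rotate:
  assumes Q: "orthogonal_matrix Q" and m: "m \<in> M_idx l" and R: "R \<in> Omega r0" and r0: "0 < r0"
  shows "phi r0 P n l m (rotate_pts Q R) = (\<Sum>\<mu>\<in>M_idx l. wprod l \<mu> m Q * phi r0 P n l \<mu> R)"
proof -
  have QR: "rotate_pts Q R \<in> Omega r0" using rotate_pts_Omega[OF Q R] .
  let ?u = "\<lambda>a. inverse (norm (R $ a)) *\<^sub>R R $ a"
  have "phi1 P (n a) (l a) (m a) (rotate_pts Q R $ a) =
      (\<Sum>\<mu>\<in>{- int (l a)..int (l a)}. wigner (l a) Q \<mu> (m a) * phi1 P (n a) (l a) \<mu> (R $ a))" for a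
  proof -
    have ma: "\<bar>m a\<bar> \<le> int (l a)" using m by (simp add: M_idx_def)
    have nu: "norm (?u a) = 1" by (rule norm_normalized[OF Omega_nth_nonzero[OF r0 R]])
    have "inverse (norm (Q *v (R $ a))) *\<^sub>R (Q *v (R $ a)) = Q *v ?u a"
      by (simp add: norm_orthogonal_matrix[OF Q] matrix_vector_mult_scaleR)
    then have "phi1 P (n a) (l a) (m a) (rotate_pts Q R $ a) = P (n a) (norm (R $ a)) * sph_harm (l a) (m a) (Q *v ?u a)"
      by (simp add: phi1_def rotate_pts_def norm_orthogonal_matrix[OF Q])
    also have "sph_harm (l a) (m a) (Q *v ?u a) = (\<Sum>\<mu> = - int (l a)..int (l a). wigner_rep (l a) Q \<mu> (m a) * sph_harm (l a) \<mu> (?u a))"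
      by (rule sph_harm_rotate[OF Q nu ma])
    also have "\<dots> = (\<Sum>\<mu> = - int (l a)..int (l a). wigner (l a) Q \<mu> (m a) * sph_harm (l a) \<mu> (?u a))"
      using ma by (intro sum.cong) (auto simp: wigner_eq[OF Q])
    finally show ?thesis by (simp add: sum_distrib_left phi1_def mult_ac)
  qed
  then have "phi r0 P n l m (rotate_pts Q R) = (\<Prod>a\<in>UNIV. \<Sum>\<mu>\<in>{- int (l a)..int (l a)}.
      wigner (l a) Q \<mu> (m a) * phi1 P (n a) (l a) \<mu> (R $ a))"
    using QR by (simp add: phi_def)
  also have "\<dots> = (\<Sum>\<mu>\<in>PiE UNIV (\<lambda>a. {- int (l a)..int (l a)}). \<Prod>a\<in>UNIV.
      wigner (l a) Q (\<mu> a) (m a) * phi1 P (n a) (l a) (\<mu> a) (R $ a))"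
    by (rule prod_sum_PiE) auto
  finally show ?thesis
    using R by (simp add: M_idx_PiE[symmetric] prod.distrib wprod_def phi_def)
qed

lemma integrable_wprod:
  assumes H: "normalised_haar_SO3 H" and m: "m \<in> M_idx l" "\<mu> \<in> M_idx l"
  shows "integrable H (wprod l \<mu> m)"
proof (rule integrable_SO3[OF H])
  show "continuous_on UNIV (\<lambda>Q. \<Prod>a\<in>UNIV. wigner_rep (l a) Q (\<mu> a) (m a))"
    by (intro continuous_on_prod continuous_wigner_rep)
  show "wprod l \<mu> m Q = (\<Prod>a\<in>UNIV. wigner_rep (l a) Q (\<mu> a) (m a))" if "Q \<in> SO3" for Q
    unfolding wprod_def using m
    by (intro prod.cong refl wigner_eq[OF SO3_orthogonal[OF that]]) (auto simp: M_idx_def)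
qed

lemma cb_phi:
  assumes r0: "0 < r0" and P: "radial_basis t r0 rcut P" and m: "m \<in> M_idx l"
  shows "cb t (Omega r0) (phi r0 P n l m :: (real^3)^'n::finite \<Rightarrow> complex)"
proof -
  have "cb t (Omega r0) (\<lambda>R::(real^3)^'n. \<Prod>a\<in>UNIV. phi1 P (n a) (l a) (m a) (R $ a))"
    using m by (intro cb_prod nondegenerate_Omega phi1_lift_cb[OF r0 radial_basis_cb[OF P]]) (auto simp: M_idx_def)
  then show ?thesis by (subst cb_cong[where g = "\<lambda>R. \<Prod>a\<in>UNIV. phi1 P (n a) (l a) (m a) (R $ a)"]) (auto simp: phi_def)
qed

text \<open>The average of \<open>phi\<close> over the rotations. Its coefficients form column
  \<open>m\<close> of \<open>Dbar\<close>, hence a vector in the range.\<close>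

definition dphi :: "(real^3^3) measure \<Rightarrow> real \<Rightarrow> (nat \<Rightarrow> real \<Rightarrow> complex) \<Rightarrow> ('n::finite \<Rightarrow> nat) \<Rightarrow> ('n \<Rightarrow> nat) \<Rightarrow> ('n \<Rightarrow> int)
    \<Rightarrow> (real^3)^'n \<Rightarrow> complex"
  where "dphi H r0 P n l m R = (\<Sum>\<mu>\<in>M_idx l. Dbar H l \<mu> m * phi r0 P n l \<mu> R)"

definition dphis :: "(real^3^3) measure \<Rightarrow> real \<Rightarrow> (nat \<Rightarrow> real \<Rightarrow> complex) \<Rightarrow> ((real^3)^'n::finite \<Rightarrow> complex) set"
  where "dphis H r0 P = {dphi H r0 P n l m |n l m. m \<in> M_idx l}"

lemma capx_dphis:
  fixes f :: "(real^3)^'n::finite \<Rightarrow> complex"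
  assumes r0: "0 < r0" and P: "radial_basis t r0 rcut P" and H: "normalised_haar_SO3 H"
    and app: "capx t (Omega r0) (cfun.span (phis r0 P)) f" and fcb: "cb t (Omega r0) f"
    and inv: "\<And>Q R. orthogonal_matrix Q \<Longrightarrow> R \<in> Omega r0 \<Longrightarrow> f (rotate_pts Q R) = f R"
  shows "capx t (Omega r0) (cfun.span (dphis H r0 P)) f"
  unfolding capx_def
proof (intro allI impI)
  let ?S = "Omega r0 :: ((real^3)^'n) set"
  fix e :: real assume "e > 0"
  \<comment> \<open>The loss from composing with a rotation; starting from \<open>e / D\<close>
    makes up for it.\<close>
  define D where "D = real DIM((real^3)^'n) ^ t"
  have D: "D > 0" unfolding D_def using DIM_positive[where 'a = "(real^3)^'n"] by simp
  then have "e / D > 0" using \<open>e > 0\<close> by simp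
  then obtain g where g: "g \<in> cfun.span (phis r0 P)" "CB t ?S (e / D) (\<lambda>R. f R - g R)"
    using app unfolding capx_def by blast
  obtain T r where T: "finite T" "T \<subseteq> phis r0 P" "g = (\<Sum>b\<in>T. cscale (r b) b)"
    using g(1) unfolding cfun.span_explicit by blast
  have "\<forall>b\<in>T. \<exists>n l m. b = phi r0 P n l m \<and> m \<in> M_idx l" using T(2) by (auto simp: phis_def)
  then obtain n l m where b: "\<And>b. b \<in> T \<Longrightarrow> b = phi r0 P (n b) (l b) (m b) \<and> m b \<in> M_idx (l b)" by metis
  define I where "I = Sigma T (\<lambda>b. M_idx (l b))"
  have I: "finite I" unfolding I_def by (intro finite_SigmaI T finite_M_idx)
  \<comment> \<open>\<open>c\<close> collects what depends on the rotation and \<open>\<psi>\<close>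
    what depends on the configuration, as \<open>average_CB\<close> requires.\<close>
  define c where "c = (\<lambda>(b, \<mu>) Q. r b * wprod (l b) \<mu> (m b) Q)"
  define \<psi> where "\<psi> = (\<lambda>(b, \<mu>). phi r0 P (n b) (l b) \<mu>)"
  have sumI: "(\<Sum>i\<in>I. h i) = (\<Sum>b\<in>T. \<Sum>\<mu>\<in>M_idx (l b). h (b, \<mu>))" for h :: "_ \<Rightarrow> complex"
    unfolding I_def by (subst sum.Sigma) (auto simp: T finite_M_idx)
  have gQ: "g (rotate_pts Q R) = (\<Sum>i\<in>I. c i Q * \<psi> i R)" if Q: "orthogonal_matrix Q" and R: "R \<in> ?S" for Q R
  proof -
    have "g (rotate_pts Q R) = (\<Sum>b\<in>T. r b * b (rotate_pts Q R))"
      by (simp add: T(3) sum_fun_apply cscale_def)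
    also have "\<dots> = (\<Sum>b\<in>T. \<Sum>\<mu>\<in>M_idx (l b). r b * (wprod (l b) \<mu> (m b) Q * phi r0 P (n b) (l b) \<mu> R))"
    proof (rule sum.cong[OF refl])
      fix b' assume "b' \<in> T"
      then have "b' (rotate_pts Q R) = phi r0 P (n b') (l b') (m b') (rotate_pts Q R)" "m b' \<in> M_idx (l b')"
        using b[of b'] by auto
      then show "r b' * b' (rotate_pts Q R) =
          (\<Sum>\<mu>\<in>M_idx (l b'). r b' * (wprod (l b') \<mu> (m b') Q * phi r0 P (n b') (l b') \<mu> R))"
        by (simp only: phi_rotate[OF Q _ R r0] sum_distrib_left)
    qed
    finally show ?thesis by (simp add: sumI c_def \<psi>_def mult.assoc)
  qed
  have main: "CB t ?S e (\<lambda>R. f R - (\<Sum>i\<in>I. (\<integral>Q. c i Q \<partial>H) * \<psi> i R))"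
  proof (rule average_CB[OF nondegenerate_Omega haar_SO3(2,3)[OF H] I _ fcb])
    show "integrable H (c i)" if "i \<in> I" for i
      using that b by (auto simp: I_def c_def intro!: integrable_mult_right integrable_wprod[OF H])
    show "cb t ?S (\<psi> i)" if "i \<in> I" for i
      using that cb_phi[OF r0 P] by (auto simp: I_def \<psi>_def)
    fix Q assume "Q \<in> space H"
    then have Q: "orthogonal_matrix Q" using haar_SO3(1)[OF H] SO3_orthogonal by blast
    have "CB t ?S (D * (e / D)) (\<lambda>R. f (rotate_pts Q R) - g (rotate_pts Q R))"
      unfolding D_def using rotate_pts_Omega[OF Q]
      by (intro CB_isometry[OF nondegenerate_Omega rotate_pts_linear norm_rotate_pts[OF Q] _ g(2)[unfolded D_def]]) auto
    then show "CB t ?S e (\<lambda>R. f R - (\<Sum>i\<in>I. c i Q * \<psi> i R))"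
      using D by (subst CB_cong[where g = "\<lambda>R. f (rotate_pts Q R) - g (rotate_pts Q R)"]) (simp_all add: gQ[OF Q] inv[OF Q])
  qed
  define g' where "g' = (\<Sum>b\<in>T. cscale (r b) (dphi H r0 P (n b) (l b) (m b)))"
  have "g' \<in> cfun.span (dphis H r0 P)"
    unfolding g'_def using b by (intro cfun.span_sum cfun.span_scale cfun.span_base) (auto simp: dphis_def)
  moreover have "(\<Sum>i\<in>I. (\<integral>Q. c i Q \<partial>H) * \<psi> i R) = g' R" for R
  proof -
    have "integral\<^sup>L H (wprod l \<mu> m) = Dbar H l \<mu> m" for l \<mu> and m :: "'n \<Rightarrow> int"
      unfolding Dbar_def wprod_def[abs_def] ..
    then show ?thesis
      by (simp add: sumI c_def \<psi>_def g'_def sum_fun_apply cscale_def dphi_def sum_distrib_left mult.assoc)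
  qed
  ultimately show "\<exists>g\<in>cfun.span (dphis H r0 P). CB t ?S e (\<lambda>R. f R - g R)" using main by auto
qed

subsection \<open>Averaging over finite groups\<close>

text \<open>Both \<open>f\<close> and the error bound survive averaging over \<open>J\<close>, since the \<open>L j\<close> are isometries fixing \<open>f\<close>.\<close>

lemma capx_average:
  fixes f :: "'a::euclidean_space \<Rightarrow> complex" and L :: "'j \<Rightarrow> 'a \<Rightarrow> 'a"
  assumes S: "nondegenerate S" and V: "cfun.subspace V" and J: "finite J" "J \<noteq> {}"
    and L: "\<And>j. j \<in> J \<Longrightarrow> bounded_linear (L j)" "\<And>j x. j \<in> J \<Longrightarrow> norm (L j x) = norm x"
      "\<And>j x. j \<in> J \<Longrightarrow> x \<in> S \<Longrightarrow> L j x \<in> S"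
    and inv: "\<And>j x. j \<in> J \<Longrightarrow> x \<in> S \<Longrightarrow> f (L j x) = f x"
    and app: "capx t S (cfun.span B) f"
    and B: "\<And>b. b \<in> B \<Longrightarrow> \<exists>h\<in>V. \<forall>x\<in>S. (\<Sum>j\<in>J. b (L j x)) = h x"
  shows "capx t S V f"
  unfolding capx_def
proof (intro allI impI)
  fix e :: real assume "e > 0"
  define D where "D = real DIM('a) ^ t"
  have D: "D > 0" unfolding D_def using DIM_positive[where 'a = 'a] by simp
  then have "e / D > 0" using \<open>e > 0\<close> by simp
  then obtain g where g: "g \<in> cfun.span B" "CB t S (e / D) (\<lambda>x. f x - g x)"
    using app unfolding capx_def by blast
  have "\<exists>h\<in>V. \<forall>x\<in>S. (\<Sum>j\<in>J. g (L j x)) = h x"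
    using g(1)
  proof (induction rule: cfun.span_induct_alt)
    case base
    show ?case using cfun.subspace_0[OF V] by (intro bexI[of _ 0]) auto
  next
    case (step c x y)
    obtain hx hy where h: "hx \<in> V" "\<forall>v\<in>S. (\<Sum>j\<in>J. x (L j v)) = hx v" "hy \<in> V" "\<forall>v\<in>S. (\<Sum>j\<in>J. y (L j v)) = hy v"
      using step B by meson
    then show ?case
      using cfun.subspace_add[OF V cfun.subspace_scale[OF V h(1), of c] h(3)]
      by (intro bexI[of _ "cscale c hx + hy"]) (auto simp: cscale_def sum.distrib sum_distrib_left[symmetric])
  qed
  then obtain h where h: "h \<in> V" "\<And>x. x \<in> S \<Longrightarrow> (\<Sum>j\<in>J. g (L j x)) = h x" by blast
  define N where "N = complex_of_nat (card J)"
  have cJ: "card J > 0" using J by (simp add: card_gt_0_iff)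
  have N: "N \<noteq> 0" "norm (1 / N) = 1 / card J" using cJ by (auto simp: N_def norm_divide)
  have "CB t S (\<Sum>j\<in>J. e) (\<lambda>x. \<Sum>j\<in>J. f (L j x) - g (L j x))"
  proof (rule CB_sum[OF S J(1)])
    fix j assume j: "j \<in> J"
    have "CB t S (D * (e / D)) (\<lambda>x. f (L j x) - g (L j x))"
      unfolding D_def using L[OF j]
      by (intro CB_isometry[OF S _ _ _ g(2)[unfolded D_def]]) auto
    then show "CB t S e (\<lambda>x. f (L j x) - g (L j x))" using D by simp
  qed
  from CB_cmult[OF S this, of "1 / N"]
  have "CB t S e (\<lambda>x. 1 / N * (\<Sum>j\<in>J. f (L j x) - g (L j x)))"
    unfolding N(2) using cJ by simp
  then have "CB t S e (\<lambda>x. f x - cscale (1 / N) h x)"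
  proof (subst CB_cong)
    fix x assume x: "x \<in> S"
    have "(\<Sum>j\<in>J. f (L j x) - g (L j x)) = N * f x - h x"
      using h(2)[OF x] inv[OF _ x] by (simp add: sum_subtractf N_def)
    then show "f x - cscale (1 / N) h x = 1 / N * (\<Sum>j\<in>J. f (L j x) - g (L j x))"
      using N(1) by (simp add: cscale_def field_simps)
  qed
  then show "\<exists>g\<in>V. CB t S e (\<lambda>x. f x - g x)"
    using cfun.subspace_scale[OF V h(1)] by blast
qed

section \<open>Parity and permutation symmetry of the tensor products\<close>

lemma poly_leg_minus: "poly (leg l m) (- z) = (-1) ^ (l + m) * poly (leg l m) z"
proof -
  let ?k = "l + m"
  have "pcompose (rodrigues l) [:0, -1:] = rodrigues l"
    unfolding rodrigues_def pcompose_power by (simp add: pcompose_pCons)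
  then have "(pderiv ^^ ?k) (rodrigues l) = smult ((-1) ^ ?k) (pcompose ((pderiv ^^ ?k) (rodrigues l)) [:0, -1:])"
    using higher_pderiv_pcompose_linear[of ?k "rodrigues l" 0 "-1"] by simp
  then have "poly ((pderiv ^^ ?k) (rodrigues l)) (- z) = (-1) ^ ?k * poly ((pderiv ^^ ?k) (rodrigues l)) z"
    by (metis (no_types, lifting) poly_pcompose poly_pCons poly_0 poly_smult add.right_neutral mult_minus1_right mult_zero_right minus_minus add_0)
  then show ?thesis by (simp add: leg_rodrigues)
qed

text \<open>The Legendre factor contributes the parity of \<open>l + m\<close>, the azimuthal factor
  that of \<open>m\<close>.\<close>

lemma sph_harm_minus:
  assumes x: "norm x = 1" and m: "\<bar>m\<bar> \<le> int l"
  shows "sph_harm l m (- x) = (-1) ^ l * sph_harm l m x"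
proof -
  have nx: "norm (- x) = 1" using x by simp
  have xy: "xy (- x) = - xy x" by (simp add: xy_def complex_eq_iff)
  have sgn: "complex_of_real ((-1) ^ (l + k)) * (-1) ^ k = (-1) ^ l" for k
    by (simp add: power_add power_mult_distrib[symmetric])
  from m show ?thesis
  proof (cases rule: sph_harm_cases)
    case (1 k)
    have "sph_harm l m (- x) = (complex_of_real ((-1) ^ (l + k)) * (-1) ^ k) *
        (of_real (sphc l k * poly (leg l k) (x $ 3)) * xy x ^ k)"
      unfolding 1(2) sph_harm_pos[OF nx] xy by (simp add: poly_leg_minus power_minus[of "xy x"])
    then show ?thesis unfolding sgn 1(2) sph_harm_pos[OF x] .
  next
    case (2 k)
    have "sph_harm l m (- x) = (complex_of_real ((-1) ^ (l + k)) * (-1) ^ k) *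
        ((- 1) ^ k * of_real (sphc l k * poly (leg l k) (x $ 3)) * cnj (xy x) ^ k)"
      unfolding 2(3) sph_harm_neg[OF nx] xy by (simp add: poly_leg_minus power_minus[of "cnj (xy x)"])
    then show ?thesis unfolding sgn 2(3) sph_harm_neg[OF x] .
  qed
qed

lemma phi_minus:
  assumes r0: "0 < r0" and R: "R \<in> Omega r0" and m: "m \<in> M_idx l"
  shows "phi r0 P n l m (- R) = (-1) ^ (\<Sum>a\<in>UNIV. l a) * phi r0 P n l m R"
proof -
  have mR: "- R \<in> Omega r0" using R by (simp add: Omega_def)
  have "phi1 P (n a) (l a) (m a) ((- R) $ a) = (-1) ^ l a * phi1 P (n a) (l a) (m a) (R $ a)" for a
    using sph_harm_minus[OF norm_normalized[OF Omega_nth_nonzero[OF r0 R]], of "m a" "l a" a] m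
    by (simp add: phi1_def M_idx_def)
  then show ?thesis using R mR by (simp add: phi_def prod.distrib power_sum)
qed

lemma permute_pts_linear: "bounded_linear (permute_pts \<sigma> :: (real^3)^'n \<Rightarrow> (real^3)^'n)"
proof -
  have "linear (permute_pts \<sigma> :: (real^3)^'n \<Rightarrow> (real^3)^'n)"
    by (rule linearI) (simp_all add: permute_pts_def vec_eq_iff)
  then show ?thesis by (simp add: linear_conv_bounded_linear)
qed

lemma norm_permute_pts:
  assumes "\<sigma> permutes UNIV" shows "norm (permute_pts \<sigma> R) = norm R"
proof -
  have "(\<Sum>j\<in>UNIV. (norm (R $ \<sigma> j))\<^sup>2) = (\<Sum>j\<in>UNIV. (norm (R $ j))\<^sup>2)"
    using sum.permute[OF assms, of "\<lambda>j. (norm (R $ j))\<^sup>2"] by (simp add: comp_def)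
  then show ?thesis
    unfolding norm_vec_def[of "permute_pts \<sigma> R"] norm_vec_def[of R] permute_pts_nth L2_set_def by simp
qed

lemma permute_pts_Omega: "\<sigma> permutes UNIV \<Longrightarrow> permute_pts \<sigma> R \<in> Omega r0 \<longleftrightarrow> R \<in> Omega r0"
  unfolding Omega_def permute_pts_def by simp (metis permutes_surj surjE)

lemma phi_permute:
  assumes "\<sigma> permutes UNIV"
  shows "phi r0 P (n \<circ> \<sigma>) (l \<circ> \<sigma>) (m \<circ> \<sigma>) (permute_pts \<sigma> R) = phi r0 P n l m R"
  using prod.permute[OF assms, of "\<lambda>a. phi1 P (n a) (l a) (m a) (R $ a)"]
  by (simp add: phi_def permute_pts_Omega[OF assms] permute_pts_nth comp_def)

lemma phi_permute_inv:
  assumes "\<sigma> permutes UNIV"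
  shows "phi r0 P n l m (permute_pts \<sigma> R) = phi r0 P (n \<circ> inv \<sigma>) (l \<circ> inv \<sigma>) (m \<circ> inv \<sigma>) R"
proof -
  have "f \<circ> inv \<sigma> \<circ> \<sigma> = f" for f :: "_ \<Rightarrow> 'z"
    using permutes_inv_o(2)[OF assms] by (simp add: comp_assoc)
  then show ?thesis
    using phi_permute[OF assms, of r0 P "n \<circ> inv \<sigma>" "l \<circ> inv \<sigma>" "m \<circ> inv \<sigma>" R]
    by (simp add: comp_assoc permutes_inv_o(2)[OF assms])
qed

lemma permute_pts_compose: "permute_pts p (permute_pts q R) = permute_pts (q \<circ> p) R"
  by (simp add: permute_pts_def vec_eq_iff)

lemma M_idx_compose: "m \<in> M_idx l \<Longrightarrow> m \<circ> \<sigma> \<in> M_idx (l \<circ> \<sigma>)"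
  by (simp add: M_idx_def)

lemma sum_M_idx_permute:
  assumes \<tau>: "\<tau> permutes UNIV"
  shows "(\<Sum>\<mu>\<in>M_idx (l \<circ> \<tau>). h \<mu>) = (\<Sum>\<mu>\<in>M_idx l. h (\<mu> \<circ> \<tau>))"
proof (rule sum.reindex_bij_witness[where i = "\<lambda>\<mu>. \<mu> \<circ> \<tau>" and j = "\<lambda>\<mu>. \<mu> \<circ> inv \<tau>"])
  fix \<mu> assume "\<mu> \<in> M_idx (l \<circ> \<tau>)"
  then have "\<mu> \<circ> inv \<tau> \<in> M_idx (l \<circ> \<tau> \<circ> inv \<tau>)" by (rule M_idx_compose)
  then show "\<mu> \<circ> inv \<tau> \<in> M_idx l" by (simp add: comp_assoc permutes_inv_o(1)[OF \<tau>])
qed (auto simp: comp_assoc permutes_inv_o[OF \<tau>] M_idx_compose)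

lemma Dbar_permute:
  assumes \<tau>: "\<tau> permutes UNIV"
  shows "Dbar H (l \<circ> \<tau>) (\<mu> \<circ> \<tau>) (m \<circ> \<tau>) = Dbar H l \<mu> m"
proof -
  have "(\<Prod>a\<in>UNIV. wigner ((l \<circ> \<tau>) a) Q ((\<mu> \<circ> \<tau>) a) ((m \<circ> \<tau>) a)) = (\<Prod>a\<in>UNIV. wigner (l a) Q (\<mu> a) (m a))" for Q
    using prod.permute[OF \<tau>, of "\<lambda>a. wigner (l a) Q (\<mu> a) (m a)"] by (simp add: comp_def)
  then show ?thesis by (simp add: Dbar_def)
qed

text \<open>Relabelling the particles by \<open>\<tau>\<close> only reorders the sum over
  permutations; so every symmetrised sum already arises from an ordered pair.\<close>

lemma dphi_sym_permute:
  assumes \<tau>: "\<tau> permutes UNIV"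
  shows "(\<Sum>\<sigma> | \<sigma> permutes UNIV. dphi H r0 P (n \<circ> \<tau>) (l \<circ> \<tau>) (m \<circ> \<tau>) (permute_pts \<sigma> R)) =
    (\<Sum>\<sigma> | \<sigma> permutes UNIV. dphi H r0 P n l m (permute_pts \<sigma> R))"
proof -
  have "dphi H r0 P (n \<circ> \<tau>) (l \<circ> \<tau>) (m \<circ> \<tau>) (permute_pts (\<sigma> \<circ> \<tau>) R) = dphi H r0 P n l m (permute_pts \<sigma> R)" for \<sigma>
    unfolding dphi_def sum_M_idx_permute[OF \<tau>] Dbar_permute[OF \<tau>]
      permute_pts_compose[of \<tau> \<sigma>, symmetric] phi_permute[OF \<tau>] ..
  then show ?thesis
    by (subst sum_permutations_compose_right[OF \<tau>]) simp
qed

subsection \<open>The symmetric basis\<close>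

text \<open>Guarantees that the indices below \<open>nsym\<close> are among those for which the
  diagonalisation specifies an eigenvalue.\<close>

lemma mat_rank_le: "mat_rank {..<k} G \<le> k"
proof -
  define col where "col j = (\<lambda>i. if i < k then G i j else 0)" for j
  have "mat_range {..<k} G \<subseteq> cfun.span (col ` {..<k})"
  proof
    fix x assume "x \<in> mat_range {..<k} G"
    then obtain c where "x = (\<lambda>i. if i \<in> {..<k} then \<Sum>j\<in>{..<k}. G i j * c j else 0)"
      unfolding mat_range_def by blast
    then have "x = (\<Sum>j\<in>{..<k}. cscale (c j) (col j))"
      by (auto simp: fun_eq_iff sum_fun_apply cscale_def col_def mult.commute)
    also have "\<dots> \<in> cfun.span (col ` {..<k})"
      by (intro cfun.span_sum cfun.span_scale cfun.span_base) auto
    finally show "x \<in> cfun.span (col ` {..<k})" .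
  qed
  then have "mat_rank {..<k} G \<le> card (col ` {..<k})"
    unfolding mat_rank_def by (rule cfun.dim_le_card) simp
  also have "\<dots> \<le> k" using card_image_le[of "{..<k}" col] by simp
  finally show ?thesis .
qed

lemma phi_permute_phis:
  assumes "m \<in> M_idx l" "\<sigma> permutes UNIV"
  shows "(\<lambda>R. phi r0 P n l m (permute_pts \<sigma> R)) \<in> phis r0 P"
  unfolding phis_def phi_permute_inv[OF assms(2)] using M_idx_compose[OF assms(1), of "inv \<sigma>"] by blast

text \<open>Separating the coefficient vector \<open>v\<close> makes linearity in it available, so
  that arguments about the range of \<open>Dbar\<close> carry over to functions.\<close>

definition sym_sum :: "real \<Rightarrow> (nat \<Rightarrow> real \<Rightarrow> complex) \<Rightarrow> ('n::finite \<Rightarrow> nat) \<Rightarrow> ('n \<Rightarrow> nat) \<Rightarrow> (('n \<Rightarrow> int) \<Rightarrow> complex)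
    \<Rightarrow> ((real, 3) vec, 'n) vec \<Rightarrow> complex"
  where "sym_sum r0 P n l v = (\<lambda>R. \<Sum>\<sigma> | \<sigma> permutes UNIV. \<Sum>m\<in>M_idx l. v m * phi r0 P n l m (permute_pts \<sigma> R))"

lemma Btilde_sym_sum: "Btilde r0 P Ut n l i = sym_sum r0 P n l (Ut l i)"
  by (simp add: Btilde_def sym_sum_def)

lemma sym_sum_linear:
  "sym_sum r0 P n l (x + y) = sym_sum r0 P n l x + sym_sum r0 P n l y"
  "sym_sum r0 P n l (cscale c x) = cscale c (sym_sum r0 P n l x)"
  by (simp_all add: sym_sum_def fun_eq_iff cscale_def sum_distrib_left distrib_right sum.distrib mult.assoc)

lemma sym_sum_explicit:
  "sym_sum r0 P n l v = (\<Sum>p\<in>{\<sigma>. \<sigma> permutes UNIV} \<times> M_idx l.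
    cscale (v (snd p)) (\<lambda>R. phi r0 P n l (snd p) (permute_pts (fst p) R)))"
proof
  fix R
  show "sym_sum r0 P n l v R = (\<Sum>p\<in>{\<sigma>. \<sigma> permutes UNIV} \<times> M_idx l.
    cscale (v (snd p)) (\<lambda>R. phi r0 P n l (snd p) (permute_pts (fst p) R))) R"
    unfolding sym_sum_def sum_fun_apply
    by (simp add: sum.cartesian_product cscale_def split_beta)
qed

lemma finite_perm_M_idx: "finite ({\<sigma>. \<sigma> permutes (UNIV :: 'n set)} \<times> M_idx (l :: 'n::finite \<Rightarrow> nat))"
  by (intro finite_cartesian_product finite_permutations finite_M_idx) simp

lemma sym_sum_span: "sym_sum r0 P n l v \<in> cfun.span (phis r0 P)"
  unfolding sym_sum_explicit
  by (intro cfun.span_sum cfun.span_scale cfun.span_base phi_permute_phis) auto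

text \<open>The products in both sums are basis elements, so they are orthogonal unless equal.
  Equality would make the two pairs relabellings of each other, hence equal, as both are
  ordered.\<close>

lemma coeff_inner_sym_sum_distinct:
  fixes n l :: "'n::{finite,linorder} \<Rightarrow> nat"
  assumes A: "cfun.independent (phis r0 P :: (((real, 3) vec, 'n) vec \<Rightarrow> complex) set)"
    and inj: "indep_family (\<lambda>(n, l, m). phi r0 P n l m :: ((real, 3) vec, 'n) vec \<Rightarrow> complex) {(n, l, m). m \<in> M_idx l}"
    and o: "ordered_pair n l" "ordered_pair n' l'" and ne: "(n, l) \<noteq> (n', l')"
  shows "coeff_inner (phis r0 P) (sym_sum r0 P n l v) (sym_sum r0 P n' l' v') = 0"
proof -
  have zero: "coeff_inner (phis r0 P) (\<lambda>R. phi r0 P n l m (permute_pts \<sigma> R)) (\<lambda>R. phi r0 P n' l' m' (permute_pts \<sigma>' R)) = 0"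
    if m: "m \<in> M_idx l" "m' \<in> M_idx l'" and s: "\<sigma> permutes UNIV" "\<sigma>' permutes UNIV" for m m' \<sigma> \<sigma>'
  proof -
    have "(\<lambda>R. phi r0 P n l m (permute_pts \<sigma> R)) \<noteq> (\<lambda>R. phi r0 P n' l' m' (permute_pts \<sigma>' R))"
    proof
      assume "(\<lambda>R. phi r0 P n l m (permute_pts \<sigma> R)) = (\<lambda>R. phi r0 P n' l' m' (permute_pts \<sigma>' R))"
      then have "(phi r0 P (n \<circ> inv \<sigma>) (l \<circ> inv \<sigma>) (m \<circ> inv \<sigma>) :: ((real, 3) vec, 'n) vec \<Rightarrow> complex) =
          phi r0 P (n' \<circ> inv \<sigma>') (l' \<circ> inv \<sigma>') (m' \<circ> inv \<sigma>')"
        by (simp add: phi_permute_inv[OF s(1)] phi_permute_inv[OF s(2)] fun_eq_iff)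
      moreover have "inj_on (\<lambda>(n, l, m). phi r0 P n l m :: ((real, 3) vec, 'n) vec \<Rightarrow> complex) {(n, l, m). m \<in> M_idx l}"
        using inj by (simp add: indep_family_def)
      ultimately have "(n \<circ> inv \<sigma>, l \<circ> inv \<sigma>, m \<circ> inv \<sigma>) = (n' \<circ> inv \<sigma>', l' \<circ> inv \<sigma>', m' \<circ> inv \<sigma>')"
        using M_idx_compose[OF m(1)] M_idx_compose[OF m(2)] by (elim inj_onD) auto
      then have eq: "n \<circ> inv \<sigma> = n' \<circ> inv \<sigma>'" "l \<circ> inv \<sigma> = l' \<circ> inv \<sigma>'" by auto
      \<comment> \<open>Composing the two relabellings gives one permutation that carries
        \<open>(n, l)\<close> to \<open>(n', l')\<close>.\<close>
      define \<tau> where "\<tau> = inv \<sigma> \<circ> \<sigma>'"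
      have \<tau>: "\<tau> permutes UNIV" unfolding \<tau>_def by (intro permutes_compose permutes_inv s)
      have "n \<circ> \<tau> = (n' \<circ> inv \<sigma>') \<circ> \<sigma>'" "l \<circ> \<tau> = (l' \<circ> inv \<sigma>') \<circ> \<sigma>'"
        unfolding \<tau>_def eq[symmetric] by (simp_all add: comp_assoc)
      then have "n \<circ> \<tau> = n'" "l \<circ> \<tau> = l'"
        by (simp_all add: comp_assoc permutes_inv_o(2)[OF s(2)])
      then show False using ordered_pair_unique[OF \<tau> o(1)] o(2) ne by auto
    qed
    then show ?thesis
      using coeff_inner_basis[OF A phi_permute_phis[OF m(1) s(1)] phi_permute_phis[OF m(2) s(2)]] by simp
  qed
  have sp: "(\<lambda>R. phi r0 P n l (snd p) (permute_pts (fst p) R)) \<in> cfun.span (phis r0 P)"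
    if "p \<in> {\<sigma>. \<sigma> permutes UNIV} \<times> M_idx l" for p and n l :: "'n \<Rightarrow> nat"
    using that by (intro cfun.span_base phi_permute_phis) auto
  have "coeff_inner (phis r0 P) (\<lambda>R. phi r0 P n l (snd p) (permute_pts (fst p) R)) (sym_sum r0 P n' l' v') = 0"
    if p: "p \<in> {\<sigma>. \<sigma> permutes UNIV} \<times> M_idx l" for p
  proof -
    have "coeff_inner (phis r0 P) (\<lambda>R. phi r0 P n l (snd p) (permute_pts (fst p) R)) (sym_sum r0 P n' l' v') =
        (\<Sum>q\<in>{\<sigma>. \<sigma> permutes UNIV} \<times> M_idx l'. cnj (v' (snd q)) *
          coeff_inner (phis r0 P) (\<lambda>R. phi r0 P n l (snd p) (permute_pts (fst p) R))
            (\<lambda>R. phi r0 P n' l' (snd q) (permute_pts (fst q) R)))"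
      unfolding sym_sum_explicit[of r0 P n'] by (rule coeff_inner_sum_right[OF A finite_perm_M_idx sp])
    also have "\<dots> = 0" using p by (intro sum.neutral ballI) (auto simp: zero)
    finally show ?thesis .
  qed
  moreover have "coeff_inner (phis r0 P) (sym_sum r0 P n l v) (sym_sum r0 P n' l' v') =
      (\<Sum>p\<in>{\<sigma>. \<sigma> permutes UNIV} \<times> M_idx l. v (snd p) *
        coeff_inner (phis r0 P) (\<lambda>R. phi r0 P n l (snd p) (permute_pts (fst p) R)) (sym_sum r0 P n' l' v'))"
    unfolding sym_sum_explicit[of r0 P n l] by (rule coeff_inner_sum_left[OF A finite_perm_M_idx sp])
  ultimately show ?thesis by simp
qed

lemma coeff_inner_add_right:
  assumes "cfun.independent A" "f \<in> cfun.span A" "f' \<in> cfun.span A"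
  shows "coeff_inner A g (f + f') = coeff_inner A g f + coeff_inner A g f'"
proof -
  have "coeff_inner A g (f + f') = cnj (coeff_inner A (f + f') g)" by (rule coeff_inner_cnj[OF assms(1)])
  also have "\<dots> = cnj (coeff_inner A f g) + cnj (coeff_inner A f' g)"
    by (simp only: coeff_inner_add_left[OF assms] complex_cnj_add)
  finally show ?thesis by (simp only: coeff_inner_cnj[OF assms(1), of g, symmetric])
qed

text \<open>The inner product is linear in its first argument, which is why combinations with the
  conjugated entries of \<open>V\<close> diagonalise the Gram matrix.\<close>

lemma gram_diagonalisation:
  fixes b :: "nat \<Rightarrow> 'a \<Rightarrow> complex" and V :: "nat \<Rightarrow> nat \<Rightarrow> complex" and s :: "nat \<Rightarrow> real"
    and k :: nat
  defines "d \<equiv> \<lambda>i. \<Sum>\<alpha><k. cscale (cnj (V \<alpha> i)) (b \<alpha>)"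
  assumes A: "cfun.independent A" and b: "\<And>\<alpha>. \<alpha> < k \<Longrightarrow> b \<alpha> \<in> cfun.span A"
    and V: "\<And>i j. i < k \<Longrightarrow> j < k \<Longrightarrow> (\<Sum>a<k. cnj (V a i) * V a j) = (if i = j then 1 else 0)"
    and G: "\<And>\<alpha> \<beta>. \<alpha> < k \<Longrightarrow> \<beta> < k \<Longrightarrow> coeff_inner A (b \<alpha>) (b \<beta>) = (\<Sum>a<k. V \<alpha> a * of_real (s a) * cnj (V \<beta> a))"
  shows "i < k \<Longrightarrow> j < k \<Longrightarrow> coeff_inner A (d i) (d j) = (if i = j then of_real (s i) else 0)"
    and "\<alpha> < k \<Longrightarrow> b \<alpha> = (\<Sum>i<k. cscale (V \<alpha> i) (d i))"
proof -
  have d: "d i = (\<Sum>\<alpha><k. cscale (cnj (V \<alpha> i)) (b \<alpha>))" for i by (simp add: d_def)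
  have dspan: "d i \<in> cfun.span A" for i
    unfolding d_def using b by (intro cfun.span_sum cfun.span_scale) auto
  have bd: "coeff_inner A (b \<alpha>) (d j) = V \<alpha> j * of_real (s j)" if "\<alpha> < k" "j < k" for \<alpha> j
  proof -
    have "coeff_inner A (b \<alpha>) (d j) = (\<Sum>\<beta><k. V \<beta> j * coeff_inner A (b \<alpha>) (b \<beta>))"
      unfolding d_def using b by (subst coeff_inner_sum_right[OF A]) auto
    also have "\<dots> = (\<Sum>\<beta><k. \<Sum>a<k. V \<alpha> a * of_real (s a) * (cnj (V \<beta> a) * V \<beta> j))"
      using that by (intro sum.cong refl) (simp add: G sum_distrib_left mult_ac)
    also have "\<dots> = (\<Sum>a<k. V \<alpha> a * of_real (s a) * (\<Sum>\<beta><k. cnj (V \<beta> a) * V \<beta> j))"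
      by (subst sum.swap) (simp add: sum_distrib_left)
    also have "\<dots> = (\<Sum>a<k. if a = j then V \<alpha> a * of_real (s a) else 0)"
      using that by (intro sum.cong refl) (simp add: V)
    also have "\<dots> = V \<alpha> j * of_real (s j)" using that by simp
    finally show ?thesis .
  qed
  have dd: "coeff_inner A (d i) (d j) = (if i = j then of_real (s i) else 0)" if "i < k" "j < k" for i j
  proof -
    have "coeff_inner A (d i) (d j) = (\<Sum>\<alpha><k. cnj (V \<alpha> i) * coeff_inner A (b \<alpha>) (d j))"
      unfolding d[of i] using b by (subst coeff_inner_sum_left[OF A]) auto
    also have "\<dots> = (\<Sum>\<alpha><k. cnj (V \<alpha> i) * V \<alpha> j) * of_real (s j)"
      using that by (simp add: bd sum_distrib_right mult.assoc)
    finally show ?thesis using that by (auto simp: V)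
  qed
  then show "i < k \<Longrightarrow> j < k \<Longrightarrow> coeff_inner A (d i) (d j) = (if i = j then of_real (s i) else 0)" .
  assume \<alpha>: "\<alpha> < k"
  \<comment> \<open>The columns of \<open>V\<close> are known to be orthonormal, while inverting the
    definition of \<open>d\<close> corresponds to orthonormal rows. Instead, the difference of
    \<open>b \<alpha>\<close> and \<open>y\<close> is shown to have norm 0: all four inner products
    equal \<open>q\<close>.\<close>
  define y where "y = (\<Sum>i<k. cscale (V \<alpha> i) (d i))"
  define q where "q = (\<Sum>i<k. V \<alpha> i * of_real (s i) * cnj (V \<alpha> i))"
  have yspan: "y \<in> cfun.span A" unfolding y_def using dspan by (intro cfun.span_sum cfun.span_scale) auto
  have bb: "coeff_inner A (b \<alpha>) (b \<alpha>) = q" using \<alpha> by (simp add: G q_def)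
  have "coeff_inner A (b \<alpha>) y = (\<Sum>i<k. cnj (V \<alpha> i) * coeff_inner A (b \<alpha>) (d i))"
    unfolding y_def using dspan by (subst coeff_inner_sum_right[OF A]) auto
  also have "\<dots> = q" unfolding q_def using \<alpha> by (intro sum.cong refl) (simp add: bd)
  finally have byq: "coeff_inner A (b \<alpha>) y = q" .
  have "cnj q = q" by (simp add: q_def mult_ac)
  then have yb: "coeff_inner A y (b \<alpha>) = q" using coeff_inner_cnj[OF A, of y "b \<alpha>"] byq by simp
  have dy: "coeff_inner A (d i) y = cnj (V \<alpha> i) * of_real (s i)" if "i < k" for i
  proof -
    have "coeff_inner A (d i) y = (\<Sum>j<k. cnj (V \<alpha> j) * coeff_inner A (d i) (d j))"
      unfolding y_def using dspan by (subst coeff_inner_sum_right[OF A]) auto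
    also have "\<dots> = (\<Sum>j<k. if j = i then cnj (V \<alpha> j) * of_real (s i) else 0)"
      using that by (intro sum.cong refl) (auto simp: dd)
    finally show ?thesis using that by simp
  qed
  have "coeff_inner A y y = (\<Sum>i<k. V \<alpha> i * coeff_inner A (d i) y)"
    by (subst (1) y_def, subst coeff_inner_sum_left[OF A]) (use dspan in auto)
  also have "\<dots> = q" unfolding q_def by (intro sum.cong refl) (simp add: dy)
  finally have yy: "coeff_inner A y y = q" .
  have my: "cscale (-1) y \<in> cfun.span A" by (rule cfun.span_scale[OF yspan])
  have "coeff_inner A (b \<alpha> + cscale (-1) y) (b \<alpha> + cscale (-1) y) = 0"
    using \<alpha> by (simp only: coeff_inner_add_left[OF A b my] coeff_inner_add_right[OF A b my]
        coeff_inner_scale_left[OF A yspan] coeff_inner_scale_right[OF A yspan] bb byq yb yy) simp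
  then have "b \<alpha> + cscale (-1) y = 0"
    using coeff_inner_definite[OF A cfun.span_add[OF b[OF \<alpha>] my]] by blast
  then have "b \<alpha> = y" by (auto simp: fun_eq_iff cscale_def)
  then show "b \<alpha> = (\<Sum>i<k. cscale (V \<alpha> i) (d i))" by (simp add: y_def)
qed

section \<open>The basis functions and their span\<close>

context
  fixes t :: nat and r0 rcut :: real
    and P :: "nat \<Rightarrow> real \<Rightarrow> complex"
    and H :: "(real^3^3) measure"
    and Ut :: "('n::{finite,linorder} \<Rightarrow> nat) \<Rightarrow> nat \<Rightarrow> ('n \<Rightarrow> int) \<Rightarrow> complex"
    and V :: "('n \<Rightarrow> nat) \<Rightarrow> ('n \<Rightarrow> nat) \<Rightarrow> nat \<Rightarrow> nat \<Rightarrow> complex"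
    and s :: "('n \<Rightarrow> nat) \<Rightarrow> ('n \<Rightarrow> nat) \<Rightarrow> nat \<Rightarrow> real"
  assumes r0: "0 < r0" and rc: "r0 < rcut"
    and P: "radial_basis t r0 rcut P"
    and H: "normalised_haar_SO3 H"
    and Ut: "\<And>l. orthonormal_vectors_spanning (M_idx l) (ntilde H l) (Ut l)
               (mat_range (M_idx l) (Dbar H l))"
    and V: "\<And>n l. unitary_diagonalisation (ntilde H l) (gram r0 P Ut n l) (V n l) (s n l)"
begin

text \<open>The orthogonal functions before scaling. Those with eigenvalue 0 are included so that
  the inversion formula for \<open>Btilde\<close> is available.\<close>

definition Bfull :: "('n \<Rightarrow> nat) \<Rightarrow> ('n \<Rightarrow> nat) \<Rightarrow> nat \<Rightarrow> ((real, 3) vec, 'n) vec \<Rightarrow> complex"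
  where "Bfull n l i = (\<Sum>\<alpha><ntilde H l. cscale (cnj (V n l \<alpha> i)) (Btilde r0 P Ut n l \<alpha>))"

lemma phis_independent: "cfun.independent (phis r0 P :: (((real, 3) vec, 'n) vec \<Rightarrow> complex) set)"
  using indep_family_phi[OF r0 P, where 'n = 'n] by (simp add: indep_family_def phis_image)

lemma Bsym_Bfull: "Bsym H r0 P Ut V s (n, l, i) = cscale (of_real (1 / sqrt (s n l i))) (Bfull n l i)"
proof
  fix R
  have "Bsym H r0 P Ut V s (n, l, i) R = (\<Sum>m\<in>M_idx l. \<Sum>\<sigma> | \<sigma> permutes UNIV. \<Sum>\<alpha><ntilde H l.
      of_real (1 / sqrt (s n l i)) * (cnj (V n l \<alpha> i) * (Ut l \<alpha> m * phi r0 P n l m (permute_pts \<sigma> R))))"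
    unfolding Bsym_def Ucoef_def prod.case sum_distrib_left sum_distrib_right
    by (intro sum.cong[OF refl]) (simp only: mult_ac)
  also have "\<dots> = (\<Sum>m\<in>M_idx l. \<Sum>\<alpha><ntilde H l. \<Sum>\<sigma> | \<sigma> permutes UNIV.
      of_real (1 / sqrt (s n l i)) * (cnj (V n l \<alpha> i) * (Ut l \<alpha> m * phi r0 P n l m (permute_pts \<sigma> R))))"
    by (intro sum.cong[OF refl] sum.swap)
  also have "\<dots> = (\<Sum>\<alpha><ntilde H l. \<Sum>m\<in>M_idx l. \<Sum>\<sigma> | \<sigma> permutes UNIV.
      of_real (1 / sqrt (s n l i)) * (cnj (V n l \<alpha> i) * (Ut l \<alpha> m * phi r0 P n l m (permute_pts \<sigma> R))))"
    by (rule sum.swap)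
  also have "\<dots> = (\<Sum>\<alpha><ntilde H l. \<Sum>\<sigma> | \<sigma> permutes UNIV. \<Sum>m\<in>M_idx l.
      of_real (1 / sqrt (s n l i)) * (cnj (V n l \<alpha> i) * (Ut l \<alpha> m * phi r0 P n l m (permute_pts \<sigma> R))))"
    by (intro sum.cong[OF refl] sum.swap)
  also have "\<dots> = cscale (of_real (1 / sqrt (s n l i))) (Bfull n l i) R"
    by (simp add: Bfull_def Btilde_def cscale_def sum_fun_apply sum_distrib_left)
  finally show "Bsym H r0 P Ut V s (n, l, i) R = cscale (of_real (1 / sqrt (s n l i))) (Bfull n l i) R" .
qed

lemma Bfull_sym_sum: "Bfull n l i = sym_sum r0 P n l (\<lambda>m. \<Sum>\<alpha><ntilde H l. cnj (V n l \<alpha> i) * Ut l \<alpha> m)"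
proof -
  have "sym_sum r0 P n l (\<lambda>m. \<Sum>\<alpha>\<in>I. c \<alpha> * Ut l \<alpha> m) = (\<Sum>\<alpha>\<in>I. cscale (c \<alpha>) (sym_sum r0 P n l (Ut l \<alpha>)))"
    if "finite I" for I c
    using that
  proof (induction I rule: finite_induct)
    case empty
    show ?case by (simp add: sym_sum_def fun_eq_iff)
  next
    case (insert \<beta> I)
    have "(\<lambda>m. \<Sum>\<alpha>\<in>insert \<beta> I. c \<alpha> * Ut l \<alpha> m) = cscale (c \<beta>) (Ut l \<beta>) + (\<lambda>m. \<Sum>\<alpha>\<in>I. c \<alpha> * Ut l \<alpha> m)"
      using insert.hyps by (simp add: fun_eq_iff cscale_def)
    then show ?case unfolding sum.insert[OF insert.hyps] by (simp only: sym_sum_linear insert.IH)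
  qed
  then show ?thesis by (simp add: Bfull_def Btilde_sym_sum)
qed

lemma Bfull_span: "Bfull n l i \<in> cfun.span (phis r0 P)"
  unfolding Bfull_sym_sum by (rule sym_sum_span)

lemma Bfull_inner:
  assumes "i < ntilde H l" "j < ntilde H l"
  shows "coeff_inner (phis r0 P) (Bfull n l i) (Bfull n l j) = (if i = j then of_real (s n l i) else 0)"
    and "Btilde r0 P Ut n l i = (\<Sum>j<ntilde H l. cscale (V n l i j) (Bfull n l j))"
proof -
  have sp: "\<And>\<alpha>. \<alpha> < ntilde H l \<Longrightarrow> Btilde r0 P Ut n l \<alpha> \<in> cfun.span (phis r0 P)"
    unfolding Btilde_sym_sum by (rule sym_sum_span)
  have U: "\<And>i j. i < ntilde H l \<Longrightarrow> j < ntilde H l \<Longrightarrow>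
      (\<Sum>a<ntilde H l. cnj (V n l a i) * V n l a j) = (if i = j then 1 else 0)"
    using V[of l n] by (simp add: unitary_diagonalisation_def)
  have G: "\<And>i j. i < ntilde H l \<Longrightarrow> j < ntilde H l \<Longrightarrow>
      coeff_inner (phis r0 P) (Btilde r0 P Ut n l i) (Btilde r0 P Ut n l j) =
      (\<Sum>a<ntilde H l. V n l i a * of_real (s n l a) * cnj (V n l j a))"
    using V[of l n] by (simp add: unitary_diagonalisation_def gram_def tensor_inner_phis)
  show "coeff_inner (phis r0 P) (Bfull n l i) (Bfull n l j) = (if i = j then of_real (s n l i) else 0)"
    unfolding Bfull_def by (rule gram_diagonalisation(1)[OF phis_independent sp U G assms])
  show "Btilde r0 P Ut n l i = (\<Sum>j<ntilde H l. cscale (V n l i j) (Bfull n l j))"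
    unfolding Bfull_def by (rule gram_diagonalisation(2)[OF phis_independent sp U G assms(1)])
qed

lemma eigenvalues:
  assumes "i < ntilde H l"
  shows "i < nsym H r0 P Ut n l \<Longrightarrow> 0 < s n l i" "\<not> i < nsym H r0 P Ut n l \<Longrightarrow> s n l i = 0"
  using V[of l n] assms by (auto simp: unitary_diagonalisation_def nsym_def)

lemma nsym_le: "nsym H r0 P Ut n l \<le> ntilde H l"
  unfolding nsym_def by (rule mat_rank_le)

lemma Bsym_span_phis: "Bsym H r0 P Ut V s k \<in> cfun.span (phis r0 P)"
  by (cases k) (simp add: Bsym_Bfull cfun.span_scale Bfull_span)

lemma Bsym_orthonormal:
  assumes a: "a \<in> Bindex H r0 P Ut" and b: "b \<in> Bindex H r0 P Ut"
  shows "coeff_inner (phis r0 P) (Bsym H r0 P Ut V s a) (Bsym H r0 P Ut V s b) = (if a = b then 1 else 0)"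
proof -
  obtain n l i where a': "a = (n, l, i)" "ordered_pair n l" "i < nsym H r0 P Ut n l" using a by (auto simp: Bindex_def)
  obtain n' l' j where b': "b = (n', l', j)" "ordered_pair n' l'" "j < nsym H r0 P Ut n' l'" using b by (auto simp: Bindex_def)
  have eq: "coeff_inner (phis r0 P) (Bsym H r0 P Ut V s a) (Bsym H r0 P Ut V s b) =
      of_real (1 / sqrt (s n l i)) * of_real (1 / sqrt (s n' l' j)) *
      coeff_inner (phis r0 P) (Bfull n l i) (Bfull n' l' j)"
    unfolding a'(1) b'(1) Bsym_Bfull
      coeff_inner_scale_left[OF phis_independent Bfull_span] coeff_inner_scale_right[OF phis_independent Bfull_span]
    by simp
  show ?thesis
  proof (cases "(n, l) = (n', l')")
    case False
    have "coeff_inner (phis r0 P) (Bfull n l i) (Bfull n' l' j) = 0"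
      unfolding Bfull_sym_sum
      by (rule coeff_inner_sym_sum_distinct[OF phis_independent indep_family_phi[OF r0 P] a'(2) b'(2) False])
    then show ?thesis using eq False a'(1) b'(1) by auto
  next
    case True
    have i: "i < ntilde H l" "j < ntilde H l" using a'(3) b'(3) nsym_le[of n l] True by auto
    have si: "0 < s n l i" using eigenvalues(1)[OF i(1)] a'(3) by simp
    have "of_real (1 / sqrt (s n l i)) * of_real (1 / sqrt (s n l i)) * complex_of_real (s n l i) = 1"
      unfolding of_real_mult[symmetric] using si by simp
    moreover have "coeff_inner (phis r0 P) (Bsym H r0 P Ut V s a) (Bsym H r0 P Ut V s b) =
      of_real (1 / sqrt (s n l i)) * of_real (1 / sqrt (s n l j)) * (if i = j then of_real (s n l i) else 0)"
      using eq True Bfull_inner(1)[OF i, of n] by simp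
    moreover have "a = b \<longleftrightarrow> i = j" using True a'(1) b'(1) by simp
    ultimately show ?thesis by (cases "i = j") simp_all
  qed
qed

lemma phi_Ct_cut:
  assumes m: "m \<in> M_idx l"
  shows "(phi r0 P n l m :: ((real, 3) vec, 'n) vec \<Rightarrow> complex) \<in> Ct_cut t r0 rcut"
proof -
  have "phi r0 P n l m R = 0" if "norm (R $ j) \<ge> rcut" for R :: "((real, 3) vec, 'n) vec" and j
  proof -
    have "P (n j) (norm (R $ j)) = 0" using P that by (auto simp: radial_basis_def radial_Ct_cut_def)
    then have "phi1 P (n j) (l j) (m j) (R $ j) = 0" by (simp add: phi1_def)
    then have "(\<Prod>a\<in>UNIV. phi1 P (n a) (l a) (m a) (R $ a)) = 0" by (intro prod_zero) auto
    then show ?thesis unfolding phi_def by simp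
  qed
  moreover have "\<exists>M. CB t (Omega r0) M (phi r0 P n l m :: ((real, 3) vec, 'n) vec \<Rightarrow> complex)"
    using cb_phi[OF r0 P m] by (simp add: cb_def)
  moreover have "phi r0 P n l m R = 0" if "R \<notin> Omega r0" for R :: "((real, 3) vec, 'n) vec"
    using that by (simp add: phi_def)
  ultimately show ?thesis unfolding Ct_cut_def Ct_iff by blast
qed

lemma span_phis_Ct_cut:
  assumes "g \<in> cfun.span (phis r0 P)"
  shows "(g :: ((real, 3) vec, 'n) vec \<Rightarrow> complex) \<in> Ct_cut t r0 rcut"
  using assms
proof (induction rule: cfun.span_induct_alt)
  case base
  have "cb t (Omega r0) (\<lambda>R::((real, 3) vec, 'n) vec. 0)" by (rule cb_const[OF nondegenerate_Omega])
  then show ?case by (auto simp: Ct_cut_def Ct_iff cb_def zero_fun_def)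
next
  case (step c x y)
  have x: "x \<in> Ct_cut t r0 rcut" using step(1) phi_Ct_cut by (auto simp: phis_def)
  have "cb t (Omega r0) (\<lambda>R. c * x R + y R)"
    using x step(2) by (intro cb_add cb_cmult nondegenerate_Omega) (auto simp: Ct_cut_def Ct_iff cb_def)
  moreover have "cscale c x + y = (\<lambda>R. c * x R + y R)" by (auto simp: cscale_def)
  ultimately show ?case using x step(2) by (auto simp: Ct_cut_def Ct_iff cb_def)
qed

lemma Bfull_span_Bsym:
  assumes "ordered_pair n l" "even (\<Sum>a\<in>UNIV. l a)" "i < ntilde H l"
  shows "Bfull n l i \<in> cfun.span (Bsym H r0 P Ut V s ` Bindex H r0 P Ut)"
proof (cases "i < nsym H r0 P Ut n l")
  case True
  then have "(n, l, i) \<in> Bindex H r0 P Ut" using assms by (simp add: Bindex_def)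
  then have "cscale (of_real (sqrt (s n l i))) (Bsym H r0 P Ut V s (n, l, i)) \<in> cfun.span (Bsym H r0 P Ut V s ` Bindex H r0 P Ut)"
    by (intro cfun.span_scale cfun.span_base) auto
  moreover have "cscale (of_real (sqrt (s n l i))) (Bsym H r0 P Ut V s (n, l, i)) = Bfull n l i"
    using eigenvalues(1)[OF assms(3) True] by (simp add: Bsym_Bfull cscale_def fun_eq_iff)
  ultimately show ?thesis by simp
next
  case False
  then have "coeff_inner (phis r0 P) (Bfull n l i) (Bfull n l i) = 0"
    using Bfull_inner(1)[OF assms(3,3)] eigenvalues(2)[OF assms(3)] by simp
  then have "Bfull n l i = 0" by (rule coeff_inner_definite[OF phis_independent Bfull_span])
  then show ?thesis using cfun.span_zero by simp
qed

lemma sym_sum_span_Bsym: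
  assumes o: "ordered_pair n l" "even (\<Sum>a\<in>UNIV. l a)" and v: "v \<in> cfun.span (Ut l ` {..<ntilde H l})"
  shows "sym_sum r0 P n l v \<in> cfun.span (Bsym H r0 P Ut V s ` Bindex H r0 P Ut)"
  using v
proof (induction rule: cfun.span_induct_alt)
  case base
  have "sym_sum r0 P n l 0 = 0" by (simp add: sym_sum_def fun_eq_iff)
  then show ?case by (simp only: cfun.span_zero)
next
  case (step c x y)
  then obtain i where i: "i < ntilde H l" "x = Ut l i" by auto
  have "Btilde r0 P Ut n l i \<in> cfun.span (Bsym H r0 P Ut V s ` Bindex H r0 P Ut)"
    unfolding Bfull_inner(2)[OF i(1,1)] by (intro cfun.span_sum cfun.span_scale Bfull_span_Bsym o) auto
  then show ?case
    unfolding sym_sum_linear i(2) Btilde_sym_sum using step(2) by (intro cfun.span_add cfun.span_scale)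
qed

lemma dphi_sym_span_Bsym:
  assumes e: "even (\<Sum>a\<in>UNIV. l a)" and m: "m \<in> M_idx l"
  shows "(\<lambda>R. \<Sum>\<sigma> | \<sigma> permutes UNIV. dphi H r0 P n l m (permute_pts \<sigma> R)) \<in>
    cfun.span (Bsym H r0 P Ut V s ` Bindex H r0 P Ut)"
proof -
  have *: "(\<lambda>R. \<Sum>\<sigma> | \<sigma> permutes UNIV. dphi H r0 P n l m (permute_pts \<sigma> R)) \<in>
    cfun.span (Bsym H r0 P Ut V s ` Bindex H r0 P Ut)"
    if o: "ordered_pair n l" and e: "even (\<Sum>a\<in>UNIV. l a)" and m: "m \<in> M_idx l" for n l m
  proof -
    \<comment> \<open>\<open>Dbar\<close> applied to a unit vector, that is its column
      \<open>m\<close>, in the form that \<open>mat_range\<close> expects.\<close>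
    define v where "v = (\<lambda>\<mu>. if \<mu> \<in> M_idx l then \<Sum>j\<in>M_idx l. Dbar H l \<mu> j * (if j = m then 1 else 0) else 0)"
    have "v \<in> mat_range (M_idx l) (Dbar H l)" unfolding mat_range_def v_def by (rule rangeI)
    then have "v \<in> cfun.span (Ut l ` {..<ntilde H l})"
      using Ut[of l] by (simp add: orthonormal_vectors_spanning_def)
    then have "sym_sum r0 P n l v \<in> cfun.span (Bsym H r0 P Ut V s ` Bindex H r0 P Ut)"
      by (rule sym_sum_span_Bsym[OF o e])
    moreover have "v \<mu> = Dbar H l \<mu> m" if "\<mu> \<in> M_idx l" for \<mu>
      using that m finite_M_idx[of l] by (simp add: v_def if_distrib[of "\<lambda>x. _ * x"] cong: if_cong)
    then have "sym_sum r0 P n l v = (\<lambda>R. \<Sum>\<sigma> | \<sigma> permutes UNIV. dphi H r0 P n l m (permute_pts \<sigma> R))"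
      by (simp add: sym_sum_def dphi_def)
    ultimately show ?thesis by simp
  qed
  \<comment> \<open>The pair is sorted by a relabelling, which changes neither the symmetrised sum
    nor the sum of the \<open>l a\<close>.\<close>
  obtain \<tau> where \<tau>: "\<tau> permutes UNIV" "ordered_pair (n \<circ> \<tau>) (l \<circ> \<tau>)" using exists_ordering by blast
  have "(\<Sum>a\<in>UNIV. (l \<circ> \<tau>) a) = (\<Sum>a\<in>UNIV. l a)" using sum.permute[OF \<tau>(1), of l] by simp
  then have "even (\<Sum>a\<in>UNIV. (l \<circ> \<tau>) a)" using e by simp
  from *[OF \<tau>(2) this M_idx_compose[OF m]] show ?thesis
    unfolding dphi_sym_permute[OF \<tau>(1)] .
qed

lemma capx_Bsym:
  assumes f: "f \<in> Ct_cut t r0 rcut"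
    and inv: "\<And>Q R. orthogonal_matrix Q \<Longrightarrow> R \<in> Omega r0 \<Longrightarrow> f (rotate_pts Q R) = f R"
      "\<And>\<sigma> R. \<sigma> permutes UNIV \<Longrightarrow> R \<in> Omega r0 \<Longrightarrow> f (permute_pts \<sigma> R) = f R"
  shows "capx t (Omega r0) (cfun.span (Bsym H r0 P Ut V s ` Bindex H r0 P Ut)) f"
proof -
  let ?S = "Omega r0 :: (((real, 3) vec, 'n) vec) set"
  let ?V = "cfun.span (Bsym H r0 P Ut V s ` Bindex H r0 P Ut)"
  define E where "E = {dphi H r0 P n l m |(n :: 'n \<Rightarrow> nat) l m. m \<in> M_idx l \<and> even (\<Sum>a\<in>UNIV. l a)}"
  have fcb: "cb t ?S f" using f by (auto simp: Ct_cut_def Ct_iff cb_def)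
  have 1: "capx t ?S (cfun.span (dphis H r0 P)) f"
    by (rule capx_dphis[OF r0 P H capx_phis[OF r0 rc P f] fcb inv(1)])
  \<comment> \<open>The inversion is the orthogonal matrix \<open>- mat 1\<close>; averaging with it
    doubles the terms of even parity and cancels the odd ones.\<close>
  have 2: "capx t ?S (cfun.span E) f"
  proof (rule capx_average[OF nondegenerate_Omega cfun.subspace_span _ _ _ _ _ _ 1, where J = "{1, -1::real}" and L = "\<lambda>j R. j *\<^sub>R R"])
    show "bounded_linear ((*\<^sub>R) j :: ((real, 3) vec, 'n) vec \<Rightarrow> ((real, 3) vec, 'n) vec)" for j by (rule bounded_linear_scaleR_right)
    show "norm (j *\<^sub>R R) = norm R" if "j \<in> {1, -1}" for j and R :: "((real, 3) vec, 'n) vec" using that by auto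
    show "j *\<^sub>R R \<in> ?S" if "j \<in> {1, -1}" "R \<in> ?S" for j R using that by (auto simp: Omega_def)
    show "f (j *\<^sub>R R) = f R" if "j \<in> {1, -1}" "R \<in> ?S" for j R
    proof -
      have "orthogonal_matrix (- mat 1 :: real^3^3)"
        unfolding orthogonal_matrix_def vec_eq_iff forall_3
        by (simp add: transpose_def mat_def matrix_matrix_mult_def sum_3)
      moreover have "rotate_pts (- mat 1) R = - R"
        unfolding vec_eq_iff forall_3 by (simp add: rotate_pts_def matrix_vector_mult_def mat_def sum_3)
      ultimately show ?thesis using inv(1)[of "- mat 1" R] that by auto
    qed
    fix b :: "((real, 3) vec, 'n) vec \<Rightarrow> complex" assume "b \<in> dphis H r0 P"
    then obtain n l m where b: "b = dphi H r0 P n l m" "m \<in> M_idx l" by (auto simp: dphis_def)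
    have mR: "b (- R) = (-1) ^ (\<Sum>a\<in>UNIV. l a) * b R" if "R \<in> ?S" for R
      unfolding b(1) dphi_def sum_distrib_left
      by (intro sum.cong refl) (simp add: phi_minus[OF r0 that])
    show "\<exists>h\<in>cfun.span E. \<forall>x\<in>?S. (\<Sum>j\<in>{1, -1::real}. b (j *\<^sub>R x)) = h x"
    proof (cases "even (\<Sum>a\<in>UNIV. l a)")
      case True
      then have "b \<in> E" using b by (auto simp: E_def)
      then have "cscale 2 b \<in> cfun.span E" by (intro cfun.span_scale cfun.span_base)
      then show ?thesis using mR True by (intro bexI[of _ "cscale 2 b"]) (auto simp: cscale_def)
    next
      case False
      then show ?thesis using mR by (intro bexI[of _ 0]) (auto intro: cfun.span_zero)
    qed
  qed auto
  show ?thesis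
  proof (rule capx_average[OF nondegenerate_Omega cfun.subspace_span _ _ _ _ _ _ 2,
        where J = "{\<sigma>. \<sigma> permutes (UNIV :: 'n set)}" and L = permute_pts])
    show "finite {\<sigma>. \<sigma> permutes (UNIV :: 'n set)}" by (rule finite_permutations) simp
    show "{\<sigma>. \<sigma> permutes (UNIV :: 'n set)} \<noteq> {}" using permutes_id by blast
    show "\<exists>h\<in>?V. \<forall>x\<in>?S. (\<Sum>\<sigma> | \<sigma> permutes UNIV. b (permute_pts \<sigma> x)) = h x" if bE: "b \<in> E" for b
    proof -
      obtain n l m where b: "b = dphi H r0 P n l m" "m \<in> M_idx l" "even (\<Sum>a\<in>UNIV. l a)"
        using bE by (auto simp: E_def)
      show ?thesis unfolding b(1) by (rule bexI[OF _ dphi_sym_span_Bsym[OF b(3,2), of n]]) simp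
    qed
  qed (use inv(2) in \<open>auto simp: permute_pts_linear norm_permute_pts permute_pts_Omega\<close>)
qed

lemma Ct_closure_Bsym:
  assumes f: "f \<in> Ct_cut t r0 rcut"
    and inv: "\<And>Q R. orthogonal_matrix Q \<Longrightarrow> R \<in> Omega r0 \<Longrightarrow> f (rotate_pts Q R) = f R"
      "\<And>\<sigma> R. \<sigma> permutes UNIV \<Longrightarrow> R \<in> Omega r0 \<Longrightarrow> f (permute_pts \<sigma> R) = f R"
  shows "f \<in> Ct_closure t (Omega r0) (cfun.span (Bsym H r0 P Ut V s ` Bindex H r0 P Ut))"
proof -
  let ?V = "cfun.span (Bsym H r0 P Ut V s ` Bindex H r0 P Ut)"
  have norm_axis_3: "norm (axis 1 x :: real^3) = \<bar>x\<bar>" for x :: real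
    by (simp add: norm_vec_def L2_set_def axis_def sum_3)
  \<comment> \<open>Any configuration in \<open>Omega r0\<close> would do; it makes the supremum in
    the norm meaningful.\<close>
  have "(\<chi> j. axis 1 (r0 + 1)) \<in> (Omega r0 :: (((real, 3) vec, 'n) vec) set)"
    using r0 by (simp add: Omega_def norm_axis_3)
  then have ne: "(Omega r0 :: (((real, 3) vec, 'n) vec) set) \<noteq> {}" by blast
  have "\<exists>g\<in>?V. Ct_norm t (Omega r0) (f - g) < e" if "e > 0" for e
  proof -
    \<comment> \<open>Halving leaves room for the strict inequality, since \<open>Ct_norm_le\<close>
      gives only a weak one.\<close>
    have "e / 2 > 0" using that by simp
    then obtain g where g: "g \<in> ?V" "CB t (Omega r0) (e / 2) (\<lambda>x. f x - g x)"
      using capx_Bsym[OF assms] unfolding capx_def by blast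
    have "Ct_norm t (Omega r0) (f - g) \<le> e / 2"
      unfolding fun_diff_def by (rule Ct_norm_le[OF g(2) ne])
    then show ?thesis using g(1) that by (intro bexI[of _ g]) auto
  qed
  then show ?thesis using f by (auto simp: Ct_closure_def Ct_cut_def)
qed

end

theorem theorem6:
  fixes t :: nat and r0 rcut :: real
    and P :: "nat \<Rightarrow> real \<Rightarrow> complex"
    and H :: "(real^3^3) measure"
    and Ut :: "('n::{finite,linorder} \<Rightarrow> nat) \<Rightarrow> nat \<Rightarrow> ('n \<Rightarrow> int) \<Rightarrow> complex"
    and V :: "('n \<Rightarrow> nat) \<Rightarrow> ('n \<Rightarrow> nat) \<Rightarrow> nat \<Rightarrow> nat \<Rightarrow> complex"
    and s :: "('n \<Rightarrow> nat) \<Rightarrow> ('n \<Rightarrow> nat) \<Rightarrow> nat \<Rightarrow> real"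
  assumes "t \<ge> 1" and "0 < r0" and "r0 < rcut"
    and "radial_basis t r0 rcut P"
    and "normalised_haar_SO3 H"
    and "\<And>l. orthonormal_vectors_spanning (M_idx l) (ntilde H l) (Ut l)
               (mat_range (M_idx l) (Dbar H l))"
    and "\<And>n l. unitary_diagonalisation (ntilde H l) (gram r0 P Ut n l) (V n l) (s n l)"
  shows "indep_family (Bsym H r0 P Ut V s) (Bindex H r0 P Ut) \<and>
    Bsym H r0 P Ut V s ` Bindex H r0 P Ut \<subseteq> Ct_cut t r0 rcut \<and>
    (\<forall>f \<in> Ct_cut t r0 rcut.
       (\<forall>Q. orthogonal_matrix Q \<longrightarrow> (\<forall>R\<in>Omega r0. f (rotate_pts Q R) = f R)) \<and>
       (\<forall>\<sigma>. \<sigma> permutes UNIV \<longrightarrow> (\<forall>R\<in>Omega r0. f (permute_pts \<sigma> R) = f R)) \<longrightarrow>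
       f \<in> Ct_closure t (Omega r0) (cfun.span (Bsym H r0 P Ut V s ` Bindex H r0 P Ut))) \<and>
    (\<forall>a \<in> Bindex H r0 P Ut. \<forall>b \<in> Bindex H r0 P Ut.
       tensor_inner r0 P (Bsym H r0 P Ut V s a) (Bsym H r0 P Ut V s b) = (if a = b then 1 else 0))"
proof (intro conjI ballI impI)
  note ctxt = assms(2-7)
  show "indep_family (Bsym H r0 P Ut V s) (Bindex H r0 P Ut)"
    by (rule orthonormal_indep_family[OF phis_independent[OF ctxt] Bsym_span_phis[OF ctxt] Bsym_orthonormal[OF ctxt]])
  show "Bsym H r0 P Ut V s ` Bindex H r0 P Ut \<subseteq> Ct_cut t r0 rcut"
    using span_phis_Ct_cut[OF ctxt Bsym_span_phis[OF ctxt]] by blast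
  show "f \<in> Ct_closure t (Omega r0) (cfun.span (Bsym H r0 P Ut V s ` Bindex H r0 P Ut))"
    if "f \<in> Ct_cut t r0 rcut"
      "(\<forall>Q. orthogonal_matrix Q \<longrightarrow> (\<forall>R\<in>Omega r0. f (rotate_pts Q R) = f R)) \<and>
       (\<forall>\<sigma>. \<sigma> permutes UNIV \<longrightarrow> (\<forall>R\<in>Omega r0. f (permute_pts \<sigma> R) = f R))" for f
    by (rule Ct_closure_Bsym[OF ctxt that(1)]) (use that(2) in blast)+
  show "tensor_inner r0 P (Bsym H r0 P Ut V s a) (Bsym H r0 P Ut V s b) = (if a = b then 1 else 0)"
    if "a \<in> Bindex H r0 P Ut" "b \<in> Bindex H r0 P Ut" for a b
    unfolding tensor_inner_phis by (rule Bsym_orthonormal[OF ctxt that])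
qed

end
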